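(* Let $f$ be a finite-order function in the class $\mathcal{B}$ (or, more generally, a finite composition of such functions). Then for every $R>0$ there exists a Cantor bouquet $X\subset J(f)$ with $f(X)\subset X$ such that: (1) $|f^j(z)|\ge R$ for all $z\in X$ and all $j\ge 0$; (2) there is $R'\ge R$ such that, if $z\in\mathbb{C}$ satisfies $|f^j(z)|\ge R'$ for all $j\geq 0$, then $z\in X$.
   Context: For a transcendental entire function $f$, $J(f)$ denotes its Julia set. $\operatorname{Sing}(f^{-1})$ is the set of critical and (finite) asymptotic values of $f$. The class $\mathcal{B}$ (Eremenko-Lyubich class) consists of all transcendental entire functions with $\operatorname{Sing}(f^{-1})$ bounded. $f$ has finite order if there are constants $c,\rho>0$ with $|f(z)|\le c\cdot e^{|z|^{\rho}}$ for all $z\in\mathbb{C}$. A straight brush is a subset $B\subset[0,+\infty)\times(\mathbb{R}\setminus\mathbb{Q})$ such that: (i) $B$ is closed in $\mathbb{R}^2$; (ii) for every $(x,y)\in B$ there is $t_y\ge 0$ with $\{x:(x,y)\in B\}=[t_y,+\infty)$; the set $[t_y,+\infty)\times\{y\}$ is called the hair attached at $y$; (iii) the set $\{y:(x,y)\in B\text{ for some }x\}$ is dense in $\mathbb{R}\setminus\mathbb{Q}$, and for every $(x,y)\in B$ there are two sequences of hairs attached respectively at $\beta_n,\gamma_n\in\mathbb{R}\setminus\mathbb{Q}$ with $\beta_n<y<\gamma_n$, $\beta_n,\gamma_n\to y$ and $t_{\beta_n},t_{\gamma_n}\to t_y$ as $n\to\infty$. A Cantor bouquet is a subset of the plane that is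 ambiently homeomorphic to a straight brush, i.e. it is the image of a straight brush under a homeomorphism of the plane onto itself. *)

theory Defs
  imports "HOL-Complex_Analysis.Complex_Analysis" "HOL-Computational_Algebra.Polynomial"
begin

definition transcendental_entire :: "(complex \<Rightarrow> complex) \<Rightarrow> bool" where
  "transcendental_entire f \<longleftrightarrow>
     f holomorphic_on UNIV \<and> (\<nexists>p. \<forall>z. f z = poly p z)"

(* Normality in the sense of Montel. The limit is allowed to be identically infinity.
   It is finite throughout or infinite throughout, so this agrees with spherical
   normality only on connected sets; it is used for such U only. *)
definition normal_family :: "(complex \<Rightarrow> complex) set \<Rightarrow> complex set \<Rightarrow> bool" where
  "normal_family F U \<longleftrightarrow>
     (\<forall>\<phi> :: nat \<Rightarrow> complex \<Rightarrow> complex. range \<phi> \<subseteq> F \<longrightarrow>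
        (\<exists>r :: nat \<Rightarrow> nat. strict_mono r \<and>
           ((\<exists>g. g holomorphic_on U \<and>
                (\<forall>K. compact K \<and> K \<subseteq> U \<longrightarrow>
                   uniform_limit K (\<phi> \<circ> r) g sequentially)) \<or>
            (\<forall>K. compact K \<and> K \<subseteq> U \<longrightarrow>
                (\<forall>M::real. \<forall>\<^sub>F n in sequentially. \<forall>z\<in>K. norm (\<phi> (r n) z) > M)))))"

definition fatou_set :: "(complex \<Rightarrow> complex) \<Rightarrow> complex set" where
  "fatou_set f =
     {z. \<exists>U. open U \<and> connected U \<and> z \<in> U \<and> normal_family (range (\<lambda>n. f ^^ n)) U}"

definition julia_set :: "(complex \<Rightarrow> complex) \<Rightarrow> complex set" where
  "julia_set f = - fatou_set f"

definition critical_values :: "(complex \<Rightarrow> complex) \<Rightarrow> complex set" where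
  "critical_values f = {f z | z. deriv f z = 0}"

definition asymptotic_values :: "(complex \<Rightarrow> complex) \<Rightarrow> complex set" where
  "asymptotic_values f =
     {a. \<exists>\<gamma> :: real \<Rightarrow> complex. continuous_on {0..} \<gamma> \<and>
           filterlim \<gamma> at_infinity at_top \<and> ((\<lambda>t. f (\<gamma> t)) \<longlongrightarrow> a) at_top}"

definition sing_inverse :: "(complex \<Rightarrow> complex) \<Rightarrow> complex set" where
  "sing_inverse f = critical_values f \<union> asymptotic_values f"

definition class_B :: "(complex \<Rightarrow> complex) set" where
  "class_B = {f. transcendental_entire f \<and> bounded (sing_inverse f)}"

definition finite_order :: "(complex \<Rightarrow> complex) \<Rightarrow> bool" where
  "finite_order f \<longleftrightarrow>
     (\<exists>c>0. \<exists>\<rho>>0. \<forall>z. norm (f z) \<le> c * exp (norm z powr \<rho>))"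

(* The values of t outside snd ` B are irrelevant. *)
definition straight_brush :: "(real \<times> real) set \<Rightarrow> bool" where
  "straight_brush B \<longleftrightarrow>
     B \<subseteq> {0..} \<times> - \<rat> \<and> closed B \<and>
     - \<rat> \<subseteq> closure (snd ` B) \<and>
     (\<exists>t :: real \<Rightarrow> real.
        (\<forall>y \<in> snd ` B. t y \<ge> 0 \<and> {x. (x, y) \<in> B} = {t y..}) \<and>
        (\<forall>y \<in> snd ` B. \<exists>\<beta> \<gamma> :: nat \<Rightarrow> real.
           range \<beta> \<subseteq> snd ` B \<and> range \<gamma> \<subseteq> snd ` B \<and>
           (\<forall>n. \<beta> n < y \<and> y < \<gamma> n) \<and>
           \<beta> \<longlonglongrightarrow> y \<and> \<gamma> \<longlonglongrightarrow> y \<and>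
           (\<lambda>n. t (\<beta> n)) \<longlonglongrightarrow> t y \<and> (\<lambda>n. t (\<gamma> n)) \<longlonglongrightarrow> t y))"

definition cantor_bouquet :: "complex set \<Rightarrow> bool" where
  "cantor_bouquet X \<longleftrightarrow>
     (\<exists>B h k. straight_brush B \<and> homeomorphism UNIV UNIV h k \<and>
        X = h ` (\<lambda>(x, y). Complex x y) ` B)"

end

(* Work in logarithmic coordinates with the periodic sequence of the given maps. For one map g, the complement
   of the tracts {|g| >= e^R} is simply connected; its Riemann map extends to the boundary, and the radial
   foliation, continued through the tracts by the images of horizontal lines, is mapped to horizontal lines.
   A length-area estimate bounds how far a leaf can come back towards the origin outside of the tracts; finite order
   gives the same bound inside. Hence the real part is coarsely monotone along the leaves, and a homeomorphism Phi of
   the plane, linearly close to the identity, straightens all leaves. Behind Phi the inverse branches become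
   contractions s(x + iy) = xi(x, y) + i v(y), and the pullbacks of Phi under the dynamics converge uniformly to a
   conjugacy near infinity. In the model, the points whose orbits stay in a right half plane form a union of
   horizontal rays; translating the k-th point of an orbit by 2 pi i and contracting back gives the approximating
   rays. These points lie in the Julia set since small discs are mapped onto neighbourhoods of large circles around
   0, and such a circle lies in no tract. *)
theory Submission
 imports Defs "HOL-Real_Asymp.Real_Asymp"
begin

section \<open>Inverse branches over a half plane\<close>

text \<open>Two properties of the inverse branches carry all estimates. Bloch's theorem bounds the
  derivative of a branch by \<open>12 * pi / (Re Z - a)\<close>. So branches contract for large
  \<open>Re Z\<close>, a displacement proportional to \<open>Re Z\<close> becomes bounded after one
  pullback, and the image of a long horizontal segment wanders only by a logarithm of its length.
  Finite order says that the real part of the branch is itself at least of the order of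
  \<open>ln (Re Z)\<close>; hence this wandering is at most linear in the real part. That is why a
  straightening map at linear distance from the identity is good enough. The obstacle lies outside
  of the tracts: nothing is known about the shape of this region, and the leaves are given there
  only by a conformal map. Comparison of length and area yields an absolute constant for it. A
  composition of maps of finite order need not have finite order, so the factors are kept apart as a
  periodic sequence instead of being replaced by the composite.\<close>

lemma entire_locally_injective:
 assumes "g holomorphic_on UNIV" "deriv g z \<noteq> 0"
 obtains r where "r > 0" "inj_on g (ball z r)" by (rule has_complex_derivative_locally_invertible[OF assms(1) UNIV_I open_UNIV assms(2)]) auto

lemma lift_unique:
 fixes g :: "complex \<Rightarrow> complex" and l1 l2 :: "complex \<Rightarrow> complex"
 assumes g: "g holomorphic_on UNIV" and S: "connected S"
  and c1: "continuous_on S l1" and c2: "continuous_on S l2"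
  and eq: "\<And>x. x \<in> S \<Longrightarrow> g (l1 x) = g (l2 x)"
  and nz: "\<And>x. x \<in> S \<Longrightarrow> deriv g (l1 x) \<noteq> 0"
  and a: "a \<in> S" "l1 a = l2 a" and x: "x \<in> S"
 shows "l1 x = l2 x"
proof -
 let ?E = "{x\<in>S. l1 x = l2 x}"
 have "closedin (top_of_set S) ?E" using continuous_closedin_preimage_constant[of S "\<lambda>x. l1 x - l2 x" 0] c1 c2
  by (auto intro!: continuous_intros simp: continuous_on_diff)
 moreover have "openin (top_of_set S) ?E" unfolding openin_contains_ball
 proof (intro conjI ballI)
  fix y assume y: "y \<in> ?E"
  hence yS: "y \<in> S" by simp
  obtain r where r: "r > 0" "inj_on g (ball (l1 y) r)" using entire_locally_injective[OF g nz[OF yS]] by blast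
  obtain d1 where d1: "d1 > 0" "\<And>x. x \<in> S \<Longrightarrow> dist x y < d1 \<Longrightarrow> dist (l1 x) (l1 y) < r"
   using c1 yS r(1) unfolding continuous_on_iff by blast
  obtain d2 where d2: "d2 > 0" "\<And>x. x \<in> S \<Longrightarrow> dist x y < d2 \<Longrightarrow> dist (l2 x) (l2 y) < r"
   using c2 yS r(1) unfolding continuous_on_iff by blast
  have "ball y (min d1 d2) \<inter> S \<subseteq> ?E"
  proof safe
   fix x assume x: "x \<in> ball y (min d1 d2)" "x \<in> S"
   have "l1 x \<in> ball (l1 y) r" "l2 x \<in> ball (l1 y) r" using d1(2)[of x] d2(2)[of x] x y by (auto simp: dist_commute)
   thus "l1 x = l2 x" using r(2) eq[OF x(2)] by (auto dest: inj_onD)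
  qed
  thus "\<exists>e>0. ball y e \<inter> S \<subseteq> ?E" using d1 d2 by (intro exI[of _ "min d1 d2"]) auto
 qed auto
 ultimately have "?E = {} \<or> ?E = S" using S by (auto simp: connected_clopen)
 thus ?thesis using a x by auto
qed

text \<open>A curve that does not tend to infinity returns to a bounded set along a sequence, hence
  accumulates at some \<open>z\<close> with \<open>g z = w\<close>. As \<open>z\<close> is not
  critical, \<open>g\<close> stays away from \<open>w\<close> on small circles around
  \<open>z\<close>; once \<open>g\<close> along the curve is close to \<open>w\<close>, the curve
  cannot cross such a circle any more.\<close>

lemma lift_limit:
 fixes g \<gamma> :: "_ \<Rightarrow> complex"
 assumes g: "g holomorphic_on UNIV" and cont: "continuous_on {0..<1} \<gamma>"
  and w: "((\<lambda>t. g (\<gamma> t)) \<longlongrightarrow> w) (at_left 1)" and nc: "w \<notin> critical_values g"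
  and na: "w \<notin> asymptotic_values g"
 obtains z where "(\<gamma> \<longlongrightarrow> z) (at_left (1::real))" "g z = w"
proof -
 have ni: "\<not> filterlim \<gamma> at_infinity (at_left 1)"
 proof
  assume inf: "filterlim \<gamma> at_infinity (at_left 1)"
  \<comment> \<open>Asymptotic values are defined by curves on \<open>{0..}\<close>;
    \<open>p\<close> reparametrises \<open>{0..<1}\<close> accordingly.\<close>
  define p where "p = (\<lambda>s::real. s / (s + 1))"
  have pl: "filterlim p (at_left 1) at_top" unfolding filterlim_at
  proof
   show "(p \<longlongrightarrow> 1) at_top" unfolding p_def by real_asymp
   show "\<forall>\<^sub>F x in at_top. p x \<in> {..<1} \<and> p x \<noteq> 1" using eventually_gt_at_top[of 0] by eventually_elim (auto simp: p_def)
  qed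
  have "continuous_on {0..} (\<lambda>s. \<gamma> (p s))" by (rule continuous_on_compose2[OF cont]) (auto simp: p_def intro!: continuous_intros)
  moreover have "filterlim (\<lambda>s. \<gamma> (p s)) at_infinity at_top" by (rule filterlim_compose[OF inf pl])
  moreover have "((\<lambda>s. g (\<gamma> (p s))) \<longlongrightarrow> w) at_top" by (rule filterlim_compose[OF w pl])
  ultimately have "w \<in> asymptotic_values g" unfolding asymptotic_values_def by blast
  thus False using na by simp
 qed
 then obtain M where M: "\<not> (\<forall>\<^sub>F t in at_left 1. M \<le> norm (\<gamma> t))" unfolding filterlim_at_infinity[OF order_refl] by blast
 have ex: "\<exists>t. 1 - 1 / Suc n < t \<and> t < 1 \<and> 0 \<le> t \<and> norm (\<gamma> t) \<le> M" for n
 proof (rule ccontr)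
  assume c: "\<not> ?thesis"
  have "\<forall>\<^sub>F t in at_left 1. t \<in> {1 - 1 / Suc n<..<1}" by (rule eventually_at_left_real) auto
  hence "\<forall>\<^sub>F t in at_left 1. M \<le> norm (\<gamma> t)"
  proof eventually_elim
   case (elim t)
   have "0 \<le> 1 - 1 / real (Suc n)" by (simp add: field_simps)
   moreover have "1 - 1 / real (Suc n) < t" using elim by simp
   ultimately have "0 \<le> t" by linarith
   thus ?case using c elim by force
  qed
  thus False using M by simp
 qed
 then obtain t where t: "\<And>n. 1 - 1 / Suc n < t n" "\<And>n. t n < 1" "\<And>n. 0 \<le> t n" "\<And>n. norm (\<gamma> (t n)) \<le> M" by metis
 have "compact (cball 0 M :: complex set)" by simp
 then obtain z r where z: "strict_mono r" "(\<lambda>n. \<gamma> (t (r n))) \<longlonglongrightarrow> z"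
  unfolding compact_def using t(4) by (force simp: o_def)
 have tl: "t \<longlonglongrightarrow> 1"
 proof (rule tendsto_sandwich[of "\<lambda>n. 1 - 1 / Suc n" _ _ "\<lambda>_. 1"])
  show "(\<lambda>n. 1 - 1 / real (Suc n)) \<longlonglongrightarrow> 1" by real_asymp
 qed (use t in \<open>auto intro!: always_eventually less_imp_le\<close>)
 have trl: "filterlim (\<lambda>n. t (r n)) (at_left 1) sequentially" unfolding filterlim_at using LIMSEQ_subseq_LIMSEQ[OF tl z(1)] t
  by (auto simp: o_def less_imp_neq)
 have gc: "continuous_on UNIV g" using g by (rule holomorphic_on_imp_continuous_on)
 have gz: "g z = w"
 proof (rule LIMSEQ_unique)
  show "(\<lambda>n. g (\<gamma> (t (r n)))) \<longlonglongrightarrow> w" by (rule filterlim_compose[OF w trl])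
  show "(\<lambda>n. g (\<gamma> (t (r n)))) \<longlonglongrightarrow> g z" using continuous_on_tendsto_compose[OF gc z(2)] by simp
 qed
 have "deriv g z \<noteq> 0" using nc gz unfolding critical_values_def by auto
 then obtain r0 where r0: "r0 > 0" "inj_on g (ball z r0)" using entire_locally_injective[OF g] by blast
 have "(\<gamma> \<longlongrightarrow> z) (at_left 1)"
 proof (rule tendstoI)
  fix e0 :: real assume "e0 > 0"
  define e where "e = min e0 (r0/2)"
  have e: "e > 0" "e \<le> e0" "e < r0" using \<open>e0 > 0\<close> r0 by (auto simp: e_def)
  have "compact ((\<lambda>x. dist (g x) w) ` sphere z e)"
   by (intro compact_continuous_image continuous_intros) (auto intro: continuous_on_subset[OF gc])
  moreover have "sphere z e \<noteq> {}" using e by simp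
  ultimately obtain x0 where x0: "x0 \<in> sphere z e" "\<And>x. x \<in> sphere z e \<Longrightarrow> dist (g x0) w \<le> dist (g x) w"
   using compact_attains_inf[of "(\<lambda>x. dist (g x) w) ` sphere z e"] by blast
  have "g x0 \<noteq> g z" using inj_onD[OF r0(2), of x0 z] x0(1) e r0(1) by auto
  hence d: "dist (g x0) w > 0" using gz by simp
  have "\<forall>\<^sub>F s in at_left 1. dist (g (\<gamma> s)) w < dist (g x0) w" using tendstoD[OF w d] .
  then obtain b where b: "b < 1" "\<And>s. b < s \<Longrightarrow> s < 1 \<Longrightarrow> dist (g (\<gamma> s)) w < dist (g x0) w"
   unfolding eventually_at_left_field by auto
  have "\<forall>\<^sub>F n in sequentially. dist (\<gamma> (t (r n))) z < e" using tendstoD[OF z(2) e(1)] .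
  moreover have "\<forall>\<^sub>F n in sequentially. max b 0 < t (r n)"
   using order_tendstoD(1)[OF LIMSEQ_subseq_LIMSEQ[OF tl z(1)], of "max b 0"] b by (simp add: o_def)
  ultimately have "\<forall>\<^sub>F n in sequentially. dist (\<gamma> (t (r n))) z < e \<and> max b 0 < t (r n)" by eventually_elim auto
  then obtain n where n: "dist (\<gamma> (t (r n))) z < e" "max b 0 < t (r n)" using eventually_happens by force
  define t0 where "t0 = t (r n)"
  have inb: "dist (\<gamma> s) z < e" if s: "t0 \<le> s" "s < 1" for s
  proof (rule ccontr)
   assume c: "\<not> ?thesis"
   have "continuous_on {t0..s} (\<lambda>u. dist (\<gamma> u) z)"
    using s n by (intro continuous_intros continuous_on_subset[OF cont]) (auto simp: t0_def)
   then obtain u where "t0 \<le> u" "u \<le> s" "dist (\<gamma> u) z = e"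
    using IVT'[of "\<lambda>u. dist (\<gamma> u) z" t0 e s] c n s by (auto simp: t0_def)
   hence "\<gamma> u \<in> sphere z e" "b < u" "u < 1" using n s by (auto simp: t0_def dist_commute)
   thus False using b(2)[of u] x0(2)[of "\<gamma> u"] by auto
  qed
  show "\<forall>\<^sub>F s in at_left 1. dist (\<gamma> s) z < e0" unfolding eventually_at_left_field
  proof (intro exI[of _ t0] conjI allI impI)
   show "t0 < 1" using t(2) by (simp add: t0_def)
   show "dist (\<gamma> s) z < e0" if "t0 < s" "s < 1" for s using inb[of s] that e(2) by simp
  qed
 qed
 thus ?thesis using that gz by blast
qed

definition hp :: "real \<Rightarrow> complex set" where "hp a = {Z. a < Re Z}"

lemma hp_iff [simp]: "Z \<in> hp a \<longleftrightarrow> a < Re Z" by (simp add: hp_def)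
lemma open_hp [simp, intro]: "open (hp a)" unfolding hp_def by (rule open_halfspace_Re_gt)
lemma convex_hp [simp, intro]: "convex (hp a)" unfolding hp_def by (rule convex_halfspace_Re_gt)
lemma connected_hp [simp, intro]: "connected (hp a)" by (simp add: convex_connected)

definition inv_branch :: "(complex \<Rightarrow> complex) \<Rightarrow> real \<Rightarrow> (complex \<Rightarrow> complex) \<Rightarrow> bool" where
 "inv_branch g a l \<longleftrightarrow> l holomorphic_on hp a \<and> (\<forall>Z\<in>hp a. g (l Z) = exp Z)"

lemma local_branch:
 fixes g :: "complex \<Rightarrow> complex"
 assumes g: "g holomorphic_on UNIV" and S: "open S" and nz1: "deriv g z1 \<noteq> 0"
  and Z1: "Z1 \<in> S" and gz: "g z1 = exp Z1"
 obtains r e b where "r > 0" "inj_on g (ball z1 r)" "e > 0" "ball Z1 e \<subseteq> S" "b holomorphic_on ball Z1 e"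
  "b Z1 = z1" "\<And>Z. Z \<in> ball Z1 e \<Longrightarrow> b Z \<in> ball z1 r \<and> g (b Z) = exp Z"
proof -
 obtain r where r: "r > 0" "inj_on g (ball z1 r)" using entire_locally_injective[OF g nz1] by blast
 have gball: "g holomorphic_on ball z1 r" using g by (rule holomorphic_on_subset) auto
 obtain h where h: "h holomorphic_on g ` ball z1 r" "\<And>z. z \<in> ball z1 r \<Longrightarrow> h (g z) = z"
  by (rule holomorphic_has_inverse[OF gball open_ball r(2)]) blast
 have og: "open (g ` ball z1 r)" using open_mapping_thm3[OF gball open_ball r(2)] .
 have "open (exp -` (g ` ball z1 r))" using og by (intro open_vimage continuous_intros) auto
 moreover have "Z1 \<in> exp -` (g ` ball z1 r)" using imageI[of z1 "ball z1 r" g] r(1) gz by simp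
 ultimately have op: "open (S \<inter> exp -` (g ` ball z1 r))" "Z1 \<in> S \<inter> exp -` (g ` ball z1 r)" using S Z1 by auto
 obtain e where e: "e > 0" "ball Z1 e \<subseteq> S \<inter> exp -` (g ` ball z1 r)" by (rule openE[OF op])
 define b where "b = (\<lambda>Z. h (exp Z))"
 have bh: "b holomorphic_on ball Z1 e" unfolding b_def
 proof -
  have "exp ` ball Z1 e \<subseteq> g ` ball z1 r" using e(2) by blast
  from holomorphic_on_compose_gen[where f=exp and g=h, OF holomorphic_on_exp h(1) this]
  show "(\<lambda>Z. h (exp Z)) holomorphic_on ball Z1 e" by (simp add: o_def)
 qed
 have bg: "b Z \<in> ball z1 r" "g (b Z) = exp Z" if "Z \<in> ball Z1 e" for Z
 proof -
  have "exp Z \<in> g ` ball z1 r" using e(2) that by blast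
  then obtain z where "z \<in> ball z1 r" "exp Z = g z" by blast
  thus "b Z \<in> ball z1 r" "g (b Z) = exp Z" using h(2) by (auto simp: b_def)
 qed
 have "b Z1 = z1" using h(2)[of z1] r(1) gz by (simp add: b_def)
 moreover have "ball Z1 e \<subseteq> S" using e(2) by blast
 moreover have "b Z \<in> ball z1 r \<and> g (b Z) = exp Z" if "Z \<in> ball Z1 e" for Z using bg[OF that] by simp
 ultimately show ?thesis by (intro that[OF r e(1) _ bh])
qed

text \<open>Domains that are star-shaped about \<open>Z0\<close> make continuation along segments
  single-valued. The part added here is a truncated cone over a small disc around \<open>Z1\<close>,
  so that the union is star-shaped again.\<close>

lemma star_branch_extend:
 fixes g l :: "complex \<Rightarrow> complex"
 assumes g: "g holomorphic_on UNIV" and U: "open U" "U \<subseteq> S" "Z0 \<in> U" and S: "open S"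
  and star: "\<And>Z. Z \<in> U \<Longrightarrow> closed_segment Z0 Z \<subseteq> U"
  and l: "l holomorphic_on U" "\<And>Z. Z \<in> U \<Longrightarrow> g (l Z) = exp Z"
  and nz: "\<And>z. g z \<in> exp ` S \<Longrightarrow> deriv g z \<noteq> 0"
  and Z1: "Z1 \<in> S" "Z1 \<notin> U" "\<And>t. 0 \<le> t \<Longrightarrow> t < 1 \<Longrightarrow> Z0 + of_real t * (Z1 - Z0) \<in> U"
  and lim: "((\<lambda>t. l (Z0 + of_real t * (Z1 - Z0))) \<longlongrightarrow> z1) (at_left (1::real))" and gz: "g z1 = exp Z1"
 obtains U' l' where "open U'" "U' \<subseteq> S" "U \<subseteq> U'" "Z1 \<in> U'"
  "\<And>Z. Z \<in> U' \<Longrightarrow> closed_segment Z0 Z \<subseteq> U'"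
  "l' holomorphic_on U'" "\<And>Z. Z \<in> U' \<Longrightarrow> g (l' Z) = exp Z" "\<And>Z. Z \<in> U \<Longrightarrow> l' Z = l Z"
proof -
 define q where "q = (\<lambda>t::real. Z0 + of_real t * (Z1 - Z0))"
 have nz1: "deriv g z1 \<noteq> 0" using nz[of z1] gz Z1(1) by auto
 obtain r e b where r: "r > 0" "inj_on g (ball z1 r)" and e: "e > 0" "ball Z1 e \<subseteq> S"
  and bh: "b holomorphic_on ball Z1 e" and bg': "\<And>Z. Z \<in> ball Z1 e \<Longrightarrow> b Z \<in> ball z1 r \<and> g (b Z) = exp Z"
  by (rule local_branch[OF g S nz1 Z1(1) gz]) blast
 have bg: "b Z \<in> ball z1 r" "g (b Z) = exp Z" if "Z \<in> ball Z1 e" for Z using bg'[OF that] by auto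
 have qcont: "continuous_on UNIV q" unfolding q_def by (intro continuous_intros)
 have q1: "q 1 = Z1" "q 0 = Z0" by (auto simp: q_def)
 have "isCont q 1" using qcont by (simp add: continuous_on_eq_continuous_at)
 hence "(q \<longlongrightarrow> q 1) (at_left 1)" by (simp add: isCont_def filterlim_at_split)
 hence "\<forall>\<^sub>F t in at_left 1. q t \<in> ball Z1 (e/2)" using e(1) by (intro topological_tendstoD) (auto simp: q1)
 moreover have "\<forall>\<^sub>F t in at_left 1. l (q t) \<in> ball z1 r" using lim r(1) unfolding q_def by (intro topological_tendstoD) auto
 moreover have "\<forall>\<^sub>F t in at_left 1. t \<in> {0::real<..<1}" by (rule eventually_at_left_real) auto
 ultimately have "\<forall>\<^sub>F t in at_left 1. (q t \<in> ball Z1 (e/2) \<and> l (q t) \<in> ball z1 r) \<and> t \<in> {0<..<1}"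
  by eventually_elim auto
 then obtain t0 where t0: "q t0 \<in> ball Z1 (e/2)" "l (q t0) \<in> ball z1 r" "0 < t0" "t0 < 1" using eventually_happens by force
 have qU: "q t \<in> U" if "0 \<le> t" "t < 1" for t using Z1(3)[OF that] by (simp add: q_def)
 have lb0: "l (q t0) = b (q t0)"
 proof -
  have "q t0 \<in> ball Z1 e" using t0(1) e(1) by auto
  thus ?thesis using bg[of "q t0"] l(2)[OF qU[of t0]] t0 inj_onD[OF r(2)] by auto
 qed
 have "compact (q ` {0..t0})" by (intro compact_continuous_image continuous_on_subset[OF qcont]) auto
 moreover have "q ` {0..t0} \<subseteq> U" using qU t0 by auto
 ultimately obtain d where d: "d > 0" "(\<Union>x\<in>q ` {0..t0}. ball x d) \<subseteq> U"
  using compact_subset_open_imp_ball_epsilon_subset[OF _ U(1)] by blast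
 define \<delta> where "\<delta> = min d (e/2)"
 have \<delta>: "\<delta> > 0" "\<delta> \<le> d" "\<delta> \<le> e/2" using d e by (auto simp: \<delta>_def)
 \<comment> \<open>The radius shrinks with \<open>s\<close>: \<open>N\<close> is the union of the
   copies of the disc around \<open>Z1\<close>, scaled from \<open>Z0\<close> by factors in
   \<open>{t0<..1}\<close>.\<close>
 define N where "N = (\<Union>s\<in>{t0<..1}. ball (q s) (s * \<delta>))"
 have N_E: "\<exists>s Z. t0 < s \<and> s \<le> 1 \<and> dist Z1 Z < \<delta> \<and> W = Z0 + of_real s * (Z - Z0)" if W: "W \<in> N" for W
 proof -
  obtain s where s: "t0 < s" "s \<le> 1" "dist (q s) W < s * \<delta>" using W unfolding N_def by auto
  hence s0: "0 < s" using t0 by simp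
  define Z where "Z = Z0 + (W - Z0) / of_real s"
  have "q s - W = of_real s * (Z1 - Z)" using s0 by (simp add: q_def Z_def field_simps)
  hence "dist (q s) W = s * dist Z1 Z" using s0 by (simp add: dist_norm norm_mult)
  hence "dist Z1 Z < \<delta>" using s s0 by simp
  thus ?thesis using s s0 by (intro exI[of _ s] exI[of _ Z]) (auto simp: Z_def)
 qed
 have N_I: "Z0 + of_real s * (Z - Z0) \<in> N" if s: "t0 < s" "s \<le> 1" "dist Z1 Z < \<delta>" for s Z
 proof -
  have "q s - (Z0 + of_real s * (Z - Z0)) = of_real s * (Z1 - Z)" by (simp add: q_def algebra_simps)
  hence "dist (q s) (Z0 + of_real s * (Z - Z0)) = s * dist Z1 Z" using s t0 by (simp add: dist_norm norm_mult)
  thus ?thesis using s t0 by (auto simp: N_def intro!: bexI[of _ s])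
 qed
 have NB: "Z0 + of_real s * (Z - Z0) \<in> ball Z1 e" if "t0 \<le> s" "s \<le> 1" "dist Z1 Z < \<delta>" for s Z
 proof -
  have *: "Z0 + of_real s * (Z - Z0) - Z1 = of_real ((1 - s)/(1 - t0)) * (q t0 - Z1) + of_real s * (Z - Z1)"
   using t0 by (simp add: q_def divide_simps) (simp add: algebra_simps)
  have "norm (of_real ((1 - s)/(1 - t0)) * (q t0 - Z1)) \<le> 1 * norm (q t0 - Z1)"
   unfolding norm_mult norm_of_real using that t0 by (intro mult_right_mono) auto
  moreover have "norm (of_real s * (Z - Z1)) \<le> 1 * norm (Z - Z1)" unfolding norm_mult using that t0 by (intro mult_right_mono) auto
  ultimately have "norm (Z0 + of_real s * (Z - Z0) - Z1) < e/2 + e/2"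
   unfolding * using t0(1) that(3) \<delta> norm_triangle_ineq[of "of_real ((1 - s)/(1 - t0)) * (q t0 - Z1)" "of_real s * (Z - Z1)"]
   by (simp add: dist_norm norm_minus_commute)
  thus ?thesis by (simp add: dist_norm norm_minus_commute)
 qed
 have NU: "Z0 + of_real s * (Z - Z0) \<in> U" if "0 \<le> s" "s \<le> t0" "dist Z1 Z < \<delta>" for s Z
 proof -
  have "q s - (Z0 + of_real s * (Z - Z0)) = of_real s * (Z1 - Z)" by (simp add: q_def algebra_simps)
  hence "dist (q s) (Z0 + of_real s * (Z - Z0)) = s * dist Z1 Z" using that by (simp add: dist_norm norm_mult)
  also have "\<dots> \<le> 1 * dist Z1 Z" using that t0 by (intro mult_right_mono) auto
  finally have "Z0 + of_real s * (Z - Z0) \<in> ball (q s) d" using that \<delta> by simp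
  moreover have "q s \<in> q ` {0..t0}" using that by simp
  ultimately show ?thesis by (intro subsetD[OF d(2)] UN_I)
 qed
 have bc: "continuous_on (ball Z1 e) b" using bh by (rule holomorphic_on_imp_continuous_on)
 have lc: "continuous_on U l" using l(1) by (rule holomorphic_on_imp_continuous_on)
 have eqU: "l x = b x" if "connected C" "C \<subseteq> U" "C \<subseteq> ball Z1 e" "a \<in> C" "l a = b a" "x \<in> C" for C a x
 proof (rule lift_unique[where S=C and a=a and x=x and ?l1.0=l and ?l2.0=b, OF g that(1) _ _ _ _ that(4,5,6)])
  show "continuous_on C l" by (rule continuous_on_subset[OF lc that(2)])
  show "continuous_on C b" by (rule continuous_on_subset[OF bc that(3)])
  fix x assume "x \<in> C"
  hence x: "x \<in> U" "x \<in> ball Z1 e" using that(2,3) by auto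
  show "g (l x) = g (b x)" using l(2)[OF x(1)] bg(2)[OF x(2)] by simp
  have "g (l x) \<in> exp ` S" using l(2)[OF x(1)] x(1) U(2) by auto
  thus "deriv g (l x) \<noteq> 0" by (rule nz)
 qed
 \<comment> \<open>The branches coincide on the copy of the disc at scale \<open>t0\<close>, which
   is connected and contains \<open>q t0\<close>. From there equality is carried along the segment
   to scale \<open>s\<close>.\<close>
 have agree: "l W = b W" if W: "W \<in> U" "W \<in> N" for W
 proof -
  obtain s Z where s: "t0 < s" "s \<le> 1" "dist Z1 Z < \<delta>" "W = Z0 + of_real s * (Z - Z0)" using W N_E by blast
  have 1: "l (Z0 + of_real t0 * (Z - Z0)) = b (Z0 + of_real t0 * (Z - Z0))"
  proof (rule eqU)
   show "connected ((\<lambda>Y. Z0 + of_real t0 * (Y - Z0)) ` ball Z1 \<delta>)" by (intro connected_continuous_image continuous_intros) auto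
   show "(\<lambda>Y. Z0 + of_real t0 * (Y - Z0)) ` ball Z1 \<delta> \<subseteq> U" using NU[of t0] t0(3) by auto
   show "(\<lambda>Y. Z0 + of_real t0 * (Y - Z0)) ` ball Z1 \<delta> \<subseteq> ball Z1 e" using NB[of t0] t0(4) by auto
   show "q t0 \<in> (\<lambda>Y. Z0 + of_real t0 * (Y - Z0)) ` ball Z1 \<delta>" using \<delta> by (auto simp: q_def)
   show "Z0 + of_real t0 * (Z - Z0) \<in> (\<lambda>Y. Z0 + of_real t0 * (Y - Z0)) ` ball Z1 \<delta>" using s by auto
  qed (rule lb0)
  show ?thesis
  proof (rule eqU[OF _ _ _ _ 1])
   show "connected ((\<lambda>u. Z0 + of_real u * (Z - Z0)) ` {t0..s})" by (intro connected_continuous_image continuous_intros) auto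
   show "(\<lambda>u. Z0 + of_real u * (Z - Z0)) ` {t0..s} \<subseteq> U"
   proof safe
    fix u assume u: "u \<in> {t0..s}"
    have "of_real (u/s) * (of_real s * (Z-Z0)) = of_real u*(Z-Z0)" using s t0 by simp
    hence "Z0 + of_real u * (Z - Z0) = (1 - u/s) *\<^sub>R Z0 + (u/s) *\<^sub>R W" by (simp only: s(4) scaleR_conv_of_real) (simp add: algebra_simps)
    hence "Z0 + of_real u * (Z - Z0) \<in> closed_segment Z0 W" unfolding in_segment using u s(1,2) t0 by (intro exI[of _ "u/s"]) auto
    thus "Z0 + of_real u * (Z - Z0) \<in> U" using star[OF W(1)] by blast
   qed
   show "(\<lambda>u. Z0 + of_real u * (Z - Z0)) ` {t0..s} \<subseteq> ball Z1 e" using NB[of _ Z] s by auto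
  qed (use s in auto)
 qed
 have Nop: "open N" by (auto simp: N_def)
 have Nsub: "N \<subseteq> ball Z1 e"
 proof
  fix W assume "W \<in> N"
  from N_E[OF this] obtain s Z where "t0 < s" "s \<le> 1" "dist Z1 Z < \<delta>" "W = Z0 + of_real s * (Z - Z0)" by blast
  thus "W \<in> ball Z1 e" using NB[of s Z] by simp
 qed
 show ?thesis
 proof (rule that[of "U \<union> N" "\<lambda>W. if W \<in> U then l W else b W"])
  show "open (U \<union> N)" using U Nop by auto
  show "U \<union> N \<subseteq> S" using U Nsub e by auto
  show "Z1 \<in> U \<union> N" using N_I[of 1 Z1] t0 \<delta> by auto
  show "closed_segment Z0 W \<subseteq> U \<union> N" if W: "W \<in> U \<union> N" for W
  proof (cases "W \<in> U")
   case True thus ?thesis using star by auto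
  next
   case False
   then obtain s Z where s: "t0 < s" "s \<le> 1" "dist Z1 Z < \<delta>" "W = Z0 + of_real s * (Z - Z0)" using W N_E by blast
   show ?thesis
   proof
    fix Y assume "Y \<in> closed_segment Z0 W"
    then obtain u where u: "0 \<le> u" "u \<le> 1" "Y = (1 - u) *\<^sub>R Z0 + u *\<^sub>R W" by (auto simp: in_segment)
    hence Y: "Y = Z0 + of_real (u * s) * (Z - Z0)" using s by (simp add: scaleR_conv_of_real algebra_simps)
    have us: "u * s \<le> 1" "0 \<le> u * s" using u s t0 by (auto intro: mult_le_one)
    show "Y \<in> U \<union> N" using N_I[of "u * s" Z] NU[of "u * s" Z] us s(3) Y by (cases "u * s \<le> t0") auto
   qed
  qed
  have "(\<lambda>W. if W \<in> U then l W else b W) holomorphic_on U" using l(1) by (rule holomorphic_transform) auto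
  moreover have "(\<lambda>W. if W \<in> U then l W else b W) holomorphic_on N"
   using holomorphic_on_subset[OF bh Nsub] by (rule holomorphic_transform) (auto simp: agree)
  ultimately show "(\<lambda>W. if W \<in> U then l W else b W) holomorphic_on U \<union> N" using U Nop by (simp add: holomorphic_on_Un)
  show "g (if W \<in> U then l W else b W) = exp W" if "W \<in> U \<union> N" for W using that l(2) bg(2) Nsub by auto
 qed auto
qed

text \<open>Branches on star-shaped domains with value \<open>z0\<close> at \<open>Z0\<close> agree
  where both are defined, so they glue to a largest one. The first missing point on a segment from
  \<open>Z0\<close> could be added by \<open>lift_limit\<close> and
  \<open>star_branch_extend\<close>, because \<open>exp\<close> maps \<open>hp a\<close> outside of
  the disc that contains the singular values.\<close>

lemma inv_branch_exists:
 assumes g: "g holomorphic_on UNIV" and sing: "sing_inverse g \<subseteq> cball 0 (exp a)"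
  and Z0: "Z0 \<in> hp a" "g z0 = exp Z0"
 obtains l where "inv_branch g a l" "l Z0 = z0"
proof -
 have crit: "deriv g z \<noteq> 0" if "g z \<in> exp ` hp a" for z using that sing by (force simp: sing_inverse_def critical_values_def norm_exp_eq_Re)
 define F where "F = {(U, l). open U \<and> U \<subseteq> hp a \<and> Z0 \<in> U \<and> (\<forall>Z\<in>U. closed_segment Z0 Z \<subseteq> U) \<and>
   l holomorphic_on U \<and> (\<forall>Z\<in>U. g (l Z) = exp Z) \<and> l Z0 = z0}"
 have FD: "open U" "U \<subseteq> hp a" "Z0 \<in> U" "\<And>Z. Z \<in> U \<Longrightarrow> closed_segment Z0 Z \<subseteq> U"
  "l holomorphic_on U" "\<And>Z. Z \<in> U \<Longrightarrow> g (l Z) = exp Z" "l Z0 = z0" if "(U, l) \<in> F" for U l using that unfolding F_def by auto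
 have agree: "l1 W = l2 W" if F1: "(U1, l1) \<in> F" and F2: "(U2, l2) \<in> F" and W: "W \<in> U1" "W \<in> U2" for U1 l1 U2 l2 W
 proof (rule lift_unique[where S="closed_segment Z0 W" and a=Z0 and x=W and ?l1.0=l1 and ?l2.0=l2, OF g])
  note s1 = FD(4)[OF F1 W(1)] and s2 = FD(4)[OF F2 W(2)]
  show "continuous_on (closed_segment Z0 W) l1" by (rule continuous_on_subset[OF holomorphic_on_imp_continuous_on[OF FD(5)[OF F1]] s1])
  show "continuous_on (closed_segment Z0 W) l2" by (rule continuous_on_subset[OF holomorphic_on_imp_continuous_on[OF FD(5)[OF F2]] s2])
  show "g (l1 x) = g (l2 x)" if x: "x \<in> closed_segment Z0 W" for x
  proof -
   have "x \<in> U1" "x \<in> U2" using s1 s2 x by auto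
   thus ?thesis using FD(6)[OF F1, of x] FD(6)[OF F2, of x] by simp
  qed
  show "deriv g (l1 x) \<noteq> 0" if "x \<in> closed_segment Z0 W" for x
  proof (rule crit)
   have "x \<in> U1" using s1 that by auto
   thus "g (l1 x) \<in> exp ` hp a" using FD(6)[OF F1, of x] FD(2)[OF F1] by auto
  qed
  show "l1 Z0 = l2 Z0" using FD(7)[OF F1] FD(7)[OF F2] by simp
 qed auto
 define U where "U = (\<Union>p\<in>F. fst p)"
 define l where "l = (\<lambda>W. (SOME w. \<exists>V m. (V, m) \<in> F \<and> W \<in> V \<and> w = m W))"
 have lE: "l W = m W" if m: "(V, m) \<in> F" "W \<in> V" for V m W
 proof -
  have "\<exists>w V m. (V, m) \<in> F \<and> W \<in> V \<and> w = m W" using m by blast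
  hence "\<exists>V m. (V, m) \<in> F \<and> W \<in> V \<and> l W = m W" unfolding l_def by (rule someI_ex)
  then obtain V' m' where "(V', m') \<in> F" "W \<in> V'" "l W = m' W" by blast
  thus ?thesis using agree[OF _ m(1) _ m(2)] by simp
 qed
 have UE: "\<exists>V m. (V, m) \<in> F \<and> W \<in> V" if "W \<in> U" for W using that by (force simp: U_def)
 have UI: "V \<subseteq> U" if "(V, m) \<in> F" for V m using that by (force simp: U_def)
 have z0c: "deriv g z0 \<noteq> 0" using crit[of z0] Z0 by auto
 obtain r e b where b: "e > 0" "ball Z0 e \<subseteq> hp a" "b holomorphic_on ball Z0 e"
  "b Z0 = z0" "\<And>Z. Z \<in> ball Z0 e \<Longrightarrow> b Z \<in> ball z0 r \<and> g (b Z) = exp Z" using local_branch[OF g open_hp z0c Z0] by metis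
 have "(ball Z0 e, b) \<in> F" unfolding F_def using b convex_contains_segment[of "ball Z0 e"] by auto
 hence Z0U: "Z0 \<in> U" using UI b(1) by force
 have Uop: "open U" unfolding U_def using FD(1) by (intro open_UN) auto
 have Usub: "U \<subseteq> hp a" using FD(2) UE by blast
 have star: "closed_segment Z0 W \<subseteq> U" if "W \<in> U" for W using UE[OF that] FD(4) UI by blast
 have lhol: "l holomorphic_on U" unfolding U_def
 proof (rule holomorphic_on_UN_open)
  fix p assume "p \<in> F"
  hence p: "(fst p, snd p) \<in> F" by simp
  show "open (fst p)" using FD(1)[OF p] .
  show "l holomorphic_on fst p" by (rule holomorphic_transform[OF FD(5)[OF p]]) (use lE[OF p] in simp)
 qed
 have lg: "g (l W) = exp W" if WU: "W \<in> U" for W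
 proof -
  obtain V m where "(V, m) \<in> F" "W \<in> V" using UE[OF WU] by blast
  thus ?thesis using lE FD(6) by simp
 qed
 have l0: "l Z0 = z0"
 proof -
  obtain V m where "(V, m) \<in> F" "Z0 \<in> V" using UE[OF Z0U] by blast
  thus ?thesis using lE FD(7) by simp
 qed
 have "U = hp a"
 proof (rule ccontr)
  assume "U \<noteq> hp a"
  then obtain Z where Z: "Z \<in> hp a" "Z \<notin> U" using Usub by blast
  define q where "q = (\<lambda>t::real. Z0 + of_real t * (Z - Z0))"
  have qc: "continuous_on UNIV q" unfolding q_def by (intro continuous_intros)
  define T where "T = {t\<in>{0..1}. q t \<notin> U}"
  have "compact T"
  proof -
   have "closed (q -` (-U))" using qc Uop by (intro closed_vimage) auto
   moreover have "T = {0..1} \<inter> q -` (-U)" by (auto simp: T_def)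
   ultimately show ?thesis by (simp add: compact_Int_closed)
  qed
  moreover have "1 \<in> T" using Z by (simp add: T_def q_def)
  ultimately obtain t1 where t1: "t1 \<in> T" "\<And>t. t \<in> T \<Longrightarrow> t1 \<le> t" using compact_attains_inf[of T] by blast
  have t1p: "0 < t1" "t1 \<le> 1" using t1(1) Z0U by (auto simp: T_def q_def less_eq_real_def)
  define Z1 where "Z1 = q t1"
  have qZ1: "Z0 + of_real t * (Z1 - Z0) = q (t * t1)" for t by (simp add: Z1_def q_def)
  have inU: "q (t * t1) \<in> U" if "0 \<le> t" "t < 1" for t
  proof (rule ccontr)
   assume "q (t * t1) \<notin> U"
   moreover have "t * t1 \<le> 1" using that t1p by (intro mult_le_one) auto
   ultimately have "t * t1 \<in> T" using that t1p by (simp add: T_def)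
   hence "t1 \<le> t * t1" using t1(2) by blast
   thus False using that t1p by simp
  qed
  have Z1: "Z1 \<in> hp a" "Z1 \<notin> U"
  proof -
   show "Z1 \<notin> U" using t1(1) by (simp add: T_def Z1_def)
   have "Z1 \<in> closed_segment Z0 Z" unfolding in_segment Z1_def q_def using t1p by (intro exI[of _ t1]) (auto simp: scaleR_conv_of_real algebra_simps)
   moreover have "closed_segment Z0 Z \<subseteq> hp a" using Z0(1) Z(1) by (intro closed_segment_subset convex_hp)
   ultimately show "Z1 \<in> hp a" by blast
  qed
  have "continuous_on {0..<1} (\<lambda>t. q (t * t1))" by (rule continuous_on_compose2[OF qc]) (auto intro!: continuous_intros)
  hence "continuous_on {0..<1} (\<lambda>t. l (q (t * t1)))"
   by (rule continuous_on_compose2[OF holomorphic_on_imp_continuous_on[OF lhol]]) (use inU in force)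
  moreover have "((\<lambda>t. g (l (q (t * t1)))) \<longlongrightarrow> exp Z1) (at_left 1)"
  proof (rule Lim_transform_eventually)
   have "isCont (\<lambda>t. exp (q (t * t1))) 1" unfolding q_def by (intro continuous_intros)
   thus "((\<lambda>t. exp (q (t * t1))) \<longlongrightarrow> exp Z1) (at_left 1)" by (simp add: isCont_def filterlim_at_split Z1_def)
   have "\<forall>\<^sub>F t in at_left 1. t \<in> {0::real<..<1}" by (rule eventually_at_left_real) auto
   thus "\<forall>\<^sub>F t in at_left 1. exp (q (t * t1)) = g (l (q (t * t1)))" by eventually_elim (use inU lg in simp)
  qed
  moreover have "exp Z1 \<notin> sing_inverse g" using sing Z1(1) by (force simp: norm_exp_eq_Re)
  ultimately obtain z1 where z1: "((\<lambda>t. l (q (t * t1))) \<longlongrightarrow> z1) (at_left 1)" "g z1 = exp Z1"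
   using lift_limit[OF g, of "\<lambda>t. l (q (t * t1))" "exp Z1"] by (auto simp: sing_inverse_def)
  obtain U' l' where U': "open U'" "U' \<subseteq> hp a" "U \<subseteq> U'" "Z1 \<in> U'"
   "\<And>Z. Z \<in> U' \<Longrightarrow> closed_segment Z0 Z \<subseteq> U'"
   "l' holomorphic_on U'" "\<And>Z. Z \<in> U' \<Longrightarrow> g (l' Z) = exp Z" "\<And>Z. Z \<in> U \<Longrightarrow> l' Z = l Z"
  proof (rule star_branch_extend[where g=g and U=U and S="hp a" and ?Z0.0=Z0 and l=l and ?Z1.0=Z1 and ?z1.0=z1])
   show "Z0 + complex_of_real t * (Z1 - Z0) \<in> U" if "0 \<le> t" "t < 1" for t using inU[OF that] by (simp only: qZ1)
   show "((\<lambda>t. l (Z0 + complex_of_real t * (Z1 - Z0))) \<longlongrightarrow> z1) (at_left 1)" using z1(1) by (simp only: qZ1)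
   show "closed_segment Z0 Z \<subseteq> U" if "Z \<in> U" for Z by (rule star[OF that])
   show "g (l Z) = exp Z" if "Z \<in> U" for Z by (rule lg[OF that])
   show "deriv g z \<noteq> 0" if "g z \<in> exp ` hp a" for z by (rule crit[OF that])
  qed ((rule g Uop Usub Z0U open_hp lhol Z1 z1(2) | blast)+)
  have "(U', l') \<in> F" unfolding F_def using U' Z0U l0 by auto
  hence "Z1 \<in> U" using UI U'(4) by blast
  thus False using Z1 by simp
 qed
 thus ?thesis using that[of l] lhol lg l0 by (auto simp: inv_branch_def)
qed

section \<open>Uniqueness and injectivity of the branches\<close>

lemma noncrit_above:
 assumes "sing_inverse g \<subseteq> cball 0 (exp a)" "g z \<in> exp ` hp a"
 shows "deriv g z \<noteq> 0"
 using assms by (force simp: sing_inverse_def critical_values_def norm_exp_eq_Re)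

lemma inv_branch_unique:
 assumes g: "g holomorphic_on UNIV" and sing: "sing_inverse g \<subseteq> cball 0 (exp a)"
  and l: "inv_branch g a l" "inv_branch g a l'" and eq: "l Z0 = l' Z0" "Z0 \<in> hp a" and Z: "Z \<in> hp a"
 shows "l Z = l' Z"
proof (rule lift_unique[where S="hp a" and a=Z0 and x=Z and ?l1.0=l and ?l2.0=l', OF g])
 show "deriv g (l x) \<noteq> 0" if "x \<in> hp a" for x using noncrit_above[OF sing, of "l x"] l(1) that by (auto simp: inv_branch_def)
qed (use assms in \<open>auto simp: inv_branch_def intro: holomorphic_on_imp_continuous_on\<close>)

lemma inv_branch_shift:
 assumes "inv_branch g a l"
 shows "inv_branch g a (\<lambda>Z. l (Z + of_int k * (of_real (2 * pi) * \<i>)))"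
proof -
 let ?s = "\<lambda>Z. Z + of_int k * (of_real (2 * pi) * \<i>)"
 have "(l \<circ> ?s) holomorphic_on hp a"
  using assms by (intro holomorphic_on_compose_gen[where t="hp a"] holomorphic_intros) (auto simp: inv_branch_def)
 moreover have "exp (?s Z) = exp Z" for Z unfolding exp_eq by (intro exI[of _ k]) (simp add: algebra_simps)
 ultimately show ?thesis using assms by (auto simp: inv_branch_def o_def)
qed

text \<open>If \<open>l\<close> took a value twice, it would be periodic with period
  \<open>2 * pi * \<i> * k\<close>, hence a function of \<open>exp (- Z / k)\<close> near 0. This
  function has a pole at 0, so its values fill a neighbourhood of infinity, where \<open>g\<close>
  then grows at most like a power. Thus \<open>g\<close> would be a polynomial.\<close>

lemma inv_branch_inj:
 assumes tr: "transcendental_entire g" and sing: "sing_inverse g \<subseteq> cball 0 (exp a)"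
  and l: "inv_branch g a l"
 shows "inj_on l (hp a)"
proof (rule ccontr)
 assume ninj: "\<not> inj_on l (hp a)"
 have g: "g holomorphic_on UNIV" using tr by (simp add: transcendental_entire_def)
 have lg: "g (l Z) = exp Z" if "Z \<in> hp a" for Z using l that by (simp add: inv_branch_def)
 have lhol: "l holomorphic_on hp a" using l by (simp add: inv_branch_def)
 obtain Z1 Z2 where Z: "Z1 \<in> hp a" "Z2 \<in> hp a" "l Z1 = l Z2" "Z1 \<noteq> Z2" using ninj by (auto simp: inj_on_def)
 have per0: "\<exists>k::nat. k > 0 \<and> (\<forall>Z\<in>hp a. l (Z + of_nat k * (of_real (2 * pi) * \<i>)) = l Z)"
 proof -
  have "exp Z2 = exp Z1" using lg[OF Z(1)] lg[OF Z(2)] Z(3) by simp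
  then obtain n :: int where n: "Z2 = Z1 + (of_int (2 * n) * pi) * \<i>" unfolding exp_eq by blast
  hence n': "Z2 = Z1 + of_int n * (of_real (2 * pi) * \<i>)" by (simp add: algebra_simps)
  have per: "l (Z + of_int n * (of_real (2 * pi) * \<i>)) = l Z" if "Z \<in> hp a" for Z
   using inv_branch_unique[OF g sing inv_branch_shift[OF l, of n] l, of Z1 Z] Z n' that by simp
  have "n \<noteq> 0" using n Z(4) by auto
  then consider "n > 0" | "n < 0" by linarith
  thus ?thesis
  proof cases
   case 1
   thus ?thesis using per by (intro exI[of _ "nat n"]) auto
  next
   case 2
   have "l (Z + of_nat (nat (-n)) * (of_real (2 * pi) * \<i>)) = l Z" if "Z \<in> hp a" for Z
    using per[of "Z + of_nat (nat (-n)) * (of_real (2 * pi) * \<i>)"] that 2 by simp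
   thus ?thesis using 2 by (intro exI[of _ "nat (-n)"]) auto
  qed
 qed
 then obtain k :: nat where k: "k > 0" and per1: "\<And>Z. Z \<in> hp a \<Longrightarrow> l (Z + of_nat k * (of_real (2 * pi) * \<i>)) = l Z" by blast
 have pern: "l (Z + of_nat n * (of_nat k * (of_real (2 * pi) * \<i>))) = l Z" if "Z \<in> hp a" for Z n
 proof (induction n)
  case (Suc n)
  have "l (Z + of_nat (Suc n) * (of_nat k * (of_real (2 * pi) * \<i>))) =
   l ((Z + of_nat n * (of_nat k * (of_real (2 * pi) * \<i>))) + of_nat k * (of_real (2 * pi) * \<i>))" by (simp add: algebra_simps)
  also have "\<dots> = l (Z + of_nat n * (of_nat k * (of_real (2 * pi) * \<i>)))" by (rule per1) (use that in simp)
  finally show ?case using Suc by simp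
 qed simp
 have per: "l X = l Y" if "X \<in> hp a" "Y = X + of_int n * (of_nat k * (of_real (2 * pi) * \<i>))" for X Y n
 proof (cases "n \<ge> 0")
  case True thus ?thesis using pern[OF that(1), of "nat n"] that(2) by simp
 next
  case False
  have "Y \<in> hp a" "X = Y + of_nat (nat (-n)) * (of_nat k * (of_real (2 * pi) * \<i>))" using that False by auto
  thus ?thesis using pern[of Y "nat (-n)"] by simp
 qed
 define \<rho> where "\<rho> = min 1 (exp (- \<bar>a\<bar>))"
 have \<rho>: "\<rho> > 0" by (simp add: \<rho>_def)
 have lnhp: "- of_nat k * W \<in> hp a" if "exp W \<in> ball 0 \<rho>" for W
 proof -
  have "exp (Re W) < exp (- \<bar>a\<bar>)" using that by (simp add: norm_exp_eq_Re \<rho>_def)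
  hence w: "Re W < - \<bar>a\<bar>" by simp
  have "\<bar>a\<bar> * 1 \<le> \<bar>a\<bar> * real k" using k by (intro mult_left_mono) auto
  also have "\<dots> < - Re W * real k" using w k by (intro mult_strict_right_mono) auto
  finally show ?thesis by (simp add: algebra_simps)
 qed
 \<comment> \<open>\<open>Ln\<close> jumps, but by periodicity any logarithm gives the same value:
   \<open>\<psi> (exp W) = l (- k * W)\<close>. So \<open>\<psi>\<close> is holomorphic around the
   puncture.\<close>
 define \<psi> where "\<psi> = (\<lambda>\<zeta>. l (- of_nat k * Ln \<zeta>))"
 have \<psi>exp: "\<psi> (exp W) = l (- of_nat k * W)" if "exp W \<in> ball 0 \<rho>" for W
 proof -
  have "exp (Ln (exp W)) = exp W" by simp
  then obtain n where n: "Ln (exp W) = W + (of_int (2 * n) * pi) * \<i>" unfolding exp_eq by blast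
  have "l (- of_nat k * W) = l (- of_nat k * Ln (exp W))" by (rule per[of _ _ "-n"]) (use lnhp[OF that] n in \<open>auto simp: algebra_simps\<close>)
  thus ?thesis by (simp add: \<psi>_def)
 qed
 have \<psi>hol: "\<psi> holomorphic_on ball 0 \<rho> - {0}"
 proof -
  define BB where "BB = (\<lambda>\<zeta>0::complex. ball \<zeta>0 (norm \<zeta>0) \<inter> ball 0 \<rho>)"
  have loc: "\<psi> holomorphic_on BB \<zeta>0" if z0: "\<zeta>0 \<in> ball 0 \<rho> - {0}" for \<zeta>0
  proof -
   define B where "B = BB \<zeta>0"
   note B_def = B_def[unfolded BB_def]
   have nz: "\<zeta> / \<zeta>0 \<notin> \<real>\<^sub>\<le>\<^sub>0" if "\<zeta> \<in> B" for \<zeta>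
   proof
    assume "\<zeta> / \<zeta>0 \<in> \<real>\<^sub>\<le>\<^sub>0"
    hence "Re (\<zeta> / \<zeta>0) \<le> 0" by (simp add: complex_nonpos_Reals_iff)
    hence "1 \<le> Re (1 - \<zeta> / \<zeta>0)" by simp
    also have "\<dots> \<le> norm (1 - \<zeta> / \<zeta>0)" by (rule complex_Re_le_cmod)
    also have "\<dots> = norm (\<zeta>0 - \<zeta>) / norm \<zeta>0" using z0 by (simp flip: norm_divide add: diff_divide_distrib)
    finally show False using that z0 by (simp add: B_def dist_norm field_simps)
   qed
   have ex: "exp (Ln (\<zeta> / \<zeta>0) + Ln \<zeta>0) = \<zeta>" if "\<zeta> \<in> B" for \<zeta>
   proof -
    have "\<zeta> \<noteq> 0" using nz[OF that] by auto
    thus ?thesis using z0 by (simp add: exp_add)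
   qed
   have "(l \<circ> (\<lambda>\<zeta>. - of_nat k * (Ln (\<zeta> / \<zeta>0) + Ln \<zeta>0))) holomorphic_on B"
   proof (rule holomorphic_on_compose_gen[OF _ lhol])
    show "(\<lambda>\<zeta>. - of_nat k * (Ln (\<zeta> / \<zeta>0) + Ln \<zeta>0)) holomorphic_on B" using nz z0 by (intro holomorphic_intros) auto
    show "(\<lambda>\<zeta>. - of_nat k * (Ln (\<zeta> / \<zeta>0) + Ln \<zeta>0)) ` B \<subseteq> hp a"
    proof safe
     fix \<zeta> assume "\<zeta> \<in> B"
     thus "- of_nat k * (Ln (\<zeta> / \<zeta>0) + Ln \<zeta>0) \<in> hp a" by (intro lnhp) (use ex B_def in auto)
    qed
   qed
   hence "\<psi> holomorphic_on B"
   proof (rule holomorphic_transform)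
    fix \<zeta> assume z: "\<zeta> \<in> B"
    thus "(l \<circ> (\<lambda>\<zeta>. - of_nat k * (Ln (\<zeta> / \<zeta>0) + Ln \<zeta>0))) \<zeta> = \<psi> \<zeta>"
     using \<psi>exp[of "Ln (\<zeta> / \<zeta>0) + Ln \<zeta>0"] ex[OF z] B_def by simp
   qed
   thus ?thesis using B_def by (simp add: BB_def)
  qed
  have "\<psi> holomorphic_on (\<Union>\<zeta>0\<in>ball 0 \<rho> - {0}. BB \<zeta>0)" by (rule holomorphic_on_UN_open[OF loc]) (auto simp: BB_def)
  thus ?thesis by (rule holomorphic_on_subset) (auto simp: BB_def)
 qed
 have g\<psi>: "g (\<psi> \<zeta>) = inverse (\<zeta> ^ k)" if "\<zeta> \<in> ball 0 \<rho> - {0}" for \<zeta>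
 proof -
  have "exp (Ln \<zeta>) \<in> ball 0 \<rho>" using that by simp
  hence "g (\<psi> \<zeta>) = exp (- of_nat k * Ln \<zeta>)" unfolding \<psi>_def using lg[OF lnhp] by simp
  also have "\<dots> = inverse (exp (Ln \<zeta>) ^ k)" by (simp add: exp_of_nat_mult exp_minus)
  finally show ?thesis using that by simp
 qed
 \<comment> \<open>\<open>g\<close> is bounded on bounded sets, while
   \<open>g (\<psi> \<zeta>)\<close> is the inverse of \<open>\<zeta> ^ k\<close>.\<close>
 have pole: "is_pole \<psi> 0" unfolding is_pole_def filterlim_at_infinity[OF order_refl]
 proof (intro allI impI)
  fix r :: real assume "r > 0"
  have "compact (g ` cball 0 r)" by (intro compact_continuous_image holomorphic_on_imp_continuous_on holomorphic_on_subset[OF g]) auto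
  then obtain M where M: "\<And>z. norm z \<le> r \<Longrightarrow> norm (g z) \<le> M" by (force dest!: compact_imp_bounded simp: bounded_iff)
  define M' where "M' = max 1 M"
  have ev: "\<forall>\<^sub>F \<zeta> in at 0. \<zeta> \<in> ball 0 (min \<rho> (1 / (M' + 1))) - {0}"
   using \<rho> by (intro eventually_at_in_open) (auto simp: M'_def add_pos_pos)
  show "\<forall>\<^sub>F \<zeta> in at 0. r \<le> norm (\<psi> \<zeta>)" using ev
  proof eventually_elim
   case (elim \<zeta>)
   hence z: "norm \<zeta> < \<rho>" "norm \<zeta> < 1 / (M' + 1)" "\<zeta> \<noteq> 0" by auto
   have "1 / (M' + 1) \<le> 1" by (simp add: M'_def)
   hence "norm \<zeta> \<le> 1" using z by simp
   hence "norm \<zeta> ^ k \<le> norm \<zeta>" using power_decreasing[of 1 k "norm \<zeta>"] k by simp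
   also have "\<dots> < 1 / (M' + 1)" using z by simp
   finally have "M' + 1 < inverse (norm \<zeta> ^ k)" using z by (simp add: field_simps M'_def)
   also have "\<dots> = norm (g (\<psi> \<zeta>))" using g\<psi>[of \<zeta>] z by (simp add: norm_inverse norm_power)
   finally have "M < norm (g (\<psi> \<zeta>))" by (simp add: M'_def)
   thus ?case using M[of "\<psi> \<zeta>"] by force
  qed
 qed
 have "\<forall>\<^sub>F \<zeta> in at 0. 1 \<le> norm (\<psi> \<zeta>)" using pole unfolding is_pole_def filterlim_at_infinity[OF order_refl] by auto
 then obtain d where d: "d > 0" "\<And>\<zeta>. \<zeta> \<noteq> 0 \<Longrightarrow> dist \<zeta> 0 < d \<Longrightarrow> 1 \<le> norm (\<psi> \<zeta>)"
  unfolding eventually_at by auto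
 define e where "e = min d \<rho>"
 have e: "e > 0" using d \<rho> by (simp add: e_def)
 define \<phi> where "\<phi> = (\<lambda>\<zeta>. if \<zeta> = 0 then 0 else inverse (\<psi> \<zeta>))"
 have \<phi>hol: "\<phi> holomorphic_on ball 0 e" unfolding \<phi>_def
 proof (rule is_pole_inverse_holomorphic[OF open_ball _ pole])
  show "\<psi> holomorphic_on ball 0 e - {0}" using \<psi>hol by (rule holomorphic_on_subset) (auto simp: e_def)
  show "\<forall>x\<in>ball 0 e - {0}. \<psi> x \<noteq> 0" using d by (force simp: e_def)
 qed
 have nconst: "\<not> \<phi> constant_on ball 0 e"
 proof
  assume "\<phi> constant_on ball 0 e"
  hence "\<phi> (of_real (e/2)) = \<phi> 0" using e unfolding constant_on_def by (metis centre_in_ball mem_ball_0 norm_of_real abs_of_pos half_gt_zero field_sum_of_halves less_add_same_cancel1)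
  hence "\<psi> (of_real (e/2)) = 0" using e by (simp add: \<phi>_def)
  moreover have "1 \<le> norm (\<psi> (of_real (e/2)))" using e by (intro d) (auto simp: e_def)
  ultimately show False by simp
 qed
 obtain D where D: "(\<phi> has_field_derivative D) (at 0)" using \<phi>hol e by (metis centre_in_ball holomorphic_on_open open_ball)
 have "((\<lambda>h. norm ((\<phi> (0 + h) - \<phi> 0) / h)) \<longlongrightarrow> norm D) (at 0)" using D unfolding DERIV_def by (rule tendsto_norm)
 hence "\<forall>\<^sub>F h in at 0. norm ((\<phi> (0 + h) - \<phi> 0) / h) < norm D + 1" by (rule order_tendstoD) simp
 then obtain e1 where e1: "e1 > 0" "\<And>h. h \<noteq> 0 \<Longrightarrow> dist h 0 < e1 \<Longrightarrow> norm (\<phi> h / h) < norm D + 1"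
  unfolding eventually_at by (auto simp: \<phi>_def)
 define e2 where "e2 = min e e1"
 have e2: "e2 > 0" using e e1 by (simp add: e2_def)
 have "open (\<phi> ` ball 0 e2)" by (rule open_mapping_thm[OF \<phi>hol _ _ _ _ nconst]) (auto simp: e2_def)
 moreover have "0 \<in> \<phi> ` ball 0 e2" using e2 by (auto simp: \<phi>_def intro!: image_eqI[of _ _ 0])
 ultimately obtain u where u: "u > 0" "ball 0 u \<subseteq> \<phi> ` ball 0 e2" by (meson openE)
 \<comment> \<open>Every \<open>z\<close> near infinity is some \<open>\<psi> \<zeta>\<close>, and
   differentiability of the inverse of \<open>\<psi>\<close> at 0 bounds
   \<open>1 / norm \<zeta>\<close> by a multiple of \<open>norm z\<close>.\<close>
 have bound: "norm (g z) \<le> (norm D + 1) ^ k * norm z ^ k" if z: "1 / u + 1 \<le> norm z" for z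
 proof -
  have zn2: "1 / u < norm z" using z by simp
  moreover have "0 < 1 / u" using u(1) by simp
  ultimately have zn: "z \<noteq> 0" "1 / u < norm z" by auto
  hence "norm (inverse z) < u" unfolding norm_inverse using u(1) by (simp add: field_simps)
  hence "inverse z \<in> \<phi> ` ball 0 e2" using u by auto
  then obtain \<zeta> where \<zeta>: "norm \<zeta> < e2" "inverse z = \<phi> \<zeta>" by auto
  have "\<zeta> \<noteq> 0" using \<zeta> zn by (auto simp: \<phi>_def)
  hence zpsi: "\<psi> \<zeta> = z" using \<zeta> by (simp add: \<phi>_def)
  have "norm (\<phi> \<zeta> / \<zeta>) < norm D + 1" using e1(2)[of \<zeta>] \<zeta> \<open>\<zeta> \<noteq> 0\<close> by (simp add: e2_def)
  hence "inverse (norm z) * inverse (norm \<zeta>) \<le> norm D + 1"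
   unfolding \<zeta>(2)[symmetric] by (simp add: norm_divide norm_mult norm_inverse divide_inverse)
  hence "norm z * (inverse (norm z) * inverse (norm \<zeta>)) \<le> norm z * (norm D + 1)" by (intro mult_left_mono) auto
  hence "inverse (norm \<zeta>) \<le> (norm D + 1) * norm z" using zn(1) by (simp add: mult.commute flip: mult.assoc)
  hence "inverse (norm \<zeta>) ^ k \<le> ((norm D + 1) * norm z) ^ k" by (intro power_mono) auto
  moreover have "norm (g z) = inverse (norm \<zeta>) ^ k"
   using g\<psi>[of \<zeta>] \<zeta> \<open>\<zeta> \<noteq> 0\<close> zpsi by (simp add: e2_def e_def norm_inverse norm_power power_inverse)
  ultimately show ?thesis by (simp add: power_mult_distrib)
 qed
 have "g z = (\<Sum>i\<le>k. (deriv ^^ i) g 0 / fact i * z ^ i)" for z by (rule Liouville_polynomial[OF g bound])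
 hence "g z = poly (\<Sum>i\<le>k. monom ((deriv ^^ i) g 0 / fact i) i) z" for z by (simp add: poly_sum poly_monom)
 thus False using tr unfolding transcendental_entire_def by blast
qed

section \<open>Logarithmic coordinates\<close>

definition tpi :: complex where "tpi = of_real (2 * pi) * \<i>"

lemma tpi_simps [simp]: "Re tpi = 0" "Im tpi = 2 * pi" "tpi \<noteq> 0" "norm tpi = 2 * pi"
 by (auto simp: tpi_def norm_mult)

lemma exp_eq_tpi: "exp w = exp z \<longleftrightarrow> (\<exists>n::int. w = z + of_int n * tpi)"
 unfolding exp_eq tpi_def by (simp add: algebra_simps)

lemma exp_tpi [simp]: "exp (z + of_int n * tpi) = exp z"
 unfolding exp_eq_tpi by blast

text \<open>Branches of the inverse of the logarithmic lift of \<open>g\<close>. The images of half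
  planes \<open>R \<le> Re Z\<close> under \<open>exp (L Z)\<close> are the closed tracts.\<close>

definition lbranch :: "(complex \<Rightarrow> complex) \<Rightarrow> real \<Rightarrow> (complex \<Rightarrow> complex) \<Rightarrow> bool" where
 "lbranch g a L \<longleftrightarrow> L holomorphic_on hp a \<and> (\<forall>Z\<in>hp a. g (exp (L Z)) = exp Z)"

text \<open>Bloch's theorem puts a disc of radius \<open>r * norm (deriv f c) / 12\<close> into the
  image, and a disc of radius greater than \<open>pi\<close> contains two points that differ by
  \<open>tpi\<close>.\<close>

lemma deriv_bound_mod_tpi:
 assumes f: "f holomorphic_on ball c r" and r: "r > 0"
  and inj: "\<And>z1 z2. z1 \<in> ball c r \<Longrightarrow> z2 \<in> ball c r \<Longrightarrow> f z1 \<noteq> f z2 + tpi"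
 shows "norm (deriv f c) \<le> 12 * pi / r"
proof (rule ccontr)
 assume "\<not> ?thesis"
 hence "pi < r * norm (deriv f c) / 12" using r by (simp add: field_simps)
 moreover obtain b where b: "ball b (r * norm (deriv f c) / 12) \<subseteq> f ` ball c r" using Bloch[OF f r order_refl] .
 ultimately have "b + tpi / 2 \<in> f ` ball c r" "b - tpi / 2 \<in> f ` ball c r" by (auto intro!: subsetD[OF b] simp: dist_norm norm_divide)
 then obtain z1 z2 where "z1 \<in> ball c r" "z2 \<in> ball c r" "f z1 = b + tpi / 2" "f z2 = b - tpi / 2" by auto
 thus False using inj[of z1 z2] by simp
qed

text \<open>\<open>growth\<close> is the form in which finite order enters the later estimates. The
  gap of 400 makes the derivative bound \<open>12 * pi / (Re Z - a)\<close> smaller than 1/8 for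
  \<open>R \<le> Re Z\<close>. Since \<open>g 0\<close> is small, inverse branches avoid 0 and have
  logarithms.\<close>

locale tracts =
 fixes g :: "complex \<Rightarrow> complex" and a R \<alpha> \<beta> :: real
 assumes tr: "transcendental_entire g" and sing: "sing_inverse g \<subseteq> cball 0 (exp a)"
  and a0: "0 \<le> a" and g0: "norm (g 0) < exp a" and R: "a + 400 \<le> R" and \<alpha>: "0 < \<alpha>"
  and growth: "\<And>L Z. lbranch g a L \<Longrightarrow> R \<le> Re Z \<Longrightarrow> \<alpha> * ln (Re Z) - \<beta> \<le> Re (L Z)"
begin

abbreviation "lb \<equiv> lbranch g a"
abbreviation "collar \<equiv> {Z. a < Re Z \<and> Re Z < R}"

lemma gh: "g holomorphic_on UNIV" using tr by (simp add: transcendental_entire_def)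
lemma Ra: "a < R" "0 < R" "1 \<le> R" using R a0 by auto

lemma lbD: assumes "lb L" shows "L holomorphic_on hp a" "\<And>Z. a < Re Z \<Longrightarrow> g (exp (L Z)) = exp Z"
 using assms by (auto simp: lbranch_def)

lemma lb_inv_branch: "lb L \<Longrightarrow> inv_branch g a (\<lambda>Z. exp (L Z))"
 by (auto simp: lbranch_def inv_branch_def intro!: holomorphic_intros)

lemma lb_exists:
 assumes "a < Re Z0" "g (exp w) = exp Z0"
 obtains L where "lb L" "L Z0 = w"
proof -
 obtain l where l: "inv_branch g a l" "l Z0 = exp w" using inv_branch_exists[OF gh sing _ assms(2)] assms(1) by auto
 have nz: "l Z \<noteq> 0" if "Z \<in> hp a" for Z
 proof
  assume "l Z = 0"
  hence "g 0 = exp Z" using l(1) that by (force simp: inv_branch_def)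
  thus False using g0 that by (simp add: norm_exp_eq_Re)
 qed
 obtain L where L: "L holomorphic_on hp a" "\<And>Z. Z \<in> hp a \<Longrightarrow> l Z = exp (L Z)"
  by (rule contractible_imp_holomorphic_log[of l "hp a"])
    (use nz l in \<open>auto simp: inv_branch_def convex_imp_contractible\<close>)
 have "exp w = exp (L Z0)" using L(2)[of Z0] l(2) assms(1) by simp
 then obtain n where n: "w = L Z0 + of_int n * tpi" unfolding exp_eq_tpi by blast
 show ?thesis
 proof (rule that[of "\<lambda>Z. L Z + of_int n * tpi"])
  show "lb (\<lambda>Z. L Z + of_int n * tpi)" using L l by (auto simp: lbranch_def inv_branch_def intro!: holomorphic_intros)
 qed (simp add: n)
qed

lemma lb_shift:
 assumes "lb L" shows "lb (\<lambda>Z. L (Z + of_int k * tpi) + of_int n * tpi)"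
proof -
 have "(L \<circ> (\<lambda>Z. Z + of_int k * tpi)) holomorphic_on hp a"
  using lbD(1)[OF assms] by (intro holomorphic_on_compose_gen[where t="hp a"] holomorphic_intros) auto
 thus ?thesis using assms by (auto simp: lbranch_def o_def intro!: holomorphic_intros)
qed

lemma lb_inj:
 assumes L: "lb L" and Z: "a < Re Z1" "a < Re Z2" "L Z1 = L Z2 + of_int n * tpi"
 shows "Z1 = Z2" "n = 0"
proof -
 have "exp (L Z1) = exp (L Z2)" using Z(3) by simp
 thus "Z1 = Z2" using inj_onD[OF inv_branch_inj[OF tr sing lb_inv_branch[OF L]], of Z1 Z2] Z by simp
 thus "n = 0" using Z by simp
qed

text \<open>Branches into the same tract differ only by translations in the source and in the
  target: their difference is continuous and takes values in the discrete set of integer multiples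
  of \<open>tpi\<close>.\<close>

lemma lb_meet:
 assumes L: "lb L" and L': "lb L'" and Z: "a < Re Z" "a < Re Z'" and eq: "exp (L Z) = exp (L' Z')"
 obtains k n :: int where "Z' = Z + of_int k * tpi" "\<And>W. a < Re W \<Longrightarrow> L' (W + of_int k * tpi) = L W + of_int n * tpi"
proof -
 have "exp Z' = exp Z" using lbD(2)[OF L Z(1)] lbD(2)[OF L' Z(2)] eq by simp
 then obtain k where k: "Z' = Z + of_int k * tpi" unfolding exp_eq_tpi by blast
 have L2: "lb (\<lambda>W. L' (W + of_int k * tpi))" using lb_shift[OF L', of k 0] by simp
 have e: "exp (L W) = exp (L' (W + of_int k * tpi))" if "W \<in> hp a" for W
  by (rule inv_branch_unique[OF gh sing lb_inv_branch[OF L] lb_inv_branch[OF L2], of Z])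
    (use that eq k Z in auto)
 define D where "D = (\<lambda>W. (L' (W + of_int k * tpi) - L W) / tpi)"
 have Dint: "D W \<in> \<int>" if W: "W \<in> hp a" for W
 proof -
  obtain m :: int where "L' (W + of_int k * tpi) = L W + of_int m * tpi" using e[OF W, symmetric] unfolding exp_eq_tpi by blast
  thus ?thesis by (simp add: D_def)
 qed
 have cD: "continuous_on (hp a) D" unfolding D_def
  using lbD(1)[OF L] lbD(1)[OF L2] by (intro continuous_intros) (auto intro: holomorphic_on_imp_continuous_on)
 have "D constant_on hp a"
 proof (rule continuous_discrete_range_constant[OF connected_hp cD])
  show "\<exists>e>0. \<forall>y. y \<in> hp a \<and> D y \<noteq> D x \<longrightarrow> e \<le> norm (D y - D x)" if x: "x \<in> hp a" for x
  proof (intro exI[of _ 1] conjI allI impI)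
   fix y assume y: "y \<in> hp a \<and> D y \<noteq> D x"
   obtain m1 m2 :: int where m: "D y = of_int m1" "D x = of_int m2" using Dint[OF x] Dint[of y] y by (auto elim!: Ints_cases)
   hence "m1 \<noteq> m2" using y by auto
   hence "1 \<le> \<bar>of_int (m1 - m2) :: real\<bar>" by linarith
   also have "\<dots> = norm (D y - D x)" unfolding m by (metis norm_of_int of_int_diff)
   finally show "1 \<le> norm (D y - D x)" .
  qed auto
 qed
 then obtain c where c: "\<And>W. W \<in> hp a \<Longrightarrow> D W = c" by (auto simp: constant_on_def)
 obtain n :: int where n: "c = of_int n" using Dint[of Z] c[of Z] Z by (auto elim!: Ints_cases)
 have "L' (W + of_int k * tpi) = L W + of_int n * tpi" if "a < Re W" for W using c[of W] that n by (simp add: D_def field_simps)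
 thus ?thesis using that k by blast
qed

lemma lb_deriv_bound:
 assumes L: "lb L" and Z: "a < Re Z"
 shows "norm (deriv L Z) \<le> 12 * pi / (Re Z - a)"
proof (rule deriv_bound_mod_tpi)
 have sub: "ball Z (Re Z - a) \<subseteq> hp a"
 proof
  fix W assume "W \<in> ball Z (Re Z - a)"
  hence "norm (Z - W) < Re Z - a" by (simp add: dist_norm)
  hence "Re (Z - W) < Re Z - a" using complex_Re_le_cmod[of "Z - W"] by linarith
  thus "W \<in> hp a" by simp
 qed
 show "L holomorphic_on ball Z (Re Z - a)" using lbD(1)[OF L] sub by (rule holomorphic_on_subset)
 fix z1 z2 assume "z1 \<in> ball Z (Re Z - a)" "z2 \<in> ball Z (Re Z - a)"
 hence "z1 \<in> hp a" "z2 \<in> hp a" using sub by blast+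
 thus "L z1 \<noteq> L z2 + tpi" using lb_inj(2)[OF L, of z1 z2 1] by auto
qed (use Z in simp)

lemma lb_lip:
 assumes L: "lb L" and x: "a < x" "x \<le> Re Z" "x \<le> Re W"
 shows "norm (L Z - L W) \<le> 12 * pi / (x - a) * norm (Z - W)"
proof (rule field_differentiable_bound[where S="{Z. x \<le> Re Z}" and f'="deriv L"])
 show "convex {Z. x \<le> Re Z}" by (rule convex_halfspace_Re_ge)
 fix z assume z: "z \<in> {Z. x \<le> Re Z}"
 hence za: "z \<in> hp a" using x by simp
 show "(L has_field_derivative deriv L z) (at z within {Z. x \<le> Re Z})"
  using holomorphic_derivI[OF lbD(1)[OF L] open_hp za] by (rule has_field_derivative_at_within)
 have "norm (deriv L z) \<le> 12 * pi / (Re z - a)" using lb_deriv_bound[OF L] za by simp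
 also have "\<dots> \<le> 12 * pi / (x - a)" using z x by (intro divide_left_mono) auto
 finally show "norm (deriv L z) \<le> 12 * pi / (x - a)" .
qed (use x in auto)

text \<open>Integrating the derivative bound along a horizontal segment costs only a logarithm of
  its length, which \<open>growth\<close> can absorb.\<close>

lemma lb_lip_log:
 assumes L: "lb L" and Z: "a < Re Z" and t: "0 \<le> t"
 shows "norm (L (Z + of_real t) - L Z) \<le> 12 * pi * ln ((Re Z - a + t) / (Re Z - a))"
proof (cases "t = 0")
 case False
 define \<phi> where "\<phi> = (\<lambda>s. 12 * pi * ln (Re Z - a + s))"
 have "norm (L (Z + of_real t) - L (Z + of_real 0)) \<le> \<phi> t - \<phi> 0"
 proof (rule differentiable_bound_general[where f="\<lambda>s. L (Z + of_real s)" and f'="\<lambda>s. deriv L (Z + of_real s)" and \<phi>'="\<lambda>s. 12 * pi / (Re Z - a + s)"])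
  show "0 < t" using t False by simp
  show "continuous_on {0..t} \<phi>" unfolding \<phi>_def using Z by (auto intro!: continuous_intros)
  show "continuous_on {0..t} (\<lambda>s. L (Z + of_real s))" by (rule continuous_on_compose2[OF holomorphic_on_imp_continuous_on[OF lbD(1)[OF L]]])
     (use Z in \<open>auto intro!: continuous_intros\<close>)
  fix s assume s: "0 < s" "s < t"
  show "(\<phi> has_vector_derivative 12 * pi / (Re Z - a + s)) (at s)" unfolding \<phi>_def has_real_derivative_iff_has_vector_derivative[symmetric]
   using Z s by (auto intro!: derivative_eq_intros)
  have h: "Z + of_real s \<in> hp a" using Z s by simp
  have "((\<lambda>s. Z + of_real s) has_vector_derivative 1) (at s)" by (auto intro!: derivative_eq_intros)
  from field_vector_diff_chain_at[OF this holomorphic_derivI[OF lbD(1)[OF L] open_hp h]]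
  show "((\<lambda>s. L (Z + of_real s)) has_vector_derivative deriv L (Z + of_real s)) (at s)" by (simp add: o_def)
  show "norm (deriv L (Z + of_real s)) \<le> 12 * pi / (Re Z - a + s)" using lb_deriv_bound[OF L, of "Z + of_real s"] h by (simp add: algebra_simps)
 qed
 thus ?thesis using Z t by (simp add: \<phi>_def ln_div algebra_simps)
qed simp

end

section \<open>The complement of the tracts\<close>

context tracts begin

definition V :: "complex set" where "V = {z. norm (g z) < exp R}"

lemma g_cont: "continuous_on UNIV g" using gh by (rule holomorphic_on_imp_continuous_on)

lemma V_open: "open V"
proof -
 have "open ((\<lambda>z. norm (g z)) -` {..<exp R})" by (intro open_vimage continuous_intros g_cont)
 moreover have "(\<lambda>z. norm (g z)) -` {..<exp R} = V" by (auto simp: V_def)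
 ultimately show ?thesis by simp
qed

lemma zero_V: "0 \<in> V"
proof -
 have "exp a < exp R" using Ra by simp
 hence "norm (g 0) < exp R" using g0 by linarith
 thus ?thesis unfolding V_def by simp
qed

lemma exp_V_iff: assumes "lb L" "a < Re Z" shows "exp (L Z) \<in> V \<longleftrightarrow> Re Z < R"
 using lbD(2)[OF assms] by (simp add: V_def norm_exp_eq_Re)

lemma tract_cover:
 assumes "exp a < norm (g (exp w))"
 obtains L Z where "lb L" "a < Re Z" "L Z = w" "exp (Re Z) = norm (g (exp w))"
proof -
 define Z where "Z = Ln (g (exp w))"
 have "g (exp w) \<noteq> 0" using assms by (metis exp_ge_zero norm_zero not_less)
 hence Z: "g (exp w) = exp Z" by (simp add: Z_def)
 hence n: "norm (g (exp w)) = exp (Re Z)" by (simp add: norm_exp_eq_Re)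
 hence "a < Re Z" using assms by simp
 from lb_exists[OF this Z] that this n show ?thesis by metis
qed

lemma tract_cover_V:
 assumes "z \<notin> V"
 obtains L Z where "lb L" "R \<le> Re Z" "exp (L Z) = z"
proof -
 have n: "exp R \<le> norm (g z)" using assms by (simp add: V_def)
 have "z \<noteq> 0" using assms zero_V by auto
 hence z: "exp (Ln z) = z" by simp
 have "exp a < exp R" using Ra by simp
 hence "exp a < norm (g z)" using n by linarith
 hence "exp a < norm (g (exp (Ln z)))" using z by simp
 from tract_cover[OF this] obtain L Z where L: "lb L" "a < Re Z" "L Z = Ln z" "exp (Re Z) = norm (g (exp (Ln z)))" .
 have "exp R \<le> exp (Re Z)" using n L(4) z by simp
 thus ?thesis using that[OF L(1)] L(3) z by simp
qed

lemma exp_lb_open: assumes "lb L" "open A" "A \<subseteq> hp a" shows "open ((\<lambda>Z. exp (L Z)) ` A)"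
proof (rule open_mapping_thm3)
 show "(\<lambda>Z. exp (L Z)) holomorphic_on A" by (rule holomorphic_on_subset[OF _ assms(3)]) (auto intro!: holomorphic_intros lbD(1)[OF assms(1)])
 show "inj_on (\<lambda>Z. exp (L Z)) A" by (rule inj_on_subset[OF inv_branch_inj[OF tr sing lb_inv_branch[OF assms(1)]] assms(3)])
qed (rule assms(2))

lemma lb_cont: assumes "lb L" "A \<subseteq> hp a" shows "continuous_on A L"
 using holomorphic_on_imp_continuous_on[OF lbD(1)[OF assms(1)]] assms(2) by (rule continuous_on_subset)

text \<open>A separation of \<open>V\<close> would extend to a separation of the plane: each tract
  is attached to the side that contains its collar, the part over \<open>a < Re Z < R\<close>, which
  is connected and lies in \<open>V\<close>.\<close>

lemma V_connected: "connected V"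
proof (rule ccontr)
 assume "\<not> connected V"
 then obtain A B where AB: "open A" "open B" "V \<subseteq> A \<union> B" "A \<inter> B \<inter> V = {}" "A \<inter> V \<noteq> {}" "B \<inter> V \<noteq> {}"
  unfolding connected_def by blast
 define K where "K = (\<lambda>L::complex \<Rightarrow> complex. (\<lambda>Z. exp (L Z)) ` collar)"
 define T where "T = (\<lambda>L::complex \<Rightarrow> complex. (\<lambda>Z. exp (L Z)) ` hp a)"
 have KV: "K L \<subseteq> V" if "lb L" for L using exp_V_iff[OF that] by (auto simp: K_def)
 have cc: "connected collar"
 proof -
  have "collar = hp a \<inter> {Z. Re Z < R}" by auto
  thus ?thesis by (simp add: convex_connected convex_Int convex_halfspace_Re_lt)
 qed
 have Kconn: "connected (K L)" if "lb L" for L unfolding K_def by (intro connected_continuous_image cc continuous_intros lb_cont[OF that]) auto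
 have Kne: "K L \<noteq> {}" for L
 proof -
  have "a < (a + R)/2" "(a+R)/2 < R" using Ra by auto
  hence "of_real ((a + R)/2) \<in> collar" by simp
  thus ?thesis unfolding K_def by blast
 qed
 have Kside: "K L \<subseteq> A \<or> K L \<subseteq> B" if L: "lb L" for L
 proof (rule ccontr)
  assume "\<not> ?thesis"
  hence "A \<inter> K L \<noteq> {}" "B \<inter> K L \<noteq> {}" using KV[OF L] AB(3) by auto
  moreover have "A \<inter> B \<inter> K L = {}" "K L \<subseteq> A \<union> B" using KV[OF L] AB(3,4) by auto
  ultimately show False using Kconn[OF L] AB(1,2) unfolding connected_def by blast
 qed
 have sep: "\<not> (K L' \<subseteq> B)" if LL: "lb L" "K L \<subseteq> A" "lb L'" "exp (L Z) = exp (L' Z')" "a < Re Z" "a < Re Z'" for L L' Z Z'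
 proof
  assume KB: "K L' \<subseteq> B"
  obtain k n where kn: "Z' = Z + of_int k * tpi" "\<And>W. a < Re W \<Longrightarrow> L' (W + of_int k * tpi) = L W + of_int n * tpi"
   by (rule lb_meet[OF LL(1,3,5,6,4)]) blast
  obtain Y where Y: "a < Re Y" "Re Y < R" using Kne[of L] by (auto simp: K_def)
  have "exp (L Y) \<in> K L" using Y by (auto simp: K_def)
  moreover have "exp (L' (Y + of_int k * tpi)) \<in> K L'" using Y by (auto simp: K_def)
  moreover have "exp (L' (Y + of_int k * tpi)) = exp (L Y)" using kn(2)[OF Y(1)] by simp
  ultimately have "exp (L Y) \<in> A \<inter> B \<inter> V" using LL(2) KB KV[OF LL(1)] by auto
  thus False using AB(4) by auto
 qed
 define A' where "A' = A \<inter> V \<union> (\<Union>L\<in>{L. lb L \<and> K L \<subseteq> A}. T L)"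
 define B' where "B' = B \<inter> V \<union> (\<Union>L\<in>{L. lb L \<and> K L \<subseteq> B}. T L)"
 have oT: "open (T L)" if "lb L" for L unfolding T_def by (rule exp_lb_open[OF that]) auto
 have "open A'" "open B'" unfolding A'_def B'_def using AB(1,2) V_open oT by (auto intro!: open_Un open_UN open_Int)
 moreover have "UNIV \<subseteq> A' \<union> B'"
 proof
  fix z :: complex
  show "z \<in> A' \<union> B'"
  proof (cases "z \<in> V")
   case True thus ?thesis using AB(3) by (auto simp: A'_def B'_def)
  next
   case False
   then obtain L Z where L: "lb L" "R \<le> Re Z" "exp (L Z) = z" by (rule tract_cover_V)
   hence "z \<in> T L" using Ra by (auto simp: T_def)
   thus ?thesis using Kside[OF L(1)] L(1) by (auto simp: A'_def B'_def)
  qed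
 qed
 moreover have "A' \<inter> B' = {}"
 proof -
  have mix: "z \<in> K L" if "z \<in> V" "lb L" "z \<in> T L" for z L using that exp_V_iff[OF that(2)] by (auto simp: T_def K_def)
  have "False" if zA: "z \<in> A'" and zB: "z \<in> B'" for z
  proof (cases "z \<in> V")
   case True
   have "z \<in> A" using zA mix[OF True] True by (auto simp: A'_def)
   moreover have "z \<in> B" using zB mix[OF True] True by (auto simp: B'_def)
   ultimately show False using True AB(4) by auto
  next
   case False
   then obtain L L' where L: "lb L" "K L \<subseteq> A" "z \<in> T L" "lb L'" "K L' \<subseteq> B" "z \<in> T L'"
    using zA zB by (auto simp: A'_def B'_def)
   obtain Z where Z: "z = exp (L Z)" "a < Re Z" using L(3) by (auto simp: T_def)
   obtain Z' where Z': "z = exp (L' Z')" "a < Re Z'" using L(6) by (auto simp: T_def)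
   show False using sep[OF L(1,2,4), of Z Z'] L(5) Z Z' by auto
  qed
  thus ?thesis by blast
 qed
 moreover have "A' \<noteq> {}" "B' \<noteq> {}" using AB(5,6) by (auto simp: A'_def B'_def)
 ultimately show False using connected_UNIV[where 'a=complex] unfolding connected_def by blast
qed

lemma Re_lb_at_top: assumes "lb L" obtains x where "R \<le> x" "\<And>Z. x \<le> Re Z \<Longrightarrow> M \<le> Re (L Z)"
proof -
 define x where "x = max R (exp ((M + \<beta>) / \<alpha>))"
 show ?thesis
 proof (rule that[of x])
  fix Z assume Z: "x \<le> Re Z"
  hence r: "R \<le> Re Z" and e: "exp ((M + \<beta>) / \<alpha>) \<le> Re Z" by (auto simp: x_def)
  have "(M + \<beta>) / \<alpha> \<le> ln (Re Z)" using e Ra r by (simp add: ln_ge_iff)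
  hence "M + \<beta> \<le> \<alpha> * ln (Re Z)" using \<alpha> by (simp add: field_simps)
  thus "M \<le> Re (L Z)" using growth[OF assms r] by simp
 qed (simp add: x_def)
qed

text \<open>Each point outside of \<open>V\<close> lies on the image of a closed half plane under
  some \<open>exp (L Z)\<close>. This image is connected, avoids \<open>V\<close> and is unbounded
  by \<open>growth\<close>, so no component of the complement is bounded.\<close>

lemma V_simply_connected: "simply_connected V"
 unfolding simply_connected_eq_unbounded_complement_components[OF V_open]
proof (intro conjI ballI V_connected notI)
 fix C assume C: "C \<in> components (- V)" "bounded C"
 then obtain z where z: "z \<in> C" using in_components_nonempty by blast
 hence "z \<notin> V" using in_components_subset[OF C(1)] by blast
 then obtain L Z where L: "lb L" "R \<le> Re Z" "exp (L Z) = z" by (rule tract_cover_V)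
 define K where "K = (\<lambda>Z. exp (L Z)) ` {Z. R \<le> Re Z}"
 have "connected K" unfolding K_def using Ra by (intro connected_continuous_image continuous_intros lb_cont[OF L(1)])
   (auto simp: convex_connected convex_halfspace_Re_ge)
 moreover have "K \<subseteq> - V" using exp_V_iff[OF L(1)] Ra by (force simp: K_def)
 moreover have "C \<inter> K \<noteq> {}" using z L by (auto simp: K_def)
 ultimately have "K \<subseteq> C" using components_maximal[OF C(1)] by blast
 hence "bounded K" using C(2) bounded_subset by blast
 then obtain b where b: "\<And>z. z \<in> K \<Longrightarrow> norm z \<le> b" by (auto simp: bounded_iff)
 obtain x where x: "R \<le> x" "\<And>Z. x \<le> Re Z \<Longrightarrow> ln (\<bar>b\<bar> + 1) \<le> Re (L Z)" by (rule Re_lb_at_top[OF L(1)]) blast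
 have "exp (L (of_real x)) \<in> K" using x(1) by (auto simp: K_def)
 hence "exp (Re (L (of_real x))) \<le> b" using b by (metis norm_exp_eq_Re)
 moreover have "exp (ln (\<bar>b\<bar> + 1)) \<le> exp (Re (L (of_real x)))" using x(2)[of "of_real x"] by (subst exp_le_cancel_iff) simp
 moreover have "exp (ln (\<bar>b\<bar> + 1)) = \<bar>b\<bar> + 1" by (intro exp_ln) auto
 ultimately show False by linarith
qed

lemma V_ne_UNIV: "V \<noteq> UNIV"
proof
 assume "V = UNIV"
 hence "norm (g z) \<le> exp R * norm z ^ 0" for z by (auto simp: V_def intro: less_imp_le)
 hence "g z = (\<Sum>i\<le>0. (deriv ^^ i) g 0 / fact i * z ^ i)" for z by (intro Liouville_polynomial[OF gh])
 hence "g z = poly [:g 0:] z" for z by simp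
 thus False using tr unfolding transcendental_entire_def by blast
qed

text \<open>A positive derivative at 0 makes the logarithm of \<open>\<rho> z / z\<close> real
  there. So lines far to the left will keep their heights, and the straightening map can be glued to
  the identity on a left half plane.\<close>

lemma riemann_map:
 obtains \<rho> \<gamma> where "\<rho> holomorphic_on V" "\<gamma> holomorphic_on ball 0 1" "\<And>z. z \<in> V \<Longrightarrow> \<rho> z \<in> ball 0 1"
  "\<And>z. z \<in> V \<Longrightarrow> \<gamma> (\<rho> z) = z" "\<And>z. z \<in> ball 0 1 \<Longrightarrow> \<gamma> z \<in> V" "\<And>z. z \<in> ball 0 1 \<Longrightarrow> \<rho> (\<gamma> z) = z"
  "\<rho> 0 = 0" "deriv \<rho> 0 \<in> \<real>" "0 < Re (deriv \<rho> 0)"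
proof -
 obtain f h where f: "f holomorphic_on V" "h holomorphic_on ball 0 1" "\<And>z. z \<in> V \<Longrightarrow> f z \<in> ball 0 1 \<and> h (f z) = z"
  "\<And>z. z \<in> ball 0 1 \<Longrightarrow> h z \<in> V \<and> f (h z) = z"
 proof -
  have "V \<noteq> {}" using zero_V by blast
  thus ?thesis using iffD1[OF Riemann_mapping_theorem[of V] conjI[OF V_open V_simply_connected]] V_ne_UNIV that by blast
 qed
 obtain m m' where m: "m (f 0) = 0" "m holomorphic_on ball 0 1" "m ` ball 0 1 \<subseteq> ball 0 1" "m' holomorphic_on ball 0 1"
  "m' ` ball 0 1 \<subseteq> ball 0 1" "\<And>z. z \<in> ball 0 1 \<Longrightarrow> m (m' z) = z" "\<And>z. z \<in> ball 0 1 \<Longrightarrow> m' (m z) = z"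
  by (rule ball_biholomorphism_exists[of "f 0"]) (use f(3)[OF zero_V] in blast)+
 define r where "r = m \<circ> f"
 have fb: "f ` V \<subseteq> ball 0 1" using f(3) by blast
 have rh: "r holomorphic_on V" unfolding r_def by (rule holomorphic_on_compose_gen[OF f(1) m(2) fb])
 have r0: "r 0 = 0" by (simp add: r_def m(1))
 have ri: "inj_on r V"
 proof (rule inj_on_inverseI)
  fix z assume "z \<in> V"
  thus "(h \<circ> m') (r z) = z" using f(3) m(7) by (auto simp: r_def)
 qed
 have d: "deriv r 0 \<noteq> 0" by (rule holomorphic_injective_imp_regular[OF rh V_open ri zero_V])
 define u where "u = cnj (deriv r 0) / of_real (norm (deriv r 0))"
 have u: "norm u = 1" "u \<noteq> 0" "u * deriv r 0 = of_real (norm (deriv r 0))"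
  using d by (auto simp: u_def norm_divide complex_norm_square[symmetric] power2_eq_square mult.commute)
 define \<rho> where "\<rho> = (\<lambda>z. u * r z)"
 define \<gamma> where "\<gamma> = (\<lambda>z. h (m' (z / u)))"
 have dr: "deriv \<rho> 0 = u * deriv r 0" unfolding \<rho>_def
  by (rule deriv_cmult) (use rh V_open zero_V holomorphic_on_imp_differentiable_at in blast)
 have ub: "z / u \<in> ball 0 1" if "z \<in> ball 0 1" for z using that u by (simp add: norm_divide)
 have rV: "r z \<in> ball 0 1" if "z \<in> V" for z unfolding r_def o_def using conjunct1[OF f(3)[OF that]] m(3) by blast
 show ?thesis
 proof (rule that[of \<rho> \<gamma>])
  show "\<rho> holomorphic_on V" unfolding \<rho>_def by (intro holomorphic_intros rh)
  have "(\<lambda>z. m' (z / u)) holomorphic_on ball 0 1"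
  proof -
   have "(\<lambda>z. z / u) holomorphic_on ball 0 1" using u by (intro holomorphic_intros) auto
   from holomorphic_on_compose_gen[OF this m(4)] show ?thesis using ub by (force simp: o_def)
  qed
  from holomorphic_on_compose_gen[OF this f(2)] show "\<gamma> holomorphic_on ball 0 1" unfolding \<gamma>_def o_def using ub m(5) by force
  show "\<rho> z \<in> ball 0 1" if "z \<in> V" for z using rV[OF that] u by (simp add: \<rho>_def norm_mult)
  show "\<gamma> (\<rho> z) = z" if "z \<in> V" for z using f(3)[OF that] m(7) u by (simp add: \<gamma>_def \<rho>_def r_def)
  show "\<gamma> z \<in> V" "\<rho> (\<gamma> z) = z" if "z \<in> ball 0 1" for z
  proof -
   have "m' (z / u) \<in> ball 0 1" using ub[OF that] m(5) by blast
   thus "\<gamma> z \<in> V" "\<rho> (\<gamma> z) = z" using f(4) m(6)[OF ub[OF that]] u by (auto simp: \<gamma>_def \<rho>_def r_def)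
  qed
  show "\<rho> 0 = 0" by (simp add: \<rho>_def r0)
  show "deriv \<rho> 0 \<in> \<real>" "0 < Re (deriv \<rho> 0)" unfolding dr u(3) using d by auto
 qed
qed

end

section \<open>Boundary behaviour of the Riemann map\<close>

lemma vertical_bound:
 fixes F F' :: "complex \<Rightarrow> complex" and u u' :: "real \<Rightarrow> real"
 assumes s: "s \<le> t" and F: "\<And>r. s \<le> r \<Longrightarrow> r \<le> t \<Longrightarrow> (F has_field_derivative F' (Complex x r)) (at (Complex x r))"
  and u: "\<And>r. s \<le> r \<Longrightarrow> r \<le> t \<Longrightarrow> (u has_real_derivative u' r) (at r)"
  and b: "\<And>r. s \<le> r \<Longrightarrow> r \<le> t \<Longrightarrow> norm (F' (Complex x r)) \<le> u' r"
 shows "norm (F (Complex x t) - F (Complex x s)) \<le> u t - u s"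
proof (cases "s = t")
 case False
 hence st: "s < t" using s by simp
 have d: "((\<lambda>r. F (Complex x r)) has_vector_derivative F' (Complex x r) * \<i>) (at r)" if r: "s \<le> r" "r \<le> t" for r
 proof -
  have ce: "(\<lambda>r. Complex x r) = (\<lambda>r. of_real x + of_real r * \<i>)" by (auto simp: complex_eq_iff)
  have "((\<lambda>r. Complex x r) has_vector_derivative \<i>) (at r)" unfolding ce by (auto intro!: derivative_eq_intros)
  from field_vector_diff_chain_at[OF this F[OF r]] show ?thesis by (simp add: o_def mult.commute)
 qed
 show ?thesis
 proof (rule differentiable_bound_general[OF st])
  show "continuous_on {s..t} u" using u by (intro continuous_at_imp_continuous_on ballI DERIV_isCont) auto
  show "continuous_on {s..t} (\<lambda>r. F (Complex x r))"
   using d by (intro continuous_at_imp_continuous_on ballI has_vector_derivative_continuous) auto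
  show "(u has_vector_derivative u' r) (at r)" if "s < r" "r < t" for r
   using u[of r] that by (simp add: has_real_derivative_iff_has_vector_derivative)
  show "((\<lambda>r. F (Complex x r)) has_vector_derivative F' (Complex x r) * \<i>) (at r)" if "s < r" "r < t" for r using d that by simp
  show "norm (F' (Complex x r) * \<i>) \<le> u' r" if "s < r" "r < t" for r using b[of r] that by (simp add: norm_mult)
 qed
qed simp

text \<open>The derivative bound would give logarithmic growth. The weaker square root is as good:
  integrated up to the real axis it stays finite, and it has an explicit primitive.\<close>

lemma sqrt_growth:
 fixes h :: "complex \<Rightarrow> complex"
 assumes w: "w > 0" and h: "h holomorphic_on {z. 0 < Im z \<and> Im z < w}" and K: "0 \<le> K"
  and d: "\<And>z. 0 < Im z \<Longrightarrow> Im z \<le> 3*w/4 \<Longrightarrow> norm (deriv h z) \<le> K / Im z"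
 shows "\<exists>A\<ge>0. \<forall>z. \<bar>Re z\<bar> \<le> m \<longrightarrow> 0 < Im z \<longrightarrow> Im z \<le> 3*w/4 \<longrightarrow> norm (h z) \<le> A / sqrt (Im z)"
proof -
 define w' where "w' = 3*w/4"
 have w': "0 < w'" "w' < w" using w by (auto simp: w'_def)
 have op: "open {z. 0 < Im z \<and> Im z < w}" using open_Int[OF open_halfspace_Im_gt[of 0] open_halfspace_Im_lt[of w]] by (simp add: Collect_conj_eq)
 have "compact ((\<lambda>x. h (Complex x w')) ` {-m..m})"
 proof (rule compact_continuous_image)
  show "continuous_on {-m..m} (\<lambda>x. h (Complex x w'))" by (rule continuous_on_compose2[OF holomorphic_on_imp_continuous_on[OF h]])
     (use w' in \<open>auto simp: complex_eq intro!: continuous_intros\<close>)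
 qed simp
 hence "bounded ((\<lambda>x. h (Complex x w')) ` {-m..m})" by (rule compact_imp_bounded)
 then obtain M where M: "M > 0" "\<And>x. \<bar>x\<bar> \<le> m \<Longrightarrow> norm (h (Complex x w')) \<le> M"
  unfolding bounded_pos by (auto simp: abs_le_iff)
 define A where "A = M * sqrt w' + 2 * K * sqrt w'"
 show ?thesis
 proof (intro exI[of _ A] conjI allI impI)
  show "0 \<le> A" using M K w' by (simp add: A_def)
  fix z :: complex assume z: "\<bar>Re z\<bar> \<le> m" "0 < Im z" "Im z \<le> 3*w/4"
  define \<phi> where "\<phi> = (\<lambda>r. - 2 * K * sqrt w' / sqrt r)"
  have "norm (h (Complex (Re z) w') - h (Complex (Re z) (Im z))) \<le> \<phi> w' - \<phi> (Im z)"
  proof (rule vertical_bound[where F'="deriv h" and u'="\<lambda>r. K * sqrt w' / (r * sqrt r)"])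
   show "Im z \<le> w'" using z by (simp add: w'_def)
   fix r assume r: "Im z \<le> r" "r \<le> w'"
   show "(h has_field_derivative deriv h (Complex (Re z) r)) (at (Complex (Re z) r))" using r z w' by (intro holomorphic_derivI[OF h op]) auto
   have "sqrt r * sqrt r = r" using r z by simp
   thus "(\<phi> has_real_derivative K * sqrt w' / (r * sqrt r)) (at r)"
    unfolding \<phi>_def using r z by (auto intro!: derivative_eq_intros simp: field_simps)
   have "norm (deriv h (Complex (Re z) r)) \<le> K / r" using d[of "Complex (Re z) r"] r z by (simp add: w'_def)
   also have "K / r = K * 1 / r" by simp
   also have "\<dots> \<le> K * (sqrt w' / sqrt r) / r" using r z K by (intro divide_right_mono mult_left_mono) auto
   finally show "norm (deriv h (Complex (Re z) r)) \<le> K * sqrt w' / (r * sqrt r)" by (simp add: mult.commute)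
  qed
  hence "norm (h (Complex (Re z) w') - h z) \<le> \<phi> w' - \<phi> (Im z)" by simp
  moreover have "\<phi> w' \<le> 0" using K w' by (simp add: \<phi>_def)
  ultimately have "norm (h z) \<le> M + 2 * K * sqrt w' / sqrt (Im z)"
   using M(2)[OF z(1)] norm_triangle_sub[of "h z" "h (Complex (Re z) w')"] by (simp add: \<phi>_def norm_minus_commute)
  also have "M = M * (sqrt (Im z) / sqrt (Im z))" using z by simp
  also have "M * (sqrt (Im z) / sqrt (Im z)) \<le> M * (sqrt w' / sqrt (Im z))"
   using z M by (intro mult_left_mono divide_right_mono) (auto simp: w'_def)
  finally show "norm (h z) \<le> A / sqrt (Im z)" by (simp add: A_def add_divide_distrib)
 qed
qed

text \<open>Two points at distance at most \<open>\<delta>\<close> are joined by going up by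
  \<open>\<delta>\<close>, across, and down again. The vertical parts cost
  \<open>2 * A * sqrt \<delta>\<close> each; the middle part costs \<open>A * sqrt \<delta>\<close>,
  because \<open>h\<close> is at most \<open>A / sqrt \<delta>\<close> above height
  \<open>\<delta>\<close>.\<close>

lemma primitive_unif_cont:
 fixes h H :: "complex \<Rightarrow> complex"
 assumes w: "w > 0" and A: "0 \<le> A"
  and H: "\<And>z. 0 < Im z \<Longrightarrow> Im z < w \<Longrightarrow> (H has_field_derivative h z) (at z)"
  and hA: "\<And>z. \<bar>Re z\<bar> \<le> m \<Longrightarrow> 0 < Im z \<Longrightarrow> Im z \<le> 3*w/4 \<Longrightarrow> norm (h z) \<le> A / sqrt (Im z)"
 shows "uniformly_continuous_on {z. \<bar>Re z\<bar> < m \<and> 0 < Im z \<and> Im z < w/2} H"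
proof -
 let ?S = "{z. \<bar>Re z\<bar> < m \<and> 0 < Im z \<and> Im z < w/2}"
 have up: "norm (H (Complex x (y + \<delta>)) - H (Complex x y)) \<le> 2 * A * sqrt \<delta>"
  if xy: "\<bar>x\<bar> \<le> m" "0 < y" "0 \<le> \<delta>" "y + \<delta> \<le> 3*w/4" for x y \<delta>
 proof -
  have "norm (H (Complex x (y + \<delta>)) - H (Complex x y)) \<le> 2 * A * sqrt (y + \<delta>) - 2 * A * sqrt y"
  proof (rule vertical_bound[where F'=h and u'="\<lambda>r. A / sqrt r"])
   fix r assume r: "y \<le> r" "r \<le> y + \<delta>"
   show "(H has_field_derivative h (Complex x r)) (at (Complex x r))" using r xy w by (intro H) auto
   show "((\<lambda>r. 2 * A * sqrt r) has_real_derivative A / sqrt r) (at r)" using r xy by (auto intro!: derivative_eq_intros simp: field_simps)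
   show "norm (h (Complex x r)) \<le> A / sqrt r" using hA[of "Complex x r"] r xy by simp
  qed (use xy in simp)
  also have "\<dots> = 2 * A * (sqrt (y + \<delta>) - sqrt y)" by (simp add: algebra_simps)
  also have "\<dots> \<le> 2 * A * sqrt \<delta>" using A xy sqrt_add_le_add_sqrt[of y \<delta>] by (intro mult_left_mono) auto
  finally show ?thesis .
 qed
 have main: "norm (H z - H z') \<le> 5 * A * sqrt \<delta>"
  if z: "z \<in> ?S" "z' \<in> ?S" "norm (z - z') \<le> \<delta>" "0 < \<delta>" "\<delta> \<le> w/4" for z z' \<delta>
 proof -
  have e: "Complex (Re u) (Im u + \<delta>) = u + \<i> * of_real \<delta>" for u by (simp add: complex_eq_iff)
  have "norm (H (z + \<i> * of_real \<delta>) - H z) \<le> 2 * A * sqrt \<delta>" using up[of "Re z" "Im z" \<delta>] z by (simp add: e)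
  moreover have "norm (H (z' + \<i> * of_real \<delta>) - H z') \<le> 2 * A * sqrt \<delta>" using up[of "Re z'" "Im z'" \<delta>] z by (simp add: e)
  moreover have "norm (H (z + \<i> * of_real \<delta>) - H (z' + \<i> * of_real \<delta>)) \<le> A / sqrt \<delta> * norm ((z + \<i> * of_real \<delta>) - (z' + \<i> * of_real \<delta>))"
  proof (rule field_differentiable_bound[where S="{u. \<bar>Re u\<bar> \<le> m \<and> \<delta> \<le> Im u \<and> Im u \<le> 3*w/4}" and f'=h])
   have "{u. \<bar>Re u\<bar> \<le> m \<and> \<delta> \<le> Im u \<and> Im u \<le> 3*w/4} = cbox (Complex (-m) \<delta>) (Complex m (3*w/4))"
    by (auto simp: in_cbox_complex_iff)
   thus "convex {u. \<bar>Re u\<bar> \<le> m \<and> \<delta> \<le> Im u \<and> Im u \<le> 3*w/4}" by simp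
   fix u assume u: "u \<in> {u. \<bar>Re u\<bar> \<le> m \<and> \<delta> \<le> Im u \<and> Im u \<le> 3*w/4}"
   show "(H has_field_derivative h u) (at u within {u. \<bar>Re u\<bar> \<le> m \<and> \<delta> \<le> Im u \<and> Im u \<le> 3*w/4})"
    using u z w by (intro has_field_derivative_at_within[OF H]) auto
   have "norm (h u) \<le> A / sqrt (Im u)" using hA[of u] u z by auto
   also have "\<dots> \<le> A / sqrt \<delta>" using u z A by (intro divide_left_mono) auto
   finally show "norm (h u) \<le> A / sqrt \<delta>" .
  qed (use z in auto)
  moreover have "A / sqrt \<delta> * norm ((z + \<i> * of_real \<delta>) - (z' + \<i> * of_real \<delta>)) \<le> A / sqrt \<delta> * \<delta>"
   using z A by (intro mult_left_mono) auto
  moreover have "A / sqrt \<delta> * \<delta> = A * sqrt \<delta>" using z by (simp add: field_simps)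
  ultimately have "norm (H (z + \<i> * of_real \<delta>) - H z) \<le> 2 * A * sqrt \<delta>"
   "norm (H (z' + \<i> * of_real \<delta>) - H z') \<le> 2 * A * sqrt \<delta>"
   "norm (H (z + \<i> * of_real \<delta>) - H (z' + \<i> * of_real \<delta>)) \<le> A * sqrt \<delta>" by auto
  moreover have "H z - H z' = - (H (z + \<i> * of_real \<delta>) - H z) + (H (z + \<i> * of_real \<delta>) - H (z' + \<i> * of_real \<delta>)) + (H (z' + \<i> * of_real \<delta>) - H z')"
   by simp
  ultimately show ?thesis
   using norm_triangle_ineq[of "- (H (z + \<i> * of_real \<delta>) - H z) + (H (z + \<i> * of_real \<delta>) - H (z' + \<i> * of_real \<delta>))" "H (z' + \<i> * of_real \<delta>) - H z'"]
    norm_triangle_ineq[of "- (H (z + \<i> * of_real \<delta>) - H z)" "H (z + \<i> * of_real \<delta>) - H (z' + \<i> * of_real \<delta>)"]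
   by (simp add: norm_minus_commute)
 qed
 show ?thesis unfolding uniformly_continuous_on_def
 proof (intro allI impI)
  fix e :: real assume e: "e > 0"
  define \<delta> where "\<delta> = min (w/4) ((e / (5 * A + 1))\<^sup>2)"
  have A5: "5 * A + 1 > 0" using A by simp
  have \<delta>: "\<delta> > 0" "\<delta> \<le> w/4" using w e A5 by (auto simp: \<delta>_def)
  have "sqrt \<delta> \<le> sqrt ((e / (5 * A + 1))\<^sup>2)" unfolding \<delta>_def by (intro real_sqrt_le_mono min.cobounded2)
  also have "\<dots> = e / (5 * A + 1)" using e A5 by (subst real_sqrt_abs) auto
  finally have sq: "sqrt \<delta> \<le> e / (5 * A + 1)" .
  have "5 * A * sqrt \<delta> < (5 * A + 1) * sqrt \<delta>" using \<delta> by simp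
  also have "\<dots> \<le> (5 * A + 1) * (e / (5 * A + 1))" using sq A5 by (intro mult_left_mono) auto
  also have "\<dots> = e" using A5 by simp
  finally have lt: "5 * A * sqrt \<delta> < e" .
  show "\<exists>d>0. \<forall>x\<in>?S. \<forall>x'\<in>?S. dist x' x < d \<longrightarrow> dist (H x') (H x) < e"
  proof (intro exI[of _ \<delta>] conjI ballI impI \<delta>(1))
   fix x x' assume "x \<in> ?S" "x' \<in> ?S" "dist x' x < \<delta>"
   hence "norm (H x' - H x) \<le> 5 * A * sqrt \<delta>" using \<delta> by (intro main) (auto simp: dist_norm)
   thus "dist (H x') (H x) < e" using lt by (simp add: dist_norm)
  qed
 qed
qed

text \<open>Reflection requires continuous boundary values, but only the imaginary part of
  \<open>h\<close> is known to converge. A primitive \<open>H\<close> does extend continuously to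
  the real axis, and its imaginary part is constant there because \<open>Im h\<close> tends to 0. So
  \<open>H\<close> is reflected, and the derivative of the result extends \<open>h\<close>.\<close>

lemma schwarz_ext_rect:
 fixes h :: "complex \<Rightarrow> complex"
 assumes w: "w > 0" and m: "m > 0" and h: "h holomorphic_on {z. 0 < Im z \<and> Im z < w}" and K: "0 \<le> K"
  and d: "\<And>z. 0 < Im z \<Longrightarrow> Im z \<le> 3*w/4 \<Longrightarrow> norm (deriv h z) \<le> K / Im z"
  and lim: "\<And>x. ((\<lambda>z. Im (h z)) \<longlongrightarrow> 0) (at (of_real x) within {z. 0 < Im z})"
 obtains G where "G holomorphic_on {z. \<bar>Re z\<bar> < m \<and> \<bar>Im z\<bar> < w/2}"
  "\<And>z. \<bar>Re z\<bar> < m \<Longrightarrow> 0 < Im z \<Longrightarrow> Im z < w/2 \<Longrightarrow> G z = h z"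
  "\<And>z. \<bar>Re z\<bar> < m \<Longrightarrow> \<bar>Im z\<bar> < w/2 \<Longrightarrow> G (cnj z) = cnj (G z)"
proof -
 let ?S = "{z. \<bar>Re z\<bar> < m \<and> 0 < Im z \<and> Im z < w/2}"
 have seq: "{z. 0 < Im z \<and> Im z < w} = {z. 0 < Im z} \<inter> {z. Im z < w}" by auto
 have op: "open {z. 0 < Im z \<and> Im z < w}" and cv: "convex {z. 0 < Im z \<and> Im z < w}"
  unfolding seq by (intro open_Int open_halfspace_Im_gt open_halfspace_Im_lt)
   (intro convex_Int convex_halfspace_Im_gt convex_halfspace_Im_lt)
 obtain H where H: "\<And>z. z \<in> {z. 0 < Im z \<and> Im z < w} \<Longrightarrow> (H has_field_derivative h z) (at z within {z. 0 < Im z \<and> Im z < w})"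
  using holomorphic_convex_primitive'[OF cv op h] by auto
 have Hd: "(H has_field_derivative h z) (at z)" if "0 < Im z" "Im z < w" for z
 proof -
  have mem: "z \<in> {z. 0 < Im z \<and> Im z < w}" using that by simp
  show ?thesis using H[OF mem] unfolding at_within_open[OF mem op] .
 qed
 obtain A where A: "0 \<le> A" "\<And>z. \<bar>Re z\<bar> \<le> m \<Longrightarrow> 0 < Im z \<Longrightarrow> Im z \<le> 3*w/4 \<Longrightarrow> norm (h z) \<le> A / sqrt (Im z)"
  using sqrt_growth[where m=m, OF w h K d] by auto
 have uc: "uniformly_continuous_on ?S H" by (rule primitive_unif_cont[OF w A(1) Hd A(2)]) auto
 obtain E where E: "uniformly_continuous_on (closure ?S) E" "\<And>x. x \<in> ?S \<Longrightarrow> H x = E x"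
  by (rule uniformly_continuous_on_extension_on_closure[OF uc]) blast
 have Ec: "continuous_on (closure ?S) E" using E(1) by (rule uniformly_continuous_imp_continuous)
 have incl: "z \<in> closure ?S" if z: "\<bar>Re z\<bar> < m" "0 \<le> Im z" "Im z < w/2" for z
 proof -
  define p where "p = (\<lambda>n. (w/2 - Im z) / 2 / real (Suc n))"
  have "p \<longlonglongrightarrow> 0" unfolding p_def divide_inverse by (rule tendsto_mult_right_zero[OF LIMSEQ_inverse_real_of_nat])
  hence "(\<lambda>n. z + \<i> * of_real (p n)) \<longlonglongrightarrow> z + \<i> * of_real 0" by (intro tendsto_intros)
  moreover have "z + \<i> * of_real (p n) \<in> ?S" for n
  proof -
   have "p n \<le> (w/2 - Im z) / 2 / 1" unfolding p_def using z by (intro divide_left_mono) auto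
   moreover have "(w/2 - Im z) / 2 / 1 < w/2 - Im z" using z by simp
   moreover have "0 < p n" using z by (simp add: p_def)
   ultimately have "0 < Im z + p n \<and> Im z + p n < w/2" using z by linarith
   thus ?thesis using z by simp
  qed
  ultimately show ?thesis unfolding closure_sequential by (intro exI[of _ "\<lambda>n. z + \<i> * of_real (p n)"]) auto
 qed
 have vlim: "((\<lambda>s. E (Complex x s)) \<longlongrightarrow> E (of_real x)) (at_right 0)" if x: "\<bar>x\<bar> < m" for x
 proof -
  have "continuous_on {0..w/4} (\<lambda>s. E (Complex x s))"
  proof (rule continuous_on_compose2[OF Ec])
   show "continuous_on {0..w/4} (\<lambda>s. Complex x s)" by (intro continuous_intros)
   show "(\<lambda>s. Complex x s) ` {0..w/4} \<subseteq> closure ?S" using x w by (intro image_subsetI incl) auto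
  qed
  hence "((\<lambda>s. E (Complex x s)) \<longlongrightarrow> E (Complex x 0)) (at 0 within {0..w/4})" using w by (auto simp: continuous_on)
  hence "((\<lambda>s. E (Complex x s)) \<longlongrightarrow> E (Complex x 0)) (at_right 0)" using w at_within_Icc_at_right[of 0 "w/4"] by simp
  moreover have "Complex x 0 = of_real x" by (simp add: complex_eq_iff)
  ultimately show ?thesis by simp
 qed
 \<comment> \<open>At small height \<open>s\<close> the difference quotients of \<open>Im H\<close>
   are bounded by the values of \<open>Im h\<close> on a small half disc. The bound does not depend
   on \<open>s\<close> and survives the limit \<open>s\<close> to 0.\<close>
 have der0: "((\<lambda>x. Im (E (of_real x))) has_real_derivative 0) (at x0)" if x0: "\<bar>x0\<bar> < m" for x0 unfolding DERIV_def
 proof (rule LIM_I)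
  fix e :: real assume e: "e > 0"
  have "\<forall>\<^sub>F z in at (of_real x0) within {z. 0 < Im z}. dist (Im (h z)) 0 < e/2" using tendstoD[OF lim, of "e/2"] e by simp
  then obtain u where u: "u > 0" "\<And>z. 0 < Im z \<Longrightarrow> dist z (of_real x0) < u \<Longrightarrow> \<bar>Im (h z)\<bar> < e/2"
   unfolding eventually_at by force
  define r where "r = min (u/2) (m - \<bar>x0\<bar>)"
  have r: "r > 0" "r \<le> u/2" "r \<le> m - \<bar>x0\<bar>" using u(1) x0 by (auto simp: r_def min_def)
  have key: "\<bar>Im (E (of_real (x0 + k))) - Im (E (of_real x0))\<bar> \<le> e/2 * \<bar>k\<bar>" if k: "\<bar>k\<bar> < r" for k
  proof (rule tendsto_upperbound)
   have xk: "\<bar>x0 + k\<bar> < m" using k r by linarith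
   show "((\<lambda>s. \<bar>Im (E (Complex (x0 + k) s)) - Im (E (Complex x0 s))\<bar>) \<longlongrightarrow> \<bar>Im (E (of_real (x0 + k))) - Im (E (of_real x0))\<bar>) (at_right 0)"
    by (intro tendsto_intros vlim xk x0)
   show "\<forall>\<^sub>F s in at_right 0. \<bar>Im (E (Complex (x0 + k) s)) - Im (E (Complex x0 s))\<bar> \<le> e/2 * \<bar>k\<bar>"
   proof -
    have "\<forall>\<^sub>F s in at_right 0. s \<in> {0<..<min (u/2) (w/2)}" by (rule eventually_at_right_real) (use u w in auto)
    thus ?thesis
    proof eventually_elim
     case (elim s)
     hence s: "0 < s" "s < u/2" "s < w/2" by auto
     define J where "J = (\<lambda>x. Im (H (Complex x s)))"
     have dJ: "(J has_real_derivative Im (h (Complex x s))) (at x)" for x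
     proof -
      have ce: "(\<lambda>r. Complex r s) = (\<lambda>r. of_real r + of_real s * \<i>)" by (auto simp: complex_eq_iff)
      have "((\<lambda>r. Complex r s) has_vector_derivative 1) (at x)" unfolding ce by (auto intro!: derivative_eq_intros)
      from field_vector_diff_chain_at[OF this Hd[of "Complex x s"]]
      have "((\<lambda>r. H (Complex r s)) has_vector_derivative h (Complex x s)) (at x)" using s w by (simp add: o_def)
      thus ?thesis unfolding J_def has_real_derivative_iff_has_vector_derivative by (rule bounded_linear.has_vector_derivative[OF bounded_linear_Im])
     qed
     have "norm (J (x0 + k) - J x0) \<le> e/2 * norm (x0 + k - x0)"
     proof (rule field_differentiable_bound[where S="{x0-\<bar>k\<bar>..x0+\<bar>k\<bar>}" and f'="\<lambda>x. Im (h (Complex x s))"])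
      fix x assume x: "x \<in> {x0-\<bar>k\<bar>..x0+\<bar>k\<bar>}"
      show "(J has_real_derivative Im (h (Complex x s))) (at x within {x0-\<bar>k\<bar>..x0+\<bar>k\<bar>})" by (rule has_field_derivative_at_within[OF dJ])
      have "dist (Complex x s) (of_real x0) \<le> \<bar>x - x0\<bar> + \<bar>s\<bar>" using cmod_le[of "Complex x s - of_real x0"] by (simp add: dist_norm)
      also have "\<dots> < u" using x k r s by auto
      finally show "norm (Im (h (Complex x s))) \<le> e/2" using u(2)[of "Complex x s"] s by simp
     qed auto
     moreover have "H (Complex (x0 + k) s) = E (Complex (x0 + k) s)" using xk s by (intro E(2)) auto
     moreover have "H (Complex x0 s) = E (Complex x0 s)" using x0 s by (intro E(2)) auto
     ultimately show ?case by (simp add: J_def)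
    qed
   qed
  qed simp
  show "\<exists>s>0. \<forall>k. k \<noteq> 0 \<and> norm (k - 0) < s \<longrightarrow> norm ((Im (E (of_real (x0 + k))) - Im (E (of_real x0))) / k - 0) < e"
  proof (intro exI[of _ r] conjI allI impI r(1))
   fix k :: real assume k: "k \<noteq> 0 \<and> norm (k - 0) < r"
   hence "\<bar>Im (E (of_real (x0 + k))) - Im (E (of_real x0))\<bar> \<le> e/2 * \<bar>k\<bar>" by (intro key) simp
   also have "\<dots> < e * \<bar>k\<bar>" using k e by simp
   finally show "norm ((Im (E (of_real (x0 + k))) - Im (E (of_real x0))) / k - 0) < e" using k by (simp add: abs_divide divide_less_eq)
  qed
 qed
 have "\<exists>c. \<forall>x\<in>{-m<..<m}. Im (E (of_real x)) = c"
 proof (rule has_derivative_zero_constant)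
  fix x assume "x \<in> {-m<..<m}"
  hence "\<bar>x\<bar> < m" by auto
  from der0[OF this] have "((\<lambda>x. Im (E (of_real x))) has_derivative (*) 0) (at x)" by (simp add: has_field_derivative_def)
  moreover have "(*) (0::real) = (\<lambda>h. 0)" by auto
  ultimately have "((\<lambda>x. Im (E (of_real x))) has_derivative (\<lambda>h. 0)) (at x)" by simp
  thus "((\<lambda>x. Im (E (of_real x))) has_derivative (\<lambda>h. 0)) (at x within {-m<..<m})" by (rule has_derivative_at_withinI)
 qed auto
 then obtain c where c0: "\<And>x. x \<in> {-m<..<m} \<Longrightarrow> Im (E (of_real x)) = c" by blast
 have c: "Im (E (of_real x)) = c" if "\<bar>x\<bar> < m" for x using c0[of x] that by (simp add: abs_less_iff)
 define Sr where "Sr = {z. \<bar>Re z\<bar> < m \<and> \<bar>Im z\<bar> < w/2}"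
 have Sr_box: "Sr = box (Complex (-m) (-w/2)) (Complex m (w/2))" by (auto simp: Sr_def in_box_complex_iff)
 define F where "F = (\<lambda>z. if 0 \<le> Im z then E z - \<i> * of_real c else cnj (E (cnj z) - \<i> * of_real c))"
 have Fhol: "F holomorphic_on Sr" unfolding F_def
 proof (rule Schwarz_reflection)
  show "open Sr" unfolding Sr_box by (rule open_box)
  show "cnj ` Sr \<subseteq> Sr" by (auto simp: Sr_def)
  have eqS: "Sr \<inter> {z. 0 < Im z} = ?S" by (auto simp: Sr_def)
  have "H holomorphic_on ?S"
  proof (rule holomorphic_onI)
   fix z assume "z \<in> ?S"
   hence "H field_differentiable at z" using Hd[of z] w by (auto simp: field_differentiable_def)
   thus "H field_differentiable at z within ?S" by (rule field_differentiable_at_within)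
  qed
  hence "E holomorphic_on ?S" by (rule holomorphic_transform) (use E(2) in auto)
  thus "(\<lambda>z. E z - \<i> * of_real c) holomorphic_on Sr \<inter> {z. 0 < Im z}" unfolding eqS by (intro holomorphic_intros)
  have "continuous_on (Sr \<inter> {z. 0 \<le> Im z}) E"
  proof (rule continuous_on_subset[OF Ec])
   show "Sr \<inter> {z. 0 \<le> Im z} \<subseteq> closure ?S"
   proof
    fix z assume "z \<in> Sr \<inter> {z. 0 \<le> Im z}"
    hence "\<bar>Re z\<bar> < m" "0 \<le> Im z" "Im z < w/2" by (auto simp: Sr_def)
    thus "z \<in> closure ?S" by (rule incl)
   qed
  qed
  thus "continuous_on (Sr \<inter> {z. 0 \<le> Im z}) (\<lambda>z. E z - \<i> * of_real c)" by (intro continuous_intros)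
  fix z assume z: "z \<in> Sr" "z \<in> \<real>"
  have zr: "of_real (Re z) = z" using z(2) by (simp add: complex_is_Real_iff complex_eq_iff)
  have "Im (E (of_real (Re z))) = c" using z(1) by (intro c) (simp add: Sr_def)
  hence "Im (E z) = c" unfolding zr .
  thus "E z - \<i> * of_real c \<in> \<real>" by (simp add: complex_is_Real_iff)
 qed
 have Srop: "open Sr" unfolding Sr_box by (rule open_box)
 have sym: "(cnj \<circ> F \<circ> cnj) y = F y" if y: "y \<in> Sr" for y
 proof (cases "Im y = 0")
  case True
  hence yr: "of_real (Re y) = y" "cnj y = y" by (auto simp: complex_eq_iff)
  have "Im (E (of_real (Re y))) = c" using y by (intro c) (simp add: Sr_def)
  hence "Im (E y) = c" unfolding yr(1) .
  thus ?thesis unfolding F_def o_def yr(2) using True by (simp add: complex_eq_iff)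
 next
  case False
  thus ?thesis by (cases "0 < Im y") (auto simp: F_def)
 qed
 have Sop: "open ?S"
 proof -
  have eq: "?S = box (Complex (-m) 0) (Complex m (w/2))" by (auto simp: in_box_complex_iff)
  show ?thesis unfolding eq by (rule open_box)
 qed
 have HF: "H y - \<i> * of_real c = F y" if "y \<in> ?S" for y using that E(2)[OF that] by (simp add: F_def)
 have DF: "deriv F z = h z" if z: "\<bar>Re z\<bar> < m" "0 < Im z" "Im z < w/2" for z
 proof -
  have zS: "z \<in> ?S" using z by simp
  have zw: "Im z < w" using z w by linarith
  have "((\<lambda>z. H z - \<i> * of_real c) has_field_derivative h z - 0) (at z)" by (intro DERIV_diff Hd z zw DERIV_const)
  hence "(F has_field_derivative h z - 0) (at z)" using Sop zS HF by (rule has_field_derivative_transform_within_open)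
  thus "deriv F z = h z" using DERIV_imp_deriv by fastforce
 qed
 show ?thesis
 proof (rule that[of "deriv F"])
  show "deriv F holomorphic_on {z. \<bar>Re z\<bar> < m \<and> \<bar>Im z\<bar> < w/2}" using holomorphic_deriv[OF Fhol Srop] by (simp add: Sr_def)
  show "deriv F z = h z" if "\<bar>Re z\<bar> < m" "0 < Im z" "Im z < w/2" for z using that by (rule DF)
  show "deriv F (cnj z) = cnj (deriv F z)" if z: "\<bar>Re z\<bar> < m" "\<bar>Im z\<bar> < w/2" for z
  proof (rule DERIV_imp_deriv)
   have zS: "z \<in> Sr" "cnj z \<in> Sr" using z by (auto simp: Sr_def)
   have "(F has_field_derivative deriv F z) (at z)" by (rule holomorphic_derivI[OF Fhol Srop zS(1)])
   hence "((cnj \<circ> F \<circ> cnj) has_field_derivative cnj (deriv F z)) (at (cnj z))"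
    using has_field_derivative_cnj_cnj[of F "deriv F z" "cnj z"] by simp
   from has_field_derivative_transform_within_open[OF this Srop zS(2) sym]
   show "(F has_field_derivative cnj (deriv F z)) (at (cnj z))" .
  qed
 qed
qed

lemma at_real_within_upper_neq_bot: "at (of_real x) within {z::complex. 0 < Im z} \<noteq> bot"
proof -
 have "(\<lambda>n. of_real x + \<i> * of_real (inverse (real (Suc n)))) \<longlonglongrightarrow> of_real x + \<i> * of_real 0"
  by (intro tendsto_intros LIMSEQ_inverse_real_of_nat)
 hence "of_real x islimpt {z::complex. 0 < Im z}" unfolding islimpt_sequential
  by (intro exI[of _ "\<lambda>n. of_real x + \<i> * of_real (inverse (real (Suc n)))"]) (auto simp: complex_eq_iff)
 thus ?thesis by (simp add: trivial_limit_within)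
qed

text \<open>Reflected functions on growing rectangles agree on the real axis, where they define
  \<open>v\<close>. Injectivity modulo \<open>2 * pi\<close> passes to the boundary because
  \<open>G m\<close> is open there: equal boundary values at two points would force equal values of
  \<open>h\<close> at distinct points nearby. The Lipschitz constant comes from discs of radius
  \<open>w/2\<close> around real points.\<close>

lemma boundary_values:
 fixes h :: "complex \<Rightarrow> complex"
 assumes w: "w > 0" and h: "h holomorphic_on {z. 0 < Im z \<and> Im z < w}" and K: "0 \<le> K"
  and d: "\<And>z. 0 < Im z \<Longrightarrow> Im z \<le> 3*w/4 \<Longrightarrow> norm (deriv h z) \<le> K / Im z"
  and lim: "\<And>x. ((\<lambda>z. Im (h z)) \<longlongrightarrow> 0) (at (of_real x) within {z. 0 < Im z})"
  and pos: "\<And>z. 0 < Im z \<Longrightarrow> Im z < w \<Longrightarrow> 0 < Im (h z)"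
  and inj: "\<And>z1 z2 n. 0 < Im z1 \<Longrightarrow> Im z1 < w \<Longrightarrow> 0 < Im z2 \<Longrightarrow> Im z2 < w \<Longrightarrow> h z1 = h z2 + of_real (2 * pi * of_int n) \<Longrightarrow> z1 = z2"
 obtains v where "\<And>y. (h \<longlongrightarrow> of_real (v y)) (at (of_real y) within {z. 0 < Im z})"
  "\<And>y y'. \<bar>v y - v y'\<bar> \<le> 24 * pi / w * \<bar>y - y'\<bar>" "strict_mono v"
  "\<And>y y' n. v y = v y' + 2 * pi * of_int n \<Longrightarrow> y = y'"
  "\<And>y e. 0 < e \<Longrightarrow> \<exists>\<delta>>0. \<forall>u. norm (u - of_real (v y)) < \<delta> \<longrightarrow> 0 < Im u \<longrightarrow> (\<exists>z. norm (z - of_real y) < e \<and> 0 < Im z \<and> Im z < w \<and> h z = u)"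
proof -
 let ?U = "{z::complex. 0 < Im z}"
 have ex: "\<exists>G. G holomorphic_on {z. \<bar>Re z\<bar> < m \<and> \<bar>Im z\<bar> < w/2} \<and>
  (\<forall>z. \<bar>Re z\<bar> < m \<longrightarrow> 0 < Im z \<longrightarrow> Im z < w/2 \<longrightarrow> G z = h z) \<and>
  (\<forall>z. \<bar>Re z\<bar> < m \<longrightarrow> \<bar>Im z\<bar> < w/2 \<longrightarrow> G (cnj z) = cnj (G z))" if "m > 0" for m
 proof -
  obtain G where "G holomorphic_on {z. \<bar>Re z\<bar> < m \<and> \<bar>Im z\<bar> < w/2}"
   "\<And>z. \<bar>Re z\<bar> < m \<Longrightarrow> 0 < Im z \<Longrightarrow> Im z < w/2 \<Longrightarrow> G z = h z"
   "\<And>z. \<bar>Re z\<bar> < m \<Longrightarrow> \<bar>Im z\<bar> < w/2 \<Longrightarrow> G (cnj z) = cnj (G z)"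
   by (rule schwarz_ext_rect[OF w \<open>m > 0\<close> h K d lim]) auto
  thus ?thesis by blast
 qed
 define G where "G = (\<lambda>m. SOME G. G holomorphic_on {z. \<bar>Re z\<bar> < m \<and> \<bar>Im z\<bar> < w/2} \<and>
  (\<forall>z. \<bar>Re z\<bar> < m \<longrightarrow> 0 < Im z \<longrightarrow> Im z < w/2 \<longrightarrow> G z = h z) \<and>
  (\<forall>z. \<bar>Re z\<bar> < m \<longrightarrow> \<bar>Im z\<bar> < w/2 \<longrightarrow> G (cnj z) = cnj (G z)))"
 have G0: "G m holomorphic_on {z. \<bar>Re z\<bar> < m \<and> \<bar>Im z\<bar> < w/2} \<and>
  (\<forall>z. \<bar>Re z\<bar> < m \<longrightarrow> 0 < Im z \<longrightarrow> Im z < w/2 \<longrightarrow> G m z = h z) \<and>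
  (\<forall>z. \<bar>Re z\<bar> < m \<longrightarrow> \<bar>Im z\<bar> < w/2 \<longrightarrow> G m (cnj z) = cnj (G m z))" if "m > 0" for m
  unfolding G_def by (rule someI_ex[OF ex[OF that]])
 define Q where "Q = (\<lambda>m. {z. \<bar>Re z\<bar> < m \<and> \<bar>Im z\<bar> < w/2})"
 have Qbox: "Q m = box (Complex (-m) (-w/2)) (Complex m (w/2))" for m by (auto simp: Q_def in_box_complex_iff)
 have Qop: "open (Q m)" "connected (Q m)" for m unfolding Qbox by (auto intro: convex_connected)
 have Ghol: "G m holomorphic_on Q m" if "m > 0" for m using G0[OF that] by (simp add: Q_def)
 have Gh: "G m z = h z" if "\<bar>Re z\<bar> < m" "0 < Im z" "Im z < w/2" for m z using G0[of m] that by auto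
 have Gc: "G m (cnj z) = cnj (G m z)" if "\<bar>Re z\<bar> < m" "\<bar>Im z\<bar> < w/2" for m z using G0[of m] that by auto
 have Glim: "(h \<longlongrightarrow> G m (of_real y)) (at (of_real y) within ?U)" if "\<bar>y\<bar> < m" for m y
 proof (rule Lim_transform_eventually)
  have yQ: "of_real y \<in> Q m" using that w by (simp add: Q_def)
  have "isCont (G m) (of_real y)"
  proof -
   have "m > 0" using that by linarith
   from holomorphic_on_imp_continuous_on[OF Ghol[OF this]] show ?thesis using continuous_on_eq_continuous_at[OF Qop(1), of m "G m"] yQ by simp
  qed
  thus "(G m \<longlongrightarrow> G m (of_real y)) (at (of_real y) within ?U)" unfolding isCont_def by (rule tendsto_within_subset) simp
  have "\<forall>\<^sub>F z in at (of_real y) within ?U. z \<in> Q m \<inter> ?U"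
   using eventually_at_topological Qop(1) yQ by (auto simp: eventually_at_topological)
  thus "\<forall>\<^sub>F z in at (of_real y) within ?U. G m z = h z" by eventually_elim (auto simp: Q_def intro!: Gh)
 qed
 have Greal: "Im (G m (of_real y)) = 0" if "\<bar>y\<bar> < m" for m y using Gc[of "of_real y" m] that w by (simp add: complex_eq_iff)
 define v where "v = (\<lambda>y. Re (G (\<bar>y\<bar> + 1) (of_real y)))"
 have Gv: "G m (of_real y) = of_real (v y)" if "\<bar>y\<bar> < m" for m y
 proof -
  have "G m (of_real y) = G (\<bar>y\<bar> + 1) (of_real y)" by (rule tendsto_unique[OF at_real_within_upper_neq_bot Glim Glim]) (use that in auto)
  also have "\<dots> = of_real (v y)" using Greal[of y "\<bar>y\<bar> + 1"] by (simp add: v_def complex_eq_iff)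
  finally show ?thesis .
 qed
 have vlim: "(h \<longlongrightarrow> of_real (v y)) (at (of_real y) within ?U)" for y
  using Glim[of y "\<bar>y\<bar> + 1"] Gv[of y "\<bar>y\<bar> + 1"] by simp
 have Glow: "Im (G m z) < 0" if "\<bar>Re z\<bar> < m" "Im z < 0" "- w/2 < Im z" for m z
  using Gc[of "cnj z" m] Gh[of "cnj z" m] pos[of "cnj z"] that by simp
 \<comment> \<open>\<open>G m\<close> covers a neighbourhood of \<open>v y\<close>. A preimage of a
   point of the upper half plane lies above the axis, since \<open>G m\<close> is real on the axis
   and maps points below it to points below it.\<close>
 have opn: "\<exists>\<delta>>0. \<forall>u. norm (u - of_real (v y)) < \<delta> \<longrightarrow> 0 < Im u \<longrightarrow>
   (\<exists>z. norm (z - of_real y) < e \<and> 0 < Im z \<and> Im z < w \<and> h z = u)" if e: "0 < e" for y e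
 proof -
  define m where "m = \<bar>y\<bar> + 1"
  have m: "m > 0" "\<bar>y\<bar> < m" by (auto simp: m_def)
  have yQ: "of_real y \<in> Q m" using m w by (simp add: Q_def)
  have nc: "\<not> G m constant_on Q m"
  proof
   assume "G m constant_on Q m"
   then obtain c where c: "\<And>z. z \<in> Q m \<Longrightarrow> G m z = c" by (auto simp: constant_on_def)
   define z where "z = of_real y + \<i> * of_real (w/4)"
   have "z \<in> Q m" using m w by (simp add: Q_def z_def)
   hence "G m z = G m (of_real y)" using c yQ by simp
   moreover have "G m z = h z" using m w by (intro Gh) (auto simp: z_def)
   moreover have "0 < Im (h z)" using w by (intro pos) (auto simp: z_def)
   ultimately show False using Greal[OF m(2)] by simp
  qed
  have "open (G m ` (ball (of_real y) e \<inter> Q m))" by (rule open_mapping_thm[OF Ghol[OF m(1)] Qop _ _ nc]) (use Qop in auto)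
  moreover have "of_real (v y) \<in> G m ` (ball (of_real y) e \<inter> Q m)" using Gv[OF m(2)] e yQ by (intro image_eqI[of _ _ "of_real y"]) auto
  ultimately obtain \<delta> where \<delta>: "\<delta> > 0" "ball (of_real (v y)) \<delta> \<subseteq> G m ` (ball (of_real y) e \<inter> Q m)"
   by (rule openE)
  show ?thesis
  proof (intro exI[of _ \<delta>] conjI allI impI \<delta>(1))
   fix u assume u: "norm (u - of_real (v y)) < \<delta>" "0 < Im u"
   hence "u \<in> ball (of_real (v y)) \<delta>" by (simp add: dist_norm norm_minus_commute)
   hence "u \<in> G m ` (ball (of_real y) e \<inter> Q m)" using \<delta>(2) by blast
   then obtain z where z: "z \<in> ball (of_real y) e" "z \<in> Q m" "u = G m z" by blast
   have "0 < Im z"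
   proof (rule ccontr)
    assume "\<not> ?thesis"
    then consider "Im z = 0" | "Im z < 0" by linarith
    thus False
    proof cases
     case 1
     hence zr: "of_real (Re z) = z" by (simp add: complex_eq_iff)
     have "Im (G m (of_real (Re z))) = 0" using z(2) by (intro Greal) (simp add: Q_def)
     thus False using u z unfolding zr by simp
    next
     case 2 thus False using Glow[of z m] z u by (simp add: Q_def)
    qed
   qed
   moreover from this have "h z = u" using Gh[of z m] z by (auto simp: Q_def)
   moreover have "Im z < w" using z w by (auto simp: Q_def)
   ultimately show "\<exists>z. norm (z - of_real y) < e \<and> 0 < Im z \<and> Im z < w \<and> h z = u"
    using z by (intro exI[of _ z]) (auto simp: dist_norm norm_minus_commute)
  qed
 qed
 have vinj: "y = y'" if eq: "v y = v y' + 2 * pi * of_int n" for y y' n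
 proof (rule ccontr)
  assume "y \<noteq> y'"
  define e where "e = \<bar>y - y'\<bar> / 2"
  have e: "e > 0" using \<open>y \<noteq> y'\<close> by (simp add: e_def)
  obtain \<delta>1 where d1: "\<delta>1 > 0" "\<And>u. norm (u - of_real (v y)) < \<delta>1 \<Longrightarrow> 0 < Im u \<Longrightarrow> \<exists>z. norm (z - of_real y) < e \<and> 0 < Im z \<and> Im z < w \<and> h z = u"
   using opn[OF e, of y] by auto
  obtain \<delta>2 where d2: "\<delta>2 > 0" "\<And>u. norm (u - of_real (v y')) < \<delta>2 \<Longrightarrow> 0 < Im u \<Longrightarrow> \<exists>z. norm (z - of_real y') < e \<and> 0 < Im z \<and> Im z < w \<and> h z = u"
   using opn[OF e, of y'] by auto
  define t where "t = min \<delta>1 \<delta>2 / 2"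
  have t: "0 < t" "t < \<delta>1" "t < \<delta>2" using d1 d2 by (auto simp: t_def)
  obtain z1 where z1: "norm (z1 - of_real y) < e" "0 < Im z1" "Im z1 < w" "h z1 = of_real (v y) + \<i> * of_real t"
   using d1(2)[of "of_real (v y) + \<i> * of_real t"] t by (auto simp: norm_mult)
  obtain z2 where z2: "norm (z2 - of_real y') < e" "0 < Im z2" "Im z2 < w" "h z2 = of_real (v y') + \<i> * of_real t"
   using d2(2)[of "of_real (v y') + \<i> * of_real t"] t by (auto simp: norm_mult)
  have "z1 = z2" by (rule inj[of _ _ n]) (use z1 z2 eq in auto)
  hence "\<bar>y - y'\<bar> < e + e" using z1(1) z2(1) norm_triangle_ineq4[of "z2 - of_real y'" "z2 - of_real y"] by (simp flip: of_real_diff)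
  thus False by (simp add: e_def)
 qed
 \<comment> \<open>The factor \<open>\<i>\<close> turns the period \<open>2 * pi\<close> into
   \<open>tpi\<close>. Equality modulo the period is excluded separately for points above, below and
   on the axis.\<close>
 have Gder: "norm (deriv (G m) (of_real x)) \<le> 24 * pi / w" if x: "\<bar>x\<bar> + w < m" for m x
 proof -
  have m: "m > 0" using x w by linarith
  have sub: "ball (complex_of_real x) (w/2) \<subseteq> Q m"
  proof
   fix z assume "z \<in> ball (complex_of_real x) (w/2)"
   hence "norm (z - of_real x) < w/2" by (simp add: dist_norm norm_minus_commute)
   hence "\<bar>Re z - x\<bar> < w/2" "\<bar>Im z\<bar> < w/2" using abs_Re_le_cmod[of "z - of_real x"] abs_Im_le_cmod[of "z - of_real x"] by auto
   hence "\<bar>Re z\<bar> < m" using x w by linarith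
   thus "z \<in> Q m" using \<open>\<bar>Im z\<bar> < w/2\<close> by (simp add: Q_def)
  qed
  have hol: "(\<lambda>z. \<i> * G m z) holomorphic_on ball (of_real x) (w/2)"
   using Ghol[OF m] sub by (intro holomorphic_intros) (rule holomorphic_on_subset)
  have "norm (deriv (\<lambda>z. \<i> * G m z) (of_real x)) \<le> 12 * pi / (w/2)"
  proof (rule deriv_bound_mod_tpi[OF hol])
   fix z1 z2 assume "z1 \<in> ball (complex_of_real x) (w/2)" "z2 \<in> ball (complex_of_real x) (w/2)"
   hence z: "z1 \<in> Q m" "z2 \<in> Q m" using sub by auto
   show "\<i> * G m z1 \<noteq> \<i> * G m z2 + tpi"
   proof
    assume "\<i> * G m z1 = \<i> * G m z2 + tpi"
    hence "\<i> * G m z1 = \<i> * (G m z2 + of_real (2 * pi))" by (simp add: tpi_def algebra_simps)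
    hence eq: "G m z1 = G m z2 + of_real (2 * pi)" by simp
    hence Imeq: "Im (G m z1) = Im (G m z2)" by simp
    have up: "0 < Im (G m z)" if "z \<in> Q m" "0 < Im z" for z using that Gh[of z m] pos[of z] by (auto simp: Q_def)
    have lo: "Im (G m z) < 0" if "z \<in> Q m" "Im z < 0" for z using that Glow[of z m] by (auto simp: Q_def)
    have re: "G m z = of_real (v (Re z))" if "z \<in> Q m" "Im z = 0" for z
    proof -
     have zr: "of_real (Re z) = z" using that by (simp add: complex_eq_iff)
     have "G m (of_real (Re z)) = of_real (v (Re z))" using that by (intro Gv) (auto simp: Q_def)
     thus ?thesis unfolding zr .
    qed
    have re0: "Im (G m z) = 0" if "z \<in> Q m" "Im z = 0" for z using re[OF that] by simp
    consider "0 < Im z1" "0 < Im z2" | "Im z1 < 0" "Im z2 < 0" | "Im z1 = 0" "Im z2 = 0"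
     using Imeq up[OF z(1)] up[OF z(2)] lo[OF z(1)] lo[OF z(2)] re0[OF z(1)] re0[OF z(2)] by linarith
    hence "z1 = z2"
    proof cases
     case 1
     thus ?thesis using Gh[of z1 m] Gh[of z2 m] z eq w by (intro inj[of z1 z2 1]) (auto simp: Q_def)
    next
     case 2
     have "G m (cnj z1) = h (cnj z1)" "G m (cnj z2) = h (cnj z2)" using Gh[of "cnj z1" m] Gh[of "cnj z2" m] z 2 by (auto simp: Q_def)
     hence "h (cnj z1) = cnj (G m z1)" "h (cnj z2) = cnj (G m z2)" using Gc[of z1 m] Gc[of z2 m] z by (auto simp: Q_def)
     hence "h (cnj z1) = h (cnj z2) + of_real (2 * pi)" using eq by simp
     hence "cnj z1 = cnj z2" using z 2 w by (intro inj[of "cnj z1" "cnj z2" 1]) (auto simp: Q_def)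
     thus ?thesis by simp
    next
     case 3
     hence "of_real (v (Re z1)) = (of_real (v (Re z2) + 2 * pi * of_int 1) :: complex)" using re[OF z(1)] re[OF z(2)] eq by simp
     hence "v (Re z1) = v (Re z2) + 2 * pi * of_int 1" by (simp only: of_real_eq_iff)
     hence "Re z1 = Re z2" by (rule vinj)
     thus ?thesis using 3 by (simp add: complex_eq_iff)
    qed
    thus False using eq by simp
   qed
  qed (use w in simp)
  moreover have "deriv (\<lambda>z. \<i> * G m z) (of_real x) = \<i> * deriv (G m) (of_real x)"
  proof (rule deriv_cmult)
   have "of_real x \<in> Q m" using x w by (simp add: Q_def)
   thus "G m field_differentiable at (of_real x)" using Ghol[OF m] Qop(1) holomorphic_on_imp_differentiable_at by blast
  qed
  ultimately show ?thesis by (simp add: norm_mult)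
 qed
 have vder: "(v has_real_derivative Re (deriv (G m) (of_real x))) (at x)" if x: "\<bar>x\<bar> < m" for m x
 proof -
  have m: "m > 0" using x by linarith
  have xQ: "of_real x \<in> Q m" using x w by (simp add: Q_def)
  have "((\<lambda>r. of_real r :: complex) has_vector_derivative 1) (at x)" by (auto intro!: derivative_eq_intros)
  from field_vector_diff_chain_at[OF this holomorphic_derivI[OF Ghol[OF m] Qop(1) xQ]]
  have "((\<lambda>r. G m (of_real r)) has_vector_derivative deriv (G m) (of_real x)) (at x)" by (simp add: o_def)
  hence "((\<lambda>r. Re (G m (of_real r))) has_vector_derivative Re (deriv (G m) (of_real x))) (at x)"
   by (rule bounded_linear.has_vector_derivative[OF bounded_linear_Re])
  hence "((\<lambda>r. Re (G m (of_real r))) has_real_derivative Re (deriv (G m) (of_real x))) (at x)"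
   by (simp add: has_real_derivative_iff_has_vector_derivative)
  thus ?thesis
  proof (rule has_field_derivative_transform_within_open)
   show "open {-m<..<m}" by simp
   show "x \<in> {-m<..<m}" using x by auto
   show "Re (G m (of_real r)) = v r" if "r \<in> {-m<..<m}" for r using Gv[of r m] that by (simp add: abs_less_iff)
  qed
 qed
 \<comment> \<open>By the Cauchy-Riemann equations this is the vertical derivative of
   \<open>Im (G m)\<close>, which vanishes on the axis and is positive above it.\<close>
 have vder0: "0 \<le> Re (deriv (G m) (of_real x))" if x: "\<bar>x\<bar> < m" for m x
 proof -
  have m: "m > 0" using x by linarith
  have xQ: "of_real x \<in> Q m" using x w by (simp add: Q_def)
  have "((\<lambda>s. of_real x + of_real s * \<i>) has_vector_derivative \<i>) (at 0)" by (auto intro!: derivative_eq_intros)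
  from field_vector_diff_chain_at[OF this, of "G m" "deriv (G m) (of_real x)"] holomorphic_derivI[OF Ghol[OF m] Qop(1) xQ]
  have "((\<lambda>s. G m (of_real x + of_real s * \<i>)) has_vector_derivative \<i> * deriv (G m) (of_real x)) (at 0)" by (simp add: o_def)
  hence "((\<lambda>s. Im (G m (of_real x + of_real s * \<i>))) has_vector_derivative Im (\<i> * deriv (G m) (of_real x))) (at 0)"
   by (rule bounded_linear.has_vector_derivative[OF bounded_linear_Im])
  hence D: "((\<lambda>s. Im (G m (of_real x + of_real s * \<i>))) has_real_derivative Re (deriv (G m) (of_real x))) (at 0)"
   by (simp add: has_real_derivative_iff_has_vector_derivative)
  show ?thesis
  proof (rule ccontr)
   assume "\<not> ?thesis"
   then obtain e where e: "e > 0" "\<And>s. 0 < s \<Longrightarrow> s < e \<Longrightarrow> Im (G m (of_real x + of_real (0 + s) * \<i>)) < Im (G m (of_real x + of_real 0 * \<i>))"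
    using DERIV_neg_dec_right[OF D] by auto
   define s where "s = min e (w/2) / 2"
   have s: "0 < s" "s < e" "s < w/2" using e w by (auto simp: s_def min_def)
   have "Im (G m (of_real x + of_real s * \<i>)) < 0" using e(2)[OF s(1,2)] Greal[OF x] by simp
   moreover have "G m (of_real x + of_real s * \<i>) = h (of_real x + of_real s * \<i>)" using x s by (intro Gh) auto
   moreover have "0 < Im (h (of_real x + of_real s * \<i>))" using s by (intro pos) auto
   ultimately show False by simp
  qed
 qed
 show ?thesis
 proof (rule that[of v])
  show "\<bar>v y - v y'\<bar> \<le> 24 * pi / w * \<bar>y - y'\<bar>" for y y'
  proof -
   define M where "M = \<bar>y\<bar> + \<bar>y'\<bar> + w + 1"
   have "norm (v y - v y') \<le> 24 * pi / w * norm (y - y')"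
   proof (rule field_differentiable_bound[where S="{min y y'..max y y'}" and f'="\<lambda>x. Re (deriv (G M) (of_real x))"])
    fix x assume x: "x \<in> {min y y'..max y y'}"
    hence xM: "\<bar>x\<bar> + w < M" by (auto simp: M_def)
    show "(v has_real_derivative Re (deriv (G M) (of_real x))) (at x within {min y y'..max y y'})"
     by (rule has_field_derivative_at_within[OF vder]) (use xM w in simp)
    show "norm (Re (deriv (G M) (of_real x))) \<le> 24 * pi / w" using Gder[OF xM] abs_Re_le_cmod[of "deriv (G M) (of_real x)"] by simp
   qed auto
   thus ?thesis by simp
  qed
  show "strict_mono v"
  proof (rule strict_monoI)
   fix x y :: real assume xy: "x < y"
   define M where "M = \<bar>x\<bar> + \<bar>y\<bar> + 1"
   have "v x \<le> v y"
   proof (rule DERIV_nonneg_imp_nondecreasing[of x y v])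
    fix t assume t: "x \<le> t" "t \<le> y"
    hence "\<bar>t\<bar> < M" by (auto simp: M_def)
    thus "\<exists>z. (v has_real_derivative z) (at t) \<and> 0 \<le> z" using vder vder0 by blast
   qed (use xy in simp)
   moreover have "v x \<noteq> v y" using vinj[of x y 0] xy by auto
   ultimately show "v x < v y" by simp
  qed
 qed (fact vlim vinj opn)+
qed

section \<open>Boundary values on the tracts and the extension of the Riemann map to the
  plane\<close>

locale riemann = tracts +
 fixes \<rho> \<gamma> :: "complex \<Rightarrow> complex"
 assumes rho: "\<rho> holomorphic_on V" and gam: "\<gamma> holomorphic_on ball 0 1"
  and rhoV: "\<And>z. z \<in> V \<Longrightarrow> \<rho> z \<in> ball 0 1" and gr: "\<And>z. z \<in> V \<Longrightarrow> \<gamma> (\<rho> z) = z"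
  and gamV: "\<And>z. z \<in> ball 0 1 \<Longrightarrow> \<gamma> z \<in> V" and rg: "\<And>z. z \<in> ball 0 1 \<Longrightarrow> \<rho> (\<gamma> z) = z"
  and rho0: "\<rho> 0 = 0" and drho: "deriv \<rho> 0 \<in> \<real>" "0 < Re (deriv \<rho> 0)"
begin

text \<open>The image of a smaller closed disc under \<open>\<gamma>\<close> is a compact subset of
  \<open>V\<close>, hence stays away from the boundary point \<open>exp (L Z0)\<close>.\<close>

lemma rho_norm_tends:
 assumes L: "lb L" and y: "Re Z0 = R"
 shows "((\<lambda>Z. norm (\<rho> (exp (L Z)))) \<longlongrightarrow> 1) (at Z0 within collar)"
proof (rule tendstoI)
 fix e :: real assume e: "e > 0"
 define r where "r = max 0 (1 - e)"
 have r: "0 \<le> r" "r < 1" "1 - e \<le> r" using e by (auto simp: r_def)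
 have "compact (\<gamma> ` cball 0 r)"
  by (intro compact_continuous_image continuous_on_subset[OF holomorphic_on_imp_continuous_on[OF gam]]) (use r in auto)
 hence "closed (\<gamma> ` cball 0 r)" by (rule compact_imp_closed)
 hence op: "open (- (\<gamma> ` cball 0 r))" by blast
 have "\<gamma> ` cball 0 r \<subseteq> V" using gamV r by auto
 moreover have "exp (L Z0) \<notin> V" using exp_V_iff[OF L, of Z0] y Ra by simp
 ultimately have mem: "exp (L Z0) \<in> - (\<gamma> ` cball 0 r)" by blast
 have "isCont L Z0" using lb_cont[OF L order_refl] continuous_on_eq_continuous_at[OF open_hp, of a L] y Ra by auto
 hence "((\<lambda>Z. exp (L Z)) \<longlongrightarrow> exp (L Z0)) (at Z0 within collar)"
  by (intro tendsto_intros) (auto simp: isCont_def intro: tendsto_within_subset)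
 from topological_tendstoD[OF this op mem]
 have "\<forall>\<^sub>F Z in at Z0 within collar. exp (L Z) \<in> - (\<gamma> ` cball 0 r)" .
 moreover have "\<forall>\<^sub>F Z in at Z0 within collar. Z \<in> collar" by (simp add: eventually_at_filter)
 ultimately show "\<forall>\<^sub>F Z in at Z0 within collar. dist (norm (\<rho> (exp (L Z)))) 1 < e"
 proof eventually_elim
  case (elim Z)
  hence inV: "exp (L Z) \<in> V" using exp_V_iff[OF L, of Z] by auto
  have "\<rho> (exp (L Z)) \<notin> cball 0 r"
  proof
   assume "\<rho> (exp (L Z)) \<in> cball 0 r"
   hence "\<gamma> (\<rho> (exp (L Z))) \<in> \<gamma> ` cball 0 r" by blast
   thus False using elim gr[OF inV] by simp
  qed
  thus ?case using rhoV[OF inV] r by (auto simp: dist_real_def)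
 qed
qed

text \<open>Turns the line \<open>Re Z = R\<close> into the real axis and the collar into a strip
  above it.\<close>

definition cpos where "cpos \<zeta> = complex_of_real R + \<i> * \<zeta>"

lemma cpos_simps [simp]: "Re (cpos d) = R - Im d" "Im (cpos d) = Re d"
 by (auto simp: cpos_def)

text \<open>A logarithm of \<open>\<rho> (exp (L (cpos z)))\<close>, divided by \<open>\<i>\<close>,
  has a positive imaginary part that tends to 0 at the real axis, so \<open>boundary_values\<close>
  applies. The strip has width at least 400, which gives the Lipschitz constant 1/4.\<close>

lemma v_exists:
 assumes L: "lb L"
 shows "\<exists>v. (\<forall>y. ((\<lambda>Z. \<rho> (exp (L Z))) \<longlongrightarrow> cis (v y)) (at (Complex R y) within collar)) \<and>
  (\<forall>y y'. \<bar>v y - v y'\<bar> \<le> 1/4 * \<bar>y - y'\<bar>) \<and> strict_mono v \<and>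
  (\<forall>y y'. cis (v y) = cis (v y') \<longrightarrow> y = y') \<and>
  (\<forall>y e. 0 < e \<longrightarrow> (\<exists>\<delta>>0. \<forall>d. norm d < 1 \<longrightarrow> norm (d - cis (v y)) < \<delta> \<longrightarrow>
    (\<exists>Z. norm (Z - Complex R y) < e \<and> a < Re Z \<and> Re Z < R \<and> \<rho> (exp (L Z)) = d)))"
proof -
 define S where "S = {z. 0 < Im z \<and> Im z < R - a}"
 have cS: "convex S" 
 proof -
  have "S = {z. 0 < Im z} \<inter> {z. Im z < R - a}" by (auto simp: S_def)
  thus ?thesis by (simp add: convex_Int convex_halfspace_Im_gt convex_halfspace_Im_lt)
 qed
 have oS: "open S"
 proof -
  have "S = {z. 0 < Im z} \<inter> {z. Im z < R - a}" by (auto simp: S_def)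
  thus ?thesis by (simp add: open_Int open_halfspace_Im_gt open_halfspace_Im_lt)
 qed
 have inV: "exp (L (cpos z)) \<in> V" if "z \<in> S" for z using exp_V_iff[OF L, of "cpos z"] that by (auto simp: S_def)
 have chol: "cpos holomorphic_on S" unfolding cpos_def by (intro holomorphic_intros)
 have Lhol: "(\<lambda>z. L (cpos z)) holomorphic_on S" using holomorphic_on_compose_gen[OF chol lbD(1)[OF L]] by (force simp: o_def S_def)
 have "(\<lambda>z. exp (L (cpos z))) holomorphic_on S" by (intro holomorphic_intros Lhol)
 from holomorphic_on_compose_gen[OF this rho]
 have rhol: "(\<lambda>z. \<rho> (exp (L (cpos z)))) holomorphic_on S" using inV by (force simp: o_def)
 have nz: "\<rho> (exp (L (cpos z))) \<noteq> 0" if "z \<in> S" for z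
 proof
  assume "\<rho> (exp (L (cpos z))) = 0"
  hence "\<gamma> (\<rho> (exp (L (cpos z)))) = \<gamma> (\<rho> 0)" by (simp add: rho0)
  thus False using gr[OF inV[OF that]] gr[OF zero_V] by simp
 qed
 obtain q where q: "q holomorphic_on S" "\<And>z. z \<in> S \<Longrightarrow> \<rho> (exp (L (cpos z))) = exp (q z)"
  by (rule contractible_imp_holomorphic_log[OF rhol convex_imp_contractible[OF cS] nz]) auto
 define h where "h = (\<lambda>z. - \<i> * q z)"
 have hq: "\<rho> (exp (L (cpos z))) = exp (\<i> * h z)" if "z \<in> S" for z using q(2)[OF that] by (simp add: h_def)
 have hhol: "h holomorphic_on S" unfolding h_def by (intro holomorphic_intros q)
 have hinj: "z1 = z2 \<and> n = 0" if z: "z1 \<in> S" "z2 \<in> S" and eq: "h z1 = h z2 + of_real (2 * pi * of_int n)" for z1 z2 n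
 proof -
  have "exp (\<i> * h z1) = exp (\<i> * h z2 + of_int n * tpi)" unfolding eq by (simp add: tpi_def algebra_simps)
  hence "\<rho> (exp (L (cpos z1))) = \<rho> (exp (L (cpos z2)))" using hq z by simp
  hence "exp (L (cpos z1)) = exp (L (cpos z2))" using gr inV z by metis
  then obtain k where "L (cpos z1) = L (cpos z2) + of_int k * tpi" unfolding exp_eq_tpi by blast
  hence "cpos z1 = cpos z2" using lb_inj(1)[OF L, of "cpos z1" "cpos z2" k] z by (auto simp: S_def)
  hence "z1 = z2" by (simp add: cpos_def)
  thus ?thesis using eq by simp
 qed
 have himp: "0 < Im (h z)" if "z \<in> S" for z
 proof -
  have "norm (exp (\<i> * h z)) < 1" using rhoV[OF inV[OF that]] hq[OF that] by simp
  thus ?thesis by (simp add: norm_exp_eq_Re)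
 qed
 have wpos: "0 < R - a" using Ra by simp
 obtain v where v: "\<And>y. (h \<longlongrightarrow> of_real (v y)) (at (of_real y) within {z. 0 < Im z})"
  "\<And>y y'. \<bar>v y - v y'\<bar> \<le> 24 * pi / (R - a) * \<bar>y - y'\<bar>" "strict_mono v"
  "\<And>y y' n. v y = v y' + 2 * pi * of_int n \<Longrightarrow> y = y'"
  "\<And>y e. 0 < e \<Longrightarrow> \<exists>\<delta>>0. \<forall>u. norm (u - of_real (v y)) < \<delta> \<longrightarrow> 0 < Im u \<longrightarrow> (\<exists>z. norm (z - of_real y) < e \<and> 0 < Im z \<and> Im z < R - a \<and> h z = u)"
 proof (rule boundary_values[OF wpos, of h "48 * pi"])
  show "h holomorphic_on {z. 0 < Im z \<and> Im z < R - a}" using hhol by (simp add: S_def)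
  \<comment> \<open>The disc of radius \<open>Im z / 3\<close> stays in the strip because
    \<open>Im z\<close> is at most three quarters of its width.\<close>
  show "norm (deriv h z) \<le> 48 * pi / Im z" if z: "0 < Im z" "Im z \<le> 3 * (R - a) / 4" for z
  proof -
   define r where "r = Im z / 3"
   have r: "0 < r" "Im z + r \<le> R - a" using z by (auto simp: r_def)
   have sub: "ball z r \<subseteq> S"
   proof
    fix u assume "u \<in> ball z r"
    hence "norm (u - z) < r" by (simp add: dist_norm norm_minus_commute)
    hence "\<bar>Im u - Im z\<bar> < r" using abs_Im_le_cmod[of "u - z"] by simp
    hence "0 < Im u \<and> Im u < R - a" using r z unfolding r_def by linarith
    thus "u \<in> S" by (simp add: S_def)
   qed
   have "norm (deriv q z) \<le> 12 * pi / r"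
   proof (rule deriv_bound_mod_tpi)
    show "q holomorphic_on ball z r" using q(1) sub by (rule holomorphic_on_subset)
    fix z1 z2 assume "z1 \<in> ball z r" "z2 \<in> ball z r"
    hence zS: "z1 \<in> S" "z2 \<in> S" using sub by auto
    show "q z1 \<noteq> q z2 + tpi"
    proof
     assume "q z1 = q z2 + tpi"
     hence "h z1 = h z2 + of_real (2 * pi * of_int 1)" by (simp add: h_def tpi_def algebra_simps)
     from hinj[OF zS this] show False by simp
    qed
   qed (rule r)
   also have "12 * pi / r \<le> 48 * pi / Im z" using z by (simp add: r_def field_simps)
   finally have "norm (deriv q z) \<le> 48 * pi / Im z" .
   moreover have "deriv h z = - \<i> * deriv q z" unfolding h_def
   proof (rule deriv_cmult)
    have "z \<in> S" using sub r by auto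
    thus "q field_differentiable at z" using q(1) oS holomorphic_on_imp_differentiable_at by blast
   qed
   ultimately show ?thesis by (simp add: norm_mult)
  qed
  show "((\<lambda>z. Im (h z)) \<longlongrightarrow> 0) (at (of_real x) within {z. 0 < Im z})" for x
  proof -
   have "((\<lambda>z. ln (norm (\<rho> (exp (L (cpos z)))))) \<longlongrightarrow> ln 1) (at (of_real x) within S)"
   proof (intro tendsto_ln)
    show "((\<lambda>z. norm (\<rho> (exp (L (cpos z))))) \<longlongrightarrow> 1) (at (of_real x) within S)"
    proof (rule filterlim_compose[OF rho_norm_tends[OF L, of "cpos (of_real x)"]])
     show "filterlim cpos (at (cpos (of_real x)) within collar) (at (of_real x) within S)" unfolding filterlim_at
     proof
      show "(cpos \<longlongrightarrow> cpos (of_real x)) (at (of_real x) within S)" unfolding cpos_def by (intro tendsto_intros)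
      show "\<forall>\<^sub>F z in at (of_real x) within S. cpos z \<in> collar \<and> cpos z \<noteq> cpos (of_real x)"
       by (auto simp: eventually_at_filter S_def cpos_def)
     qed
    qed simp
   qed simp
   hence "((\<lambda>z. - ln (norm (\<rho> (exp (L (cpos z)))))) \<longlongrightarrow> 0) (at (of_real x) within S)" using tendsto_minus by fastforce
   hence lS: "((\<lambda>z. Im (h z)) \<longlongrightarrow> 0) (at (of_real x) within S)"
   proof (rule Lim_transform_eventually)
    have "\<forall>\<^sub>F z in at (of_real x) within S. z \<in> S" by (simp add: eventually_at_filter)
    thus "\<forall>\<^sub>F z in at (of_real x) within S. - ln (norm (\<rho> (exp (L (cpos z))))) = Im (h z)"
     by eventually_elim (simp add: hq norm_exp_eq_Re)
   qed
   have "at (of_real x) within S = at (of_real x) within {z. 0 < Im z}"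
   proof (rule at_within_nhd)
    show "open {z. Im z < R - a}" by (rule open_halfspace_Im_lt)
   qed (use wpos in \<open>auto simp: S_def\<close>)
   thus ?thesis using lS by simp
  qed
  show "0 < Im (h z)" if "0 < Im z" "Im z < R - a" for z using himp[of z] that by (simp add: S_def)
  show "z1 = z2" if "0 < Im z1" "Im z1 < R - a" "0 < Im z2" "Im z2 < R - a" "h z1 = h z2 + of_real (2 * pi * of_int n)" for z1 z2 n
   using hinj[of z1 z2 n] that by (simp add: S_def)
 qed auto
 define ci where "ci = (\<lambda>Z. - \<i> * (Z - complex_of_real R))"
 have ci: "cpos (ci Z) = Z" "Im (ci Z) = R - Re Z" "Re (ci Z) = Im Z" "ci (Complex R y) = of_real y" for Z y
  by (auto simp: ci_def cpos_def complex_eq_iff)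
 have ciS: "ci Z \<in> S" if "a < Re Z" "Re Z < R" for Z using that by (simp add: S_def ci)
 show ?thesis
 proof (intro exI[of _ v] conjI allI impI v(3))
  fix y
  let ?F = "at (Complex R y) within collar"
  have cl: "filterlim ci (at (of_real y) within {z. 0 < Im z}) ?F" unfolding filterlim_at
  proof
   have "((\<lambda>Z. - \<i> * (Z - complex_of_real R)) \<longlongrightarrow> - \<i> * (Complex R y - complex_of_real R)) ?F" by (intro tendsto_intros)
   thus "(ci \<longlongrightarrow> of_real y) ?F" using ci(4)[of y] by (simp add: ci_def)
   have "\<forall>\<^sub>F Z in ?F. Z \<in> collar" by (simp add: eventually_at_filter)
   thus "\<forall>\<^sub>F Z in ?F. ci Z \<in> {z. 0 < Im z} \<and> ci Z \<noteq> of_real y"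
   proof eventually_elim
    case (elim Z)
    hence "0 < Im (ci Z)" by (simp add: ci)
    thus ?case by (auto simp: complex_eq_iff)
   qed
  qed
  have "((\<lambda>Z. exp (\<i> * h (ci Z))) \<longlongrightarrow> exp (\<i> * of_real (v y))) ?F"
   by (intro tendsto_intros filterlim_compose[OF v(1) cl])
  hence "((\<lambda>Z. exp (\<i> * h (ci Z))) \<longlongrightarrow> cis (v y)) ?F" by (simp add: cis_conv_exp)
  thus "((\<lambda>Z. \<rho> (exp (L Z))) \<longlongrightarrow> cis (v y)) ?F"
  proof (rule Lim_transform_eventually)
   have "\<forall>\<^sub>F Z in ?F. Z \<in> collar" by (simp add: eventually_at_filter)
   thus "\<forall>\<^sub>F Z in ?F. exp (\<i> * h (ci Z)) = \<rho> (exp (L Z))"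
   proof eventually_elim
    case (elim Z)
    thus ?case using hq[OF ciS[of Z]] by (simp add: ci)
   qed
  qed
 next
  fix y y'
  have "24 * pi / (R - a) \<le> 1/4" using R pi_less_4 by (simp add: field_simps)
  hence "24 * pi / (R - a) * \<bar>y - y'\<bar> \<le> 1/4 * \<bar>y - y'\<bar>" by (rule mult_right_mono) simp
  thus "\<bar>v y - v y'\<bar> \<le> 1/4 * \<bar>y - y'\<bar>" using v(2)[of y y'] by linarith
 next
  fix y y' assume "cis (v y) = cis (v y')"
  hence "exp (\<i> * of_real (v y)) = exp (\<i> * of_real (v y'))" by (simp add: cis_conv_exp)
  then obtain n where "\<i> * of_real (v y) = \<i> * of_real (v y') + of_int n * tpi" unfolding exp_eq_tpi by blast
  hence "Im (\<i> * of_real (v y)) = Im (\<i> * of_real (v y') + of_int n * tpi)" by simp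
  hence "v y = v y' + 2 * pi * of_int n" by simp
  thus "y = y'" by (rule v(4))
 next
  fix y e :: real assume e: "0 < e"
  obtain \<delta>1 where d1: "\<delta>1 > 0" "\<And>u. norm (u - of_real (v y)) < \<delta>1 \<Longrightarrow> 0 < Im u \<Longrightarrow> \<exists>z. norm (z - of_real y) < e \<and> 0 < Im z \<and> Im z < R - a \<and> h z = u"
   using v(5)[OF e, of y] by auto
  have "isCont Ln 1" by (intro continuous_at_Ln) (auto simp: complex_nonpos_Reals_iff)
  then obtain \<delta>2 where d2: "\<delta>2 > 0" "\<And>x. dist x 1 < \<delta>2 \<Longrightarrow> dist (Ln x) (Ln 1) < \<delta>1"
   using d1(1) unfolding continuous_at_eps_delta by blast
  show "\<exists>\<delta>>0. \<forall>d. norm d < 1 \<longrightarrow> norm (d - cis (v y)) < \<delta> \<longrightarrow>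
    (\<exists>Z. norm (Z - Complex R y) < e \<and> a < Re Z \<and> Re Z < R \<and> \<rho> (exp (L Z)) = d)"
  proof (intro exI[of _ "min \<delta>2 1"] conjI allI impI)
   fix d assume z: "norm d < 1" "norm (d - cis (v y)) < min \<delta>2 1"
   \<comment> \<open>The rotation moves \<open>d\<close> close to 1, where \<open>Ln\<close> is
     continuous.\<close>
   define x where "x = d * cis (- v y)"
   have nx: "norm x = norm d" by (simp add: x_def norm_mult)
   have "x - 1 = (d - cis (v y)) * cis (- v y)" by (simp add: x_def algebra_simps cis_mult)
   hence x1: "norm (x - 1) < min \<delta>2 1" using z by (simp add: norm_mult)
   hence x0: "x \<noteq> 0" by auto
   define u where "u = of_real (v y) - \<i> * Ln x"
   have "norm (Ln x) < \<delta>1" using d2(2)[of x] x1 by (simp add: dist_norm)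
   hence "norm (u - of_real (v y)) < \<delta>1" by (simp add: u_def norm_mult)
   moreover have "0 < Im u"
   proof -
    have "0 < norm x" "norm x < 1" using x0 nx z by auto
    hence "ln (norm x) < 0" by (rule ln_less_zero)
    thus ?thesis using x0 by (simp add: u_def)
   qed
   ultimately obtain z' where z': "norm (z' - of_real y) < e" "0 < Im z'" "Im z' < R - a" "h z' = u" using d1(2)[of u] by blast
   have "\<i> * u = \<i> * of_real (v y) + Ln x" by (simp add: u_def algebra_simps)
   hence "exp (\<i> * u) = cis (v y) * x" using x0 by (simp add: exp_add cis_conv_exp)
   also have "\<dots> = d" by (simp add: x_def cis_mult mult.assoc mult.left_commute)
   finally have "\<rho> (exp (L (cpos z'))) = d" using hq[of z'] z' by (simp add: S_def)
   moreover have "cpos z' - Complex R y = \<i> * (z' - of_real y)" by (simp add: cpos_def complex_eq_iff)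
   hence "norm (cpos z' - Complex R y) < e" using z'(1) by (simp add: norm_mult)
   ultimately show "\<exists>Z. norm (Z - Complex R y) < e \<and> a < Re Z \<and> Re Z < R \<and> \<rho> (exp (L Z)) = d"
    using z' by (intro exI[of _ "cpos z'"]) auto
  qed (use d2 in simp)
 qed
qed

definition vb :: "(complex \<Rightarrow> complex) \<Rightarrow> real \<Rightarrow> real" where
 "vb L = (SOME v. (\<forall>y. ((\<lambda>Z. \<rho> (exp (L Z))) \<longlongrightarrow> cis (v y)) (at (Complex R y) within collar)) \<and>
  (\<forall>y y'. \<bar>v y - v y'\<bar> \<le> 1/4 * \<bar>y - y'\<bar>) \<and> strict_mono v \<and>
  (\<forall>y y'. cis (v y) = cis (v y') \<longrightarrow> y = y') \<and>
  (\<forall>y e. 0 < e \<longrightarrow> (\<exists>\<delta>>0. \<forall>\<zeta>. norm \<zeta> < 1 \<longrightarrow> norm (\<zeta> - cis (v y)) < \<delta> \<longrightarrow>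
    (\<exists>Z. norm (Z - Complex R y) < e \<and> a < Re Z \<and> Re Z < R \<and> \<rho> (exp (L Z)) = \<zeta>))))"

lemma vb:
 assumes "lb L"
 shows "((\<lambda>Z. \<rho> (exp (L Z))) \<longlongrightarrow> cis (vb L y)) (at (Complex R y) within collar)"
  "\<bar>vb L y - vb L y'\<bar> \<le> 1/4 * \<bar>y - y'\<bar>" "strict_mono (vb L)"
  "cis (vb L y) = cis (vb L y') \<Longrightarrow> y = y'"
  "0 < e \<Longrightarrow> \<exists>u>0. \<forall>d. norm d < 1 \<longrightarrow> norm (d - cis (vb L y)) < u \<longrightarrow>
    (\<exists>Z. norm (Z - Complex R y) < e \<and> a < Re Z \<and> Re Z < R \<and> \<rho> (exp (L Z)) = d)"
 using someI_ex[OF v_exists[OF assms], folded vb_def] by blast+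

lemma collar_nontrivial: "at (Complex R y) within collar \<noteq> bot"
proof -
 define p where "p = (\<lambda>n. (R - a) / 2 * inverse (real (Suc n)))"
 define f where "f = (\<lambda>n. Complex R y - of_real (p n))"
 have "p \<longlonglongrightarrow> (R - a) / 2 * 0" unfolding p_def by (intro tendsto_intros LIMSEQ_inverse_real_of_nat)
 hence "f \<longlonglongrightarrow> Complex R y - of_real ((R - a) / 2 * 0)" unfolding f_def by (intro tendsto_intros)
 moreover have "f n \<in> collar - {Complex R y}" for n
 proof -
  have "p n \<le> (R - a) / 2 * 1" unfolding p_def using Ra by (intro mult_left_mono) (auto simp: field_simps)
  also have "\<dots> < R - a" using Ra by simp
  finally have "p n < R - a" .
  moreover have "0 < p n" using Ra by (simp add: p_def)
  moreover have "Re (f n) = R - p n" by (simp add: f_def)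
  ultimately have "a < Re (f n) \<and> Re (f n) < R" using Ra by linarith
  thus ?thesis by auto
 qed
 ultimately have "Complex R y islimpt collar" unfolding islimpt_sequential by (intro exI[of _ f]) auto
 thus ?thesis by (simp add: trivial_limit_within)
qed

lemma vb_compat:
 assumes L: "lb L" "lb L'" and eq: "\<And>W. a < Re W \<Longrightarrow> exp (L' (W + of_int k * tpi)) = exp (L W)"
 shows "cis (vb L' (y + 2 * pi * of_int k)) = cis (vb L y)"
proof (rule tendsto_unique[OF collar_nontrivial[of y]])
 let ?C = "collar"
 show "((\<lambda>Z. \<rho> (exp (L Z))) \<longlongrightarrow> cis (vb L y)) (at (Complex R y) within ?C)" by (rule vb(1)[OF L(1)])
 have fl: "filterlim (\<lambda>W. W + of_int k * tpi) (at (Complex R (y + 2 * pi * of_int k)) within ?C) (at (Complex R y) within ?C)"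
  unfolding filterlim_at
 proof
  have "((\<lambda>W. W + of_int k * tpi) \<longlongrightarrow> Complex R y + of_int k * tpi) (at (Complex R y) within ?C)" by (intro tendsto_intros)
  moreover have "Complex R y + of_int k * tpi = Complex R (y + 2 * pi * of_int k)" by (simp add: complex_eq_iff)
  ultimately show "((\<lambda>W. W + of_int k * tpi) \<longlongrightarrow> Complex R (y + 2 * pi * of_int k)) (at (Complex R y) within ?C)" by simp
  show "\<forall>\<^sub>F W in at (Complex R y) within ?C. W + of_int k * tpi \<in> ?C \<and> W + of_int k * tpi \<noteq> Complex R (y + 2 * pi * of_int k)"
   by (auto simp: eventually_at_filter complex_eq_iff)
 qed
 from filterlim_compose[OF vb(1)[OF L(2)] fl]
 show "((\<lambda>Z. \<rho> (exp (L Z))) \<longlongrightarrow> cis (vb L' (y + 2 * pi * of_int k))) (at (Complex R y) within ?C)"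
 proof (rule Lim_transform_eventually)
  have "\<forall>\<^sub>F Z in at (Complex R y) within ?C. Z \<in> ?C" by (simp add: eventually_at_filter)
  thus "\<forall>\<^sub>F W in at (Complex R y) within ?C. \<rho> (exp (L' (W + of_int k * tpi))) = \<rho> (exp (L W))"
   by eventually_elim (simp add: eq)
 qed
qed


text \<open>Beyond the unit circle, the radii of the disc are continued along the images of
  horizontal lines in the tracts. The value does not depend on the chosen \<open>L\<close> and
  \<open>Z\<close>, see \<open>rbar_T\<close>.\<close>

definition rbar :: "complex \<Rightarrow> complex" where
 "rbar z = (if z \<in> V then \<rho> z else
   (case (SOME (L, Z). lb L \<and> R \<le> Re Z \<and> exp (L Z) = z) of (L, Z) \<Rightarrow> of_real (1 + Re Z - R) * cis (vb L (Im Z))))"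

lemma rbar_T:
 assumes L: "lb L" and Z: "R \<le> Re Z"
 shows "rbar (exp (L Z)) = of_real (1 + Re Z - R) * cis (vb L (Im Z))"
proof -
 have nV: "exp (L Z) \<notin> V" using exp_V_iff[OF L, of Z] Z Ra by simp
 obtain L' Z' where S: "(SOME (L', Z'). lb L' \<and> R \<le> Re Z' \<and> exp (L' Z') = exp (L Z)) = (L', Z')" by (rule prod.exhaust)
 have "case (SOME (L', Z'). lb L' \<and> R \<le> Re Z' \<and> exp (L' Z') = exp (L Z)) of (L', Z') \<Rightarrow> lb L' \<and> R \<le> Re Z' \<and> exp (L' Z') = exp (L Z)"
  by (rule someI[where x="(L, Z)"]) (use assms in simp)
 hence L': "lb L'" "R \<le> Re Z'" "exp (L' Z') = exp (L Z)" unfolding S by auto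
 obtain k n where k: "Z' = Z + of_int k * tpi" "\<And>W. a < Re W \<Longrightarrow> L' (W + of_int k * tpi) = L W + of_int n * tpi"
  by (rule lb_meet[OF L L'(1) _ _ L'(3)[symmetric]]) (use Z L'(2) Ra in auto)
 have "cis (vb L' (Im Z + 2 * pi * of_int k)) = cis (vb L (Im Z))" by (rule vb_compat[OF L L'(1)]) (simp add: k(2))
 hence "cis (vb L' (Im Z')) = cis (vb L (Im Z))" by (simp add: k(1) mult.commute)
 moreover have "Re Z' = Re Z" by (simp add: k(1))
 ultimately show ?thesis using nV by (simp add: rbar_def S)
qed

lemma rbar_V: "z \<in> V \<Longrightarrow> rbar z = \<rho> z"
 by (simp add: rbar_def)

lemma vb_cont: "lb L \<Longrightarrow> continuous_on UNIV (vb L)"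
proof -
 assume L: "lb L"
 have "(1/4)-lipschitz_on UNIV (vb L)" using vb(2)[OF L] by (intro lipschitz_onI) (auto simp: dist_real_def)
 thus ?thesis by (rule lipschitz_on_continuous_on)
qed

lemma rbar_lb_cont:
 assumes L: "lb L"
 shows "continuous_on (hp a) (\<lambda>Z. rbar (exp (L Z)))"
proof -
 define E where "E = (\<lambda>Z. rbar (exp (L Z)))"
 have E1: "E Z = \<rho> (exp (L Z))" if "a < Re Z" "Re Z < R" for Z using exp_V_iff[OF L, of Z] that by (simp add: E_def rbar_V)
 have E2: "E Z = of_real (1 + Re Z - R) * cis (vb L (Im Z))" if "R \<le> Re Z" for Z using rbar_T[OF L that] by (simp add: E_def)
 have vc: "continuous_on A (\<lambda>Z. vb L (Im Z))" for A by (rule continuous_on_compose2[OF vb_cont[OF L]]) (auto intro!: continuous_intros)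
 have c2: "continuous_on {Z. R \<le> Re Z} (\<lambda>Z. of_real (1 + Re Z - R) * cis (vb L (Im Z)))" by (intro continuous_intros vc continuous_on_cis)
 have c2': "continuous_on {Z. R \<le> Re Z} E" using c2 by (rule continuous_on_eq) (simp add: E2)
 have cc1: "open collar" using open_Int[OF open_halfspace_Re_gt[of a] open_halfspace_Re_lt[of R]] by (simp add: Collect_conj_eq)
 have c1: "continuous_on collar (\<lambda>Z. \<rho> (exp (L Z)))" by (rule continuous_on_compose2[OF holomorphic_on_imp_continuous_on[OF rho]])
    (use exp_V_iff[OF L] in \<open>auto intro!: continuous_intros lb_cont[OF L]\<close>)
 have c1': "continuous_on collar E" using c1 by (rule continuous_on_eq) (simp add: E1)
 have "continuous (at Z within hp a) E" if Z: "Z \<in> hp a" for Z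
 proof -
  have hpeq: "hp a = collar \<union> {Z. R \<le> Re Z}" using Ra by auto
  have t2: "(E \<longlongrightarrow> E Z) (at Z within {Z. R \<le> Re Z})" if "R \<le> Re Z" using c2' that by (auto simp: continuous_on)
  have t1: "(E \<longlongrightarrow> E Z) (at Z within collar)" if "Re Z \<le> R"
  proof (cases "Re Z = R")
   case False
   thus ?thesis using c1' that Z by (auto simp: continuous_on)
  next
   case True
   hence ZR: "Z = Complex R (Im Z)" by (simp add: complex_eq_iff)
   have "((\<lambda>Z. \<rho> (exp (L Z))) \<longlongrightarrow> cis (vb L (Im Z))) (at Z within collar)" using vb(1)[OF L, of "Im Z"] ZR by simp
   hence "((\<lambda>Z. \<rho> (exp (L Z))) \<longlongrightarrow> E Z) (at Z within collar)" using E2[of Z] True by simp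
   thus ?thesis
   proof (rule Lim_transform_eventually)
    have "\<forall>\<^sub>F Y in at Z within collar. Y \<in> collar" by (simp add: eventually_at_filter)
    thus "\<forall>\<^sub>F Y in at Z within collar. \<rho> (exp (L Y)) = E Y" by eventually_elim (simp add: E1)
   qed
  qed
  consider "Re Z < R" | "Re Z = R" | "R < Re Z" by linarith
  hence "(E \<longlongrightarrow> E Z) (at Z within hp a)"
  proof cases
   case 1
   have "at Z within hp a = at Z within collar" by (rule at_within_nhd[of Z "{Z. Re Z < R}"]) (use 1 in \<open>auto simp: open_halfspace_Re_lt\<close>)
   thus ?thesis using t1 1 by simp
  next
   case 2
   thus ?thesis unfolding hpeq Lim_within_Un using t1 t2 by simp
  next
   case 3
   have "at Z within hp a = at Z within {Z. R \<le> Re Z}"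
    by (rule at_within_nhd[of Z "{Z. R < Re Z}"]) (use 3 Ra in \<open>auto simp: open_halfspace_Re_gt\<close>)
   thus ?thesis using t2 3 by simp
  qed
  thus ?thesis by (simp add: continuous_within)
 qed
 thus ?thesis unfolding E_def by (simp add: continuous_on_eq_continuous_within)
qed

lemma rbar_cont: "continuous_on UNIV rbar"
proof -
 have "continuous (at z) rbar" for z
 proof (cases "z \<in> V")
  case True
  have "continuous_on V rbar" using holomorphic_on_imp_continuous_on[OF rho] by (rule continuous_on_eq) (simp add: rbar_V)
  thus ?thesis using True V_open continuous_on_eq_continuous_at by blast
 next
  case False
  then obtain L Z where L: "lb L" "R \<le> Re Z" "exp (L Z) = z" by (rule tract_cover_V)
  let ?e = "\<lambda>Z. exp (L Z)"
  have eh: "?e holomorphic_on hp a" by (intro holomorphic_intros lbD(1)[OF L(1)])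
  have ei: "inj_on ?e (hp a)" by (rule inv_branch_inj[OF tr sing lb_inv_branch[OF L(1)]])
  obtain k where k: "k holomorphic_on ?e ` hp a" "\<And>Z. Z \<in> hp a \<Longrightarrow> k (?e Z) = Z"
   by (rule holomorphic_has_inverse[OF eh open_hp ei]) blast
  have "continuous_on (?e ` hp a) (\<lambda>u. rbar (?e (k u)))"
   by (rule continuous_on_compose2[OF rbar_lb_cont[OF L(1)] holomorphic_on_imp_continuous_on[OF k(1)]]) (use k(2) in auto)
  hence "continuous_on (?e ` hp a) rbar" by (rule continuous_on_eq) (use k(2) in auto)
  moreover have "open (?e ` hp a)" by (rule exp_lb_open[OF L(1)]) auto
  moreover have "z \<in> ?e ` hp a" using L Ra by auto
  ultimately show ?thesis using continuous_on_eq_continuous_at by blast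
 qed
 thus ?thesis by (simp add: continuous_on_eq_continuous_at)
qed

text \<open>All points of the disc close to the common boundary value are attained from both
  collars. So the collars meet in the plane, and \<open>lb_meet\<close> applies.\<close>

lemma rbar_same_T:
 assumes L: "lb L" "lb L'" and eq: "cis (vb L y) = cis (vb L' y')"
 obtains k n :: int where "y' = y + 2 * pi * of_int k" "\<And>W. a < Re W \<Longrightarrow> L' (W + of_int k * tpi) = L W + of_int n * tpi"
proof -
 obtain d1 where d1: "d1 > 0" "\<And>\<zeta>. norm \<zeta> < 1 \<Longrightarrow> norm (\<zeta> - cis (vb L y)) < d1 \<Longrightarrow>
   \<exists>Z. norm (Z - Complex R y) < 1 \<and> a < Re Z \<and> Re Z < R \<and> \<rho> (exp (L Z)) = \<zeta>" using vb(5)[OF L(1), of 1 y] by auto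
 obtain d2 where d2: "d2 > 0" "\<And>\<zeta>. norm \<zeta> < 1 \<Longrightarrow> norm (\<zeta> - cis (vb L' y')) < d2 \<Longrightarrow>
   \<exists>Z. norm (Z - Complex R y') < 1 \<and> a < Re Z \<and> Re Z < R \<and> \<rho> (exp (L' Z)) = \<zeta>" using vb(5)[OF L(2), of 1 y'] by auto
 define t where "t = min (min d1 d2) 1 / 2"
 have t: "0 < t" "t < d1" "t < d2" "t < 1" using d1 d2 by (auto simp: t_def)
 define \<zeta> where "\<zeta> = of_real (1 - t) * cis (vb L y)"
 have z1: "norm \<zeta> < 1" using t by (simp add: \<zeta>_def norm_mult del: of_real_diff)
 have "\<zeta> - cis (vb L y) = - of_real t * cis (vb L y)" by (simp add: \<zeta>_def algebra_simps)
 hence z2: "norm (\<zeta> - cis (vb L y)) = t" using t by (simp add: norm_mult)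
 obtain Z where Z: "norm (Z - Complex R y) < 1" "a < Re Z" "Re Z < R" "\<rho> (exp (L Z)) = \<zeta>" using d1(2)[OF z1] z2 t by auto
 obtain Z' where Z': "norm (Z' - Complex R y') < 1" "a < Re Z'" "Re Z' < R" "\<rho> (exp (L' Z')) = \<zeta>" using d2(2)[OF z1] z2 t eq by auto
 have "exp (L Z) \<in> V" "exp (L' Z') \<in> V" using exp_V_iff L Z Z' by auto
 hence e: "exp (L Z) = exp (L' Z')" using gr Z(4) Z'(4) by metis
 obtain k n where k: "Z' = Z + of_int k * tpi" "\<And>W. a < Re W \<Longrightarrow> L' (W + of_int k * tpi) = L W + of_int n * tpi"
  by (rule lb_meet[OF L Z(2) Z'(2) e]) blast
 have "cis (vb L' (y + 2 * pi * of_int k)) = cis (vb L y)" by (rule vb_compat[OF L]) (simp add: k(2))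
 hence "cis (vb L' (y + 2 * pi * of_int k)) = cis (vb L' y')" using eq by simp
 hence "y + 2 * pi * of_int k = y'" by (rule vb(4)[OF L(2)])
 thus ?thesis using that k(2) by metis
qed

lemma rbar_norm: "norm (rbar z) < 1 \<longleftrightarrow> z \<in> V"
proof (cases "z \<in> V")
 case True thus ?thesis using rhoV by (simp add: rbar_V)
next
 case False
 then obtain L Z where L: "lb L" "R \<le> Re Z" "exp (L Z) = z" by (rule tract_cover_V)
 hence "norm (rbar z) = 1 + Re Z - R" using rbar_T[OF L(1,2)] by (simp add: norm_mult del: of_real_add of_real_diff)
 thus ?thesis using False L by simp
qed

lemma rbar_inj: "inj rbar"
proof (rule injI)
 fix z z' assume eq: "rbar z = rbar z'"
 show "z = z'"
 proof (cases "z \<in> V")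
  case True
  hence "z' \<in> V" using eq rbar_norm by metis
  thus ?thesis using True eq gr rbar_V by metis
 next
  case False
  hence "z' \<notin> V" using eq rbar_norm by metis
  obtain L Z where L: "lb L" "R \<le> Re Z" "exp (L Z) = z" using False by (rule tract_cover_V)
  obtain L' Z' where L': "lb L'" "R \<le> Re Z'" "exp (L' Z') = z'" using \<open>z' \<notin> V\<close> by (rule tract_cover_V)
  have e: "of_real (1 + Re Z - R) * cis (vb L (Im Z)) = of_real (1 + Re Z' - R) * cis (vb L' (Im Z'))"
   using eq rbar_T[OF L(1,2)] rbar_T[OF L'(1,2)] L(3) L'(3) by simp
  hence "norm (of_real (1 + Re Z - R) * cis (vb L (Im Z))) = norm (of_real (1 + Re Z' - R) * cis (vb L' (Im Z')))" by simp
  hence re: "Re Z = Re Z'" using L(2) L'(2) by (simp add: norm_mult del: of_real_add of_real_diff)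
  hence c: "cis (vb L (Im Z)) = cis (vb L' (Im Z'))" using e L(2) by (simp del: of_real_add of_real_diff)
  obtain k n where k: "Im Z' = Im Z + 2 * pi * of_int k" "\<And>W. a < Re W \<Longrightarrow> L' (W + of_int k * tpi) = L W + of_int n * tpi"
   by (rule rbar_same_T[OF L(1) L'(1) c]) blast
  have "Z' = Z + of_int k * tpi" using re k(1) by (simp add: complex_eq_iff)
  thus ?thesis using k(2)[of Z] L L' Ra by simp
 qed
qed

end

section \<open>Radial coordinates in logarithmic form\<close>

context riemann begin

lemma rbar_0: "rbar 0 = 0" using zero_V rho0 by (simp add: rbar_V)

lemma rbar_nz: "z \<noteq> 0 \<Longrightarrow> rbar z \<noteq> 0" using rbar_inj rbar_0 by (metis injD)

text \<open>\<open>rbar w / w\<close>, continued to 0 by the derivative of \<open>\<rho>\<close>, is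
  continuous without zeros, hence has a continuous logarithm on the plane.\<close>

lemma ex_lam: "\<exists>lam. continuous_on UNIV lam \<and> (\<forall>w. rbar w = w * exp (lam w)) \<and> Im (lam 0) = 0"
proof -
 define k where "k = (\<lambda>w. if w = 0 then deriv \<rho> 0 else rbar w / w)"
 have "isCont k w" for w
 proof (cases "w = 0")
  case True
  have "(\<rho> has_field_derivative deriv \<rho> 0) (at 0)" by (rule holomorphic_derivI[OF rho V_open zero_V])
  hence "((\<lambda>h. (\<rho> (0 + h) - \<rho> 0) / h) \<longlongrightarrow> deriv \<rho> 0) (at 0)" by (simp add: DERIV_def)
  hence "(k \<longlongrightarrow> deriv \<rho> 0) (at 0)"
  proof (rule Lim_transform_eventually)
   have "\<forall>\<^sub>F h in at 0. h \<in> V - {0}" by (rule eventually_at_in_open[OF V_open zero_V])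
   thus "\<forall>\<^sub>F h in at 0. (\<rho> (0 + h) - \<rho> 0) / h = k h" by eventually_elim (simp add: k_def rho0 rbar_V)
  qed
  thus ?thesis using True by (simp add: isCont_def k_def)
 next
  case False
  have "continuous_on (-{0}) (\<lambda>w. rbar w / w)" by (intro continuous_intros continuous_on_subset[OF rbar_cont]) auto
  hence "continuous_on (-{0}) k" by (rule continuous_on_eq) (simp add: k_def)
  thus ?thesis using False by (subst (asm) continuous_on_eq_continuous_at) auto
 qed
 hence kc: "continuous_on UNIV k" by (simp add: continuous_on_eq_continuous_at)
 have knz: "k w \<noteq> 0" for w using rbar_nz[of w] drho by (auto simp: k_def)
 obtain l where l: "continuous_on UNIV l" "\<And>w. k w = exp (l w)" by (rule continuous_logarithm_on_contractible[OF kc contractible_UNIV knz]) auto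
 have d0: "deriv \<rho> 0 = of_real (Re (deriv \<rho> 0))" using drho(1) by (simp add: complex_is_Real_iff complex_eq_iff)
 have "exp (l 0) = deriv \<rho> 0" using l(2)[of 0] by (simp add: k_def)
 also have "\<dots> = exp (of_real (ln (Re (deriv \<rho> 0))))" using drho(2) d0 by (simp add: exp_of_real)
 finally obtain n where n: "l 0 = of_real (ln (Re (deriv \<rho> 0))) + of_int n * tpi" unfolding exp_eq_tpi by blast
 show ?thesis
 proof (intro exI[of _ "\<lambda>w. l w + of_int (-n) * tpi"] conjI allI)
  show "continuous_on UNIV (\<lambda>w. l w + of_int (-n) * tpi)" by (intro continuous_intros l)
  show "rbar w = w * exp (l w + of_int (-n) * tpi)" for w unfolding exp_tpi using l(2)[of w, symmetric] rbar_0 by (simp add: k_def)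
  show "Im (l 0 + of_int (-n) * tpi) = 0" using n by simp
 qed
qed

definition "lam = (SOME lam. continuous_on UNIV lam \<and> (\<forall>w. rbar w = w * exp (lam w)) \<and> Im (lam 0) = 0)"

lemma lam: "continuous_on UNIV lam" "rbar w = w * exp (lam w)" "Im (lam 0) = 0"
 using someI_ex[OF ex_lam, folded lam_def] by auto

text \<open>The lift of \<open>rbar\<close> to logarithmic coordinates. It takes the leaves of the
  radial foliation to horizontal lines.\<close>

definition P :: "complex \<Rightarrow> complex" where "P z = z + lam (exp z)"

lemma P_cont: "continuous_on UNIV P"
 unfolding P_def by (intro continuous_intros continuous_on_compose2[OF lam(1)]) auto

lemma exp_P: "exp (P z) = rbar (exp z)" by (simp add: P_def exp_add lam(2))

lemma P_tpi: "P (z + of_int n * tpi) = P z + of_int n * tpi" by (simp add: P_def)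

lemma P_inj: "inj P"
proof (rule injI)
 fix z z' assume eq: "P z = P z'"
 hence "rbar (exp z) = rbar (exp z')" by (metis exp_P)
 hence "exp z = exp z'" using rbar_inj by (metis injD)
 then obtain n where n: "z = z' + of_int n * tpi" unfolding exp_eq_tpi by blast
 hence "P z' + of_int n * tpi = P z'" using eq P_tpi by simp
 thus "z = z'" using n by simp
qed

lemma P_left: assumes "e > 0" obtains x where "\<And>z. Re z \<le> x \<Longrightarrow> norm (P z - z - lam 0) < e"
proof -
 have "isCont lam 0" using lam(1) by (simp add: continuous_on_eq_continuous_at)
 then obtain d where d: "d > 0" "\<And>w. dist w 0 < d \<Longrightarrow> dist (lam w) (lam 0) < e"
  using assms unfolding continuous_at_eps_delta by blast
 show ?thesis
 proof (rule that[of "ln (d/2)"])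
  fix z assume "Re z \<le> ln (d/2)"
  hence "exp (Re z) \<le> d/2" using d(1) by (simp add: ln_ge_iff)
  hence "exp (Re z) < d" using d(1) by simp
  thus "norm (P z - z - lam 0) < e" using d(2)[of "exp z"] by (simp add: P_def dist_norm norm_exp_eq_Re)
 qed
qed

lemma P_V: "Re (P z) < 0 \<longleftrightarrow> exp z \<in> V"
proof -
 have "norm (exp (P z)) < 1 \<longleftrightarrow> exp z \<in> V" by (simp add: exp_P rbar_norm)
 thus ?thesis by (simp add: norm_exp_eq_Re)
qed

lemma T_cover:
 assumes "exp z \<notin> V" obtains L Z where "lb L" "R \<le> Re Z" "z = L Z"
proof -
 obtain L Z where L: "lb L" "R \<le> Re Z" "exp (L Z) = exp z" using assms by (rule tract_cover_V)
 obtain n where n: "z = L Z + of_int n * tpi" using L(3)[symmetric] unfolding exp_eq_tpi by blast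
 have "lb (\<lambda>Z. L (Z + of_int 0 * tpi) + of_int n * tpi)" by (rule lb_shift[OF L(1)])
 thus ?thesis using that[of "\<lambda>Z. L Z + of_int n * tpi" Z] L n by simp
qed

text \<open>The height in straight coordinates of the leaf through the boundary point
  \<open>Complex R y\<close> of the tract; by \<open>P_lb\<close> it is constant along the ray to
  the right.\<close>

definition vt :: "(complex \<Rightarrow> complex) \<Rightarrow> real \<Rightarrow> real" where "vt L y = Im (P (L (Complex R y)))"

lemma P_lb_vb:
 assumes L: "lb L"
 obtains n :: int where "\<And>Z. R \<le> Re Z \<Longrightarrow> P (L Z) = Complex (ln (1 + Re Z - R)) (vb L (Im Z) + 2 * pi * of_int n)"
proof -
 define C where "C = (\<lambda>Z. Complex (ln (1 + Re Z - R)) (vb L (Im Z)))"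
 define D where "D = (\<lambda>Z. (P (L Z) - C Z) / tpi)"
 let ?H = "{Z. R \<le> Re Z}"
 have Dint: "D Z \<in> \<int>" if Z: "Z \<in> ?H" for Z
 proof -
  have "exp (P (L Z)) = of_real (1 + Re Z - R) * cis (vb L (Im Z))" using Z rbar_T[OF L, of Z] by (simp add: exp_P)
  also have "\<dots> = exp (C Z)"
  proof -
   have "exp (C Z) = of_real (exp (ln (1 + Re Z - R))) * cis (vb L (Im Z))" by (simp add: C_def exp_eq_polar)
   thus ?thesis using Z by simp
  qed
  finally obtain n where "P (L Z) = C Z + of_int n * tpi" unfolding exp_eq_tpi by blast
  thus ?thesis by (simp add: D_def)
 qed
 have cD: "continuous_on ?H D"
 proof -
  have "continuous_on ?H (\<lambda>Z. vb L (Im Z))" by (rule continuous_on_compose2[OF vb_cont[OF L]]) (auto intro!: continuous_intros)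
  hence "continuous_on ?H C" unfolding C_def by (intro continuous_intros) auto
  thus ?thesis unfolding D_def using Ra by (intro continuous_intros continuous_on_compose2[OF P_cont] lb_cont[OF L]) auto
 qed
 have "D constant_on ?H"
 proof (rule continuous_discrete_range_constant[OF _ cD])
  show "connected ?H" by (simp add: convex_connected convex_halfspace_Re_ge)
  show "\<exists>e>0. \<forall>y. y \<in> ?H \<and> D y \<noteq> D x \<longrightarrow> e \<le> norm (D y - D x)" if x: "x \<in> ?H" for x
  proof (intro exI[of _ 1] conjI allI impI)
   fix y assume y: "y \<in> ?H \<and> D y \<noteq> D x"
   obtain m1 m2 :: int where m: "D y = of_int m1" "D x = of_int m2" using Dint[OF x] Dint[of y] y by (auto elim!: Ints_cases)
   hence "m1 \<noteq> m2" using y by auto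
   hence "1 \<le> \<bar>of_int (m1 - m2) :: real\<bar>" by linarith
   also have "\<dots> = norm (D y - D x)" unfolding m by (metis norm_of_int of_int_diff)
   finally show "1 \<le> norm (D y - D x)" .
  qed auto
 qed
 then obtain c where c: "\<And>W. W \<in> ?H \<Longrightarrow> D W = c" by (auto simp: constant_on_def)
 obtain n :: int where n: "c = of_int n" using Dint[of "of_real R"] c[of "of_real R"] by (auto elim!: Ints_cases)
 show ?thesis
 proof (rule that[of n])
  fix Z assume "R \<le> Re Z"
  hence "D Z = of_int n" using c n by simp
  hence "P (L Z) = C Z + of_int n * tpi" by (simp add: D_def field_simps)
  thus "P (L Z) = Complex (ln (1 + Re Z - R)) (vb L (Im Z) + 2 * pi * of_int n)" by (simp add: C_def complex_eq_iff)
 qed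
qed

lemma vt_vb: assumes "lb L" obtains n :: int where "\<And>y. vt L y = vb L y + 2 * pi * of_int n"
proof -
 obtain n where n: "\<And>Z. R \<le> Re Z \<Longrightarrow> P (L Z) = Complex (ln (1 + Re Z - R)) (vb L (Im Z) + 2 * pi * of_int n)"
  by (rule P_lb_vb[OF assms]) blast
 show ?thesis by (rule that[of n]) (use n[of "Complex R _"] in \<open>simp add: vt_def\<close>)
qed

lemma P_lb: assumes "lb L" "R \<le> Re Z" shows "P (L Z) = Complex (ln (1 + Re Z - R)) (vt L (Im Z))"
proof -
 obtain n where n: "\<And>Z. R \<le> Re Z \<Longrightarrow> P (L Z) = Complex (ln (1 + Re Z - R)) (vb L (Im Z) + 2 * pi * of_int n)"
  by (rule P_lb_vb[OF assms(1)]) blast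
 show ?thesis using n[OF assms(2)] n[of "Complex R (Im Z)"] by (simp add: vt_def)
qed

lemma vt:
 assumes L: "lb L"
 shows "\<bar>vt L y - vt L y'\<bar> \<le> 1/4 * \<bar>y - y'\<bar>" "strict_mono (vt L)"
  "vt L y = vt L y' + 2 * pi * of_int n \<Longrightarrow> y = y'"
proof -
 obtain k where k: "\<And>y. vt L y = vb L y + 2 * pi * of_int k" by (rule vt_vb[OF L]) blast
 show "\<bar>vt L y - vt L y'\<bar> \<le> 1/4 * \<bar>y - y'\<bar>" using vb(2)[OF L, of y y'] by (simp add: k)
 show "strict_mono (vt L)" using vb(3)[OF L] by (simp add: k strict_mono_def)
 assume "vt L y = vt L y' + 2 * pi * of_int n"
 hence "vb L y = vb L y' + 2 * pi * of_int n" by (simp add: k)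
 hence "cis (vb L y) = cis (vb L y') * cis (2 * pi * of_int n)" by (simp only: cis_mult)
 also have "cis (2 * pi * of_int n) = 1" by (rule cis_multiple_2pi) auto
 finally show "y = y'" using vb(4)[OF L] by simp
qed

lemma vt_cont: "lb L \<Longrightarrow> continuous_on UNIV (vt L)"
proof -
 assume L: "lb L"
 have "(1/4)-lipschitz_on UNIV (vt L)" using vt(1)[OF L] by (intro lipschitz_onI) (auto simp: dist_real_def)
 thus ?thesis by (rule lipschitz_on_continuous_on)
qed

text \<open>Heights of the leaves that enter a tract. In the coordinate \<open>P z\<close> the
  remaining leaves end before \<open>Re p = 0\<close>.\<close>

definition I :: "real set" where "I = {v. \<exists>L y. lb L \<and> v = vt L y}"

lemma range_P: "p \<in> range P \<longleftrightarrow> Re p < 0 \<or> Im p \<in> I"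
proof
 assume "p \<in> range P"
 then obtain z where z: "p = P z" by blast
 show "Re p < 0 \<or> Im p \<in> I"
 proof (cases "exp z \<in> V")
  case False
  then obtain L Z where L: "lb L" "R \<le> Re Z" "z = L Z" by (rule T_cover)
  hence "Im p = vt L (Im Z)" using z P_lb[OF L(1,2)] by simp
  thus ?thesis using L by (auto simp: I_def)
 qed (use z P_V in simp)
next
 assume "Re p < 0 \<or> Im p \<in> I"
 then consider "Re p < 0" | "0 \<le> Re p" "Im p \<in> I" by linarith
 thus "p \<in> range P"
 proof cases
  case 1
  hence b: "exp p \<in> ball 0 1" by (simp add: norm_exp_eq_Re)
  define w where "w = \<gamma> (exp p)"
  have w: "w \<in> V" "\<rho> w = exp p" using gamV[OF b] rg[OF b] by (auto simp: w_def)
  hence "w \<noteq> 0" using rho0 by auto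
  hence "exp (P (Ln w)) = exp p" using w by (simp add: exp_P rbar_V)
  then obtain n where "P (Ln w) = p + of_int n * tpi" unfolding exp_eq_tpi by blast
  hence "P (Ln w + of_int (-n) * tpi) = p" unfolding P_tpi by simp
  thus ?thesis by (metis rangeI)
 next
  case 2
  then obtain L y where L: "lb L" "Im p = vt L y" by (auto simp: I_def)
  have "1 \<le> exp (Re p)" using 2 by simp
  hence "P (L (Complex (R - 1 + exp (Re p)) y)) = p" using P_lb[OF L(1), of "Complex (R - 1 + exp (Re p)) y"] L(2) by (simp add: complex_eq_iff)
  thus ?thesis by (metis rangeI)
 qed
qed

text \<open>A leaf can run out of the range of \<open>P\<close> only by going to infinity on the
  right: if the real parts are bounded above, the points \<open>exp (z n)\<close> stay in a disc and
  accumulate at a point of the plane, which is not 0 because \<open>exp p\<close> is not.\<close>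

lemma P_proper:
 assumes z: "\<And>n. Re (z n) \<le> B" and lim: "(\<lambda>n. P (z n)) \<longlonglongrightarrow> p"
 shows "p \<in> range P"
proof -
 have "exp (z n) \<in> cball 0 (exp B)" for n :: nat using z[of n] by (simp add: norm_exp_eq_Re)
 moreover have "compact (cball 0 (exp B) :: complex set)" by simp
 ultimately obtain w r where w: "strict_mono r" "(\<lambda>n. exp (z (r n))) \<longlonglongrightarrow> w" unfolding compact_def by (force simp: o_def)
 have "(\<lambda>n. rbar (exp (z (r n)))) \<longlonglongrightarrow> rbar w" using continuous_on_tendsto_compose[OF rbar_cont w(2)] by simp
 moreover have "(\<lambda>n. exp (P (z (r n)))) \<longlonglongrightarrow> exp p"
  using LIMSEQ_subseq_LIMSEQ[OF lim w(1)] by (intro tendsto_intros) (simp add: o_def)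
 hence "(\<lambda>n. rbar (exp (z (r n)))) \<longlonglongrightarrow> exp p" by (simp add: exp_P)
 ultimately have e: "rbar w = exp p" by (rule LIMSEQ_unique)
 hence "w \<noteq> 0" using rbar_0 by auto
 hence "exp (P (Ln w)) = exp p" using e by (simp add: exp_P)
 then obtain n where "P (Ln w) = p + of_int n * tpi" unfolding exp_eq_tpi by blast
 hence "P (Ln w + of_int (-n) * tpi) = p" unfolding P_tpi by simp
 thus ?thesis by (metis rangeI)
qed

text \<open>Over a gap of \<open>I\<close>, \<open>P_proper\<close> forces
  \<open>\<gamma> (exp (\<i> * d))\<close> to tend to infinity as \<open>d\<close> approaches the
  real axis. Its inverse, extended by 0 and reflected, would vanish identically.\<close>

lemma I_dense: assumes ab: "\<alpha>' < \<beta>'" obtains v where "v \<in> I" "\<alpha>' < v" "v < \<beta>'"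
proof (rule ccontr)
 assume "\<not> thesis"
 hence nI: "v \<notin> I" if "\<alpha>' < v" "v < \<beta>'" for v using that \<open>\<And>v. v \<in> I \<Longrightarrow> \<alpha>' < v \<Longrightarrow> v < \<beta>' \<Longrightarrow> thesis\<close> by blast
 define F where "F = (\<lambda>d. if 0 < Im d then inverse (\<gamma> (exp (\<i> * d))) else 0)"
 have nz: "\<gamma> (exp (\<i> * d)) \<noteq> 0" if "0 < Im d" for d
 proof
  assume "\<gamma> (exp (\<i> * d)) = 0"
  moreover have "exp (\<i> * d) \<in> ball 0 1" using that by (simp add: norm_exp_eq_Re)
  ultimately have "exp (\<i> * d) = \<rho> 0" using rg by metis
  thus False by (simp add: rho0)
 qed
 have Fhol: "F holomorphic_on {d. 0 < Im d}"
 proof -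
  have "(\<lambda>d. exp (\<i> * d)) holomorphic_on {d. 0 < Im d}" by (intro holomorphic_intros)
  from holomorphic_on_compose_gen[OF this gam] have "(\<lambda>d. \<gamma> (exp (\<i> * d))) holomorphic_on {d. 0 < Im d}"
   by (force simp: o_def norm_exp_eq_Re)
  hence "(\<lambda>d. inverse (\<gamma> (exp (\<i> * d)))) holomorphic_on {d. 0 < Im d}"
   using nz by (intro holomorphic_intros) auto
  thus ?thesis by (rule holomorphic_transform) (simp add: F_def)
 qed
 have F0: "(F \<longlongrightarrow> 0) (at (of_real v))" if v: "\<alpha>' < v" "v < \<beta>'" for v
 proof (rule ccontr)
  assume "\<not> ?thesis"
  then obtain e where e: "e > 0" "\<not> (\<forall>\<^sub>F d in at (of_real v). dist (F d) 0 < e)" unfolding tendsto_iff by blast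
  have "\<exists>d. dist d (of_real v) < inverse (real (Suc n)) \<and> e \<le> norm (F d)" for n
  proof (rule ccontr)
   assume c: "\<not> ?thesis"
   have "\<forall>\<^sub>F d in at (of_real v). dist (F d) 0 < e"
    unfolding eventually_at using c by (intro exI[of _ "inverse (real (Suc n))"]) (auto simp: not_le)
   thus False using e by simp
  qed
  hence "\<forall>n. \<exists>d. dist d (of_real v) < inverse (real (Suc n)) \<and> e \<le> norm (F d)" by blast
  then obtain d where z0: "\<forall>n. dist (d n) (of_real v) < inverse (real (Suc n)) \<and> e \<le> norm (F (d n))"
   by (rule exE[OF choice])
  have z1: "dist (d n) (of_real v) < inverse (real (Suc n))" for n by (rule conjunct1[OF spec[OF z0]])
  have z2: "e \<le> norm (F (d n))" for n by (rule conjunct2[OF spec[OF z0]])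
  note d = z1 z2
  have up: "0 < Im (d n)" for n 
  proof (rule ccontr)
   assume "\<not> 0 < Im (d n)"
   hence "F (d n) = 0" unfolding F_def by (rule if_not_P)
   thus False using z2[of n] e(1) by simp
  qed
  have "(\<lambda>n. dist (d n) (of_real v)) \<longlonglongrightarrow> 0"
   by (rule tendsto_sandwich[OF _ _ tendsto_const LIMSEQ_inverse_real_of_nat])
     (use d(1) in \<open>auto intro!: always_eventually less_imp_le\<close>)
  hence zl: "d \<longlonglongrightarrow> of_real v" by (rule iffD2[OF tendsto_dist_iff])
  define z where "z = (\<lambda>n. inv P (\<i> * d n))"
  have z: "P (z n) = \<i> * d n" for n unfolding z_def by (rule f_inv_into_f) (use range_P[of "\<i> * d n"] up[of n] in simp)
  have "Re (z n) \<le> ln (1/e)" for n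
  proof -
   have b: "exp (z n) \<in> V" using up[of n] z[of n] P_V[of "z n"] by simp
   have "\<rho> (exp (z n)) = exp (\<i> * d n)" using exp_P[of "z n"] z[of n] rbar_V[OF b] by simp
   hence "\<gamma> (exp (\<i> * d n)) = exp (z n)" using gr[OF b] by simp
   hence "e \<le> inverse (exp (Re (z n)))" using d(2)[of n] up[of n] by (simp add: F_def norm_inverse norm_exp_eq_Re)
   hence "exp (Re (z n)) \<le> 1/e" using e(1) by (simp add: field_simps)
   thus ?thesis using e(1) by (simp add: ln_ge_iff)
  qed
  moreover have "(\<lambda>n. P (z n)) \<longlonglongrightarrow> \<i> * of_real v" unfolding z by (intro tendsto_intros zl)
  ultimately have "\<i> * of_real v \<in> range P" by (rule P_proper)
  thus False using range_P nI[OF v] by simp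
 qed
 define Q where "Q = box (Complex \<alpha>' (-1)) (Complex \<beta>' 1)"
 have Q: "z \<in> Q \<longleftrightarrow> \<alpha>' < Re z \<and> Re z < \<beta>' \<and> \<bar>Im z\<bar> < 1" for z by (auto simp: Q_def in_box_complex_iff)
 define G where "G = (\<lambda>z. if 0 \<le> Im z then F z else cnj (F (cnj z)))"
 have G: "G holomorphic_on Q" unfolding G_def
 proof (rule Schwarz_reflection)
  show "open Q" unfolding Q_def by (rule open_box)
  show "cnj ` Q \<subseteq> Q" by (auto simp: Q)
  show "F holomorphic_on Q \<inter> {z. 0 < Im z}" using Fhol by (rule holomorphic_on_subset) auto
  show "F z \<in> \<real>" if "z \<in> \<real>" for z using that by (simp add: F_def complex_is_Real_iff)
  show "continuous_on (Q \<inter> {z. 0 \<le> Im z}) F" unfolding continuous_on_eq_continuous_within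
  proof
   fix z assume z: "z \<in> Q \<inter> {z. 0 \<le> Im z}"
   show "continuous (at z within Q \<inter> {z. 0 \<le> Im z}) F"
   proof (cases "0 < Im z")
    case True
    have "isCont F z" using holomorphic_on_imp_continuous_on[OF Fhol] True
      continuous_on_eq_continuous_at[OF open_halfspace_Im_gt[of 0], of F] by simp
    thus ?thesis by (rule continuous_at_imp_continuous_at_within)
   next
    case False
    hence zr: "of_real (Re z) = z" "F z = 0" using z by (auto simp: complex_eq_iff F_def)
    have "(F \<longlongrightarrow> 0) (at (of_real (Re z)))" by (rule F0) (use z Q in auto)
    hence "(F \<longlongrightarrow> F z) (at z)" unfolding zr .
    thus ?thesis unfolding continuous_within by (rule tendsto_within_subset) simp
   qed
  qed
 qed
 define c where "c = (\<alpha>' + \<beta>') / 2"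
 have c: "\<alpha>' < c" "c < \<beta>'" using ab by (auto simp: c_def)
 have "G (of_real c + \<i> * of_real (1/2)) = 0"
 proof (rule analytic_continuation[OF G])
  show "open Q" "connected Q" unfolding Q_def by (auto intro: convex_connected open_box)
  show "of_real ` {\<alpha>'<..<\<beta>'} \<subseteq> Q" by (auto simp: Q)
  show "of_real c \<in> Q" using c by (simp add: Q)
  have "c islimpt {\<alpha>'<..<\<beta>'}" using c by (simp add: islimpt_greaterThanLessThan1 open_imp_islimpt)
  thus "(of_real c :: complex) islimpt of_real ` {\<alpha>'<..<\<beta>'}" by (rule islimpt_isCont_image) (auto simp: eventually_at_filter)
  show "G z = 0" if "z \<in> of_real ` {\<alpha>'<..<\<beta>'}" for z using that by (auto simp: G_def F_def)
  show "of_real c + \<i> * of_real (1/2) \<in> Q" using c by (simp add: Q)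
 qed
 thus False using nz[of "of_real c + \<i> * of_real (1/2)"] by (simp add: G_def F_def)
qed

end

section \<open>A length-area estimate\<close>

text \<open>The translates of the discs by the first \<open>N\<close> multiples of
  \<open>tpi\<close> are disjoint and lie in a box of height \<open>2 * M + 2 * pi * N\<close>. The
  excess \<open>2 * M\<close> becomes negligible for large \<open>N\<close>.\<close>

lemma disc_area:
 fixes b :: "'q \<Rightarrow> complex" and r :: "'q \<Rightarrow> real"
 assumes F: "finite F" and r: "\<And>q. q \<in> F \<Longrightarrow> 0 \<le> r q" and AB: "A \<le> B"
  and strip: "\<And>q z. q \<in> F \<Longrightarrow> z \<in> ball (b q) (r q) \<Longrightarrow> A \<le> Re z \<and> Re z \<le> B"
  and disj: "\<And>q q' z z' n. q \<in> F \<Longrightarrow> q' \<in> F \<Longrightarrow> z \<in> ball (b q) (r q) \<Longrightarrow> z' \<in> ball (b q') (r q') \<Longrightarrow>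
   z = z' + of_int n * tpi \<Longrightarrow> q = q' \<and> n = 0"
 shows "(\<Sum>q\<in>F. pi * (r q)\<^sup>2) \<le> 2 * pi * (B - A)"
proof (rule ccontr)
 define s where "s = (\<Sum>q\<in>F. pi * (r q)\<^sup>2)"
 assume "\<not> ?thesis"
 hence gt: "0 < s - 2 * pi * (B - A)" by (simp add: s_def)
 have "bounded (\<Union>q\<in>F. ball (b q) (r q))" using F by (intro bounded_UN) auto
 then obtain M where M: "M > 0" "\<And>z. z \<in> (\<Union>q\<in>F. ball (b q) (r q)) \<Longrightarrow> norm z \<le> M" unfolding bounded_pos by blast
 have key: "real N * s \<le> (B - A) * (2 * M + 2 * pi * real N)" for N :: nat
 proof -
  define D where "D = (\<lambda>(q, j::nat). ball (b q + of_nat j * tpi) (r q))"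
  have Dm: "z \<in> D (q, j) \<longleftrightarrow> z - of_nat j * tpi \<in> ball (b q) (r q)" for z q j by (simp add: D_def dist_norm algebra_simps)
  have "measure lborel (\<Union>p\<in>F \<times> {..<N}. D p) = (\<Sum>p\<in>F \<times> {..<N}. measure lborel (D p))"
  proof (rule measure_finite_Union)
   show "disjoint_family_on D (F \<times> {..<N})" unfolding disjoint_family_on_def
   proof (intro ballI impI)
    fix p p' assume pp: "p \<in> F \<times> {..<N}" "p' \<in> F \<times> {..<N}" "p \<noteq> p'"
    obtain q j q' j' where p: "p = (q, j)" "p' = (q', j')" by fastforce
    show "D p \<inter> D p' = {}"
    proof (rule ccontr)
     assume "D p \<inter> D p' \<noteq> {}"
     then obtain z where z: "z - of_nat j * tpi \<in> ball (b q) (r q)" "z - of_nat j' * tpi \<in> ball (b q') (r q')" using p Dm by blast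
     have "z - of_nat j * tpi = z - of_nat j' * tpi + of_int (int j' - int j) * tpi" by (simp add: algebra_simps)
     moreover have "q \<in> F" "q' \<in> F" using pp p by auto
     ultimately have "q = q' \<and> int j' - int j = 0" using disj[OF _ _ z] by blast
     thus False using pp p by simp
    qed
   qed
   show "emeasure lborel (D p) \<noteq> \<infinity>" for p using emeasure_bounded_finite[of "D p"] by (auto simp: D_def split: prod.splits)
  qed (use F in \<open>auto simp: D_def\<close>)
  also have "\<dots> = (\<Sum>p\<in>F \<times> {..<N}. pi * (r (fst p))\<^sup>2)"
   by (rule sum.cong) (use r in \<open>auto simp: D_def content_ball unit_ball_vol_2 numeral_2_eq_2[symmetric]\<close>)
  also have "\<dots> = (\<Sum>q\<in>F. \<Sum>j<N. pi * (r q)\<^sup>2)" unfolding sum.cartesian_product by (intro sum.cong) auto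
  also have "\<dots> = real N * s" by (simp add: s_def sum_distrib_left)
  finally have 1: "measure lborel (\<Union>p\<in>F \<times> {..<N}. D p) = real N * s" .
  have sub: "(\<Union>p\<in>F \<times> {..<N}. D p) \<subseteq> cbox (Complex A (- M)) (Complex B (M + 2 * pi * real N))"
  proof
   fix z assume "z \<in> (\<Union>p\<in>F \<times> {..<N}. D p)"
   then obtain q j where q: "q \<in> F" "j < N" "z - of_nat j * tpi \<in> ball (b q) (r q)" using Dm by fastforce
   have 1: "A \<le> Re z \<and> Re z \<le> B" using strip[OF q(1,3)] by simp
   have "norm (z - of_nat j * tpi) \<le> M" using q by (intro M(2)) blast
   hence 2: "\<bar>Im z - 2 * pi * real j\<bar> \<le> M" using abs_Im_le_cmod[of "z - of_nat j * tpi"] by (simp add: mult.commute)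
   have "0 \<le> 2 * pi * real j" by simp
   moreover have "2 * pi * real j \<le> 2 * pi * real N" using q(2) by (intro mult_left_mono) auto
   ultimately have "- M \<le> Im z \<and> Im z \<le> M + 2 * pi * real N" using 2 by linarith
   thus "z \<in> cbox (Complex A (- M)) (Complex B (M + 2 * pi * real N))" using 1 by (simp add: in_cbox_complex_iff)
  qed
  have "measure lborel (\<Union>p\<in>F \<times> {..<N}. D p) \<le> measure lborel (cbox (Complex A (- M)) (Complex B (M + 2 * pi * real N)))"
   by (rule measure_mono_fmeasurable[OF sub]) (auto simp: D_def F intro!: borel_open)
  also have "\<dots> = (B - A) * (2 * M + 2 * pi * real N)" using AB M(1) by (subst content_cbox) (auto simp: Basis_complex_def inner_complex_def)
  finally show ?thesis using 1 by simp
 qed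
 obtain N :: nat where N: "(B - A) * (2 * M) < real N * (s - 2 * pi * (B - A))" using reals_Archimedean3[OF gt] by blast
 thus False using key[of N] by (simp add: algebra_simps)
qed

text \<open>For \<open>x \<le> y\<close>, take the first time at level \<open>B\<close> and the last
  time at level \<open>A\<close> before it: in between, the function cannot leave the range.
  Reversing time gives the other order.\<close>

lemma crossing_interval:
 fixes d :: "real \<Rightarrow> real"
 assumes c: "continuous_on {-T..T} d" and xy: "x \<in> {-T..T}" "y \<in> {-T..T}" and A: "A \<le> d x" and B: "d y \<le> B" and AB: "B < A"
 obtains lo hi where "-T \<le> lo" "lo \<le> hi" "hi \<le> T" "\<bar>d lo - d hi\<bar> = A - B" "\<And>t. lo \<le> t \<Longrightarrow> t \<le> hi \<Longrightarrow> B \<le> d t \<and> d t \<le> A"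
proof -
 have main: "\<exists>lo hi. -T \<le> lo \<and> lo \<le> hi \<and> hi \<le> T \<and> d lo = A \<and> d hi = B \<and> (\<forall>t. lo \<le> t \<longrightarrow> t \<le> hi \<longrightarrow> B \<le> d t \<and> d t \<le> A)"
  if c: "continuous_on {-T..T} d" and xy: "x \<in> {-T..T}" "y \<in> {-T..T}" "x \<le> y" and A: "A \<le> d x" and B: "d y \<le> B"
  for d :: "real \<Rightarrow> real" and x y
 proof -
  have cxy: "continuous_on {x..y} d" using c xy by (auto intro: continuous_on_subset)
  have lev: "compact {t\<in>{u..v}. d t = c}" if "{u..v} \<subseteq> {x..y}" for u v c
  proof -
   have "continuous_on {u..v} d" using cxy that by (rule continuous_on_subset)
   hence "closed {t\<in>{u..v}. d t = c}" by (rule continuous_closed_preimage_constant) simp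
   moreover have "{t\<in>{u..v}. d t = c} \<subseteq> {u..v}" by auto
   ultimately show ?thesis using compact_Int_closed[of "{u..v}" "{t\<in>{u..v}. d t = c}"] by (simp add: Int_absorb1)
  qed
  have ne: "{t\<in>{x..y}. d t = B} \<noteq> {}" using IVT2'[of d y B x] A B AB xy cxy by fastforce
  obtain hi where hi: "hi \<in> {t\<in>{x..y}. d t = B}" "\<And>t. t \<in> {t\<in>{x..y}. d t = B} \<Longrightarrow> hi \<le> t"
   using compact_attains_inf[OF lev[OF order_refl] ne] by blast
  have ne2: "{t\<in>{x..hi}. d t = A} \<noteq> {}"
  proof -
   have "continuous_on {x..hi} d" by (rule continuous_on_subset[OF cxy]) (use hi in auto)
   thus ?thesis using IVT2'[of d hi A x] A AB hi(1) by fastforce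
  qed
  have "{x..hi} \<subseteq> {x..y}" using hi by auto
  then obtain lo where lo: "lo \<in> {t\<in>{x..hi}. d t = A}" "\<And>t. t \<in> {t\<in>{x..hi}. d t = A} \<Longrightarrow> t \<le> lo"
   using compact_attains_sup[OF lev ne2] by blast
  have "B \<le> d t \<and> d t \<le> A" if t: "lo \<le> t" "t \<le> hi" for t
  proof (rule ccontr)
   assume "\<not> ?thesis"
   then consider "d t < B" | "A < d t" by linarith
   thus False
   proof cases
    case 1
    have "continuous_on {lo..t} d" by (rule continuous_on_subset[OF cxy]) (use lo hi t in auto)
    then obtain u where "lo \<le> u" "u \<le> t" "d u = B" using IVT2'[of d t B lo] 1 lo(1) t AB by auto
    moreover from this have "u \<noteq> t" using 1 by auto
    ultimately show False using hi(2)[of u] lo(1) hi(1) t by auto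
   next
    case 2
    have "continuous_on {t..hi} d" by (rule continuous_on_subset[OF cxy]) (use lo hi t in auto)
    then obtain u where u: "t \<le> u" "u \<le> hi" "d u = A" using IVT2'[of d hi A t] 2 hi(1) t AB by auto
    have "u \<noteq> t" using 2 u by auto
    thus False using lo(2)[of u] lo(1) u t by auto
   qed
  qed
  thus ?thesis using lo(1) hi(1) xy by (intro exI[of _ lo] exI[of _ hi]) auto
 qed
 show ?thesis
 proof (cases "x \<le> y")
  case True
  obtain lo hi where "-T \<le> lo" "lo \<le> hi" "hi \<le> T" "d lo = A" "d hi = B" "\<forall>t. lo \<le> t \<longrightarrow> t \<le> hi \<longrightarrow> B \<le> d t \<and> d t \<le> A"
   using main[OF c xy True A B] by blast
  thus ?thesis using that[of lo hi] AB by auto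
 next
  case False
  have c': "continuous_on {-T..T} (\<lambda>t. d (- t))" by (rule continuous_on_compose2[OF c]) (auto intro!: continuous_intros)
  obtain lo hi where lh: "-T \<le> lo" "lo \<le> hi" "hi \<le> T" "d (-lo) = A" "d (-hi) = B" "\<forall>t. lo \<le> t \<longrightarrow> t \<le> hi \<longrightarrow> B \<le> d (-t) \<and> d (-t) \<le> A"
   using main[OF c', of "-x" "-y"] xy False A B by auto
  have "B \<le> d t \<and> d t \<le> A" if "-hi \<le> t" "t \<le> -lo" for t using lh(6)[rule_format, of "-t"] that by simp
  thus ?thesis using that[of "-hi" "-lo"] lh AB by auto
 qed
qed

text \<open>The sum is restricted to cells that overlap the interval. In \<open>length_area\<close>
  these are the cells on which \<open>Re k\<close> is close to the values between \<open>B\<close>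
  and \<open>A\<close>, so that only their area has to be counted.\<close>

lemma grid_variation:
 fixes d :: "real \<Rightarrow> real"
 assumes n: "0 < n" and lh: "lo \<le> hi" "\<bar>lo\<bar> \<le> real m / real n" "\<bar>hi\<bar> \<le> real m / real n"
  and g: "g = (\<lambda>t::nat. (real t - real m) / real n)"
  and M: "\<And>t x y. t < 2 * m \<Longrightarrow> g t \<le> x \<Longrightarrow> x < y \<Longrightarrow> y \<le> g (Suc t) \<Longrightarrow> lo \<le> x \<Longrightarrow> y \<le> hi \<Longrightarrow> \<bar>d x - d y\<bar> \<le> M t"
  and M0: "\<And>t. 0 \<le> M t"
 shows "\<bar>d lo - d hi\<bar> \<le> (\<Sum>t\<in>{t. t < 2 * m \<and> lo < g (Suc t) \<and> g t < hi}. M t)"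
proof -
 define x where "x = (\<lambda>t. max lo (min hi (g t)))"
 have n': "0 < real n" using n by simp
 have gm: "g t < g (Suc t)" for t using n' by (simp add: g divide_strict_right_mono)
 have "g 0 = - (real m / real n)" "g (2 * m) = real m / real n" by (auto simp: g)
 hence x0: "x 0 = lo" "x (2 * m) = hi" using lh by (auto simp: x_def)
 have "\<bar>d lo - d hi\<bar> = \<bar>\<Sum>t<2*m. d (x t) - d (x (Suc t))\<bar>"
  using x0 sum_lessThan_telescope'[of "\<lambda>t. d (x t)" "2 * m"] by simp
 also have "\<dots> \<le> (\<Sum>t<2*m. \<bar>d (x t) - d (x (Suc t))\<bar>)" by (rule sum_abs)
 also have "\<dots> = (\<Sum>t\<in>{t. t < 2 * m \<and> lo < g (Suc t) \<and> g t < hi}. \<bar>d (x t) - d (x (Suc t))\<bar>)"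
 proof (rule sum.mono_neutral_right)
  show "\<forall>t\<in>{..<2*m} - {t. t < 2 * m \<and> lo < g (Suc t) \<and> g t < hi}. \<bar>d (x t) - d (x (Suc t))\<bar> = 0"
  proof
   fix t assume "t \<in> {..<2*m} - {t. t < 2 * m \<and> lo < g (Suc t) \<and> g t < hi}"
   hence "g (Suc t) \<le> lo \<or> hi \<le> g t" by auto
   hence "x t = x (Suc t)" using gm[of t] lh(1) by (auto simp: x_def)
   thus "\<bar>d (x t) - d (x (Suc t))\<bar> = 0" by simp
  qed
 qed auto
 also have "\<dots> \<le> (\<Sum>t\<in>{t. t < 2 * m \<and> lo < g (Suc t) \<and> g t < hi}. M t)"
 proof (rule sum_mono)
  fix t assume t: "t \<in> {t. t < 2 * m \<and> lo < g (Suc t) \<and> g t < hi}"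
  hence xt: "x t = max lo (g t)" "x (Suc t) = min hi (g (Suc t))" using lh(1) by (auto simp: x_def)
  show "\<bar>d (x t) - d (x (Suc t))\<bar> \<le> M t"
  proof (cases "x t < x (Suc t)")
   case True
   show ?thesis by (rule M[of t]) (use t True xt in auto)
  next
   case False
   hence "lo = hi" using xt t gm[of t] lh(1) by (auto simp: max_def min_def split: if_splits)
   hence "x t = x (Suc t)" by (simp add: x_def)
   thus ?thesis using M0 by simp
  qed
 qed
 finally show ?thesis .
qed

text \<open>The classical comparison of length and area, on a grid of cells of width
  \<open>1 / n\<close> on which \<open>deriv k\<close> varies little. Each of \<open>n\<close>
  vertical lines crosses the range from \<open>A\<close> to \<open>B\<close>, which bounds the sum
  of \<open>norm (deriv k)\<close> over the cells from below. Bloch's theorem gives discs, disjoint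
  modulo \<open>tpi\<close>, in a strip of width \<open>A - B + 2\<close>; this bounds the sum of
  the squares from above.\<close>

lemma length_area:
 fixes k :: "complex \<Rightarrow> complex"
 assumes D: "open D" "k holomorphic_on D" and T: "0 < T" "T \<le> 2"
  and box: "cbox (Complex 0 (-T)) (Complex 1 T) \<subseteq> D"
  and inj: "\<And>z z' n. z \<in> D \<Longrightarrow> z' \<in> D \<Longrightarrow> k z = k z' + of_int n * tpi \<Longrightarrow> z = z' \<and> n = 0"
  and hi: "\<And>u. 0 \<le> u \<Longrightarrow> u \<le> 1 \<Longrightarrow> A \<le> Re (k (Complex u 0))"
  and lo: "\<And>u. 0 \<le> u \<Longrightarrow> u \<le> 1 \<Longrightarrow> \<exists>l. \<bar>l\<bar> \<le> T \<and> Re (k (Complex u l)) \<le> B"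
 shows "A - B \<le> 8000"
proof (rule ccontr)
 assume "\<not> ?thesis"
 hence AB: "8000 < A - B" by simp
 let ?K = "cbox (Complex 0 (-T)) (Complex 1 T)"
 have dh: "deriv k holomorphic_on D" using D by (intro holomorphic_deriv)
 obtain e where e: "e > 0" "(\<Union>x\<in>?K. cball x e) \<subseteq> D"
 proof -
  obtain e where "e > 0" "(\<Union>x\<in>?K. ball x e) \<subseteq> D"
   using compact_subset_open_imp_ball_epsilon_subset[OF compact_cbox D(1) box] by blast
  thus ?thesis by (intro that[of "e/2"]) force+
 qed
 define KK where "KK = (\<Union>x\<in>?K. cball x e)"
 have "compact KK"
 proof -
  have "KK = {x + y | x y. x \<in> ?K \<and> y \<in> cball 0 e}"
  proof safe
   fix w assume "w \<in> KK"
   then obtain x where "x \<in> ?K" "w \<in> cball x e" by (auto simp: KK_def)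
   thus "\<exists>x y. w = x + y \<and> x \<in> ?K \<and> y \<in> cball 0 e"
    by (intro exI[of _ x] exI[of _ "w - x"]) (auto simp: dist_norm norm_minus_commute)
  next
   fix x y :: complex assume "x \<in> ?K" "y \<in> cball 0 e"
   thus "x + y \<in> KK" by (auto simp: KK_def dist_norm intro!: bexI[of _ x])
  qed
  thus ?thesis using compact_sums[OF compact_cbox[of "Complex 0 (-T)" "Complex 1 T"] compact_cball[of 0 e]] by simp
 qed
 moreover have "continuous_on KK (deriv k)" using holomorphic_on_imp_continuous_on[OF dh] e(2) by (auto simp: KK_def intro: continuous_on_subset)
 ultimately have uc: "uniformly_continuous_on KK (deriv k)" and bd: "bounded (deriv k ` KK)"
  using compact_uniformly_continuous compact_imp_bounded compact_continuous_image by blast+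
 obtain M where M: "M > 0" "\<And>x. x \<in> KK \<Longrightarrow> norm (deriv k x) \<le> M" using bd unfolding bounded_pos by auto
 obtain d where d: "d > 0" "\<And>x x'. x \<in> KK \<Longrightarrow> x' \<in> KK \<Longrightarrow> dist x' x < d \<Longrightarrow> dist (deriv k x') (deriv k x) < 1"
  using uc unfolding uniformly_continuous_on_def by (metis zero_less_one)
 \<comment> \<open>The four terms ensure that the discs of the grid lie in \<open>KK\<close>, that
   \<open>deriv k\<close> varies by less than 1 on each of them, that \<open>k\<close> moves by at
   most 1 there, and that \<open>2 * m\<close> is at most \<open>5 * n\<close>.\<close>
 obtain n :: nat where n: "max (max (2/e) (2/d)) (max (2 * (M + 1)) 2) < real n" using reals_Archimedean2 by blast
 have n': "2 / e < real n" "2 / d < real n" "2 * (M + 1) < real n" "2 < real n" using n by auto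
 have n0: "0 < real n" "0 < n" using n'(4) by auto
 have ne: "2 / real n < e" "2 / real n < d" using n' e(1) d(1) n0 by (auto simp: field_simps)
 define m where "m = nat \<lceil>T * real n\<rceil>"
 have m: "T * real n \<le> real m" "real m < T * real n + 1" using T n0 by (auto simp: m_def) linarith+
 have Tm: "T \<le> real m / real n" using m(1) n0 by (simp add: field_simps)
 have mT: "real m / real n < T + 1 / real n" using m(2) n0 by (simp add: field_simps)
 define g where "g = (\<lambda>t::nat. (real t - real m) / real n)"
 define us where "us = (\<lambda>i::nat. (real i + 1/2) / real n)"
 define c where "c = (\<lambda>(i, t). Complex (us i) (g t + 1 / (2 * real n)))"
 have us01: "0 < us i" "us i < 1" if "i < n" for i using that n0 by (auto simp: us_def field_simps)
 have gS: "g (Suc t) = g t + 1 / real n" for t by (simp add: g_def add_divide_distrib diff_divide_distrib)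
 have grange: "- (T + 1 / real n) \<le> g t" "g (Suc t) \<le> T + 1 / real n" if "t < 2 * m" for t
 proof -
  have "- (real m / real n) \<le> g t" unfolding g_def using n0 by (simp add: field_simps)
  thus "- (T + 1 / real n) \<le> g t" using mT by linarith
  have "g (Suc t) \<le> real m / real n" unfolding g_def using n0 that by (intro divide_right_mono) auto
  thus "g (Suc t) \<le> T + 1 / real n" using mT by linarith
 qed
 have cD: "cball (c (i, t)) (1 / (2 * real n)) \<subseteq> KK" if it: "i < n" "t < 2 * m" for i t
 proof
  fix w assume w: "w \<in> cball (c (i, t)) (1 / (2 * real n))"
  define s where "s = max (-T) (min T (g t + 1 / (2 * real n)))"
  have h: "1 / (2 * real n) = (1 / real n) / 2" "0 < 1 / real n" using n0 by auto
  have "g t + 1 / (2 * real n) \<le> T + 1 / real n" "- T - 1 / real n \<le> g t + 1 / (2 * real n)" using grange[OF it(2)] gS[of t] h by linarith+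
  hence "\<bar>s - (g t + 1 / (2 * real n))\<bar> \<le> 1 / real n" using T(1) h(2) unfolding s_def by linarith
  moreover have "c (i, t) - Complex (us i) s = \<i> * of_real (g t + 1 / (2 * real n) - s)" by (simp add: c_def complex_eq_iff)
  hence "dist (c (i, t)) (Complex (us i) s) = \<bar>g t + 1 / (2 * real n) - s\<bar>" unfolding dist_norm by (simp add: norm_mult del: of_real_diff of_real_add)
  ultimately have "dist (c (i, t)) (Complex (us i) s) \<le> 1 / real n" by (simp add: abs_minus_commute)
  hence "dist (Complex (us i) s) w \<le> 1 / real n + 1 / (2 * real n)"
   using w dist_triangle[of "Complex (us i) s" w "c (i, t)"] by (simp add: dist_commute)
  also have "\<dots> \<le> 2 / real n" using n0 by (simp add: field_simps)
  finally have "w \<in> cball (Complex (us i) s) e" using ne by simp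
  moreover have "Complex (us i) s \<in> ?K" using us01[OF it(1)] T(1) by (auto simp: in_cbox_complex_iff s_def)
  ultimately show "w \<in> KK" unfolding KK_def by blast
 qed
 have kd: "(k has_field_derivative deriv k w) (at w)" if "w \<in> KK" for w
  by (rule holomorphic_derivI[OF D(2) D(1) subsetD[OF e(2)[folded KK_def] that]])
 have cc: "c q \<in> cball (c q) (1 / (2 * real n))" for q using n0 by simp
 have kvar: "norm (k w - k w') \<le> (norm (deriv k (c (i, t))) + 1) * norm (w - w')"
  if it: "i < n" "t < 2 * m" and w: "w \<in> cball (c (i, t)) (1 / (2 * real n))" "w' \<in> cball (c (i, t)) (1 / (2 * real n))" for i t w w'
 proof (rule field_differentiable_bound[where S="cball (c (i, t)) (1 / (2 * real n))" and f'="deriv k"])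
  fix z assume z: "z \<in> cball (c (i, t)) (1 / (2 * real n))"
  have zK: "z \<in> KK" "c (i, t) \<in> KK" using cD[OF it] z cc by blast+
  show "(k has_field_derivative deriv k z) (at z within cball (c (i, t)) (1 / (2 * real n)))" by (rule has_field_derivative_at_within[OF kd[OF zK(1)]])
  have "1 / (2 * real n) \<le> 2 / real n" using n0 by (simp add: field_simps)
  hence "dist z (c (i, t)) < d" using z ne by (simp add: dist_commute)
  hence "norm (deriv k z - deriv k (c (i, t))) < 1" using d(2)[OF zK(2) zK(1)] by (simp add: dist_norm)
  thus "norm (deriv k z) \<le> norm (deriv k (c (i, t))) + 1" using norm_triangle_sub[of "deriv k z" "deriv k (c (i, t))"] by linarith
 qed (use w in auto)
 define b where "b = (\<lambda>i l. Re (k (Complex (us i) l)))"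
 have lh_ex: "\<exists>lo hi. -T \<le> lo \<and> lo \<le> hi \<and> hi \<le> T \<and> \<bar>b i lo - b i hi\<bar> = A - B \<and> (\<forall>t. lo \<le> t \<longrightarrow> t \<le> hi \<longrightarrow> B \<le> b i t \<and> b i t \<le> A)"
  if i: "i < n" for i
 proof -
  have "continuous_on {-T..T} (\<lambda>l. Complex (us i) l)" by (intro continuous_intros)
  moreover have "(\<lambda>l. Complex (us i) l) ` {-T..T} \<subseteq> D"
   using us01[OF i] by (intro image_subsetI subsetD[OF box]) (auto simp: in_cbox_complex_iff)
  ultimately have "continuous_on {-T..T} (\<lambda>l. k (Complex (us i) l))"
   by (rule continuous_on_compose2[OF holomorphic_on_imp_continuous_on[OF D(2)]])
  hence cb: "continuous_on {-T..T} (b i)" unfolding b_def by (rule continuous_on_Re)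
  obtain l where th: "\<bar>l\<bar> \<le> T" "b i l \<le> B" using lo[of "us i"] us01[OF i] by (auto simp: b_def)
  have "A \<le> b i 0" using hi[of "us i"] us01[OF i] by (simp add: b_def)
  moreover have "0 \<in> {-T..T}" "l \<in> {-T..T}" "B < A" using th T AB by (auto simp: abs_le_iff)
  ultimately obtain lo hi where "-T \<le> lo" "lo \<le> hi" "hi \<le> T" "\<bar>b i lo - b i hi\<bar> = A - B"
   and lhB: "\<And>t. lo \<le> t \<Longrightarrow> t \<le> hi \<Longrightarrow> B \<le> b i t \<and> b i t \<le> A"
   using crossing_interval[OF cb _ _ _ th(2)] by metis
  thus ?thesis by (intro exI[of _ lo] exI[of _ hi]) simp
 qed
 define lo' where "lo' = (\<lambda>i. SOME lo. \<exists>hi. -T \<le> lo \<and> lo \<le> hi \<and> hi \<le> T \<and> \<bar>b i lo - b i hi\<bar> = A - B \<and> (\<forall>t. lo \<le> t \<longrightarrow> t \<le> hi \<longrightarrow> B \<le> b i t \<and> b i t \<le> A))"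
 define hi' where "hi' = (\<lambda>i. SOME hi. -T \<le> lo' i \<and> lo' i \<le> hi \<and> hi \<le> T \<and> \<bar>b i (lo' i) - b i hi\<bar> = A - B \<and> (\<forall>t. lo' i \<le> t \<longrightarrow> t \<le> hi \<longrightarrow> B \<le> b i t \<and> b i t \<le> A))"
 have lh: "-T \<le> lo' i \<and> lo' i \<le> hi' i \<and> hi' i \<le> T \<and> \<bar>b i (lo' i) - b i (hi' i)\<bar> = A - B \<and> (\<forall>t. lo' i \<le> t \<longrightarrow> t \<le> hi' i \<longrightarrow> B \<le> b i t \<and> b i t \<le> A)"
  if i: "i < n" for i unfolding hi'_def by (rule someI_ex) (unfold lo'_def, rule someI_ex, rule lh_ex[OF i])
 define J where "J = (\<lambda>i. {t. t < 2 * m \<and> lo' i < g (Suc t) \<and> g t < hi' i})"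
 have var: "A - B \<le> (\<Sum>t\<in>J i. (norm (deriv k (c (i, t))) + 1) / real n)" if i: "i < n" for i
 proof -
  have "\<bar>b i (lo' i) - b i (hi' i)\<bar> \<le> (\<Sum>t\<in>{t. t < 2 * m \<and> lo' i < g (Suc t) \<and> g t < hi' i}. (norm (deriv k (c (i, t))) + 1) / real n)"
  proof (rule grid_variation[OF n0(2)])
   fix t x y assume t: "t < 2 * m" and xy: "g t \<le> x" "x < y" "y \<le> g (Suc t)"
   have w: "Complex (us i) v \<in> cball (c (i, t)) (1 / (2 * real n))" if "g t \<le> v" "v \<le> g (Suc t)" for v
   proof -
    have "c (i, t) - Complex (us i) v = \<i> * of_real (g t + 1 / (2 * real n) - v)" by (simp add: c_def complex_eq_iff)
    hence "dist (c (i, t)) (Complex (us i) v) = \<bar>g t + 1 / (2 * real n) - v\<bar>" unfolding dist_norm by (simp add: norm_mult del: of_real_diff of_real_add)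
    also have "\<dots> \<le> 1 / (2 * real n)"
    proof -
     have h: "1 / (2 * real n) = (1 / real n) / 2" using n0 by auto
     show ?thesis using that gS[of t] h by (simp add: abs_le_iff)
    qed
    finally show ?thesis by simp
   qed
   have "\<bar>b i x - b i y\<bar> \<le> norm (k (Complex (us i) x) - k (Complex (us i) y))"
    using abs_Re_le_cmod[of "k (Complex (us i) x) - k (Complex (us i) y)"] by (simp add: b_def)
   also have "\<dots> \<le> (norm (deriv k (c (i, t))) + 1) * norm (Complex (us i) x - Complex (us i) y)" by (rule kvar[OF i t]) (use w xy in auto)
   also have "norm (Complex (us i) x - Complex (us i) y) = y - x"
   proof -
    have "Complex (us i) x - Complex (us i) y = \<i> * of_real (x - y)" by (simp add: complex_eq_iff)
    thus ?thesis using xy by (simp add: norm_mult del: of_real_diff)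
   qed
   also have "(norm (deriv k (c (i, t))) + 1) * (y - x) \<le> (norm (deriv k (c (i, t))) + 1) * (1 / real n)"
    using xy gS[of t] by (intro mult_left_mono) auto
   finally show "\<bar>b i x - b i y\<bar> \<le> (norm (deriv k (c (i, t))) + 1) / real n" by simp
  qed (use lh[OF i] T Tm in \<open>auto simp: g_def\<close>)
  thus ?thesis using lh[OF i] by (simp add: J_def)
 qed
 have finJ: "finite (J i)" "card (J i) \<le> 2 * m" for i
 proof -
  have "J i \<subseteq> {..<2*m}" by (auto simp: J_def)
  thus "finite (J i)" "card (J i) \<le> 2 * m" using finite_subset card_mono[of "{..<2*m}" "J i"] by auto
 qed
 define F where "F = Sigma {..<n} J"
 have finF: "finite F" using finJ by (auto simp: F_def)
 \<comment> \<open>A cell of \<open>F\<close> meets one of the crossings, where \<open>Re k\<close>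
   is between \<open>B\<close> and \<open>A\<close>; within the disc it changes by at most
   1.\<close>
 have cwin: "B - 1 \<le> Re (k w) \<and> Re (k w) \<le> A + 1" if q: "(i, t) \<in> F" and w: "w \<in> ball (c (i, t)) (1 / (2 * real n))" for i t w
 proof -
  have it: "i < n" "t < 2 * m" "t \<in> J i" using q by (auto simp: F_def J_def)
  define x where "x = max (lo' i) (g t)"
  have h: "1 / (2 * real n) = (1 / real n) / 2" "0 < 1 / real n" using n0 by auto
  have x: "g t \<le> x" "x \<le> g (Suc t)" "lo' i \<le> x" "x \<le> hi' i" using it lh[OF it(1)] gS[of t] h by (auto simp: x_def J_def)
  have bx: "B \<le> b i x" "b i x \<le> A" using lh[OF it(1)] x by auto
  have "c (i, t) - Complex (us i) x = \<i> * of_real (g t + 1 / (2 * real n) - x)" by (simp add: c_def complex_eq_iff)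
  hence "dist (c (i, t)) (Complex (us i) x) = \<bar>g t + 1 / (2 * real n) - x\<bar>" unfolding dist_norm by (simp add: norm_mult del: of_real_diff of_real_add)
  also have "\<dots> \<le> 1 / (2 * real n)" using x(1,2) gS[of t] h by (simp add: abs_le_iff)
  finally have xc: "Complex (us i) x \<in> cball (c (i, t)) (1 / (2 * real n))" by simp
  have "norm (k w - k (Complex (us i) x)) \<le> (norm (deriv k (c (i, t))) + 1) * norm (w - Complex (us i) x)"
   by (rule kvar[OF it(1,2)]) (use w xc in auto)
  also have "\<dots> \<le> (M + 1) * (1 / real n)"
  proof (intro mult_mono)
   show "norm (deriv k (c (i, t))) + 1 \<le> M + 1" using M(2)[OF subsetD[OF cD[OF it(1,2)] cc]] by simp
   have "dist w (Complex (us i) x) \<le> 1 / (2 * real n) + 1 / (2 * real n)"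
    using w xc dist_triangle[of w "Complex (us i) x" "c (i, t)"] by (simp add: dist_commute)
   thus "norm (w - Complex (us i) x) \<le> 1 / real n" using h by (simp add: dist_norm)
  qed (use M in auto)
  also have "\<dots> \<le> 1" using n' M by (simp add: field_simps)
  finally have "\<bar>Re (k w) - b i x\<bar> \<le> 1" using abs_Re_le_cmod[of "k w - k (Complex (us i) x)"] by (simp add: b_def)
  thus ?thesis using bx by linarith
 qed
 \<comment> \<open>Bloch's radius for the disc of radius \<open>1 / (2 * n)\<close> around
   \<open>c q\<close>.\<close>
 define r where "r = (\<lambda>q. 1 / (2 * real n) * norm (deriv k (c q)) / 12)"
 have "\<exists>z. ball z (r q) \<subseteq> k ` ball (c q) (1 / (2 * real n))" if q: "q \<in> F" for q
 proof -
  have "ball (c q) (1 / (2 * real n)) \<subseteq> D" using cD[of "fst q" "snd q"] q e(2) ball_subset_cball by (fastforce simp: F_def J_def KK_def)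
  hence "k holomorphic_on ball (c q) (1 / (2 * real n))" using D(2) by (rule holomorphic_on_subset[rotated])
  moreover have "0 < 1 / (2 * real n)" using n0 by simp
  ultimately obtain y where "ball y (1 / (2 * real n) * norm (deriv k (c q)) / 12) \<subseteq> k ` ball (c q) (1 / (2 * real n))"
   by (rule Bloch[OF _ _ order_refl])
  thus ?thesis unfolding r_def by (rule exI)
 qed
 then obtain z where z: "\<And>q. q \<in> F \<Longrightarrow> ball (z q) (r q) \<subseteq> k ` ball (c q) (1 / (2 * real n))" by metis
 have "(\<Sum>q\<in>F. pi * (r q)\<^sup>2) \<le> 2 * pi * ((A + 1) - (B - 1))"
 proof (rule disc_area[OF finF])
  show "0 \<le> r q" for q by (simp add: r_def)
  show "B - 1 \<le> A + 1" using AB by simp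
  show "B - 1 \<le> Re y \<and> Re y \<le> A + 1" if "q \<in> F" "y \<in> ball (z q) (r q)" for q y
   using z[OF that(1)] that cwin[of "fst q" "snd q"] by fastforce
  fix q q' y y' N assume qq: "q \<in> F" "q' \<in> F" and y: "y \<in> ball (z q) (r q)" "y' \<in> ball (z q') (r q')" "y = y' + of_int N * tpi"
  obtain w where w: "w \<in> ball (c q) (1 / (2 * real n))" "y = k w" using z[OF qq(1)] y(1) by blast
  obtain w' where w': "w' \<in> ball (c q') (1 / (2 * real n))" "y' = k w'" using z[OF qq(2)] y(2) by blast
  have sub: "ball (c p) (1 / (2 * real n)) \<subseteq> D" if "p \<in> F" for p
   using cD[of "fst p" "snd p"] that e(2) ball_subset_cball by (fastforce simp: F_def J_def KK_def)
  have ww: "w = w' \<and> N = 0" using inj[of w w' N] sub[OF qq(1)] sub[OF qq(2)] w w' y(3) by blast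
  have "dist (c q) (c q') < 1 / real n"
  proof -
   have "dist (c q) (c q') \<le> dist (c q) w + dist (c q') w" using dist_triangle2 by blast
   also have "\<dots> < 1 / (2 * real n) + 1 / (2 * real n)" using w(1) w'(1) ww by (intro add_strict_mono) auto
   finally show ?thesis by simp
  qed
  moreover obtain i t i' t' where it: "q = (i, t)" "q' = (i', t')" by fastforce
  ultimately have dd: "\<bar>Re (c q - c q')\<bar> < 1 / real n" "\<bar>Im (c q - c q')\<bar> < 1 / real n"
   using abs_Re_le_cmod[of "c q - c q'"] abs_Im_le_cmod[of "c q - c q'"] by (auto simp: dist_norm simp del: minus_complex.sel)
  have "Re (c q - c q') = (real i - real i') / real n" "Im (c q - c q') = (real t - real t') / real n"
   using n0 by (auto simp: it c_def us_def g_def field_simps)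
  hence "\<bar>real i - real i'\<bar> < 1" "\<bar>real t - real t'\<bar> < 1" using dd n0 by (auto simp: abs_divide divide_less_cancel)
  hence "i = i'" "t = t'" by linarith+
  thus "q = q' \<and> N = 0" using ww it by simp
 qed
 hence area: "(\<Sum>q\<in>F. (norm (deriv k (c q)) / real n)\<^sup>2) \<le> 1152 * (A - B + 2)"
 proof -
  have "(\<Sum>q\<in>F. pi * (r q)\<^sup>2) = pi / 576 * (\<Sum>q\<in>F. (norm (deriv k (c q)) / real n)\<^sup>2)"
   unfolding sum_distrib_left by (rule sum.cong) (auto simp: r_def power2_eq_square field_simps)
  moreover assume "(\<Sum>q\<in>F. pi * (r q)\<^sup>2) \<le> 2 * pi * ((A + 1) - (B - 1))"
  ultimately have "pi * ((\<Sum>q\<in>F. (norm (deriv k (c q)) / real n)\<^sup>2) / 576) \<le> pi * (2 * (A - B + 2))" by (simp add: algebra_simps)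
  hence "(\<Sum>q\<in>F. (norm (deriv k (c q)) / real n)\<^sup>2) / 576 \<le> 2 * (A - B + 2)" by (rule mult_left_le_imp_le) simp
  thus ?thesis by simp
 qed
 have "real n * (A - B) = (\<Sum>i<n. A - B)" by simp
 also have "\<dots> \<le> (\<Sum>i<n. \<Sum>t\<in>J i. (norm (deriv k (c (i, t))) + 1) / real n)" by (intro sum_mono var) auto
 also have "\<dots> = (\<Sum>q\<in>F. (norm (deriv k (c q)) + 1) / real n)"
  unfolding F_def by (subst sum.Sigma) (use finJ in \<open>auto simp: split_beta\<close>)
 \<comment> \<open>4608 is four times the 1152 of \<open>area\<close>, so only a quarter of
   \<open>A - B\<close> comes back on the right-hand side. Completing the square at 2304 = 4608 / 2
   costs 2304^2 / 4608 = 1152; the remaining 1 is the variation of \<open>deriv k\<close>.\<close>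
 also have "\<dots> \<le> (\<Sum>q\<in>F. real n * ((norm (deriv k (c q)) / real n)\<^sup>2 / 4608) + 1153 / real n)"
 proof (rule sum_mono)
  fix q
  define X where "X = norm (deriv k (c q))"
  have "0 \<le> (X - 2304)\<^sup>2" by simp
  hence "X * 4608 \<le> X\<^sup>2 + 2304\<^sup>2" by (simp add: power2_diff)
  hence "X + 1 \<le> X\<^sup>2 / 4608 + 1153" by simp
  hence "(X + 1) / real n \<le> (X\<^sup>2 / 4608 + 1153) / real n" using n0 by (intro divide_right_mono) auto
  also have "\<dots> = real n * ((X / real n)\<^sup>2 / 4608) + 1153 / real n" using n0 by (simp add: field_simps power2_eq_square)
  finally show "(norm (deriv k (c q)) + 1) / real n \<le> real n * ((norm (deriv k (c q)) / real n)\<^sup>2 / 4608) + 1153 / real n"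
   by (simp add: X_def)
 qed
 also have "\<dots> = real n / 4608 * (\<Sum>q\<in>F. (norm (deriv k (c q)) / real n)\<^sup>2) + real (card F) * (1153 / real n)"
  by (simp add: sum.distrib sum_distrib_left)
 also have "\<dots> \<le> real n / 4608 * (1152 * (A - B + 2)) + (5 * real n * real n) * (1153 / real n)"
 proof (intro add_mono mult_left_mono mult_right_mono area)
  have "card F = (\<Sum>i<n. card (J i))" unfolding F_def using finJ by (intro card_SigmaI) auto
  also have "\<dots> \<le> (\<Sum>i<n. 2 * m)" by (intro sum_mono finJ)
  finally have "real (card F) \<le> real n * real (2 * m)" by (simp flip: of_nat_mult)
  also have "real (2 * m) \<le> 5 * real n"
  proof -
   have "T * real n \<le> 2 * real n" using T by (intro mult_right_mono) auto
   thus ?thesis using m(2) n'(4) by linarith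
  qed
  finally show "real (card F) \<le> 5 * real n * real n" using n0 by (simp add: mult_left_mono mult.commute)
 qed auto
 also have "\<dots> = real n * ((A - B + 2) / 4 + 5765)" using n0 by (simp add: field_simps)
 finally have "A - B \<le> (A - B + 2) / 4 + 5765" using n0 by simp
 hence "4 * (A - B) \<le> (A - B + 2) + 4 * 5765" by (simp add: field_simps)
 thus False using AB by (simp add: algebra_simps)
qed

section \<open>Coarse monotonicity along rays\<close>

context riemann begin

definition Pv :: "complex \<Rightarrow> complex" where "Pv = inv P"

lemma Pv_P [simp]: "Pv (P z) = z" by (simp add: Pv_def P_inj)
lemma P_Pv: "p \<in> range P \<Longrightarrow> P (Pv p) = p" by (simp add: Pv_def f_inv_into_f)
lemma left_range: "Re p < 0 \<Longrightarrow> p \<in> range P" by (simp add: range_P)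

lemma range_P_tpi: "p + of_int n * tpi \<in> range P \<longleftrightarrow> p \<in> range P"
proof -
 have 1: "p + of_int n * tpi \<in> range P" if pr: "p \<in> range P" for p n
 proof -
  obtain z where "p = P z" using pr by blast
  hence "p + of_int n * tpi = P (z + of_int n * tpi)" by (simp only: P_tpi)
  thus ?thesis by blast
 qed
 show ?thesis using 1[of p n] 1[of "p + of_int n * tpi" "-n"] by auto
qed

lemma Pv_tpi: assumes "p \<in> range P" shows "Pv (p + of_int n * tpi) = Pv p + of_int n * tpi"
proof -
 obtain z where z: "p = P z" using assms by blast
 hence "p + of_int n * tpi = P (z + of_int n * tpi)" by (simp only: P_tpi)
 thus ?thesis using z by (simp only: Pv_P)
qed

lemma range_P_open: "open (range P)" and Pv_cont: "continuous_on (range P) Pv"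
proof -
 obtain k where k: "homeomorphism UNIV (range P) P k" by (rule invariance_of_domain_homeomorphism[OF open_UNIV P_cont order_refl P_inj])
 have "k p = Pv p" if p: "p \<in> range P" for p using homeomorphism_apply1[OF k] p by auto
 thus "continuous_on (range P) Pv" using homeomorphism_cont2[OF k] by (simp cong: continuous_on_cong)
 show "open (range P)" by (rule invariance_of_domain[OF P_cont open_UNIV P_inj])
qed

lemma exp_Pv: assumes "Re p < 0" shows "exp (Pv p) = \<gamma> (exp p)"
proof -
 have P: "P (Pv p) = p" using assms by (intro P_Pv left_range)
 hence V: "exp (Pv p) \<in> V" using P_V[of "Pv p"] assms by simp
 have "rbar (exp (Pv p)) = exp p" using exp_P[of "Pv p"] P by simp
 thus ?thesis using gr[OF V] rbar_V[OF V] by simp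
qed

text \<open>\<open>Pv\<close> is a continuous logarithm of \<open>\<gamma> (exp p)\<close> on a half
  plane, so it differs from a holomorphic one by a constant.\<close>

lemma Pv_hol: "Pv holomorphic_on {p. Re p < 0}"
proof -
 let ?S = "{p. Re p < 0}"
 have e: "exp p \<in> ball 0 1" if "p \<in> ?S" for p using that by (simp add: norm_exp_eq_Re)
 have h1: "(\<lambda>p. \<gamma> (exp p)) holomorphic_on ?S"
  using holomorphic_on_compose_gen[OF _ gam, of exp ?S] e by (force simp: o_def intro: holomorphic_intros)
 have h2: "\<gamma> (exp p) \<noteq> 0" if "p \<in> ?S" for p using that exp_Pv[of p] by (metis exp_not_eq_zero mem_Collect_eq)
 have h3: "contractible ?S" by (intro convex_imp_contractible convex_halfspace_Re_lt)
 obtain G where G: "G holomorphic_on ?S" "\<And>p. p \<in> ?S \<Longrightarrow> \<gamma> (exp p) = exp (G p)"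
  by (rule contractible_imp_holomorphic_log[OF h1 h3 h2]) auto
 have "exp (Pv (-1)) = exp (G (-1))" using exp_Pv[of "-1"] G(2)[of "-1"] by simp
 then obtain n where n: "Pv (-1) = G (-1) + of_int n * tpi" unfolding exp_eq_tpi by blast
 have "Pv p = G p + of_int n * tpi" if p: "p \<in> ?S" for p
 proof (rule lift_unique[of exp ?S Pv "\<lambda>p. G p + of_int n * tpi" "-1"])
  show "(exp :: complex \<Rightarrow> complex) holomorphic_on UNIV" by (intro holomorphic_intros)
  show "connected ?S" by (intro convex_connected convex_halfspace_Re_lt)
  show "continuous_on ?S Pv" by (rule continuous_on_subset[OF Pv_cont]) (use left_range in auto)
  show "continuous_on ?S (\<lambda>p. G p + of_int n * tpi)" using G(1) by (intro continuous_intros holomorphic_on_imp_continuous_on)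
  show "exp (Pv x) = exp (G x + of_int n * tpi)" if "x \<in> ?S" for x using that exp_Pv[of x] G(2)[of x] by simp
  show "deriv exp (Pv x) \<noteq> 0" for x using DERIV_imp_deriv[OF DERIV_exp, of "Pv x"] by simp
 qed (use n p in auto)
 thus ?thesis using G(1) by (subst holomorphic_cong[OF refl, of _ _ "\<lambda>p. G p + of_int n * tpi"]) (auto intro!: holomorphic_intros)
qed

lemma Pv_inj_tpi: assumes "p \<in> range P" "q \<in> range P" "Pv p = Pv q + of_int n * tpi" shows "p = q + of_int n * tpi"
proof -
 have "P (Pv p) = P (Pv q) + of_int n * tpi" unfolding assms(3) by (rule P_tpi)
 thus ?thesis unfolding P_Pv[OF assms(1)] P_Pv[OF assms(2)] .
qed

text \<open>In a disc of radius at most 1 no two points differ by \<open>tpi\<close>; as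
  \<open>Pv\<close> is injective modulo \<open>tpi\<close>, no two values do either.\<close>

lemma Pv_deriv: assumes p: "-1 \<le> Re p" "Re p < 0" shows "norm (deriv Pv p) \<le> 12 * pi / (- Re p)"
proof (rule deriv_bound_mod_tpi)
 have sub: "Re z < 0" if "z \<in> ball p (- Re p)" for z using that complex_Re_le_cmod[of "z - p"] by (simp add: dist_norm norm_minus_commute)
 thus "Pv holomorphic_on ball p (- Re p)" by (intro holomorphic_on_subset[OF Pv_hol]) auto
 show "0 < - Re p" using p by simp
 fix z1 z2 assume z: "z1 \<in> ball p (- Re p)" "z2 \<in> ball p (- Re p)"
 show "Pv z1 \<noteq> Pv z2 + tpi"
 proof
  assume "Pv z1 = Pv z2 + tpi"
  hence "z1 - z2 = tpi" using Pv_inj_tpi[of z1 z2 1] sub[OF z(1)] sub[OF z(2)] left_range by auto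
  moreover have "norm (z1 - z2) < 2" using z p dist_triangle[of z1 z2 p] by (simp add: dist_norm norm_minus_commute)
  ultimately show False using pi_gt3 by (simp add: norm_mult tpi_def)
 qed
qed

text \<open>The derivative is at most \<open>36 * pi / s\<close> on the segment, whose length is at
  most \<open>s\<close>; 114 exceeds \<open>36 * pi\<close>.\<close>

lemma Pv_seg:
 assumes s: "0 < s" "s \<le> 1" and x: "s / 3 \<le> x" "x \<le> s"
 shows "norm (Pv (Complex (-s) v) - Pv (Complex (-x) v)) \<le> 114"
proof -
 let ?S = "{p. -s \<le> Re p} \<inter> {p. Re p \<le> -(s/3)}"
 have "norm (Pv (Complex (-s) v) - Pv (Complex (-x) v)) \<le> (36 * pi / s) * norm (Complex (-s) v - Complex (-x) v)"
 proof (rule field_differentiable_bound[where S="?S" and f'="deriv Pv"])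
  show "convex ?S" by (intro convex_Int convex_halfspace_Re_le convex_halfspace_Re_ge)
  fix z assume z: "z \<in> ?S"
  hence zn: "Re z < 0" using s by auto
  thus "(Pv has_field_derivative deriv Pv z) (at z within ?S)"
   by (intro has_field_derivative_at_within[OF holomorphic_derivI[OF Pv_hol open_halfspace_Re_lt]]) simp
  have "norm (deriv Pv z) \<le> 12 * pi / (- Re z)" using z s zn by (intro Pv_deriv) auto
  also have "\<dots> \<le> 12 * pi / (s / 3)" using z s zn by (intro divide_left_mono) (auto simp: mult_less_0_iff mult_neg_pos)
  finally show "norm (deriv Pv z) \<le> 36 * pi / s" by simp
 qed (use x s in auto)
 also have "norm (Complex (-s) v - Complex (-x) v) = \<bar>s - x\<bar>" by (simp add: cmod_def)
 also have "36 * pi / s * \<bar>s - x\<bar> \<le> 36 * pi / s * s" using x s by (intro mult_left_mono) auto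
 also have "\<dots> \<le> 114" using s pi_less_4 pi_approx by simp
 finally show ?thesis .
qed

lemma Pv_left_bounded: obtains C where "0 \<le> C" "\<And>p. Re p \<le> -1/2 \<Longrightarrow> Re (Pv p) \<le> C"
proof -
 have "exp (-1/2) < (1::real)" by simp
 hence "continuous_on (cball 0 (exp (-1/2))) \<gamma>"
  by (intro continuous_on_subset[OF holomorphic_on_imp_continuous_on[OF gam]]) (simp add: cball_subset_ball_iff)
 hence "bounded (\<gamma> ` cball 0 (exp (-1/2)))" by (intro compact_imp_bounded compact_continuous_image) auto
 then obtain M where M: "M > 0" "\<And>x. x \<in> cball 0 (exp (-1/2)) \<Longrightarrow> norm (\<gamma> x) \<le> M" unfolding bounded_pos by auto
 show ?thesis
 proof (rule that[of "max 0 (ln M)"])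
  fix p :: complex assume p: "Re p \<le> -1/2"
  have "exp (Re (Pv p)) = norm (\<gamma> (exp p))" using p exp_Pv[of p] by (metis norm_exp_eq_Re le_less_trans neg_less_0_iff_less divide_minus_left half_gt_zero zero_less_one)
  also have "\<dots> \<le> M" using p by (intro M(2)) (simp add: norm_exp_eq_Re)
  finally show "Re (Pv p) \<le> max 0 (ln M)" using M(1) by (simp add: le_max_iff_disj ln_ge_iff)
 qed simp
qed

lemma exp_less_3: "exp 1 < (3::real)" using e_less_272 by simp

text \<open>The substitution \<open>e\<close> turns semicircles of radius
  \<open>s * exp (u - 1)\<close> around \<open>Complex 0 v\<close> into vertical segments, so
  \<open>length_area\<close> applies to radii between \<open>s / exp 1\<close> and \<open>s\<close>.
  It yields a good radius for each half-height \<open>T n < pi / 2\<close>, and nested compact sets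
  give one radius for the whole open semicircle. 8001 is the bound 8000 plus 1, which makes the
  contradiction strict.\<close>

lemma crosscut:
 assumes s: "0 < s" "s \<le> 1/2" and A: "\<And>x. s / 3 \<le> x \<Longrightarrow> x \<le> s \<Longrightarrow> A \<le> Re (Pv (Complex (-x) v))"
 obtains r where "s / 3 < r" "r \<le> s" "\<And>p. Re p < 0 \<Longrightarrow> norm (p - Complex 0 v) = r \<Longrightarrow> A - 8001 \<le> Re (Pv p)"
proof -
 define D where "D = {\<zeta>. \<bar>Im \<zeta>\<bar> < pi / 2 \<and> Re \<zeta> < 2}"
 define e where "e = (\<lambda>\<zeta>. Complex 0 v - of_real s * exp (\<zeta> - 1))"
 define k where "k = (\<lambda>\<zeta>. Pv (e \<zeta>))"
 have eRe: "Re (e \<zeta>) = - (s * exp (Re \<zeta> - 1) * cos (Im \<zeta>))" for \<zeta> by (simp add: e_def Re_exp)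
 have eD: "Re (e \<zeta>) < 0" if "\<zeta> \<in> D" for \<zeta> unfolding eRe using that s cos_gt_zero_pi[of "Im \<zeta>"] by (auto simp: D_def)
 have openD: "open D" and convD: "convex D"
 proof -
  define c where "c = pi / 2"
  have "D = {\<zeta>. Im \<zeta> < c} \<inter> {\<zeta>. -c < Im \<zeta>} \<inter> {\<zeta>. Re \<zeta> < 2}" by (auto simp: D_def c_def abs_less_iff)
  thus "open D" "convex D" by (auto intro!: open_Int convex_Int open_halfspace_Im_lt open_halfspace_Im_gt open_halfspace_Re_lt
     convex_halfspace_Im_lt convex_halfspace_Im_gt convex_halfspace_Re_lt)
 qed
 have khol: "k holomorphic_on D" using holomorphic_on_compose_gen[OF _ Pv_hol, of e D] eD by (force simp: o_def k_def e_def intro!: holomorphic_intros)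
 have kinj: "z = z' \<and> n = 0" if z: "z \<in> D" "z' \<in> D" and eq: "k z = k z' + of_int n * tpi" for z z' n
 proof -
  have ee: "e z = e z' + of_int n * tpi" using Pv_inj_tpi[OF left_range[OF eD[OF z(1)]] left_range[OF eD[OF z(2)]]] eq by (simp add: k_def)
  \<comment> \<open>As \<open>s\<close> is at most 1/2, values of \<open>e\<close> stay within
    distance 2 of \<open>Complex 0 v\<close> and cannot differ by a nonzero multiple of
    \<open>tpi\<close>.\<close>
  have nb: "norm (of_real s * exp (w - 1)) < 2" if "w \<in> D" for w
  proof -
   have "exp (Re w - 1) < exp 1" using that by (simp add: D_def)
   hence "exp (Re w - 1) \<le> 3" using exp_less_3 by linarith
   hence "s * exp (Re w - 1) \<le> 1/2 * 3" using s by (intro mult_mono) auto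
   moreover have "norm (of_real s * exp (w - 1)) = s * exp (Re w - 1)" using s(1) by (simp add: norm_mult norm_exp_eq_Re)
   ultimately show ?thesis by linarith
  qed
  have n0: "n = 0"
  proof (rule ccontr)
   assume n: "n \<noteq> 0"
   have "norm (of_int n * tpi) = norm (of_real s * exp (z' - 1) - of_real s * exp (z - 1))"
    using ee by (simp add: e_def algebra_simps norm_minus_commute)
   also have "\<dots> < 2 + 2" using nb[OF z(1)] nb[OF z(2)] norm_triangle_ineq4 by (smt (verit, best))
   finally have "\<bar>of_int n\<bar> * (2 * pi) < 4" by (simp add: norm_mult tpi_def)
   moreover have "1 * (2 * pi) \<le> \<bar>of_int n\<bar> * (2 * pi)" using n by (intro mult_right_mono) (linarith, simp)
   ultimately show False using pi_gt3 by linarith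
  qed
  hence "exp z = exp z'" using ee s by (simp add: e_def exp_diff)
  then obtain j where j: "z = z' + of_int j * tpi" unfolding exp_eq_tpi by blast
  have "\<bar>Im z - Im z'\<bar> < pi" using z by (auto simp: D_def)
  hence "\<bar>of_int j\<bar> * (2 * pi) < pi" using j by (simp add: abs_mult)
  hence "j = 0" using mult_right_mono[of 1 "\<bar>of_int j\<bar>" "2*pi"] pi_gt_zero by (cases "j = 0") auto
  thus ?thesis using n0 j by simp
 qed
 define T where "T = (\<lambda>n::nat. pi/2 - inverse (real (Suc n)))"
 have Tb: "0 < T n" "T n < pi / 2" "T n \<le> 2" for n
 proof -
  have "0 < inverse (real (Suc n))" "inverse (real (Suc n)) \<le> 1" by (simp_all add: inverse_le_1_iff)
  thus "0 < T n" "T n < pi / 2" "T n \<le> 2" unfolding T_def using pi_gt3 pi_less_4 by linarith+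
 qed
 define Fs where "Fs = (\<lambda>n. {u \<in> {0..1}. \<forall>d\<in>{-T n..T n}. A - 8001 \<le> Re (k (Complex u d))})"
 have ne: "Fs n \<noteq> {}" for n
 proof (rule ccontr)
  assume Fe: "\<not> Fs n \<noteq> {}"
  have c: "\<exists>d. \<bar>d\<bar> \<le> T n \<and> Re (k (Complex u d)) \<le> A - 8001" if "0 \<le> u" "u \<le> 1" for u
  proof (rule ccontr)
   assume n: "\<not> ?thesis"
   have "A - 8001 \<le> Re (k (Complex u d))" if "d \<in> {-T n..T n}" for d
   proof -
    have "\<bar>d\<bar> \<le> T n" using that by auto
    thus ?thesis using n by (meson le_less_linear less_imp_le)
   qed
   hence "u \<in> Fs n" using \<open>0 \<le> u\<close> \<open>u \<le> 1\<close> by (simp add: Fs_def)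
   thus False using Fe by blast
  qed
  have "A - (A - 8001) \<le> 8000"
  proof (rule length_area[OF openD khol Tb(1) Tb(3)])
   show "cbox (Complex 0 (- T n)) (Complex 1 (T n)) \<subseteq> D" using Tb[of n] by (auto simp: in_cbox_complex_iff D_def)
   show "A \<le> Re (k (Complex u 0))" if u: "0 \<le> u" "u \<le> 1" for u
   proof -
    have "Complex u 0 - 1 = of_real (u - 1)" by (simp add: complex_eq_iff)
    hence "exp (Complex u 0 - 1) = of_real (exp (u - 1))" by (simp only: exp_of_real)
    hence "e (Complex u 0) = Complex (- (s * exp (u - 1))) v" by (simp add: e_def complex_eq_iff)
    moreover have "exp (-1) \<le> exp (u - 1)" "exp (u - 1) \<le> 1" using u by auto
    moreover have "1/3 \<le> exp (-1::real)" using exp_le by (simp add: exp_minus field_simps)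
    moreover have "s * (1/3) \<le> s * exp (u - 1)" "s * exp (u - 1) \<le> s * 1" by (rule mult_left_mono; use s(1) calculation in linarith)+
    ultimately show ?thesis unfolding k_def using A[of "s * exp (u - 1)"] by simp
   qed
  qed (use kinj c in auto)
  thus False by simp
 qed
 have inD: "Complex u d \<in> D" if "u \<in> {0..1}" "d \<in> {-T n..T n}" for u d n using that Tb[of n] by (auto simp: D_def)
 have cl: "compact (Fs n)" for n
 proof -
  have 1: "closed ({0..1} \<inter> (\<lambda>u. Re (k (Complex u d))) -` {A - 8001..})" if th: "d \<in> {-T n..T n}" for d
  proof (rule continuous_closed_preimage)
   have "continuous_on {0..1} (\<lambda>u. Complex u d)" by (intro continuous_intros)
   hence "continuous_on {0..1} (\<lambda>u. k (Complex u d))"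
    by (rule continuous_on_compose2[OF holomorphic_on_imp_continuous_on[OF khol]]) (intro image_subsetI inD[OF _ th])
   thus "continuous_on {0..1} (\<lambda>u. Re (k (Complex u d)))" by (rule continuous_on_Re)
  qed (rule closed_atLeastAtMost, rule closed_atLeast)
  have 0: "0 \<in> {- T n..T n}" using Tb[of n] by simp
  have "closed (\<Inter>d\<in>{-T n..T n}. {0..1} \<inter> (\<lambda>u. Re (k (Complex u d))) -` {A - 8001..})"
   using 1 by (intro closed_INT ballI)
  moreover have "Fs n = {0..1} \<inter> (\<Inter>d\<in>{-T n..T n}. {0..1} \<inter> (\<lambda>u. Re (k (Complex u d))) -` {A - 8001..})"
   unfolding Fs_def by fastforce
  ultimately show ?thesis by (simp add: compact_Int_closed)
 qed
 have "\<Inter>(range Fs) \<noteq> {}"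
 proof (rule compact_nest[OF cl ne])
  fix m n :: nat assume "m \<le> n"
  hence "T m \<le> T n" by (simp add: T_def le_imp_inverse_le)
  thus "Fs n \<subseteq> Fs m" by (auto simp: Fs_def)
 qed
 then obtain u where u: "\<And>n. u \<in> Fs n" by auto
 have u01: "0 \<le> u" "u \<le> 1" using u[of 0] by (auto simp: Fs_def)
 show ?thesis
 proof (rule that[of "s * exp (u - 1)"])
  have "inverse 3 < inverse (exp (1::real))" by (rule less_imp_inverse_less[OF exp_less_3]) simp
  also have "\<dots> = exp (-1)" by (rule exp_minus[symmetric])
  also have "\<dots> \<le> exp (u - 1)" using u01(1) by simp
  finally have "s * inverse 3 < s * exp (u - 1)" using s(1) by (rule mult_strict_left_mono)
  thus "s / 3 < s * exp (u - 1)" by (simp only: divide_inverse)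
  have "exp (u - 1) \<le> 1" using u01(2) by simp
  thus "s * exp (u - 1) \<le> s" using s(1) by (rule mult_left_le[OF _ less_imp_le])
  fix p assume p: "Re p < 0" "norm (p - Complex 0 v) = s * exp (u - 1)"
  define w where "w = (Complex 0 v - p) / of_real s"
  have w: "0 < Re w" "norm w = exp (u - 1)" "w \<noteq> 0" using p s by (auto simp: w_def norm_divide norm_minus_commute field_simps)
  define \<zeta> where "\<zeta> = Ln w + 1"
  have Reu: "Re \<zeta> = u" using w by (simp add: \<zeta>_def)
  have Im: "\<bar>Im \<zeta>\<bar> < pi / 2" using Re_Ln_pos_lt_imp[OF w(1)] by (simp add: \<zeta>_def)
  have "e \<zeta> = p" using w(3) s by (simp add: e_def \<zeta>_def w_def)
  obtain n where n: "inverse (real (Suc n)) < pi / 2 - \<bar>Im \<zeta>\<bar>" using reals_Archimedean[of "pi / 2 - \<bar>Im \<zeta>\<bar>"] Im by auto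
  hence "Im \<zeta> \<in> {-T n..T n}" by (auto simp: T_def)
  hence "A - 8001 \<le> Re (k (Complex u (Im \<zeta>)))" using u[of n] by (auto simp: Fs_def)
  moreover have "Complex u (Im \<zeta>) = \<zeta>" using Reu by (simp add: complex_eq_iff)
  ultimately show "A - 8001 \<le> Re (Pv p)" using \<open>e \<zeta> = p\<close> by (simp add: k_def)
 qed
qed

text \<open>\<open>growth\<close> at the far point bounds the logarithm of the distance travelled by
  the real part there, and \<open>lb_lip_log\<close> bounds the way back by this logarithm.\<close>

lemma tract_coarse:
 assumes L: "lb L" and Z: "R \<le> Re Z" "0 \<le> t"
 shows "Re (L Z) \<le> (1 + 12 * pi / \<alpha>) * max 0 (Re (L (Z + of_real t))) + 12 * pi * \<bar>\<beta>\<bar> / \<alpha>"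
proof -
 have Za: "1 \<le> Re Z - a" "0 < Re Z" using Z R a0 by auto
 define m where "m = max 0 (Re (L (Z + of_real t)))"
 have "\<alpha> * ln (Re Z + t) - \<beta> \<le> Re (L (Z + of_real t))" using growth[OF L, of "Z + of_real t"] Z by simp
 hence "\<alpha> * ln (Re Z + t) \<le> m + \<bar>\<beta>\<bar>" by (simp add: m_def)
 hence ln: "ln (Re Z + t) \<le> (m + \<bar>\<beta>\<bar>) / \<alpha>" using \<alpha> by (simp add: field_simps)
 have "(Re Z - a + t) / (Re Z - a) \<le> (Re Z - a + t) / 1" using Za Z by (intro divide_left_mono) auto
 hence "ln ((Re Z - a + t) / (Re Z - a)) \<le> ln (Re Z + t)" using Za Z a0 by (subst ln_le_cancel_iff) auto
 hence "12 * pi * ln ((Re Z - a + t) / (Re Z - a)) \<le> 12 * pi * ((m + \<bar>\<beta>\<bar>) / \<alpha>)" using ln by (intro mult_left_mono) auto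
 moreover have "norm (L (Z + of_real t) - L Z) \<le> 12 * pi * ln ((Re Z - a + t) / (Re Z - a))" using Za Z by (intro lb_lip_log[OF L]) auto
 moreover have "Re (L Z) \<le> Re (L (Z + of_real t)) + norm (L (Z + of_real t) - L Z)" using abs_Re_le_cmod[of "L (Z + of_real t) - L Z"] by simp
 moreover have "Re (L (Z + of_real t)) \<le> m" by (simp add: m_def)
 ultimately have "Re (L Z) \<le> m + 12 * pi * ((m + \<bar>\<beta>\<bar>) / \<alpha>)" by linarith
 thus ?thesis unfolding m_def[symmetric] using \<alpha> by (simp add: field_simps)
qed

lemma range_P_right:
 assumes "p \<in> range P" "0 \<le> Re p"
 obtains L Z where "lb L" "R \<le> Re Z" "p = P (L Z)" "Pv p = L Z"
proof -
 obtain z where z: "p = P z" using assms(1) by blast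
 hence "exp z \<notin> V" using P_V[of z] assms(2) by simp
 then obtain L Z where "lb L" "R \<le> Re Z" "z = L Z" by (rule T_cover)
 thus ?thesis using that[of L Z] z by simp
qed

lemma P_lb_add:
 assumes L: "lb L" and Z: "R \<le> Re Z" and t: "0 \<le> t"
 obtains d where "0 \<le> d" "P (L Z) + of_real t = P (L (Z + of_real d))"
proof (rule that[of "(exp t - 1) * (1 + Re Z - R)"])
 let ?x = "1 + Re Z - R"
 have x: "0 < ?x" using Z by simp
 show d: "0 \<le> (exp t - 1) * ?x" using x t by simp
 have "1 + Re (Z + of_real ((exp t - 1) * ?x)) - R = exp t * ?x" by (simp add: algebra_simps)
 hence "ln (1 + Re (Z + of_real ((exp t - 1) * ?x)) - R) = t + ln ?x" using x by (simp only: ln_mult_pos[OF exp_gt_zero x] ln_exp)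
 moreover have "R \<le> Re (Z + of_real ((exp t - 1) * ?x))" using d Z by simp
 ultimately show "P (L Z) + of_real t = P (L (Z + of_real ((exp t - 1) * ?x)))"
  using P_lb[OF L Z] P_lb[OF L, of "Z + of_real ((exp t - 1) * ?x)"] by (simp add: complex_eq_iff)
qed

text \<open>If \<open>q\<close> lies beyond the crosscut, the horizontal line to the left of
  \<open>Pv q\<close> must leave the region bounded by the crosscut and by the leaves that start at
  its ends. It does so on the crosscut, where the real part is large, or on such a leaf within a
  tract, where \<open>tract_coarse\<close> compares with the end of the crosscut. The constant is
  8115 = 114 + 8001.\<close>

lemma Pv_coarse_left:
 assumes s: "0 < s" "s \<le> 1/2" and q: "q \<in> range P" "- s \<le> Re q" "Im q = v"
 shows "Re (Pv (Complex (-s) v)) \<le> (1 + 12 * pi / \<alpha>) * max 0 (Re (Pv q)) + 12 * pi * \<bar>\<beta>\<bar> / \<alpha> + 8115"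
proof -
 define K C where "K = 1 + 12 * pi / \<alpha>" and "C = 12 * pi * \<bar>\<beta>\<bar> / \<alpha>"
 have K: "1 \<le> K" "0 \<le> C" using \<alpha> by (auto simp: K_def C_def)
 have Km: "x \<le> K * max 0 x" for x
 proof -
  have "1 * max 0 x \<le> K * max 0 x" using K by (intro mult_right_mono) auto
  thus ?thesis by simp
 qed
 define \<rho>' where "\<rho>' = Re (Pv (Complex (-s) v))"
 have seg: "\<rho>' - 114 \<le> Re (Pv (Complex (-x) v))" if "s / 3 \<le> x" "x \<le> s" for x
  using Pv_seg[of s x v] abs_Re_le_cmod[of "Pv (Complex (-s) v) - Pv (Complex (-x) v)"] that s by (simp add: \<rho>'_def)
 show ?thesis
 proof (cases "Re q \<le> - (s / 3)")
  case True
  have "q = Complex (- (- Re q)) v" using q(3) by (simp add: complex_eq_iff)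
  hence "\<rho>' - 114 \<le> Re (Pv q)" using seg[of "- Re q"] True q(2) by simp
  thus ?thesis using Km[of "Re (Pv q)"] K unfolding \<rho>'_def K_def[symmetric] C_def[symmetric] by linarith
 next
  case False
  obtain r where r: "s / 3 < r" "r \<le> s" and arc0: "\<And>p. Re p < 0 \<Longrightarrow> norm (p - Complex 0 v) = r \<Longrightarrow> (\<rho>' - 114) - 8001 \<le> Re (Pv p)"
   by (rule crosscut[OF s seg], assumption, assumption) blast
  define B where "B = \<rho>' - 8115"
  have arc: "B \<le> Re (Pv p)" if "Re p < 0" "norm (p - Complex 0 v) = r" for p using arc0[OF that] by (simp add: B_def)
  have r0: "0 < r" using r s by simp
  \<comment> \<open>An end of the crosscut is a limit of its points, and \<open>Pv\<close> is
    continuous at this end if the leaf there enters a tract.\<close>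
  have tip: "B \<le> Re (Pv (Complex 0 (v + \<sigma> * r)))" if \<sigma>: "\<sigma> = 1 \<or> \<sigma> = -1" and i: "v + \<sigma> * r \<in> I" for \<sigma>
  proof -
   define c where "c = (\<lambda>n. Complex 0 v + of_real (\<sigma> * r) * \<i> * cis (\<sigma> * inverse (real (Suc n))))"
   have "(\<lambda>n. cis (\<sigma> * inverse (real (Suc n)))) \<longlonglongrightarrow> cis (\<sigma> * 0)"
    by (intro tendsto_intros LIMSEQ_inverse_real_of_nat continuous_on_tendsto_compose[OF continuous_on_cis[OF continuous_on_id]])
   hence "c \<longlonglongrightarrow> Complex 0 v + of_real (\<sigma> * r) * \<i> * 1" unfolding c_def by (intro tendsto_intros) simp
   moreover have "Complex 0 v + of_real (\<sigma> * r) * \<i> * 1 = Complex 0 (v + \<sigma> * r)" by (simp add: complex_eq_iff)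
   ultimately have lim: "c \<longlonglongrightarrow> Complex 0 (v + \<sigma> * r)" by simp
   have c1: "norm (c n - Complex 0 v) = r" for n using \<sigma> r0 by (auto simp: c_def norm_mult)
   have c2: "Re (c n) < 0" for n
   proof -
    have "0 < inverse (real (Suc n))" "inverse (real (Suc n)) \<le> 1" by (simp_all add: inverse_le_1_iff)
    hence "0 < sin (inverse (real (Suc n)))" using pi_gt3 by (intro sin_gt_zero) auto
    thus ?thesis using \<sigma> r0 by (auto simp: c_def)
   qed
   have "Complex 0 (v + \<sigma> * r) \<in> range P" using i by (simp add: range_P)
   hence "(\<lambda>n. Pv (c n)) \<longlonglongrightarrow> Pv (Complex 0 (v + \<sigma> * r))"
    using lim c2 by (intro continuous_on_tendsto_compose[OF Pv_cont]) (auto intro!: always_eventually left_range)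
   hence "(\<lambda>n. Re (Pv (c n))) \<longlonglongrightarrow> Re (Pv (Complex 0 (v + \<sigma> * r)))" by (rule tendsto_Re)
   thus ?thesis by (rule LIMSEQ_le_const) (use arc c1 c2 in auto)
  qed
  define z where "z = Pv q"
  \<comment> \<open>The level set \<open>Df p = r\<close> is the semicircle together with the two
    horizontal rays to the right from its ends.\<close>
  define Df where "Df = (\<lambda>p. norm (Complex (min 0 (Re p)) (Im p - v)))"
  have Dfc: "continuous_on UNIV Df"
  proof -
   have "Df = (\<lambda>p. sqrt ((min 0 (Re p))\<^sup>2 + (Im p - v)\<^sup>2))" by (simp add: Df_def cmod_def)
   thus ?thesis by (simp only:) (intro continuous_intros)
  qed
  obtain x where x: "\<And>z. Re z \<le> x \<Longrightarrow> norm (P z - z - lam 0) < 1" by (rule P_left[of 1]) auto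
  \<comment> \<open>Far to the left \<open>P\<close> is nearly the translation by
    \<open>lam 0\<close>, so the second term of the maximum makes this estimate available and the
    third one then brings \<open>P (z - of_real t1)\<close> to the left of -1, outside of the level
    curve.\<close>
  define t1 where "t1 = max 0 (max (Re z - x) (Re z + \<bar>Re (lam 0)\<bar> + 3))"
  have "Re (z - of_real t1) \<le> x" by (simp add: t1_def)
  hence "\<bar>Re (P (z - of_real t1) - (z - of_real t1) - lam 0)\<bar> < 1"
   using x[of "z - of_real t1"] abs_Re_le_cmod[of "P (z - of_real t1) - (z - of_real t1) - lam 0"] by linarith
  hence far: "Re (P (z - of_real t1)) < - 1" unfolding t1_def by (auto simp: max_def split: if_splits)
  have t10: "0 \<le> t1" by (simp add: t1_def)
  have "Df (P (z - of_real 0)) \<le> r"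
  proof -
   have "Df q = \<bar>min 0 (Re q)\<bar>" using q(3) by (simp add: Df_def cmod_def)
   thus ?thesis using False r P_Pv[OF q(1)] by (simp add: z_def min_def)
  qed
  moreover have "r \<le> Df (P (z - of_real t1))"
  proof -
   have "\<bar>min 0 (Re (P (z - of_real t1)))\<bar> \<le> Df (P (z - of_real t1))"
    unfolding Df_def using abs_Re_le_cmod[of "Complex (min 0 (Re (P (z - of_real t1)))) (Im (P (z - of_real t1)) - v)"] by simp
   thus ?thesis using far r s by (simp add: min_def)
  qed
  moreover have "continuous_on {0..t1} (\<lambda>t. Df (P (z - of_real t)))"
   by (intro continuous_on_compose2[OF Dfc] continuous_on_compose2[OF P_cont] continuous_intros) auto
  ultimately obtain t where t: "0 \<le> t" "Df (P (z - of_real t)) = r" using IVT'[of "\<lambda>t. Df (P (z - of_real t))" 0 r t1] t10 by blast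
  define p where "p = P (z - of_real t)"
  have pz: "Re (Pv p) \<le> Re z" using t by (simp add: p_def)
  have "B \<le> K * max 0 (Re z) + C"
  proof (cases "Re p < 0")
   case True
   hence "norm (p - Complex 0 v) = r" using t(2) by (simp add: Df_def p_def[symmetric] cmod_def)
   hence "B \<le> Re (Pv p)" using arc True by simp
   thus ?thesis using pz Km[of "Re z"] K by linarith
  next
   case F: False
   have pr: "p \<in> range P" by (simp add: p_def)
   hence pI: "Im p \<in> I" using F by (simp add: range_P)
   have "\<bar>Im p - v\<bar> = r" using t(2) F by (simp add: Df_def p_def[symmetric] cmod_def min_def)
   hence "Im p = v + 1 * r \<or> Im p = v + (-1) * r" by linarith
   then obtain \<sigma> where \<sigma>: "\<sigma> = 1 \<or> \<sigma> = -1" "Im p = v + \<sigma> * r" by blast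
   hence B1: "B \<le> Re (Pv (Complex 0 (Im p)))" using tip[of \<sigma>] pI by simp
   obtain L Z where LZ: "lb L" "R \<le> Re Z" "p = P (L Z)" "Pv p = L Z" by (rule range_P_right[OF pr leI[OF F]])
   have e: "p = Complex (ln (1 + Re Z - R)) (vt L (Im Z))" using P_lb[OF LZ(1,2)] LZ(3) by simp
   have "P (L (Complex R (Im Z))) = Complex 0 (Im p)" using P_lb[OF LZ(1), of "Complex R (Im Z)"] e by simp
   hence "B \<le> Re (L (Complex R (Im Z)))" using B1 Pv_P[of "L (Complex R (Im Z))"] by simp
   also have "\<dots> \<le> K * max 0 (Re (L (Complex R (Im Z) + of_real (Re Z - R)))) + C"
    unfolding K_def C_def by (rule tract_coarse[OF LZ(1)]) (use LZ in auto)
   also have "Complex R (Im Z) + of_real (Re Z - R) = Z" by (simp add: complex_eq_iff)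
   also have "K * max 0 (Re (L Z)) + C \<le> K * max 0 (Re z) + C" using pz LZ(4) K by (intro add_right_mono mult_left_mono) auto
   finally show ?thesis .
  qed
  thus ?thesis unfolding z_def B_def \<rho>'_def K_def C_def by linarith
 qed
qed

text \<open>Far to the left \<open>Re (Pv p)\<close> is bounded above, between -1/2 and 0 the
  crosscut estimate applies, and on the right \<open>tract_coarse\<close> does.\<close>

lemma Pv_coarse:
 obtains K C where "1 \<le> K" "0 \<le> C"
  "\<And>p t. 0 \<le> t \<Longrightarrow> p \<in> range P \<Longrightarrow> p + of_real t \<in> range P \<Longrightarrow> Re (Pv p) \<le> K * max 0 (Re (Pv (p + of_real t))) + C"
proof -
 obtain C0 where C0: "0 \<le> C0" "\<And>p. Re p \<le> -1/2 \<Longrightarrow> Re (Pv p) \<le> C0" by (rule Pv_left_bounded) blast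
 define K C where "K = 1 + 12 * pi / \<alpha>" and "C = 12 * pi * \<bar>\<beta>\<bar> / \<alpha>"
 have K: "1 \<le> K" "0 \<le> C" using \<alpha> by (auto simp: K_def C_def)
 have Km: "0 \<le> K * max 0 x" for x using K by simp
 show ?thesis
 proof (rule that[of K "C + C0 + 8115"])
  fix p t assume t: "0 \<le> (t::real)" and p: "p \<in> range P" "p + of_real t \<in> range P"
  consider "Re p \<le> -1/2" | "-1/2 < Re p" "Re p < 0" | "0 \<le> Re p" by linarith
  thus "Re (Pv p) \<le> K * max 0 (Re (Pv (p + of_real t))) + (C + C0 + 8115)"
  proof cases
   case 1
   show ?thesis using C0(2)[OF 1] K(2) Km[of "Re (Pv (p + of_real t))"] by linarith
  next
   case 2
   have e: "Complex (- (- Re p)) (Im p) = p" by (simp add: complex_eq_iff)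
   have "Re (Pv (Complex (- (- Re p)) (Im p))) \<le> K * max 0 (Re (Pv (p + of_real t))) + C + 8115"
    unfolding K_def C_def by (rule Pv_coarse_left) (use 2 p t in auto)
   thus ?thesis unfolding e using C0(1) by linarith
  next
   case 3
   obtain L Z where LZ: "lb L" "R \<le> Re Z" "p = P (L Z)" "Pv p = L Z" by (rule range_P_right[OF p(1) 3])
   obtain d where d: "0 \<le> d" "P (L Z) + of_real t = P (L (Z + of_real d))" by (rule P_lb_add[OF LZ(1,2) t])
   have "Pv (p + of_real t) = L (Z + of_real d)" using d(2) LZ(3) by simp
   hence "Re (Pv p) \<le> K * max 0 (Re (Pv (p + of_real t))) + C" unfolding K_def C_def LZ(4) using tract_coarse[OF LZ(1,2) d(1)] by simp
   thus ?thesis using C0(1) by linarith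
  qed
 qed (use K C0 in auto)
qed

end

section \<open>Straightening the plane\<close>

lemma plane_homeo:
 fixes H :: "complex \<Rightarrow> complex"
 assumes c: "continuous_on UNIV H" and i: "inj H" and s: "surj H"
 shows "homeomorphism UNIV UNIV H (inv H)"
proof -
 obtain k where "homeomorphism UNIV (range H) H k" by (rule invariance_of_domain_homeomorphism[OF open_UNIV c order_refl i])
 hence k: "homeomorphism UNIV UNIV H k" by (simp add: s)
 have "k = inv H" using homeomorphism_apply1[OF k] homeomorphism_apply2[OF k] by (intro ext) (metis i UNIV_I inv_f_f)
 thus ?thesis using k by simp
qed

text \<open>\<open>kinv\<close> pushes the plane into \<open>R < Re z\<close> and is the identity from \<open>R + 1\<close> on; thus the tracts avoid the half plane
 where the straightening map is the identity.\<close>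

definition kinv :: "real \<Rightarrow> real \<Rightarrow> real" where "kinv R t = (if R + 1 \<le> t then t else R + exp (t - R - 1))"
definition kk :: "real \<Rightarrow> real \<Rightarrow> real" where "kk R x = (if R + 1 \<le> x then x else R + 1 + ln (x - R))"

lemma kinv_gt: "R < kinv R t" by (simp add: kinv_def)
lemma kinv_ge: "t \<le> kinv R t" using exp_ge_add_one_self[of "t - R - 1"] by (simp add: kinv_def)
lemma kk_kinv [simp]: "kk R (kinv R t) = t" by (simp add: kinv_def kk_def)
lemma kinv_kk: "R < x \<Longrightarrow> kinv R (kk R x) = x" by (auto simp: kinv_def kk_def)
lemma kk_le: "R < x \<Longrightarrow> kk R x \<le> x" using kinv_ge[of "kk R x" R] by (simp add: kinv_kk)
lemma kk_ge: "R + 1 \<le> x \<Longrightarrow> kk R x = x" by (simp add: kk_def)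

lemma kinv_alt: "kinv R t = max t (R + 1) + exp (min t (R + 1) - (R + 1)) - 1"
 by (auto simp: kinv_def max_def min_def algebra_simps)

lemma kinv_lip: "\<bar>kinv R t - kinv R s\<bar> \<le> \<bar>t - s\<bar>"
proof -
 have *: "kinv R t - kinv R s \<le> t - s \<and> 0 \<le> kinv R t - kinv R s" if "s \<le> t" for s t
 proof -
  define u v where "u = min s (R + 1) - (R + 1)" and "v = min t (R + 1) - (R + 1)"
  have uv: "u \<le> v" "v \<le> 0" using that by (auto simp: u_def v_def)
  have "exp v - exp u \<le> v - u"
  proof -
   have "exp v * (1 - exp (u - v)) \<le> 1 * (v - u)"
   proof (rule mult_mono)
    show "1 - exp (u - v) \<le> v - u" using exp_ge_add_one_self[of "u - v"] by linarith
   qed (use uv in auto)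
   thus ?thesis by (simp add: algebra_simps flip: exp_add)
  qed
  moreover have "exp u \<le> exp v" using uv by simp
  moreover have "max s (R + 1) \<le> max t (R + 1)" "(t - s) = (max t (R+1) - max s (R+1)) + (v - u)"
   using that by (auto simp: u_def v_def max_def min_def)
  ultimately show ?thesis unfolding kinv_alt u_def[symmetric] v_def[symmetric] by linarith
 qed
 show ?thesis using *[of s t] *[of t s] by linarith
qed

lemma kk_cont: "continuous_on {R<..} (kk R)"
proof -
 have "continuous_on {R<..} (\<lambda>x. max x (R + 1) + ln (min x (R + 1) - R))" by (intro continuous_intros) auto
 thus ?thesis by (rule continuous_on_eq) (auto simp: kk_def max_def min_def)
qed

text \<open>A branch followed by the push to the right; \<open>chi\<close> undoes the push.\<close>

definition lt :: "real \<Rightarrow> (complex \<Rightarrow> complex) \<Rightarrow> complex \<Rightarrow> complex" where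
 "lt R L Z = Complex (kinv R (Re (L Z))) (Im (L Z))"

lemma lt_simps [simp]: "Re (lt R L Z) = kinv R (Re (L Z))" "Im (lt R L Z) = Im (L Z)" by (simp_all add: lt_def)

definition chi :: "real \<Rightarrow> complex \<Rightarrow> complex" where "chi R z = Complex (kk R (Re z)) (Im z)"
lemma chi_simps [simp]: "Re (chi R z) = kk R (Re z)" "Im (chi R z) = Im z" by (simp_all add: chi_def)
lemma chi_lt [simp]: "chi R (lt R L Z) = L Z" by (simp add: chi_def)

lemma chi_cont: "continuous_on {z. R < Re z} (chi R)"
 unfolding chi_def by (intro continuous_intros continuous_on_compose2[OF kk_cont]) auto

section \<open>Construction of the straightening map\<close>

context riemann begin

lemma P_near: obtains C where "0 \<le> C" "\<And>z. Re z \<le> X \<Longrightarrow> norm (z - P z) \<le> C"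
proof -
 have "bounded (lam ` cball 0 (exp X))" by (intro compact_imp_bounded compact_continuous_image continuous_on_subset[OF lam(1)]) auto
 then obtain C where "C > 0" "\<And>w. w \<in> cball 0 (exp X) \<Longrightarrow> norm (lam w) \<le> C" unfolding bounded_pos by auto
 thus ?thesis by (intro that[of C]) (auto simp: P_def norm_exp_eq_Re)
qed

text \<open>One leaf through a tract is confined to a sector: \<open>lb_lip_log\<close> makes its
  distance from the start logarithmic in the parameter, and \<open>growth\<close> makes this linear
  in the real part. Going up or down vertically from any point one meets a translate of this leaf of
  nearly the same height, so every point obeys the same bound.\<close>

lemma spiral:
 obtains C where "0 \<le> C" "\<And>z. \<bar>Im z - Im (P z)\<bar> \<le> C * (1 + max 0 (Re z))"
proof -
 obtain v0 where "v0 \<in> I" by (rule I_dense[of 0 1]) auto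
 then obtain L0 y0 where L0: "lb L0" "v0 = vt L0 y0" by (auto simp: I_def)
 obtain C1 where C1: "0 \<le> C1" "\<And>p. Re p \<le> -1/2 \<Longrightarrow> Re (Pv p) \<le> C1" by (rule Pv_left_bounded) blast
 obtain C2 where C2: "0 \<le> C2" "\<And>z. Re z \<le> C1 \<Longrightarrow> norm (z - P z) \<le> C2" by (rule P_near) blast
 have "continuous_on {-1/2..0} (\<lambda>t. Complex t v0)" by (intro continuous_intros)
 moreover have "(\<lambda>t. Complex t v0) ` {-1/2..0} \<subseteq> range P" using \<open>v0 \<in> I\<close> by (auto simp: range_P)
 ultimately have "bounded ((\<lambda>t. Pv (Complex t v0)) ` {-1/2..0})"
  by (intro compact_imp_bounded compact_continuous_image continuous_on_compose2[OF Pv_cont]) auto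
 then obtain C3 where C3: "C3 > 0" "\<And>t. t \<in> {-1/2..0} \<Longrightarrow> norm (Pv (Complex t v0)) \<le> C3" unfolding bounded_pos by auto
 define Z0 where "Z0 = Complex R y0"
 define A where "A = 12 * pi / \<alpha>"
 have A0: "0 \<le> A" using \<alpha> by (simp add: A_def)
 define C where "C = C2 + \<bar>v0\<bar> + C3 + norm (L0 Z0) + A + A * \<bar>\<beta>\<bar>"
 have C0: "0 \<le> C" using C2(1) C3(1) A0 by (simp add: C_def)
 have leaf: "\<bar>Im z\<bar> \<le> C * (1 + max 0 (Re z))" if z: "Im (P z) = v0" for z
 proof -
  have *: "C * 1 + C * max 0 (Re z) = C * (1 + max 0 (Re z))" by (simp add: algebra_simps)
  have CC: "C \<le> C * (1 + max 0 (Re z))" using C0 by (simp add: algebra_simps)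
  consider "Re (P z) \<le> -1/2" | "-1/2 < Re (P z)" "Re (P z) < 0" | "0 \<le> Re (P z)" by linarith
  thus ?thesis
  proof cases
   case 1
   hence "norm (z - P z) \<le> C2" using C1(2)[OF 1] C2(2)[of z] by simp
   hence "\<bar>Im z - v0\<bar> \<le> C2" using abs_Im_le_cmod[of "z - P z"] z by simp
   hence "\<bar>Im z\<bar> \<le> C" unfolding C_def using C3(1) A0 norm_ge_zero[of "L0 Z0"] mult_nonneg_nonneg[OF A0, of "\<bar>\<beta>\<bar>"] by linarith
   thus ?thesis using CC by linarith
  next
   case 2
   have "P z = Complex (Re (P z)) v0" using z by (simp add: complex_eq_iff)
   hence "z = Pv (Complex (Re (P z)) v0)" by (metis Pv_P)
   hence "norm z \<le> C3" using C3(2)[of "Re (P z)"] 2 by simp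
   hence "\<bar>Im z\<bar> \<le> C" unfolding C_def using abs_Im_le_cmod[of z] C2(1) A0 norm_ge_zero[of "L0 Z0"] mult_nonneg_nonneg[OF A0, of "\<bar>\<beta>\<bar>"] by linarith
   thus ?thesis using CC by linarith
  next
   case 3
   have P0: "P (L0 Z0) = Complex 0 v0" using P_lb[OF L0(1), of Z0] L0(2) by (simp add: Z0_def)
   obtain d where d: "0 \<le> d" "P (L0 Z0) + of_real (Re (P z)) = P (L0 (Z0 + of_real d))" by (rule P_lb_add[OF L0(1) _ 3, of Z0]) (auto simp: Z0_def)
   have "P z = P (L0 (Z0 + of_real d))" using d(2) z P0 by (simp add: complex_eq_iff)
   hence zL: "z = L0 (Z0 + of_real d)" using P_inj by (simp add: inj_eq)
   have "norm (z - L0 Z0) \<le> 12 * pi * ln ((R - a + d) / (R - a))" using lb_lip_log[OF L0(1), of Z0 d] Ra d zL by (simp add: Z0_def)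
   also have "\<dots> \<le> 12 * pi * ln (R + d)"
   proof (intro mult_left_mono)
    have "(R - a + d) / (R - a) \<le> (R - a + d) / 1" using R d by (intro divide_left_mono) auto
    thus "ln ((R - a + d) / (R - a)) \<le> ln (R + d)" using R d a0 by (subst ln_le_cancel_iff) auto
   qed simp
   also have "\<dots> \<le> 12 * pi * ((Re z + \<bar>\<beta>\<bar>) / \<alpha>)"
   proof (intro mult_left_mono)
    have "\<alpha> * ln (R + d) - \<beta> \<le> Re z" using growth[OF L0(1), of "Z0 + of_real d"] d zL by (simp add: Z0_def)
    thus "ln (R + d) \<le> (Re z + \<bar>\<beta>\<bar>) / \<alpha>" using \<alpha> by (simp add: field_simps)
   qed simp
   also have "\<dots> = A * (Re z + \<bar>\<beta>\<bar>)" by (simp add: A_def)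
   finally have "\<bar>Im z\<bar> \<le> norm (L0 Z0) + A * (Re z + \<bar>\<beta>\<bar>)"
    using norm_triangle_sub[of z "L0 Z0"] abs_Im_le_cmod[of z] by linarith
   also have "\<dots> \<le> norm (L0 Z0) + A * \<bar>\<beta>\<bar> + A * max 0 (Re z)"
    using mult_left_mono[OF max.cobounded2[of "Re z" 0] A0] by (simp add: algebra_simps)
   also have "\<dots> \<le> C + C * max 0 (Re z)"
   proof (intro add_mono mult_right_mono)
    show "norm (L0 Z0) + A * \<bar>\<beta>\<bar> \<le> C" unfolding C_def using C2(1) C3(1) A0 by simp
    show "A \<le> C" unfolding C_def using C2(1) C3(1) A0 by simp
   qed simp
   finally show ?thesis using * by simp
  qed
 qed
 \<comment> \<open>Moving by \<open>2 * pi * k\<close> changes the height by the same amount, so the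
   intermediate value theorem finds the leaf above or below.\<close>
 have Pvert: "\<exists>t\<ge>0. Im (P (z + of_real (\<sigma> * t) * \<i>)) = v0" if \<sigma>: "\<sigma> = 1 \<or> \<sigma> = -1" and z: "\<sigma> * Im (P z) \<le> \<sigma> * v0" for z \<sigma>
 proof -
  obtain k :: nat where k: "\<bar>v0 - Im (P z)\<bar> \<le> real k" using real_arch_simple by blast
  define f where "f = (\<lambda>t. \<sigma> * Im (P (z + of_real (\<sigma> * t) * \<i>)))"
  have "continuous_on {0..2 * pi * real k} f" unfolding f_def by (intro continuous_intros continuous_on_compose2[OF P_cont]) auto
  moreover have "f 0 \<le> \<sigma> * v0" using z by (simp add: f_def)
  moreover have "\<sigma> * v0 \<le> f (2 * pi * real k)"
  proof -
   have k1: "real k \<le> 2 * pi * real k" using mult_right_mono[of 1 "2*pi" "real k"] pi_gt3 by simp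
   have "z + of_real (\<sigma> * (2 * pi * real k)) * \<i> = z + of_int (if \<sigma> = 1 then int k else - int k) * tpi"
    using \<sigma> by (auto simp: complex_eq_iff)
   hence "f (2 * pi * real k) = \<sigma> * Im (P z) + 2 * pi * real k" unfolding f_def using \<sigma> by (auto simp: P_tpi)
   thus ?thesis using k k1 \<sigma> by auto
  qed
  ultimately obtain t where "0 \<le> t" "f t = \<sigma> * v0" using IVT'[of f 0 "\<sigma> * v0" "2 * pi * real k"] by auto
  thus ?thesis using \<sigma> by (auto simp: f_def)
 qed
 have side: "\<sigma> * Im z \<le> C * (1 + max 0 (Re z))" if \<sigma>: "\<sigma> = 1 \<or> \<sigma> = -1" and z: "\<sigma> * Im (P z) \<le> \<sigma> * v0" for z \<sigma>
 proof -
  obtain t where t: "0 \<le> t" "Im (P (z + of_real (\<sigma> * t) * \<i>)) = v0" using Pvert[OF \<sigma> z] by blast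
  have "\<bar>Im z + \<sigma> * t\<bar> \<le> C * (1 + max 0 (Re z))" using leaf[OF t(2)] by simp
  thus ?thesis using t(1) \<sigma> by auto
 qed
 show ?thesis
 proof (rule that[of "C + \<bar>v0\<bar> + 4 * pi"])
  show "0 \<le> C + \<bar>v0\<bar> + 4 * pi" using C0 pi_gt_zero by simp
  fix z
  define n where "n = \<lfloor>(Im (P z) - v0) / (2 * pi)\<rfloor>"
  have n: "v0 \<le> Im (P z) - 2 * pi * of_int n" "Im (P z) - 2 * pi * of_int n < v0 + 2 * pi"
  proof -
   have "of_int n \<le> (Im (P z) - v0) / (2 * pi)" "(Im (P z) - v0) / (2 * pi) < of_int n + 1" by (simp_all add: n_def)
   hence "of_int n * (2 * pi) \<le> Im (P z) - v0" "Im (P z) - v0 < (of_int n + 1) * (2 * pi)" using pi_gt_zero by (simp_all add: field_simps)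
   thus "v0 \<le> Im (P z) - 2 * pi * of_int n" "Im (P z) - 2 * pi * of_int n < v0 + 2 * pi" by (simp_all add: algebra_simps)
  qed
  have "-1 * Im (z + of_int (-n) * tpi) \<le> C * (1 + max 0 (Re (z + of_int (-n) * tpi)))"
   by (rule side) (use n in \<open>auto simp only: P_tpi, auto simp: algebra_simps\<close>)
  moreover have "1 * Im (z + of_int (-n-1) * tpi) \<le> C * (1 + max 0 (Re (z + of_int (-n-1) * tpi)))"
   by (rule side) (use n in \<open>auto simp only: P_tpi, auto simp: algebra_simps\<close>)
  ultimately have "\<bar>Im z - Im (P z)\<bar> \<le> C * (1 + max 0 (Re z)) + \<bar>v0\<bar> + 4 * pi" using n by (simp add: algebra_simps)
  also have "\<dots> \<le> (C + \<bar>v0\<bar> + 4 * pi) * (1 + max 0 (Re z))"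
   using mult_nonneg_nonneg[of "\<bar>v0\<bar> + 4 * pi" "max 0 (Re z)"] pi_gt_zero by (simp add: algebra_simps)
  finally show "\<bar>Im z - Im (P z)\<bar> \<le> (C + \<bar>v0\<bar> + 4 * pi) * (1 + max 0 (Re z))" .
 qed
qed

definition N :: "complex \<Rightarrow> real" where "N p = kinv R (Re (Pv p))"
text \<open>\<open>M\<close> is the increasing envelope of \<open>N\<close> along a leaf, made strictly increasing by \<open>tau\<close>.\<close>

definition M :: "complex \<Rightarrow> real" where "M p = Inf {N (p + of_real t) | t. 0 \<le> t \<and> p + of_real t \<in> range P}"
definition tau :: "real \<Rightarrow> real" where "tau t = (if t \<le> 0 then exp t else 1 + (1 - exp (- t)) / 8)"
definition G :: "complex \<Rightarrow> complex" where "G p = Complex (M p + tau (Re p)) (Im p)"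
definition Phi :: "complex \<Rightarrow> complex" where "Phi z = (if Re z \<le> R then z else G (P (chi R z)))"

lemma N_P [simp]: "N (P z) = kinv R (Re z)" by (simp add: N_def)

lemma M_le: assumes "0 \<le> t" "p + of_real t \<in> range P" shows "M p \<le> N (p + of_real t)"
 unfolding M_def
proof (rule cInf_lower)
 show "bdd_below {N (p + of_real t) | t. 0 \<le> t \<and> p + of_real t \<in> range P}"
  by (rule bdd_belowI[of _ R]) (auto simp: N_def intro!: less_imp_le[OF kinv_gt])
qed (use assms in blast)

lemma M_ge: assumes "p \<in> range P" "\<And>t. 0 \<le> t \<Longrightarrow> p + of_real t \<in> range P \<Longrightarrow> b \<le> N (p + of_real t)" shows "b \<le> M p"
proof -
 have "N (p + of_real 0) \<in> {N (p + of_real t) | t. 0 \<le> t \<and> p + of_real t \<in> range P}" using assms(1) by force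
 thus ?thesis unfolding M_def by (intro cInf_greatest) (use assms in auto)
qed

lemma M_near: assumes "p \<in> range P" "M p < b" obtains t where "0 \<le> t" "p + of_real t \<in> range P" "N (p + of_real t) < b"
 using M_ge[OF assms(1), of b] assms(2) by (meson not_le)

lemma M_le_N: "p \<in> range P \<Longrightarrow> M p \<le> N p" using M_le[of 0 p] by simp

lemma M_R: "p \<in> range P \<Longrightarrow> R \<le> M p" by (rule M_ge) (auto simp: N_def kinv_gt less_imp_le)

lemma M_mono: assumes "p \<in> range P" "0 \<le> t" "p + of_real t \<in> range P" shows "M p \<le> M (p + of_real t)"
proof (rule M_ge[OF assms(3)])
 fix s assume "0 \<le> (s::real)" "p + of_real t + of_real s \<in> range P"
 thus "M p \<le> N (p + of_real t + of_real s)" using M_le[of "t + s" p] assms by (simp add: add.assoc)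
qed

lemma N_tpi: "p \<in> range P \<Longrightarrow> N (p + of_int n * tpi) = N p" by (simp add: N_def Pv_tpi)

lemma M_tpi: assumes "p \<in> range P" shows "M (p + of_int n * tpi) = M p"
proof -
 have "p + of_int n * tpi + of_real t = (p + of_real t) + of_int n * tpi" for t by simp
 thus ?thesis unfolding M_def using range_P_tpi N_tpi by (intro arg_cong[of _ _ Inf] Collect_cong) metis
qed

text \<open>By coarse monotonicity the infimum over the rest of the leaf loses only an affine
  factor; this makes \<open>Re (Phi z)\<close> comparable with \<open>Re z\<close>.\<close>

lemma M_coarse: obtains K C where "1 \<le> K" "0 \<le> C" "\<And>p. p \<in> range P \<Longrightarrow> Re (Pv p) \<le> K * M p + C"
proof -
 obtain K C where KC: "1 \<le> K" "0 \<le> C"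
  "\<And>p t. 0 \<le> t \<Longrightarrow> p \<in> range P \<Longrightarrow> p + of_real t \<in> range P \<Longrightarrow> Re (Pv p) \<le> K * max 0 (Re (Pv (p + of_real t))) + C"
  by (rule Pv_coarse) blast
 show ?thesis
 proof (rule that[OF KC(1,2)])
  fix p assume p: "p \<in> range P"
  have "(Re (Pv p) - C) / K \<le> M p"
  proof (rule M_ge[OF p])
   fix t assume t: "0 \<le> (t::real)" "p + of_real t \<in> range P"
   have "max 0 (Re (Pv (p + of_real t))) \<le> N (p + of_real t)"
    using kinv_ge[of "Re (Pv (p + of_real t))" R] kinv_gt[of R "Re (Pv (p + of_real t))"] Ra by (simp add: N_def)
   hence "K * max 0 (Re (Pv (p + of_real t))) \<le> K * N (p + of_real t)" using KC(1) by (intro mult_left_mono) auto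
   hence "Re (Pv p) \<le> K * N (p + of_real t) + C" using KC(3)[OF t(1) p t(2)] by linarith
   thus "(Re (Pv p) - C) / K \<le> N (p + of_real t)" using KC(1) by (simp add: field_simps)
  qed
  thus "Re (Pv p) \<le> K * M p + C" using KC(1) by (simp add: field_simps)
 qed
qed

text \<open>Further to the right \<open>N\<close> exceeds \<open>b\<close>, so only a bounded range
  of \<open>t\<close> matters for the infimum in \<open>M\<close>.\<close>

lemma N_bounded_Re: assumes "p \<in> range P" "N p \<le> b" shows "Re p \<le> ln (1 + exp ((b + \<bar>\<beta>\<bar>) / \<alpha>))"
proof (cases "Re p < 0")
 case True
 moreover have "0 \<le> ln (1 + exp ((b + \<bar>\<beta>\<bar>) / \<alpha>))" by simp
 ultimately show ?thesis by linarith
next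
 case False
 obtain L Z where LZ: "lb L" "R \<le> Re Z" "p = P (L Z)" "Pv p = L Z" by (rule range_P_right[OF assms(1) leI[OF False]])
 have Z0: "0 < Re Z" using LZ(2) Ra by simp
 have "\<alpha> * ln (Re Z) - \<beta> \<le> b" using growth[OF LZ(1,2)] assms(2) kinv_ge[of "Re (L Z)" R] LZ(4) by (simp add: N_def)
 hence "\<alpha> * ln (Re Z) \<le> b + \<bar>\<beta>\<bar>" by simp
 hence "ln (Re Z) \<le> (b + \<bar>\<beta>\<bar>) / \<alpha>" using \<alpha> by (simp add: field_simps)
 hence "exp (ln (Re Z)) \<le> exp ((b + \<bar>\<beta>\<bar>) / \<alpha>)" by (rule iffD2[OF exp_le_cancel_iff])
 hence "Re Z \<le> exp ((b + \<bar>\<beta>\<bar>) / \<alpha>)" unfolding exp_ln[OF Z0] .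
 moreover have "Re p = ln (1 + Re Z - R)" using P_lb[OF LZ(1,2)] LZ(3) by simp
 moreover have "ln (1 + Re Z - R) \<le> ln (1 + exp ((b + \<bar>\<beta>\<bar>) / \<alpha>))"
  using calculation(1) LZ(2) Ra by (subst ln_le_cancel_iff) (auto intro: add_pos_pos)
 ultimately show ?thesis by simp
qed

lemma N_cont: "continuous_on (range P) N"
proof -
 have "continuous_on (range P) (\<lambda>p. Re (Pv p))" by (rule continuous_on_Re[OF Pv_cont])
 thus ?thesis unfolding N_def kinv_alt by (intro continuous_intros Pv_cont)
qed

text \<open>Upper semicontinuity holds because \<open>range P\<close> is open: a nearly optimal
  \<open>t\<close> for \<open>p\<close> can be used for \<open>q n\<close> as well. For lower
  semicontinuity, nearly optimal \<open>t n\<close> stay bounded by \<open>N_bounded_Re\<close>, and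
  the limit point belongs to the range by \<open>P_proper\<close>.\<close>

lemma M_tendsto:
 assumes p: "p \<in> range P" and q: "\<And>n. q n \<in> range P" and lim: "q \<longlonglongrightarrow> p"
 shows "(\<lambda>n. M (q n)) \<longlonglongrightarrow> M p"
proof (rule order_tendstoI)
 fix b assume "M p < b"
 then obtain t where t: "0 \<le> t" "p + of_real t \<in> range P" "N (p + of_real t) < b" by (rule M_near[OF p])
 have l: "(\<lambda>n. q n + of_real t) \<longlonglongrightarrow> p + of_real t" by (intro tendsto_intros lim)
 have ev: "\<forall>\<^sub>F n in sequentially. q n + of_real t \<in> range P" using topological_tendstoD[OF l range_P_open t(2)] .
 have "(\<lambda>n. N (q n + of_real t)) \<longlonglongrightarrow> N (p + of_real t)" by (rule continuous_on_tendsto_compose[OF N_cont l t(2) ev])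
 from order_tendstoD(2)[OF this t(3)] ev show "\<forall>\<^sub>F n in sequentially. M (q n) < b" by eventually_elim (use M_le[OF t(1)] in force)
next
 fix b assume b: "b < M p"
 show "\<forall>\<^sub>F n in sequentially. b < M (q n)"
 proof (rule ccontr)
  assume "\<not> ?thesis"
  then obtain r :: "nat \<Rightarrow> nat" where r: "strict_mono r" "\<And>n. M (q (r n)) \<le> b"
   using not_eventually_sequentiallyD[of "\<lambda>n. b < M (q n)"] by (auto simp: not_less)
  define b' where "b' = (b + M p) / 2"
  have b': "b < b'" "b' < M p" using b by (auto simp: b'_def)
  have "\<exists>t. 0 \<le> t \<and> q (r n) + of_real t \<in> range P \<and> N (q (r n) + of_real t) < b'" for n
   using M_near[OF q[of "r n"], of b'] r(2)[of n] b' by (metis le_less_trans)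
  hence "\<forall>n. \<exists>t. 0 \<le> t \<and> q (r n) + of_real t \<in> range P \<and> N (q (r n) + of_real t) < b'" by blast
  then obtain t where t: "\<forall>n. 0 \<le> t n \<and> q (r n) + of_real (t n) \<in> range P \<and> N (q (r n) + of_real (t n)) < b'" by (rule exE[OF choice])
  have t1: "0 \<le> t n" and t2: "q (r n) + of_real (t n) \<in> range P" and t3: "N (q (r n) + of_real (t n)) < b'" for n using t by auto
  have lr: "(\<lambda>n. q (r n)) \<longlonglongrightarrow> p" using LIMSEQ_subseq_LIMSEQ[OF lim r(1)] by (simp add: o_def)
  define B where "B = ln (1 + exp ((b' + \<bar>\<beta>\<bar>) / \<alpha>))"
  have "Bseq (\<lambda>n. q (r n))" using lr by (intro convergent_imp_Bseq convergentI)
  then obtain Q where Q: "\<And>n. norm (q (r n)) \<le> Q" unfolding Bseq_def by auto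
  have tb: "t n \<in> {0..B + Q}" for n
   using N_bounded_Re[OF t2[of n] less_imp_le[OF t3[of n]]] t1[of n] abs_Re_le_cmod[of "q (r n)"] Q[of n] by (simp add: B_def)
  have "compact {0..B + Q}" by simp
  then obtain t0 u where tu: "t0 \<in> {0..B + Q}" "strict_mono u" "(t \<circ> u) \<longlonglongrightarrow> t0" using tb unfolding compact_def by meson
  define w where "w = (\<lambda>n. q (r (u n)) + of_real (t (u n)))"
  have wl: "w \<longlonglongrightarrow> p + of_real t0" unfolding w_def
   using LIMSEQ_subseq_LIMSEQ[OF lr tu(2)] tu(3) by (intro tendsto_intros) (auto simp: o_def)
  have wr: "w n \<in> range P" for n using t2 by (simp add: w_def)
  have pr: "p + of_real t0 \<in> range P"
  proof (rule P_proper[of "\<lambda>n. Pv (w n)" b'])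
   show "Re (Pv (w n)) \<le> b'" for n using t3[of "u n"] kinv_ge[of "Re (Pv (w n))" R] by (simp add: N_def w_def)
   show "(\<lambda>n. P (Pv (w n))) \<longlonglongrightarrow> p + of_real t0" using wl P_Pv[OF wr] by simp
  qed
  have "(\<lambda>n. N (w n)) \<longlonglongrightarrow> N (p + of_real t0)" using wr by (intro continuous_on_tendsto_compose[OF N_cont wl pr]) auto
  hence "N (p + of_real t0) \<le> b'" by (rule LIMSEQ_le_const2) (use t3 in \<open>auto simp: w_def intro: less_imp_le\<close>)
  moreover have "M p \<le> N (p + of_real t0)" using tu pr by (intro M_le) auto
  ultimately show False using b' by linarith
 qed
qed

text \<open>\<open>tau\<close> tends to 0 on the left, as is needed for joining \<open>Phi\<close>
  to the identity. In a tract, where \<open>Re p = ln (1 + Re Z - R)\<close>, it is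
  \<open>1 + (1 - 1 / (1 + Re Z - R)) / 8\<close>: still strictly increasing, but with Lipschitz
  constant 1/8 in \<open>Z\<close>.\<close>

lemma tau_props: "0 < tau t" "tau t < 9/8" "t \<le> 0 \<Longrightarrow> tau t = exp t" "0 \<le> t \<Longrightarrow> tau t = 1 + (1 - exp (- t)) / 8"
proof -
 have e: "0 < exp t" "0 < exp (- t)" by simp_all
 have "0 < tau t \<and> tau t < 9/8"
 proof (cases "t \<le> 0")
  case True
  hence "exp t \<le> 1" by simp
  hence "exp t < 9/8" by linarith
  thus ?thesis using True e by (simp add: tau_def)
 next
  case False
  hence "exp (- t) \<le> 1" by simp
  hence "0 < 1 + (1 - exp (- t)) / 8 \<and> 1 + (1 - exp (- t)) / 8 < 9/8" using e unfolding diff_divide_distrib by linarith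
  thus ?thesis using False unfolding tau_def by simp
 qed
 thus "0 < tau t" "tau t < 9/8" by blast+
qed (auto simp: tau_def)

lemma tau_strict: assumes "s < t" shows "tau s < tau t"
proof -
 have e: "exp s < exp t" "exp (- t) < exp (- s)" using assms by simp_all
 consider "t \<le> 0" | "0 < t" "s \<le> 0" | "0 < s" using assms by linarith
 thus ?thesis
 proof cases
  case 2
  hence "exp s \<le> 1" "exp (- t) < 1" by simp_all
  hence "exp s < 1 + (1 - exp (- t)) / 8" unfolding diff_divide_distrib by linarith
  thus ?thesis using 2 unfolding tau_def by simp
 qed (use e assms in \<open>auto simp: tau_def\<close>)
qed

lemma tau_cont: "continuous_on UNIV tau"
proof -
 have e: "tau = (\<lambda>t. exp (min t 0) + (1 - exp (- max t 0)) / 8)" by (auto simp: tau_def min_def max_def)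
 show ?thesis unfolding e by (intro continuous_intros) simp
qed

lemma G_cont: "continuous_on (range P) G"
proof (rule continuous_on_sequentiallyI)
 fix u a' assume u: "\<forall>n. u n \<in> range P" "a' \<in> range P" "u \<longlonglongrightarrow> a'"
 have "(\<lambda>n. M (u n)) \<longlonglongrightarrow> M a'" using u by (intro M_tendsto) auto
 moreover have "(\<lambda>n. tau (Re (u n))) \<longlonglongrightarrow> tau (Re a')"
  using u(3) by (intro continuous_on_tendsto_compose[OF tau_cont] tendsto_intros) auto
 ultimately show "(\<lambda>n. G (u n)) \<longlonglongrightarrow> G a'" unfolding G_def using u(3) by (intro tendsto_intros)
qed

lemma Phi_left: "Re z \<le> R \<Longrightarrow> Phi z = z" by (simp add: Phi_def)

lemma Phi_right: assumes "R < Re z"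
 shows "Re (Phi z) = M (P (chi R z)) + tau (Re (P (chi R z)))" "Im (Phi z) = Im (P (chi R z))"
  "R < Re (Phi z)" "Re (Phi z) \<le> Re z + 9/8"
proof -
 show e: "Re (Phi z) = M (P (chi R z)) + tau (Re (P (chi R z)))" and "Im (Phi z) = Im (P (chi R z))" using assms by (auto simp: Phi_def G_def)
 show "R < Re (Phi z)" using M_R[of "P (chi R z)"] tau_props(1)[of "Re (P (chi R z))"] e by simp
 have "M (P (chi R z)) \<le> Re z" using M_le_N[of "P (chi R z)"] kinv_kk[OF assms] by simp
 thus "Re (Phi z) \<le> Re z + 9/8" using tau_props(2)[of "Re (P (chi R z))"] e by simp
qed

lemma Phi_tpi: "Phi (z + of_int n * tpi) = Phi z + of_int n * tpi"
proof (cases "Re z \<le> R")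
 case False
 have "chi R (z + of_int n * tpi) = chi R z + of_int n * tpi" by (simp add: chi_def complex_eq_iff)
 hence "P (chi R (z + of_int n * tpi)) = P (chi R z) + of_int n * tpi" by (simp only: P_tpi)
 hence "Phi (z + of_int n * tpi) = G (P (chi R z) + of_int n * tpi)" using False by (simp add: Phi_def)
 thus ?thesis using False M_tpi[of "P (chi R z)" n] by (simp add: Phi_def G_def complex_eq_iff)
qed (simp add: Phi_def)

lemma P_chi_inj: assumes "R < Re z" "R < Re w" "P (chi R z) = P (chi R w)" shows "z = w"
proof -
 have "chi R z = chi R w" by (rule injD[OF P_inj assms(3)])
 hence e: "kk R (Re z) = kk R (Re w)" "Im z = Im w" by (simp_all add: chi_def)
 have "Re z = kinv R (kk R (Re z))" by (rule kinv_kk[OF assms(1), symmetric])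
 also have "\<dots> = Re w" unfolding e by (rule kinv_kk[OF assms(2)])
 finally show ?thesis using e by (simp add: complex_eq_iff)
qed

lemma Phi_inj: "inj Phi"
proof (rule injI)
 fix z w assume eq: "Phi z = Phi w"
 have *: "R < Re z \<longleftrightarrow> R < Re (Phi z)" for z using Phi_left[of z] Phi_right(3)[of z] by (cases "R < Re z") auto
 have less: False if zw: "R < Re z" "R < Re w" "Phi z = Phi w" "Re (P (chi R z)) < Re (P (chi R w))" for z w
 proof -
  define t where "t = Re (P (chi R w)) - Re (P (chi R z))"
  have pw: "P (chi R w) = P (chi R z) + of_real t" using zw Phi_right(2)[of z] Phi_right(2)[of w] by (simp add: t_def complex_eq_iff)
  have "M (P (chi R z)) \<le> M (P (chi R z) + of_real t)" using pw zw(4) by (intro M_mono) (auto simp: t_def simp flip: pw)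
  thus False using tau_strict[OF zw(4)] zw(3) Phi_right(1)[OF zw(1)] Phi_right(1)[OF zw(2)] pw by simp
 qed
 show "z = w"
 proof (cases "R < Re z")
  case True
  hence w: "R < Re w" using * eq by metis
  have "Re (P (chi R z)) = Re (P (chi R w))" using less[OF True w eq] less[OF w True eq[symmetric]] by (metis linorder_neqE)
  hence "P (chi R z) = P (chi R w)" using Phi_right(2)[OF True] Phi_right(2)[OF w] eq by (simp add: complex_eq_iff)
  thus ?thesis by (rule P_chi_inj[OF True w])
 next
  case False
  hence "\<not> R < Re w" using * eq by metis
  thus ?thesis using False eq by (simp add: Phi_left)
 qed
qed

lemma Phi_bound_near: assumes "R < Re z"
 shows "norm (Phi z - z) \<le> (Re z - R) + tau (Re (P (chi R z))) + \<bar>Im z - Im (P (chi R z))\<bar>"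
proof -
 have "M (P (chi R z)) \<le> Re z" "R \<le> M (P (chi R z))" using M_le_N[of "P (chi R z)"] kinv_kk[OF assms] M_R[of "P (chi R z)"] by simp_all
 hence "\<bar>Re (Phi z - z)\<bar> \<le> (Re z - R) + tau (Re (P (chi R z)))" using tau_props(1)[of "Re (P (chi R z))"] Phi_right(1)[OF assms] by simp
 moreover have "\<bar>Im (Phi z - z)\<bar> = \<bar>Im z - Im (P (chi R z))\<bar>" using Phi_right(2)[OF assms] by simp
 ultimately show ?thesis using cmod_le[of "Phi z - z"] by linarith
qed

lemma Phi_cont: "continuous_on UNIV Phi"
proof -
 have cr: "isCont Phi z" if "R < Re z" for z
 proof -
  have "continuous_on {z. R < Re z} (\<lambda>z. G (P (chi R z)))"
   by (intro continuous_on_compose2[OF G_cont] continuous_on_compose2[OF P_cont] chi_cont) auto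
  hence "continuous_on {z. R < Re z} Phi" by (rule continuous_on_eq) (auto simp: Phi_def)
  thus ?thesis using that by (simp add: continuous_on_eq_continuous_at open_halfspace_Re_gt)
 qed
 \<comment> \<open>\<open>chi R\<close> sends points just to the right of the line
   \<open>Re z = R\<close> far to the left. There \<open>P\<close> keeps heights up to a small error
   because \<open>Im (lam 0) = 0\<close>, and \<open>tau\<close> is small; \<open>M\<close> lies
   between \<open>R\<close> and \<open>Re z\<close> anyway.\<close>
 have cl: "isCont Phi z0" if z0: "Re z0 \<le> R" for z0 unfolding continuous_at_eps_delta
 proof (intro allI impI)
  fix e :: real assume e: "e > 0"
  obtain x where x: "\<And>z. Re z \<le> x \<Longrightarrow> norm (P z - z - lam 0) < min 1 (e/4)" by (rule P_left[of "min 1 (e/4)"]) (use e in auto)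
  define x' where "x' = min x (min (ln (e/8) - \<bar>Re (lam 0)\<bar> - 1) (- \<bar>Re (lam 0)\<bar> - 1))"
  define d where "d = min (e/4) (min 1 (exp (x' - R - 1)))"
  have d: "d > 0" "d \<le> e/4" "d \<le> 1" "d \<le> exp (x' - R - 1)" using e by (auto simp: d_def)
  have key: "norm (Phi z - z) \<le> 3 * e / 4" if z: "Re z < R + d" for z
  proof (cases "Re z \<le> R")
   case False
   hence zR: "R < Re z" by simp
   have "kk R (Re z) \<le> x'"
   proof (cases "R + 1 \<le> Re z")
    case False
    hence "ln (Re z - R) < ln (exp (x' - R - 1))" using z d zR by (subst ln_less_cancel_iff) auto
    thus ?thesis using False by (simp add: kk_def)
   qed (use z d in auto)
   hence c: "Re (chi R z) \<le> x'" by simp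
   hence n: "norm (P (chi R z) - chi R z - lam 0) < min 1 (e/4)" by (intro x) (simp add: x'_def)
   hence "\<bar>Re (P (chi R z) - chi R z - lam 0)\<bar> < 1" using abs_Re_le_cmod le_less_trans by fastforce
   hence "Re (P (chi R z)) \<le> ln (e/8)" "Re (P (chi R z)) \<le> 0" using c by (auto simp: x'_def)
   hence "tau (Re (P (chi R z))) \<le> exp (ln (e/8))" using tau_props(3) by simp
   hence "tau (Re (P (chi R z))) \<le> e/8" using e by simp
   moreover have "\<bar>Im z - Im (P (chi R z))\<bar> \<le> e/4"
   proof -
    have "\<bar>Im (P (chi R z)) - Im z\<bar> \<le> norm (P (chi R z) - chi R z - lam 0)"
     using abs_Im_le_cmod[of "P (chi R z) - chi R z - lam 0"] lam(3) by simp
    thus ?thesis using n by linarith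
   qed
   ultimately show ?thesis using Phi_bound_near[OF zR] z d by linarith
  qed (use e in \<open>simp add: Phi_left\<close>)
  show "\<exists>d>0. \<forall>z. dist z z0 < d \<longrightarrow> dist (Phi z) (Phi z0) < e"
  proof (intro exI[of _ d] conjI allI impI)
   fix z assume zd: "dist z z0 < d"
   hence "Re z < R + d" using abs_Re_le_cmod[of "z - z0"] z0 by (simp add: dist_norm)
   hence "norm (Phi z - z) \<le> 3 * e / 4" by (rule key)
   moreover have "norm (z - z0) < e / 4" using zd d by (simp add: dist_norm)
   ultimately show "dist (Phi z) (Phi z0) < e" using Phi_left[OF z0] norm_triangle_ineq[of "Phi z - z" "z - z0"] by (simp add: dist_norm)
  qed (use d in auto)
 qed
 show ?thesis using cr cl by (intro continuous_at_imp_continuous_on) (metis not_le)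
qed

end

text \<open>The interface between the geometry of the tracts and the dynamics. The prefix
  \<open>s\<close> refers to the branch in straight coordinates, the prefix \<open>v\<close> to its
  action on heights. \<open>s_lip\<close> makes it a contraction, and \<open>s_log\<close> controls
  points whose distance is proportional to their real part. By \<open>v_eq\<close> and
  \<open>v_dense\<close>, the intervals \<open>range (v L)\<close> are disjoint for different tracts
  and have a dense union.\<close>

locale model = tracts +
 fixes \<Phi> :: "complex \<Rightarrow> complex" and v :: "(complex \<Rightarrow> complex) \<Rightarrow> real \<Rightarrow> real" and C :: real
 assumes C1: "1 \<le> C"
  and \<Phi>_homeo: "homeomorphism UNIV UNIV \<Phi> (inv \<Phi>)"
  and \<Phi>_left: "Re z \<le> R \<Longrightarrow> \<Phi> z = z" and \<Phi>_right: "R < Re z \<Longrightarrow> R < Re (\<Phi> z)"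
  and \<Phi>_tpi: "\<Phi> (z + of_int n * tpi) = \<Phi> z + of_int n * tpi"
  and \<Phi>_near: "R \<le> Re z \<Longrightarrow> norm (\<Phi> z - z) \<le> C * Re z"
  and \<Phi>_coarse: "R \<le> Re z \<Longrightarrow> Re z \<le> C * Re (\<Phi> z)"
  and s_Im: "lbranch g a L \<Longrightarrow> R \<le> Re Z \<Longrightarrow> Im (\<Phi> (lt R L Z)) = v L (Im Z)"
  and s_lip: "lbranch g a L \<Longrightarrow> R \<le> Re Z \<Longrightarrow> R \<le> Re W \<Longrightarrow> norm (\<Phi> (lt R L Z) - \<Phi> (lt R L W)) \<le> 1/2 * norm (Z - W)"
  and s_log: "lbranch g a L \<Longrightarrow> R \<le> x \<Longrightarrow> x \<le> Re Z \<Longrightarrow> x \<le> Re W \<Longrightarrow>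
   norm (\<Phi> (lt R L Z) - \<Phi> (lt R L W)) \<le> 12 * pi / (x - a) * norm (Z - W) + 7"
  and s_mono: "lbranch g a L \<Longrightarrow> R \<le> Re Z \<Longrightarrow> Re Z < Re W \<Longrightarrow> Im Z = Im W \<Longrightarrow> Re (\<Phi> (lt R L Z)) < Re (\<Phi> (lt R L W))"
  and s_top: "lbranch g a L \<Longrightarrow> \<exists>x\<ge>R. B \<le> Re (\<Phi> (lt R L (Complex x y)))"
  and v_lip: "lbranch g a L \<Longrightarrow> \<bar>v L y - v L y'\<bar> \<le> 1/4 * \<bar>y - y'\<bar>"
  and v_mono: "lbranch g a L \<Longrightarrow> strict_mono (v L)"
  and v_range: "lbranch g a L \<Longrightarrow> \<bar>v L y - v L y'\<bar> \<le> 2 * pi"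
  and v_eq: "lbranch g a L \<Longrightarrow> lbranch g a L' \<Longrightarrow> v L y = v L' y' \<Longrightarrow>
   \<exists>k::int. y' = y + 2 * pi * of_int k \<and> (\<forall>W. a < Re W \<longrightarrow> L' (W + of_int k * tpi) = L W)"
  and v_dense: "b < c \<Longrightarrow> \<exists>L y. lbranch g a L \<and> b < v L y \<and> v L y < c"

context riemann begin

text \<open>On each leaf the first coordinate of \<open>G\<close> takes all values above
  \<open>R\<close>. If the leaf enters a tract, it becomes large by \<open>growth\<close> and coarse
  monotonicity. If it does not, boundedness would put its end point into
  \<open>range P\<close>.\<close>

lemma Phi_surj: "surj Phi"
proof -
 have "\<exists>z. Phi z = w" for w
 proof (cases "Re w \<le> R")
  case False
  define X v where "X = Re w" and "v = Im w"
  have X: "R < X" using False by (simp add: X_def)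
  define h where "h = (\<lambda>x. Re (G (Complex x v)))"
  have h: "h x = M (Complex x v) + tau x" for x by (simp add: h_def G_def)
  define J where "J = {x. Complex x v \<in> range P}"
  have J: "J = (if v \<in> I then UNIV else {..<0})" by (auto simp: J_def range_P)
  obtain C1 where C1: "0 \<le> C1" "\<And>p. Re p \<le> -1/2 \<Longrightarrow> Re (Pv p) \<le> C1" by (rule Pv_left_bounded) blast
  obtain C2 where C2: "0 \<le> C2" "\<And>z. Re z \<le> C1 \<Longrightarrow> norm (z - P z) \<le> C2" by (rule P_near) blast
  obtain K C where KC: "1 \<le> K" "0 \<le> C" "\<And>p. p \<in> range P \<Longrightarrow> Re (Pv p) \<le> K * M p + C" by (rule M_coarse) blast
  define \<delta> where "\<delta> = (X - R) / 3"
  have \<delta>: "0 < \<delta>" using X by (simp add: \<delta>_def)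
  \<comment> \<open>Chosen such that \<open>N\<close> exceeds \<open>R\<close> and
    \<open>tau\<close> exceeds 0 by at most a third of \<open>X - R\<close> each.\<close>
  define x1 where "x1 = min (-1/2) (min (ln \<delta> - C2) (R - C2))"
  have x1: "x1 \<le> -1/2" "x1 \<le> ln \<delta> - C2" "x1 \<le> R - C2" by (auto simp: x1_def)
  have x1J: "x1 \<in> J" using x1(1) by (auto simp: J_def intro!: left_range)
  have "h x1 < X"
  proof -
   let ?p = "Complex x1 v"
   have "norm (Pv ?p - P (Pv ?p)) \<le> C2" using C1(2)[of ?p] x1(1) by (intro C2(2)) simp
   hence "Re (Pv ?p) \<le> x1 + C2" using P_Pv[of ?p] x1J abs_Re_le_cmod[of "Pv ?p - ?p"] by (simp add: J_def)
   hence r: "Re (Pv ?p) < R + 1" "Re (Pv ?p) - R - 1 \<le> ln \<delta>" using x1 Ra by linarith+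
   hence "exp (Re (Pv ?p) - R - 1) \<le> exp (ln \<delta>)" by (rule_tac iffD2[OF exp_le_cancel_iff])
   hence "N ?p \<le> R + \<delta>" using r \<delta> by (simp add: N_def kinv_def)
   moreover have "tau x1 \<le> \<delta>"
   proof -
    have "exp x1 \<le> exp (ln \<delta>)" using x1 C2(1) by (intro iffD2[OF exp_le_cancel_iff]) linarith
    thus ?thesis using tau_props(3)[of x1] x1(1) \<delta> by simp
   qed
   moreover have "M ?p \<le> N ?p" using x1J by (intro M_le_N) (simp add: J_def)
   moreover have "X = R + 3 * \<delta>" by (simp add: \<delta>_def field_simps)
   ultimately show ?thesis unfolding h using \<delta> by linarith
  qed
  have "\<exists>x2\<in>J. X \<le> h x2"
  proof (cases "v \<in> I")
   case True
   then obtain L y where L: "lb L" "v = vt L y" by (auto simp: I_def)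
   define x where "x = max R (exp ((K * X + C + \<beta>) / \<alpha>))"
   have x: "R \<le> x" "exp ((K * X + C + \<beta>) / \<alpha>) \<le> x" "0 < x" using Ra by (auto simp: x_def)
   have "(K * X + C + \<beta>) / \<alpha> \<le> ln x" using x by (simp add: ln_ge_iff)
   hence "K * X + C \<le> \<alpha> * ln x - \<beta>" using \<alpha> by (simp add: field_simps)
   also have "\<dots> \<le> Re (L (Complex x y))" using growth[OF L(1), of "Complex x y"] x by simp
   also have "\<dots> \<le> K * M (P (L (Complex x y))) + C" using KC(3)[of "P (L (Complex x y))"] by simp
   finally have "K * X \<le> K * M (P (L (Complex x y)))" by simp
   hence XM: "X \<le> M (P (L (Complex x y)))" using KC(1) by simp
   define t where "t = ln (1 + x - R)"
   have "P (L (Complex x y)) = Complex t v" using P_lb[OF L(1), of "Complex x y"] x L(2) by (simp add: t_def)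
   hence "X \<le> h t" using XM tau_props(1)[of t] by (simp add: h)
   thus ?thesis using True J by auto
  next
   case False
   show ?thesis
   proof (rule ccontr)
    assume "\<not> ?thesis"
    hence lt: "h x < X" if "x < 0" for x using that False J by (auto simp: not_le)
    define p where "p = (\<lambda>n. Complex (- inverse (real (Suc n))) v)"
    have p: "p n \<in> range P" for n by (rule left_range) (simp add: p_def)
    have "Complex 0 v \<in> range P"
    proof (rule P_proper[of "\<lambda>n. Pv (p n)" "K * X + C"])
     fix n
     have "M (p n) \<le> X" using lt[of "- inverse (real (Suc n))"] tau_props(1)[of "- inverse (real (Suc n))"] by (simp add: h p_def)
     hence "K * M (p n) \<le> K * X" using KC(1) by (intro mult_left_mono) auto
     thus "Re (Pv (p n)) \<le> K * X + C" using KC(3)[OF p[of n]] by linarith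
    next
     have "p \<longlonglongrightarrow> Complex (- 0) v" unfolding p_def by (intro tendsto_intros LIMSEQ_inverse_real_of_nat)
     thus "(\<lambda>n. P (Pv (p n))) \<longlonglongrightarrow> Complex 0 v" using P_Pv[OF p] by simp
    qed
    thus False using False by (simp add: range_P)
   qed
  qed
  then obtain x2 where x2: "x2 \<in> J" "X \<le> h x2" by blast
  have "connected (h ` J)"
  proof (rule connected_continuous_image)
   have "continuous_on J (\<lambda>x. Complex x v)" by (intro continuous_intros)
   hence "continuous_on J (\<lambda>x. G (Complex x v))" by (rule continuous_on_compose2[OF G_cont]) (auto simp: J_def)
   thus "continuous_on J h" unfolding h_def by (rule continuous_on_Re)
   show "connected J" unfolding J by simp
  qed
  hence "X \<in> h ` J" using x1J \<open>h x1 < X\<close> x2 unfolding connected_iff_interval by (meson image_eqI less_imp_le)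
  then obtain x where x: "x \<in> J" "h x = X" by blast
  then obtain z' where z': "Complex x v = P z'" by (auto simp: J_def)
  define z where "z = Complex (kinv R (Re z')) (Im z')"
  have cz: "chi R z = z'" by (simp add: chi_def z_def)
  have "Phi z = G (P z')" using kinv_gt[of R "Re z'"] cz by (simp add: Phi_def z_def not_le)
  also have "\<dots> = w" using x(2) unfolding z'[symmetric] h_def by (simp add: complex_eq_iff X_def v_def G_def)
  finally show ?thesis by blast
 qed (intro exI[of _ w] Phi_left)
 thus ?thesis unfolding surj_def by metis
qed

lemma Phi_homeo: "homeomorphism UNIV UNIV Phi (inv Phi)"
 by (rule plane_homeo[OF Phi_cont Phi_inj Phi_surj])

lemma Phi_coarse_bounds:
 obtains C where "1 \<le> C" "\<And>z. R \<le> Re z \<Longrightarrow> norm (Phi z - z) \<le> C * Re z" "\<And>z. R \<le> Re z \<Longrightarrow> Re z \<le> C * Re (Phi z)"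
proof -
 obtain C0 where C0: "0 \<le> C0" "\<And>z. \<bar>Im z - Im (P z)\<bar> \<le> C0 * (1 + max 0 (Re z))" by (rule spiral) blast
 obtain K C where KC: "1 \<le> K" "0 \<le> C" "\<And>p. p \<in> range P \<Longrightarrow> Re (Pv p) \<le> K * M p + C" by (rule M_coarse) blast
 define C' where "C' = 3 + 2 * C0 + K + C"
 show ?thesis
 proof (rule that[of C'])
  show "1 \<le> C'" using C0(1) KC(1,2) by (simp add: C'_def)
  fix z assume z: "R \<le> Re z"
  have z1: "1 \<le> Re z" using z Ra by simp
  show "norm (Phi z - z) \<le> C' * Re z"
  proof (cases "R < Re z")
   case True
   have "max 0 (Re (chi R z)) \<le> Re z" using kk_le[OF True] z1 by simp
   hence "C0 * (1 + max 0 (Re (chi R z))) \<le> C0 * (Re z + Re z)" using C0(1) z1 by (intro mult_left_mono) linarith+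
   hence "\<bar>Im z - Im (P (chi R z))\<bar> \<le> 2 * C0 * Re z" using C0(2)[of "chi R z"] by simp
   hence "norm (Phi z - z) \<le> Re z + 9/8 + 2 * C0 * Re z" using Phi_bound_near[OF True] tau_props(2)[of "Re (P (chi R z))"] Ra by linarith
   also have "\<dots> \<le> 3 * Re z + 2 * C0 * Re z" using z1 by simp
   also have "\<dots> \<le> C' * Re z" using KC(1,2) z1 by (simp add: C'_def distrib_right)
   finally show ?thesis .
  qed (use z1 \<open>1 \<le> C'\<close> in \<open>simp add: Phi_left\<close>)
  show "Re z \<le> C' * Re (Phi z)"
  proof (cases "R + 1 \<le> Re z")
   case True
   hence zR: "R < Re z" by simp
   define q where "q = Re (Phi z)"
   have q1: "1 \<le> q" using Phi_right(3)[OF zR] Ra by (simp add: q_def)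
   have "Re z \<le> K * M (P (chi R z)) + C" using KC(3)[of "P (chi R z)"] kk_ge[OF True] by simp
   also have "K * M (P (chi R z)) \<le> K * q"
    using Phi_right(1)[OF zR] tau_props(1)[of "Re (P (chi R z))"] KC(1) by (intro mult_left_mono) (auto simp: q_def)
   also have "K * q + C \<le> K * q + C * q + (3 + 2 * C0) * q" 
   proof -
    have "0 \<le> (3 + 2 * C0) * q" "C * 1 \<le> C * q" using q1 C0(1) KC(2) by (intro mult_nonneg_nonneg mult_left_mono; linarith)+
    thus ?thesis by linarith
   qed
   also have "\<dots> = C' * q" by (simp add: C'_def algebra_simps)
   finally show ?thesis by (simp add: q_def)
  next
   case False
   have "R \<le> Re (Phi z)" using Phi_right(3)[of z] Phi_left[of z] z by (cases "R < Re z") auto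
   hence "Re z \<le> 2 * Re (Phi z)" using False Ra by simp
   also have "\<dots> \<le> C' * Re (Phi z)" using \<open>R \<le> Re (Phi z)\<close> Ra C0(1) KC(1,2) by (intro mult_right_mono) (auto simp: C'_def)
   finally show ?thesis .
  qed
 qed
qed

lemma Phi_lt:
 assumes L: "lb L" and Z: "R \<le> Re Z"
 shows "Re (Phi (lt R L Z)) = M (P (L Z)) + 1 + (1 - 1 / (1 + Re Z - R)) / 8" "Im (Phi (lt R L Z)) = vt L (Im Z)"
proof -
 have r: "R < Re (lt R L Z)" by (simp add: kinv_gt)
 have t: "0 \<le> ln (1 + Re Z - R)" and e: "exp (- ln (1 + Re Z - R)) = 1 / (1 + Re Z - R)" using Z by (auto simp: exp_minus inverse_eq_divide)
 show "Re (Phi (lt R L Z)) = M (P (L Z)) + 1 + (1 - 1 / (1 + Re Z - R)) / 8"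
  unfolding Phi_right(1)[OF r] chi_lt using tau_props(4)[OF t] e by (simp add: P_lb[OF L Z])
 show "Im (Phi (lt R L Z)) = vt L (Im Z)" unfolding Phi_right(2)[OF r] chi_lt by (simp add: P_lb[OF L Z])
qed

lemma P_lb_plus:
 assumes L: "lb L" and Z: "R \<le> Re Z" and d: "0 \<le> d"
 obtains t where "0 \<le> t" "P (L (Z + of_real d)) = P (L Z) + of_real t"
proof (rule that[of "ln (1 + Re Z + d - R) - ln (1 + Re Z - R)"])
 show "0 \<le> ln (1 + Re Z + d - R) - ln (1 + Re Z - R)" using Z d by simp
 show "P (L (Z + of_real d)) = P (L Z) + of_real (ln (1 + Re Z + d - R) - ln (1 + Re Z - R))"
  using P_lb[OF L Z] P_lb[OF L, of "Z + of_real d"] Z d by (simp add: complex_eq_iff algebra_simps)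
qed

text \<open>The same shift \<open>d\<close> is applied to both rays: what \<open>N\<close> attains
  further along the ray of \<open>Z\<close>, it nearly attains along the ray of
  \<open>W\<close>.\<close>

lemma M_lip:
 assumes L: "lb L" and x: "R \<le> x" "x \<le> Re Z" "x \<le> Re W"
 shows "M (P (L W)) - 12 * pi / (x - a) * norm (Z - W) \<le> M (P (L Z))"
proof (rule M_ge)
 fix t assume t: "0 \<le> (t::real)"
 have Z: "R \<le> Re Z" "R \<le> Re W" using x by auto
 obtain d where d: "0 \<le> d" "P (L Z) + of_real t = P (L (Z + of_real d))" by (rule P_lb_add[OF L Z(1) t])
 obtain t' where t': "0 \<le> t'" "P (L (W + of_real d)) = P (L W) + of_real t'" by (rule P_lb_plus[OF L Z(2) d(1)])
 have "M (P (L W)) \<le> N (P (L (W + of_real d)))" unfolding t'(2) by (rule M_le[OF t'(1)]) (simp flip: t'(2))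
 also have "\<dots> \<le> N (P (L (Z + of_real d))) + 12 * pi / (x - a) * norm (Z - W)"
 proof -
  have "norm (L (W + of_real d) - L (Z + of_real d)) \<le> 12 * pi / (x - a) * norm ((W + of_real d) - (Z + of_real d))"
   using x Ra d by (intro lb_lip[OF L]) auto
  hence "\<bar>Re (L (W + of_real d)) - Re (L (Z + of_real d))\<bar> \<le> 12 * pi / (x - a) * norm (Z - W)"
   using abs_Re_le_cmod[of "L (W + of_real d) - L (Z + of_real d)"] by (simp add: norm_minus_commute)
  thus ?thesis using kinv_lip[of R "Re (L (W + of_real d))" "Re (L (Z + of_real d))"] by simp
 qed
 finally show "M (P (L W)) - 12 * pi / (x - a) * norm (Z - W) \<le> N (P (L Z) + of_real t)" unfolding d(2) by simp
qed simp

lemma Phi_lt_diff: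
 assumes L: "lb L" and x: "R \<le> x" "x \<le> Re Z" "x \<le> Re W"
 shows "\<bar>Re (Phi (lt R L Z)) - Re (Phi (lt R L W))\<bar> \<le> 12 * pi / (x - a) * norm (Z - W) + min 1 (norm (Z - W)) / 8"
proof -
 have ZW: "R \<le> Re Z" "R \<le> Re W" using x by auto
 define u w where "u = 1 + Re Z - R" and "w = 1 + Re W - R"
 have uw: "1 \<le> u" "1 \<le> w" using ZW by (auto simp: u_def w_def)
 have "\<bar>1/u - 1/w\<bar> \<le> min 1 (norm (Z - W))"
 proof -
  have "0 \<le> 1/u" "1/u \<le> 1" "0 \<le> 1/w" "1/w \<le> 1" using uw by auto
  hence 1: "\<bar>1/u - 1/w\<bar> \<le> 1" by linarith
  have "\<bar>1/u - 1/w\<bar> = \<bar>w - u\<bar> / (u * w)" using uw by (simp add: field_simps abs_divide)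
  also have "\<dots> \<le> \<bar>w - u\<bar> / 1" using uw mult_mono[of 1 u 1 w] by (intro divide_left_mono) auto
  also have "\<dots> \<le> norm (Z - W)" using abs_Re_le_cmod[of "Z - W"] by (simp add: u_def w_def abs_minus_commute)
  finally show ?thesis using 1 by simp
 qed
 moreover have "\<bar>M (P (L Z)) - M (P (L W))\<bar> \<le> 12 * pi / (x - a) * norm (Z - W)"
  using M_lip[OF L x] M_lip[OF L x(1,3,2)] by (simp add: norm_minus_commute)
 ultimately show ?thesis unfolding Phi_lt(1)[OF L ZW(1)] Phi_lt(1)[OF L ZW(2)] u_def[symmetric] w_def[symmetric]
  by (simp add: abs_le_iff diff_divide_distrib) linarith
qed

text \<open>The heights of one tract form an interval and are distinct modulo
  \<open>2 * pi\<close>.\<close>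

lemma vt_range: assumes L: "lb L" shows "\<bar>vt L y - vt L y'\<bar> \<le> 2 * pi"
proof -
 have no: "\<not> vt L y + 2 * pi < vt L y'" for y y'
 proof
  assume yy: "vt L y + 2 * pi < vt L y'"
  have y: "y < y'" using yy strict_mono_less[OF vt(2)[OF L], of y y'] pi_gt_zero by simp
  have "continuous_on {y..y'} (vt L)" by (rule continuous_on_subset[OF vt_cont[OF L]]) simp
  then obtain u where "vt L u = vt L y + 2 * pi" using IVT'[of "vt L" y "vt L y + 2 * pi" y'] yy y pi_gt_zero by auto
  hence "u = y" using vt(3)[OF L, of u y 1] by simp
  thus False using \<open>vt L u = _\<close> by simp
 qed
 show ?thesis using no[of y y'] no[of y' y] by linarith
qed

text \<open>The contraction factor 1/2 is composed of 1/8 for \<open>M\<close>, 1/8 for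
  \<open>tau\<close> and 1/4 for the heights. The constant 7 in \<open>s_log\<close> exceeds
  \<open>2 * pi + 1/8\<close>, the total contribution of heights and \<open>tau\<close> without
  regard to the distance.\<close>

theorem model_exists: "\<exists>C. model g a R \<alpha> \<beta> Phi vt C"
proof -
 obtain C where C: "1 \<le> C" "\<And>z. R \<le> Re z \<Longrightarrow> norm (Phi z - z) \<le> C * Re z" "\<And>z. R \<le> Re z \<Longrightarrow> Re z \<le> C * Re (Phi z)"
  by (rule Phi_coarse_bounds) blast
 obtain K C0 where KC: "1 \<le> K" "0 \<le> C0" "\<And>p. p \<in> range P \<Longrightarrow> Re (Pv p) \<le> K * M p + C0" by (rule M_coarse) blast
 show ?thesis
 proof (rule exI[of _ C], intro model.intro model_axioms.intro)
  fix L assume L: "lb L"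
  fix Z W x assume x: "R \<le> x" "x \<le> Re Z" "x \<le> Re W"
  have "\<bar>vt L (Im Z) - vt L (Im W)\<bar> \<le> 2 * pi" by (rule vt_range[OF L])
  thus "norm (Phi (lt R L Z) - Phi (lt R L W)) \<le> 12 * pi / (x - a) * norm (Z - W) + 7"
   using cmod_le[of "Phi (lt R L Z) - Phi (lt R L W)"] Phi_lt_diff[OF L x] Phi_lt(2)[OF L, of Z] Phi_lt(2)[OF L, of W] x pi_approx by simp
 next
  fix L assume L: "lb L"
  fix Z W assume ZW: "R \<le> Re Z" "R \<le> Re W"
  have "12 * pi / (R - a) * norm (Z - W) \<le> 1/8 * norm (Z - W)" using R pi_approx by (intro mult_right_mono) (auto simp: field_simps)
  moreover have "\<bar>vt L (Im Z) - vt L (Im W)\<bar> \<le> 1/4 * norm (Z - W)" using vt(1)[OF L, of "Im Z" "Im W"] abs_Im_le_cmod[of "Z - W"] by simp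
  moreover have "Im (Phi (lt R L Z) - Phi (lt R L W)) = vt L (Im Z) - vt L (Im W)" using Phi_lt(2)[OF L ZW(1)] Phi_lt(2)[OF L ZW(2)] by simp
  moreover have "min 1 (norm (Z - W)) / 8 \<le> 1/8 * norm (Z - W)" by simp
  moreover have "Re (Phi (lt R L Z) - Phi (lt R L W)) = Re (Phi (lt R L Z)) - Re (Phi (lt R L W))" by simp
  ultimately show "norm (Phi (lt R L Z) - Phi (lt R L W)) \<le> 1/2 * norm (Z - W)"
   using cmod_le[of "Phi (lt R L Z) - Phi (lt R L W)"] Phi_lt_diff[OF L order_refl ZW] by linarith
 next
  fix L Z W assume L: "lb L" and Z: "R \<le> Re Z" "Re Z < Re W" "Im Z = Im W"
  obtain t where t: "0 \<le> t" "P (L (Z + of_real (Re W - Re Z))) = P (L Z) + of_real t"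
   by (rule P_lb_plus[OF L Z(1), of "Re W - Re Z"]) (use Z in auto)
  have "Z + of_real (Re W - Re Z) = W" using Z by (simp add: complex_eq_iff)
  hence "P (L W) = P (L Z) + of_real t" using t(2) by simp
  hence "M (P (L Z)) \<le> M (P (L W))" using M_mono[of "P (L Z)" t] t(1) by (metis rangeI)
  moreover have "1 / (1 + Re W - R) < 1 / (1 + Re Z - R)" using Z by (intro divide_strict_left_mono) auto
  hence "(1 - 1 / (1 + Re Z - R)) / 8 < (1 - 1 / (1 + Re W - R)) / 8" by (intro divide_strict_right_mono) auto
  ultimately show "Re (Phi (lt R L Z)) < Re (Phi (lt R L W))" 
   using Phi_lt(1)[OF L Z(1)] Phi_lt(1)[OF L order_trans[OF Z(1) less_imp_le[OF Z(2)]]] by linarith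
 next
  fix L B y assume L: "lb L"
  define x where "x = max R (exp ((K * max 0 B + C0 + \<beta>) / \<alpha>))"
  have x: "R \<le> x" "exp ((K * max 0 B + C0 + \<beta>) / \<alpha>) \<le> x" "0 < x" using Ra by (auto simp: x_def)
  have "(K * max 0 B + C0 + \<beta>) / \<alpha> \<le> ln x" using x by (simp add: ln_ge_iff)
  hence "K * max 0 B + C0 \<le> \<alpha> * ln x - \<beta>" using \<alpha> by (simp add: field_simps)
  also have "\<dots> \<le> Re (L (Complex x y))" using growth[OF L, of "Complex x y"] x by simp
  also have "\<dots> \<le> K * M (P (L (Complex x y))) + C0" using KC(3)[of "P (L (Complex x y))"] by simp
  finally have "K * max 0 B \<le> K * M (P (L (Complex x y)))" by simp
  hence "max 0 B \<le> M (P (L (Complex x y)))" using KC(1) by simp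
  moreover have "M (P (L (Complex x y))) \<le> Re (Phi (lt R L (Complex x y)))" using Phi_lt(1)[OF L, of "Complex x y"] x by simp
  ultimately show "\<exists>x\<ge>R. B \<le> Re (Phi (lt R L (Complex x y)))" using x(1) by (intro exI[of _ x]) auto
 next
  fix L L' y y' assume L: "lb L" "lb L'" "vt L y = vt L' y'"
  have "P (L (Complex R y)) = P (L' (Complex R y'))" using P_lb[OF L(1), of "Complex R y"] P_lb[OF L(2), of "Complex R y'"] L(3) by simp
  hence e: "L (Complex R y) = L' (Complex R y')" by (rule injD[OF P_inj])
  obtain k n :: int where k: "Complex R y' = Complex R y + of_int k * tpi" "\<And>W. a < Re W \<Longrightarrow> L' (W + of_int k * tpi) = L W + of_int n * tpi"
   by (rule lb_meet[OF L(1,2), of "Complex R y" "Complex R y'"]) (use Ra e in auto)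
  have "n = 0" using k(2)[of "Complex R y"] k(1) e Ra by simp
  moreover have "y' = y + 2 * pi * of_int k" using k(1) by (simp add: complex_eq_iff)
  ultimately show "\<exists>k::int. y' = y + 2 * pi * of_int k \<and> (\<forall>W. a < Re W \<longrightarrow> L' (W + of_int k * tpi) = L W)"
   using k(2) by (intro exI[of _ k]) auto
 next
  fix b c :: real assume "b < c"
  then obtain u where "u \<in> I" "b < u" "u < c" by (rule I_dense)
  thus "\<exists>L y. lb L \<and> b < vt L y \<and> vt L y < c" by (auto simp: I_def)
 qed (use C Phi_homeo Phi_left Phi_right(3) Phi_tpi Phi_lt(2) vt(1,2) vt_range in \<open>auto intro: tracts_axioms\<close>)
qed

end

section \<open>The pullback conjugacy\<close>

text \<open>A substitute for \<open>Ln (x n)\<close>, which may jump at the negative real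
  axis.\<close>

lemma Ln_lift:
 assumes "x \<longlonglongrightarrow> l" "l \<noteq> 0" "\<And>n. x n \<noteq> 0"
 obtains z where "z \<longlonglongrightarrow> Ln l" "\<And>n. exp (z n) = x n"
proof (rule that[of "\<lambda>n. Ln l + Ln (x n / l)"])
 have "(\<lambda>n. x n / l) \<longlonglongrightarrow> l / l" by (intro tendsto_intros assms)
 hence "(\<lambda>n. Ln (x n / l)) \<longlonglongrightarrow> Ln 1" using assms(2) by (intro tendsto_Ln) auto
 from tendsto_add[OF tendsto_const this, of "Ln l"] show "(\<lambda>n. Ln l + Ln (x n / l)) \<longlonglongrightarrow> Ln l" by simp
qed (use assms in \<open>simp add: exp_add\<close>)

lemma half_powers: "(\<lambda>n. c / 2 ^ n) \<longlonglongrightarrow> (0::real)"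
 using tendsto_mult_right_zero[OF LIMSEQ_power_zero[of "1/2::real"], of c] by (simp add: power_one_over field_simps)

lemma half_powers_less: assumes "0 < e" obtains n0 where "\<And>n. n0 \<le> n \<Longrightarrow> c / 2 ^ n < (e::real)"
 using order_tendstoD(2)[OF half_powers assms, of c] unfolding eventually_sequentially by blast

lemma geometric_limit:
 fixes f :: "nat \<Rightarrow> 'a::topological_space \<Rightarrow> complex"
 assumes D: "\<And>n z. norm (f (Suc n) z - f n z) \<le> D / 2 ^ n"
 obtains g where "\<And>n z. norm (f n z - g z) \<le> 2 * D / 2 ^ n" "\<And>z. (\<lambda>n. f n z) \<longlonglongrightarrow> g z"
  "(\<And>n. continuous_on UNIV (f n)) \<Longrightarrow> continuous_on UNIV g"
proof -
 have D0: "0 \<le> D" using order_trans[OF norm_ge_zero D[of 0 undefined]] by simp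
 have tail: "norm (f (n + k) z - f n z) \<le> 2 * D / 2 ^ n - 2 * D / 2 ^ (n + k)" for n k z
 proof (induction k)
  case (Suc k)
  have "norm (f (n + Suc k) z - f n z) \<le> norm (f (Suc (n + k)) z - f (n + k) z) + norm (f (n + k) z - f n z)"
   using norm_triangle_ineq[of "f (Suc (n + k)) z - f (n + k) z" "f (n + k) z - f n z"] by simp
  also have "\<dots> \<le> D / 2 ^ (n + k) + (2 * D / 2 ^ n - 2 * D / 2 ^ (n + k))" using D Suc by (intro add_mono)
  also have "\<dots> = 2 * D / 2 ^ n - 2 * D / 2 ^ (n + Suc k)" by (simp add: field_simps)
  finally show ?case .
 qed simp
 have tail': "norm (f m z - f n z) \<le> 2 * D / 2 ^ n" if "n \<le> m" for m n z
 proof -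
  have "0 \<le> 2 * D / 2 ^ (n + (m - n))" using D0 by simp
  thus ?thesis using tail[of n "m - n" z] that by simp
 qed
 have "Cauchy (\<lambda>n. f n z)" for z
 proof (rule CauchyI)
  fix e :: real assume "e > 0"
  then obtain n0 where n0: "2 * D / 2 ^ n0 < e / 2" using half_powers_less[of "e / 2" "2 * D"] by auto
  show "\<exists>M. \<forall>m\<ge>M. \<forall>n\<ge>M. norm (f m z - f n z) < e"
  proof (intro exI[of _ n0] allI impI)
   fix m n assume "n0 \<le> m" "n0 \<le> n"
   hence "norm (f m z - f n0 z) < e / 2" "norm (f n z - f n0 z) < e / 2" using tail'[of n0] n0 by (metis le_less_trans)+
   thus "norm (f m z - f n z) < e" using norm_triangle_ineq4[of "f m z - f n0 z" "f n z - f n0 z"] by simp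
  qed
 qed
 hence "\<forall>z. \<exists>l. (\<lambda>n. f n z) \<longlonglongrightarrow> l" by (simp add: Cauchy_convergent_iff convergent_def)
 then obtain g where g: "\<forall>z. (\<lambda>n. f n z) \<longlonglongrightarrow> g z" by (rule exE[OF choice])
 have b: "norm (f n z - g z) \<le> 2 * D / 2 ^ n" for n z
 proof -
  have "(\<lambda>m. norm (f m z - f n z)) \<longlonglongrightarrow> norm (g z - f n z)" by (intro tendsto_intros g[rule_format])
  hence "norm (g z - f n z) \<le> 2 * D / 2 ^ n" by (rule LIMSEQ_le_const2) (use tail' in blast)
  thus ?thesis by (simp add: norm_minus_commute)
 qed
 show ?thesis
 proof (rule that[OF b])
  assume c: "\<And>n. continuous_on UNIV (f n)"
  have "uniform_limit UNIV f g sequentially"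
  proof (rule uniform_limitI)
   fix e :: real assume "e > 0"
   hence "\<forall>\<^sub>F n in sequentially. 2 * D / 2 ^ n < e" by (rule order_tendstoD(2)[OF half_powers])
   thus "\<forall>\<^sub>F n in sequentially. \<forall>x\<in>UNIV. dist (f n x) (g x) < e"
    by eventually_elim (use b in \<open>auto simp: dist_norm intro: le_less_trans\<close>)
  qed
  thus "continuous_on UNIV g" using c by (intro uniform_limit_theorem[where f=f and F=sequentially]) (auto intro: always_eventually)
 qed (use g in blast)
qed

lemma model_mono:
 assumes m: "model g a R \<alpha> \<beta> \<Phi> v C" and C: "C \<le> C'" shows "model g a R \<alpha> \<beta> \<Phi> v C'"
proof -
 interpret model g a R \<alpha> \<beta> \<Phi> v C by (rule m)
 have 1: "norm (\<Phi> z - z) \<le> C' * Re z" if "R \<le> Re z" for z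
 proof -
  have "C * Re z \<le> C' * Re z" using C that Ra by (intro mult_right_mono) auto
  thus ?thesis using \<Phi>_near[OF that] by linarith
 qed
 have 2: "Re z \<le> C' * Re (\<Phi> z)" if "R \<le> Re z" for z
 proof -
  have "0 \<le> Re (\<Phi> z)" using \<Phi>_right[of z] \<Phi>_left[of z] that Ra by (cases "R < Re z") auto
  hence "C * Re (\<Phi> z) \<le> C' * Re (\<Phi> z)" using C by (intro mult_right_mono)
  thus ?thesis using \<Phi>_coarse[OF that] by linarith
 qed
 show ?thesis using m C C1 1 2 unfolding model_def model_axioms_def by (elim conjE) (intro conjI; (assumption | linarith | blast))
qed

text \<open>All maps share \<open>a\<close>, \<open>R\<close> and \<open>C\<close>, so the estimates
  are uniform in the index.\<close>

locale system =
 fixes h :: "nat \<Rightarrow> complex \<Rightarrow> complex" and a R :: real and \<alpha> \<beta> :: "nat \<Rightarrow> real"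
  and \<Phi> :: "nat \<Rightarrow> complex \<Rightarrow> complex" and v :: "nat \<Rightarrow> (complex \<Rightarrow> complex) \<Rightarrow> real \<Rightarrow> real" and C :: real and N :: nat
 assumes md: "model (h m) a R (\<alpha> m) (\<beta> m) (\<Phi> m) (v m) C"
  and N0: "0 < N" and per: "h (m + N) = h m" "\<Phi> (m + N) = \<Phi> m" "v (m + N) = v m"
begin

lemmas tr = model.axioms(1)[OF md]

abbreviation "lbm m \<equiv> lbranch (h m) a"

definition S :: "nat \<Rightarrow> (complex \<Rightarrow> complex) \<Rightarrow> complex \<Rightarrow> complex" where "S m L Z = \<Phi> m (lt R L Z)"

lemmas Ra = tracts.Ra[OF tr] and C1 = model.C1[OF md]
lemmas S_Im = model.s_Im[OF md, folded S_def] and S_lip = model.s_lip[OF md, folded S_def]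
 and S_log = model.s_log[OF md, folded S_def] and S_mono = model.s_mono[OF md, folded S_def] and S_top = model.s_top[OF md, folded S_def]

lemma R400: "a + 400 \<le> R" "0 \<le> a" using tr[unfolded tracts_def] by auto

text \<open>The maps that can be pulled back: they fix a left half plane and commute with
  \<open>tpi\<close>, so that their lifts through the branches are well defined and can be glued to
  the identity.\<close>

definition good :: "(complex \<Rightarrow> complex) \<Rightarrow> bool" where
 "good f \<longleftrightarrow> continuous_on UNIV f \<and> (\<forall>z. Re z \<le> R \<longrightarrow> f z = z) \<and> (\<forall>z. R < Re z \<longrightarrow> R < Re (f z)) \<and>
   (\<forall>z n. f (z + of_int n * tpi) = f z + of_int n * tpi)"

lemma goodD: assumes "good f"
 shows "continuous_on UNIV f" "Re z \<le> R \<Longrightarrow> f z = z" "R < Re z \<Longrightarrow> R < Re (f z)" "f (z + of_int n * tpi) = f z + of_int n * tpi"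
  "R \<le> Re z \<Longrightarrow> R \<le> Re (f z)" "a < Re z \<Longrightarrow> a < Re (f z)" "R < Re (f z) \<longleftrightarrow> R < Re z"
proof -
 have f: "Re z \<le> R \<Longrightarrow> f z = z" "R < Re z \<Longrightarrow> R < Re (f z)" for z using assms by (auto simp: good_def)
 show "R \<le> Re z \<Longrightarrow> R \<le> Re (f z)" "a < Re z \<Longrightarrow> a < Re (f z)" "R < Re (f z) \<longleftrightarrow> R < Re z"
  using f[of z] Ra by (cases "R < Re z"; simp)+
qed (use assms in \<open>auto simp: good_def\<close>)

lemma good_comp: assumes f: "good f" and g: "good g" shows "good (f \<circ> g)"
 using goodD[OF f] goodD[OF g] unfolding good_def by (auto intro!: continuous_on_compose2[of UNIV f] simp: o_def)

lemma good_id: "good (\<lambda>z. z)" by (simp add: good_def)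

lemma good_\<Phi>: "good (\<Phi> m)"
 using model.\<Phi>_homeo[OF md, of m] model.\<Phi>_left[OF md, of _ m] model.\<Phi>_right[OF md, of _ m] model.\<Phi>_tpi[OF md, of m]
 unfolding good_def homeomorphism_def by blast

lemma good_inv: assumes f: "good f" and fg: "\<And>z. f (g z) = z" and gf: "\<And>z. g (f z) = z" and c: "continuous_on UNIV g" shows "good g"
 unfolding good_def
proof (intro conjI allI impI c)
 fix z :: complex
 show "g z = z" if "Re z \<le> R" using gf[of z] goodD(2)[OF f that] by simp
 show "R < Re (g z)" if "R < Re z" using goodD(7)[OF f, of "g z"] that fg by simp
 show "g (z + of_int n * tpi) = g z + of_int n * tpi" for n using goodD(4)[OF f, of "g z" n] fg gf by metis
qed

definition \<Psi> where "\<Psi> m = inv (\<Phi> m)"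

lemma \<Psi>: "\<Phi> m (\<Psi> m z) = z" "\<Psi> m (\<Phi> m z) = z" "good (\<Psi> m)"
proof -
 have hm: "homeomorphism UNIV UNIV (\<Phi> m) (inv (\<Phi> m))" by (rule model.\<Phi>_homeo[OF md])
 show 1: "\<Phi> m (\<Psi> m z) = z" and 2: "\<Psi> m (\<Phi> m z) = z" for z
  using homeomorphism_apply2[OF hm, of z] homeomorphism_apply1[OF hm, of z] by (simp_all add: \<Psi>_def)
 show "good (\<Psi> m)" by (rule good_inv[OF good_\<Phi> 1 2]) (use homeomorphism_cont2[OF hm] in \<open>simp add: \<Psi>_def\<close>)
qed

text \<open>For \<open>R < Re z\<close> this is \<open>exp (chi R z)\<close>, and it is continued by
  0. Being continuous on the plane, it makes the tracts \<open>T m\<close> closed.\<close>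

definition ez :: "complex \<Rightarrow> complex" where
 "ez z = of_real (exp (max (Re z) (R + 1)) * max 0 (min (Re z - R) 1)) * cis (Im z)"

lemma ez_cont: "continuous_on UNIV ez"
 unfolding ez_def by (intro continuous_intros continuous_on_compose2[OF continuous_on_cis[OF continuous_on_id]]) auto

lemma ez_right: assumes "R < Re z" shows "ez z = exp (chi R z)"
proof -
 have "exp (max (Re z) (R + 1)) * max 0 (min (Re z - R) 1) = exp (kk R (Re z))" using assms by (auto simp: kk_def exp_add max_def min_def)
 thus ?thesis by (simp add: ez_def exp_eq_polar)
qed

lemma ez_left: "Re z \<le> R \<Longrightarrow> ez z = 0" by (simp add: ez_def)

definition T :: "nat \<Rightarrow> complex set" where "T m = {z. exp R \<le> norm (h m (ez z))}"

lemma T_closed: "closed (T m)"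
proof -
 have "continuous_on UNIV (\<lambda>z. norm (h m (ez z)))"
  using tracts.gh[OF tr, of m] by (intro continuous_intros continuous_on_compose2[OF holomorphic_on_imp_continuous_on ez_cont]) auto
 thus ?thesis unfolding T_def by (rule closed_Collect_le[OF continuous_on_const])
qed

lemma T_right: assumes "z \<in> T m" shows "R < Re z"
proof (rule ccontr)
 assume "\<not> R < Re z"
 hence "exp R \<le> norm (h m 0)" using assms ez_left[of z] by (simp add: T_def)
 moreover have "norm (h m 0) < exp a" using tr[of m, unfolded tracts_def] by simp
 moreover have "exp a < exp R" using Ra by simp
 ultimately show False by linarith
qed

lemma h_lb: "lbm m L \<Longrightarrow> a < Re Z \<Longrightarrow> h m (exp (L Z)) = exp Z" by (simp add: lbranch_def)

lemma T_lt: assumes "lbm m L" "a < Re Z" shows "lt R L Z \<in> T m \<longleftrightarrow> R \<le> Re Z"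
proof -
 have "ez (lt R L Z) = exp (L Z)" by (subst ez_right) (simp_all add: kinv_gt)
 thus ?thesis using h_lb[OF assms] by (simp add: T_def norm_exp_eq_Re)
qed

lemma T_elim: assumes "z \<in> T m" obtains L Z where "lbm m L" "R \<le> Re Z" "z = lt R L Z"
proof -
 have r: "R < Re z" by (rule T_right[OF assms])
 hence "exp R \<le> norm (h m (exp (chi R z)))" using assms by (simp add: T_def ez_right)
 moreover define W where "W = Ln (h m (exp (chi R z)))"
 ultimately have nz: "h m (exp (chi R z)) \<noteq> 0" using exp_gt_zero[of R] by (metis norm_zero not_le)
 hence eW: "h m (exp (chi R z)) = exp W" by (simp add: W_def)
 have RW: "R \<le> Re W" using \<open>exp R \<le> _\<close> by (simp add: eW norm_exp_eq_Re)
 hence aW: "a < Re W" using Ra by simp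
 obtain L where L: "lbm m L" "L W = chi R z" by (rule tracts.lb_exists[OF tr aW eW])
 have "z = lt R L W" using kinv_kk[OF r] L(2) by (simp add: lt_def chi_def complex_eq_iff)
 thus ?thesis using that L RW by blast
qed

lemma lt_eq: assumes "lbm m L" "lbm m L'" "a < Re Z" "a < Re Z'" "lt R L Z = lt R L' Z'"
 obtains k :: int where "Z' = Z + of_int k * tpi" "\<And>W. a < Re W \<Longrightarrow> L' (W + of_int k * tpi) = L W"
proof -
 have e: "L Z = L' Z'" using chi_lt assms(5) by metis
 hence e': "exp (L Z) = exp (L' Z')" by simp
 obtain k n :: int where k: "Z' = Z + of_int k * tpi" "\<And>W. a < Re W \<Longrightarrow> L' (W + of_int k * tpi) = L W + of_int n * tpi"
  by (rule tracts.lb_meet[OF tr assms(1-4) e']) blast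
 have "n = 0" using k(2)[OF assms(3)] k(1) e by simp
 thus ?thesis using that[of k] k by simp
qed

text \<open>The lift of \<open>f\<close> through the branches of \<open>h m\<close>, continued by
  the identity. The parts fit together because \<open>f\<close> is the identity up to the line
  \<open>Re Z = R\<close>; the choice of the branch is harmless because \<open>f\<close> commutes
  with \<open>tpi\<close>, see \<open>A_lt\<close>.\<close>

definition A :: "nat \<Rightarrow> (complex \<Rightarrow> complex) \<Rightarrow> complex \<Rightarrow> complex" where
 "A m f z = (if z \<in> T m then SOME w. \<exists>L Z. lbm m L \<and> R \<le> Re Z \<and> z = lt R L Z \<and> w = lt R L (f Z) else z)"

lemma A_lt: assumes f: "good f" and L: "lbm m L" and Z: "a < Re Z" shows "A m f (lt R L Z) = lt R L (f Z)"
proof (cases "R \<le> Re Z")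
 case True
 let ?Q = "\<lambda>w. \<exists>L' Z'. lbm m L' \<and> R \<le> Re Z' \<and> lt R L Z = lt R L' Z' \<and> w = lt R L' (f Z')"
 have "?Q (SOME w. ?Q w)" by (rule someI[of ?Q "lt R L (f Z)"]) (use L True in blast)
 then obtain L' Z' where L': "lbm m L'" "R \<le> Re Z'" "lt R L Z = lt R L' Z'" and w: "(SOME w. ?Q w) = lt R L' (f Z')" by blast
 have aZ': "a < Re Z'" using L'(2) Ra by simp
 obtain k :: int where k: "Z' = Z + of_int k * tpi" "\<And>W. a < Re W \<Longrightarrow> L' (W + of_int k * tpi) = L W"
  by (rule lt_eq[OF L L'(1) Z aZ' L'(3)]) blast
 have "L' (f Z') = L (f Z)" unfolding k(1) goodD(4)[OF f] by (rule k(2)[OF goodD(6)[OF f Z]])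
 hence "lt R L' (f Z') = lt R L (f Z)" by (simp add: lt_def)
 thus ?thesis using T_lt[OF L Z] True w by (simp add: A_def)
next
 case False
 thus ?thesis using T_lt[OF L Z] goodD(2)[OF f, of Z] by (simp add: A_def)
qed

lemma lt_homeo:
 assumes L: "lbm m L"
 obtains k where "open (lt R L ` hp a)" "homeomorphism (hp a) (lt R L ` hp a) (lt R L) k"
proof -
 have cL: "continuous_on (hp a) L" using tracts.lbD(1)[OF tr L] by (rule holomorphic_on_imp_continuous_on)
 have ck: "continuous_on UNIV (kinv R)" unfolding kinv_alt by (intro continuous_intros)
 have c: "continuous_on (hp a) (lt R L)" unfolding lt_def by (intro continuous_intros continuous_on_compose2[OF ck] cL) auto
 have i: "inj_on (lt R L) (hp a)"
 proof (rule inj_onI)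
  fix x y assume xy: "x \<in> hp a" "y \<in> hp a" "lt R L x = lt R L y"
  hence "L x = L y" using chi_lt by metis
  thus "x = y" using tracts.lb_inj(1)[OF tr L, of x y 0] xy by simp
 qed
 obtain k where "homeomorphism (hp a) (lt R L ` hp a) (lt R L) k" by (rule invariance_of_domain_homeomorphism[OF open_hp c order_refl i])
 thus ?thesis using that[OF invariance_of_domain[OF c open_hp i]] by blast
qed

text \<open>Near the boundary of a tract the formula \<open>lt R L (f (k w))\<close> is valid on
  both sides, since \<open>A_lt\<close> covers all of \<open>a < Re Z\<close>.\<close>

lemma good_A: assumes f: "good f" shows "good (A m f)"
 unfolding good_def
proof (intro conjI allI impI)
 have "isCont (A m f) z0" for z0
 proof (cases "z0 \<in> T m")
  case True
  obtain L Z0 where L: "lbm m L" "R \<le> Re Z0" "z0 = lt R L Z0" by (rule T_elim[OF True])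
  obtain k where k: "open (lt R L ` hp a)" "homeomorphism (hp a) (lt R L ` hp a) (lt R L) k" by (rule lt_homeo[OF L(1)])
  have e: "A m f w = lt R L (f (k w))" if w: "w \<in> lt R L ` hp a" for w
  proof -
   obtain W where W: "W \<in> hp a" "w = lt R L W" using w by blast
   hence "k w = W" using homeomorphism_apply1[OF k(2)] by simp
   thus ?thesis using A_lt[OF f L(1), of W] W by simp
  qed
  have ki: "k ` (lt R L ` hp a) \<subseteq> hp a" using homeomorphism_image2[OF k(2)] by simp
  have "continuous_on (lt R L ` hp a) (\<lambda>w. lt R L (f (k w)))"
  proof (rule continuous_on_compose2[OF homeomorphism_cont1[OF k(2)]])
   show "continuous_on (lt R L ` hp a) (\<lambda>w. f (k w))" by (rule continuous_on_compose2[OF goodD(1)[OF f] homeomorphism_cont2[OF k(2)]]) simp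
   show "(\<lambda>w. f (k w)) ` (lt R L ` hp a) \<subseteq> hp a"
   proof (intro image_subsetI)
    fix w assume "w \<in> lt R L ` hp a"
    hence "k w \<in> hp a" using ki by blast
    thus "f (k w) \<in> hp a" using goodD(6)[OF f] by simp
   qed
  qed
  hence "continuous_on (lt R L ` hp a) (A m f)" using e by (simp cong: continuous_on_cong)
  moreover have "z0 \<in> lt R L ` hp a" using L Ra by simp
  ultimately show ?thesis using continuous_on_eq_continuous_at[OF k(1), of "A m f"] by blast
 next
  case False
  have "continuous_on (- T m) (A m f) \<longleftrightarrow> continuous_on (- T m) (\<lambda>z. z)" by (rule continuous_on_cong) (auto simp: A_def)
  hence "continuous_on (- T m) (A m f)" by simp
  thus ?thesis using False T_closed[of m] by (simp add: continuous_on_eq_continuous_at open_Compl)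
 qed
 thus "continuous_on UNIV (A m f)" by (intro continuous_at_imp_continuous_on) blast
 fix z
 show "A m f z = z" if "Re z \<le> R" using T_right[of z m] that by (auto simp: A_def)
 show "R < Re (A m f z)" if "R < Re z"
 proof (cases "z \<in> T m")
  case True
  obtain L Z where L: "lbm m L" "R \<le> Re Z" "z = lt R L Z" by (rule T_elim[OF True])
  thus ?thesis using A_lt[OF f L(1), of Z] Ra by (simp add: kinv_gt)
 qed (use that in \<open>simp add: A_def\<close>)
 fix n :: int
 show "A m f (z + of_int n * tpi) = A m f z + of_int n * tpi"
 proof (cases "z \<in> T m")
  case True
  obtain L Z where L: "lbm m L" "R \<le> Re Z" "z = lt R L Z" by (rule T_elim[OF True])
  define L' where "L' = (\<lambda>W. L (W + of_int 0 * tpi) + of_int n * tpi)"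
  have L': "lbm m L'" unfolding L'_def by (rule tracts.lb_shift[OF tr L(1)])
  have e: "lt R L' W = lt R L W + of_int n * tpi" for W by (simp add: lt_def L'_def complex_eq_iff)
  have "a < Re Z" using L Ra by simp
  thus ?thesis using A_lt[OF f L(1), of Z] A_lt[OF f L', of Z] e L(3) by simp
 next
  case False
  have "cis (Im z + 2 * pi * of_int n) = cis (Im z)" using cis_multiple_2pi[of "of_int n"] by (simp flip: cis_mult)
  hence "ez (z + of_int n * tpi) = ez z" by (simp add: ez_def mult.commute mult.left_commute)
  hence "z + of_int n * tpi \<notin> T m" using False by (simp add: T_def)
  thus ?thesis using False by (simp add: A_def)
 qed
qed

lemma A_inverse: assumes f: "good f" and g: "good g" and fg: "\<And>z. f (g z) = z" shows "A m f (A m g z) = z"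
proof (cases "z \<in> T m")
 case True
 obtain L Z where L: "lbm m L" "R \<le> Re Z" "z = lt R L Z" by (rule T_elim[OF True])
 have aZ: "a < Re Z" using L Ra by simp
 show ?thesis using A_lt[OF g L(1) aZ] A_lt[OF f L(1) goodD(6)[OF g aZ]] fg L(3) by simp
qed (simp add: A_def)

lemma A_id: "A m (\<lambda>z. z) z = z"
 using A_inverse[OF good_id good_id, of m z]
proof (cases "z \<in> T m")
 case True
 obtain L Z where L: "lbm m L" "R \<le> Re Z" "z = lt R L Z" by (rule T_elim[OF True])
 thus ?thesis using A_lt[OF good_id L(1), of Z] Ra by simp
qed (simp add: A_def)

text \<open>The \<open>n\<close>-fold pullback of the straightening maps; \<open>ps\<close> is its
  inverse. Each pullback passes to the next map of the sequence.\<close>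

primrec ph :: "nat \<Rightarrow> nat \<Rightarrow> complex \<Rightarrow> complex" where
 "ph 0 m = (\<lambda>z. z)"
| "ph (Suc n) m = \<Phi> m \<circ> A m (ph n (Suc m))"

primrec ps :: "nat \<Rightarrow> nat \<Rightarrow> complex \<Rightarrow> complex" where
 "ps 0 m = (\<lambda>z. z)"
| "ps (Suc n) m = A m (ps n (Suc m)) \<circ> \<Psi> m"

lemma good_ph: "good (ph n m)" by (induction n arbitrary: m) (auto intro: good_id good_comp good_\<Phi> good_A)
lemma good_ps: "good (ps n m)" by (induction n arbitrary: m) (auto intro: good_id good_comp \<Psi> good_A)

lemma ph_ps: "ph n m (ps n m z) = z" "ps n m (ph n m z) = z"
proof (induction n arbitrary: m z)
 case (Suc n)
 { case 1 show ?case using A_inverse[OF good_ph good_ps Suc(1)] \<Psi>(1) by simp }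
 { case 2 show ?case using A_inverse[OF good_ps good_ph Suc(2)] \<Psi>(2) by simp }
qed simp_all

lemma ph_lt: assumes "lbm m L" "R \<le> Re Z" shows "ph (Suc n) m (lt R L Z) = S m L (ph n (Suc m) Z)"
 using A_lt[OF good_ph assms(1), of Z n "Suc m"] assms(2) Ra by (simp add: S_def)

lemma ps_lt: assumes "lbm m L" "R \<le> Re Z" "\<Psi> m z = lt R L Z" shows "ps (Suc n) m z = lt R L (ps n (Suc m) Z)"
 using A_lt[OF good_ps assms(1), of Z n "Suc m"] assms(2,3) Ra by simp

definition D0 where "D0 = 12 * pi * (C * C * (1 + a)) + 7"

lemma D0_pos: "0 \<le> D0" using R400 C1 by (simp add: D0_def)

text \<open>The derivative of a branch decays like \<open>1 / (x - a)\<close>, which turns a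
  displacement proportional to \<open>Re Z\<close> into a bounded one. The constant arises from
  \<open>norm (Z - W) \<le> C * C * x\<close> and \<open>x \<le> (1 + a) * (x - a)\<close>.\<close>

lemma near_log:
 assumes Z: "R \<le> Re Z" "R \<le> Re W" and n: "norm (W - Z) \<le> C * Re Z" "Re Z \<le> C * Re W"
 shows "12 * pi / (min (Re Z) (Re W) - a) * norm (Z - W) + 7 \<le> D0"
proof -
 define x where "x = min (Re Z) (Re W)"
 have x: "R \<le> x" using Z by (simp add: x_def)
 have xa: "400 \<le> x - a" using x R400 by simp
 have "Re Z \<le> C * x"
 proof (cases "Re Z \<le> Re W")
  case True
  have "1 * x \<le> C * x" using C1 x Ra by (intro mult_right_mono) auto
  thus ?thesis using True by (simp add: x_def)
 qed (use n in \<open>simp add: x_def\<close>)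
 hence "C * Re Z \<le> C * (C * x)" using C1 by (intro mult_left_mono) auto
 hence nz: "norm (Z - W) \<le> C * C * x" using n by (simp add: norm_minus_commute)
 have "x \<le> (1 + a) * (x - a)"
 proof -
  have "a * 1 \<le> a * (x - a)" using R400 xa by (intro mult_left_mono) auto
  thus ?thesis by (simp add: algebra_simps)
 qed
 hence "C * C * x \<le> C * C * ((1 + a) * (x - a))" using C1 by (intro mult_left_mono) auto
 hence "12 * pi / (x - a) * norm (Z - W) \<le> 12 * pi / (x - a) * (C * C * ((1 + a) * (x - a)))" using nz xa by (intro mult_left_mono) auto
 also have "\<dots> = 12 * pi * (C * C * (1 + a))" using xa by simp
 finally show ?thesis by (simp add: D0_def x_def)
qed

text \<open>\<open>\<Phi> m\<close> is only at linear distance from the identity, so the sequence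
  starts with the index \<open>Suc n\<close>: the first difference has passed through one branch and
  is bounded by \<open>near_log\<close>. From then on \<open>S_lip\<close> halves it.\<close>

lemma ph_step: "norm (ph (Suc (Suc n)) m z - ph (Suc n) m z) \<le> D0 / 2 ^ n"
proof (induction n arbitrary: m z)
 case 0
 show ?case
 proof (cases "z \<in> T m")
  case True
  obtain L Z where L: "lbm m L" "R \<le> Re Z" "z = lt R L Z" by (rule T_elim[OF True])
  have W: "R \<le> Re (\<Phi> (Suc m) Z)" by (rule goodD(5)[OF good_\<Phi> L(2)])
  have "norm (S m L (\<Phi> (Suc m) Z) - S m L Z) \<le> 12 * pi / (min (Re Z) (Re (\<Phi> (Suc m) Z)) - a) * norm (Z - \<Phi> (Suc m) Z) + 7"
   using S_log[OF L(1), of "min (Re Z) (Re (\<Phi> (Suc m) Z))" "\<Phi> (Suc m) Z" Z] L(2) W by (simp add: norm_minus_commute)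
  also have "\<dots> \<le> D0" by (rule near_log[OF L(2) W model.\<Phi>_near[OF md L(2)] model.\<Phi>_coarse[OF md L(2)]])
  finally have "norm (S m L (ph (Suc 0) (Suc m) Z) - S m L (ph 0 (Suc m) Z)) \<le> D0" by (simp add: A_id)
  thus ?thesis using ph_lt[OF L(1,2)] L(3) by (simp del: ph.simps)
 next
  case False
  thus ?thesis using D0_pos by (simp add: A_def)
 qed
next
 case (Suc n)
 show ?case
 proof (cases "z \<in> T m")
  case True
  obtain L Z where L: "lbm m L" "R \<le> Re Z" "z = lt R L Z" by (rule T_elim[OF True])
  have "norm (S m L (ph (Suc (Suc n)) (Suc m) Z) - S m L (ph (Suc n) (Suc m) Z))
    \<le> 1/2 * norm (ph (Suc (Suc n)) (Suc m) Z - ph (Suc n) (Suc m) Z)" by (intro S_lip[OF L(1)] goodD(5)[OF good_ph L(2)])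
  also have "\<dots> \<le> 1/2 * (D0 / 2 ^ n)" using Suc by (intro mult_left_mono) auto
  finally show ?thesis using ph_lt[OF L(1,2)] L(3) by (simp del: ph.simps)
 next
  case False
  thus ?thesis using D0_pos by (simp add: A_def)
 qed
qed

lemma lt_lip: assumes L: "lbm m L" and x: "R \<le> x" "x \<le> Re Z" "x \<le> Re W"
 shows "norm (lt R L Z - lt R L W) \<le> 12 * pi / (x - a) * norm (Z - W)"
proof -
 have "norm (lt R L Z - lt R L W) \<le> norm (L Z - L W)"
  unfolding cmod_def using kinv_lip[of R "Re (L Z)" "Re (L W)"] by (auto simp: abs_le_square_iff)
 also have "\<dots> \<le> 12 * pi / (x - a) * norm (Z - W)" using x Ra by (intro tracts.lb_lip[OF tr L]) auto
 finally show ?thesis .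
qed

lemma ps_step: "norm (ps (Suc (Suc n)) m z - ps (Suc n) m z) \<le> D0 / 2 ^ n"
proof (induction n arbitrary: m z)
 case 0
 show ?case
 proof (cases "\<Psi> m z \<in> T m")
  case True
  obtain L Z where L: "lbm m L" "R \<le> Re Z" "\<Psi> m z = lt R L Z" by (rule T_elim[OF True])
  define W where "W = \<Psi> (Suc m) Z"
  have W: "R \<le> Re W" unfolding W_def by (rule goodD(5)[OF \<Psi>(3) L(2)])
  have Z: "Z = \<Phi> (Suc m) W" by (simp add: W_def \<Psi>)
  have "norm (lt R L W - lt R L Z) \<le> 12 * pi / (min (Re W) (Re Z) - a) * norm (W - Z)" using L(2) W by (intro lt_lip[OF L(1)]) auto
  also have "\<dots> \<le> D0" using near_log[OF W L(2), unfolded Z, OF model.\<Phi>_near[OF md W] model.\<Phi>_coarse[OF md W]] by (simp add: Z)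
  finally have "norm (lt R L (ps (Suc 0) (Suc m) Z) - lt R L (ps 0 (Suc m) Z)) \<le> D0" by (simp add: A_id W_def)
  thus ?thesis using ps_lt[OF L] by (simp del: ps.simps)
 next
  case False
  thus ?thesis using D0_pos by (simp add: A_def)
 qed
next
 case (Suc n)
 show ?case
 proof (cases "\<Psi> m z \<in> T m")
  case True
  obtain L Z where L: "lbm m L" "R \<le> Re Z" "\<Psi> m z = lt R L Z" by (rule T_elim[OF True])
  have "norm (lt R L (ps (Suc (Suc n)) (Suc m) Z) - lt R L (ps (Suc n) (Suc m) Z))
    \<le> 12 * pi / (R - a) * norm (ps (Suc (Suc n)) (Suc m) Z - ps (Suc n) (Suc m) Z)" by (intro lt_lip[OF L(1)] order_refl goodD(5)[OF good_ps L(2)])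
  also have "\<dots> \<le> 1/2 * (D0 / 2 ^ n)" using Suc R400 pi_less_4 by (intro mult_mono) (auto simp: field_simps)
  finally show ?thesis using ps_lt[OF L] by (simp del: ps.simps)
 next
  case False
  thus ?thesis using D0_pos by (simp add: A_def)
 qed
qed

definition phi_spec where
 "phi_spec m p \<longleftrightarrow> (\<forall>n z. norm (ph (Suc n) m z - p z) \<le> 2 * D0 / 2 ^ n) \<and> (\<forall>z. (\<lambda>n. ph (Suc n) m z) \<longlonglongrightarrow> p z) \<and>
   homeomorphism UNIV UNIV p (inv p)"

lemma phi_ex: "\<exists>p. phi_spec m p"
proof -
 obtain p where p: "\<And>n z. norm (ph (Suc n) m z - p z) \<le> 2 * D0 / 2 ^ n" "\<And>z. (\<lambda>n. ph (Suc n) m z) \<longlonglongrightarrow> p z"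
  "(\<And>n. continuous_on UNIV (ph (Suc n) m)) \<Longrightarrow> continuous_on UNIV p"
  by (rule geometric_limit[of "\<lambda>n. ph (Suc n) m" D0, OF ph_step]) blast
 obtain q where q: "\<And>n z. norm (ps (Suc n) m z - q z) \<le> 2 * D0 / 2 ^ n" "\<And>z. (\<lambda>n. ps (Suc n) m z) \<longlonglongrightarrow> q z"
  "(\<And>n. continuous_on UNIV (ps (Suc n) m)) \<Longrightarrow> continuous_on UNIV q"
  by (rule geometric_limit[of "\<lambda>n. ps (Suc n) m" D0, OF ps_step]) blast
 have pc: "continuous_on UNIV p" by (rule p(3)) (rule goodD(1)[OF good_ph])
 have qc: "continuous_on UNIV q" by (rule q(3)) (rule goodD(1)[OF good_ps])
 \<comment> \<open>Uniform convergence of one sequence and pointwise convergence of the other one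
   suffice to pass to the limit in \<open>F n (G n z) = z\<close>.\<close>
 have inv: "f (g z) = z" if fc: "continuous_on UNIV f" and F: "\<And>n z. norm (F n z - f z) \<le> 2 * D0 / 2 ^ n"
  and G: "\<And>z. (\<lambda>n. G n z) \<longlonglongrightarrow> g z" and FG: "\<And>n z. F n (G n z) = z" for f g :: "complex \<Rightarrow> complex" and F G z
 proof (rule LIMSEQ_unique)
  show "(\<lambda>n. f (G n z)) \<longlonglongrightarrow> f (g z)" by (intro continuous_on_tendsto_compose[OF fc] G) auto
  have "norm (f (G n z) - z) \<le> 2 * D0 / 2 ^ n" for n using F[of n "G n z"] FG[of n z] by (simp add: norm_minus_commute)
  hence "(\<lambda>n. norm (f (G n z) - z)) \<longlonglongrightarrow> 0"
   by (intro tendsto_sandwich[OF _ _ tendsto_const half_powers] always_eventually allI norm_ge_zero)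
  thus "(\<lambda>n. f (G n z)) \<longlonglongrightarrow> z" by (simp add: tendsto_norm_zero_iff LIM_zero_iff)
 qed
 have pq: "p (q z) = z" for z by (rule inv[OF pc p(1) q(2)]) (rule ph_ps)
 have qp: "q (p z) = z" for z by (rule inv[OF qc q(1) p(2)]) (rule ph_ps)
 have "inv p = q" by (rule inv_equality[OF qp pq])
 moreover have "homeomorphism UNIV UNIV p q" unfolding homeomorphism_def using pc qc pq qp by (auto simp: surj_def) metis+
 ultimately show ?thesis using p(1,2) unfolding phi_spec_def by auto
qed

definition phi :: "nat \<Rightarrow> complex \<Rightarrow> complex" where "phi m = (SOME p. phi_spec m p)"
definition psi :: "nat \<Rightarrow> complex \<Rightarrow> complex" where "psi m = inv (phi m)"

lemma phi: "norm (ph (Suc n) m z - phi m z) \<le> 2 * D0 / 2 ^ n" "(\<lambda>n. ph (Suc n) m z) \<longlonglongrightarrow> phi m z"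
 "homeomorphism UNIV UNIV (phi m) (psi m)" using someI_ex[OF phi_ex[of m], folded phi_def] unfolding phi_spec_def psi_def by blast+

lemma phi_psi [simp]: "phi m (psi m z) = z" "psi m (phi m z) = z"
 using homeomorphism_apply1[OF phi(3), of z m] homeomorphism_apply2[OF phi(3), of z m] by auto

lemma phi_tpi: "phi m (z + of_int n * tpi) = phi m z + of_int n * tpi"
proof (rule LIMSEQ_unique[OF phi(2)])
 have "(\<lambda>k. ph (Suc k) m z + of_int n * tpi) \<longlonglongrightarrow> phi m z + of_int n * tpi" by (intro tendsto_intros phi(2))
 thus "(\<lambda>k. ph (Suc k) m (z + of_int n * tpi)) \<longlonglongrightarrow> phi m z + of_int n * tpi" unfolding goodD(4)[OF good_ph] .
qed

lemma psi_tpi: "psi m (z + of_int n * tpi) = psi m z + of_int n * tpi"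
 using phi_tpi[of m "psi m z" n] phi_psi by metis

lemma phi_left: assumes "Re z \<le> R" shows "phi m z = z"
proof (rule LIMSEQ_unique[OF phi(2)])
 show "(\<lambda>k. ph (Suc k) m z) \<longlonglongrightarrow> z" unfolding goodD(2)[OF good_ph assms] by simp
qed

lemma phi_right: assumes "R < Re z" shows "R < Re (phi m z)"
proof (rule ccontr)
 assume n: "\<not> ?thesis"
 hence "phi m (phi m z) = phi m z" by (intro phi_left) simp
 hence "phi m z = z" using phi_psi(2) by metis
 thus False using n assms by simp
qed

text \<open>The conjugacy between the branches \<open>lt R L\<close> and the straight maps
  \<open>S m L\<close>, obtained from \<open>ph_lt\<close> in the limit.\<close>

lemma phi_lt: assumes L: "lbm m L" and Z: "R \<le> Re Z" shows "phi m (lt R L Z) = S m L (phi (Suc m) Z)"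
proof (rule LIMSEQ_unique)
 show "(\<lambda>n. ph (Suc (Suc n)) m (lt R L Z)) \<longlonglongrightarrow> phi m (lt R L Z)" by (rule LIMSEQ_Suc[OF phi(2)])
 have W: "R \<le> Re (phi (Suc m) Z)" using phi_right[of Z "Suc m"] phi_left[of Z "Suc m"] Z by (cases "R < Re Z") auto
 have "(\<lambda>n. norm (ph (Suc n) (Suc m) Z - phi (Suc m) Z)) \<longlonglongrightarrow> 0"
  using phi(2)[of "Suc m" Z] by (intro tendsto_norm_zero) (simp add: LIM_zero)
 note l = tendsto_mult_right_zero[OF this, of "1/2"]
 have "(\<lambda>n. norm (S m L (ph (Suc n) (Suc m) Z) - S m L (phi (Suc m) Z))) \<longlonglongrightarrow> 0"
  by (intro tendsto_sandwich[OF _ _ tendsto_const l] always_eventually allI norm_ge_zero S_lip[OF L goodD(5)[OF good_ph Z] W])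
 hence "(\<lambda>n. S m L (ph (Suc n) (Suc m) Z)) \<longlonglongrightarrow> S m L (phi (Suc m) Z)" by (simp only: tendsto_norm_zero_iff LIM_zero_iff)
 thus "(\<lambda>n. ph (Suc (Suc n)) m (lt R L Z)) \<longlonglongrightarrow> S m L (phi (Suc m) Z)" using ph_lt[OF L Z] by (simp only:)
qed

lemma phi_near: "norm (phi m z - \<Phi> m z) \<le> 2 * D0"
proof -
 have "A m (\<lambda>z. z) = (\<lambda>z. z)" using A_id by auto
 hence "ph (Suc 0) m z = \<Phi> m z" by (simp add: o_def)
 thus ?thesis using phi(1)[of 0 m z] by (simp add: norm_minus_commute)
qed

lemma phi_coarse: assumes "R \<le> Re z" shows "Re z \<le> C * (Re (phi m z) + 2 * D0)"
proof -
 have "\<bar>Re (phi m z - \<Phi> m z)\<bar> \<le> 2 * D0" using phi_near[of m z] abs_Re_le_cmod order_trans by blast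
 hence "Re (\<Phi> m z) \<le> Re (phi m z) + 2 * D0" by simp
 hence "C * Re (\<Phi> m z) \<le> C * (Re (phi m z) + 2 * D0)" using C1 by (intro mult_left_mono) auto
 thus ?thesis using model.\<Phi>_coarse[OF md assms, of m] by linarith
qed

lemma phi_large: assumes t: "R \<le> t" and p: "(1 + C) * t + 2 * D0 \<le> Re (phi m z)" shows "t \<le> Re z"
proof (cases "Re z \<le> R")
 case True
 have "t \<le> (1 + C) * t" using C1 t Ra mult_right_mono[of 1 "1 + C" t] by simp
 thus ?thesis using p True D0_pos by (simp add: phi_left)
next
 case False
 have "\<bar>Re (phi m z - \<Phi> m z)\<bar> \<le> 2 * D0" using phi_near[of m z] abs_Re_le_cmod order_trans by blast
 moreover have "\<bar>Re (\<Phi> m z - z)\<bar> \<le> C * Re z" using model.\<Phi>_near[OF md, of z m] False abs_Re_le_cmod order_trans by (metis less_imp_le not_le)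
 ultimately have "(1 + C) * t \<le> (1 + C) * Re z" using p by (simp add: distrib_right)
 thus ?thesis using C1 by simp
qed

lemma phi_period: "phi (m + N) = phi m"
proof -
 have "T (m + N) = T m" for m by (simp add: T_def per)
 hence "A (m + N) f = A m f" for m f by (auto simp: A_def per)
 hence "ph n (m + N) = ph n m" for n m by (induction n arbitrary: m) (use per(2) in \<open>auto simp flip: add_Suc\<close>)
 thus ?thesis by (simp add: phi_def phi_spec_def)
qed

end

section \<open>The straight model\<close>

text \<open>By \<open>phi_large\<close>, \<open>Q \<le> Re (phi m z)\<close> implies
  \<open>R + 1 \<le> Re z\<close>. There the push \<open>kinv\<close> is the identity, so
  \<open>lt R L\<close> agrees with the true branch \<open>L\<close>.\<close>

locale large_system = system +
 fixes Q :: real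
 assumes Q: "(1 + C) * (R + 1) + 2 * D0 \<le> Q"
begin

primrec orb :: "nat \<Rightarrow> complex \<Rightarrow> nat \<Rightarrow> complex" where
 "orb m w 0 = w" | "orb m w (Suc k) = h (m + k) (orb m w k)"

lemma orb_shift: "orb m w (Suc k) = orb (Suc m) (h m w) k"
 by (induction k) auto

text \<open>The orbit is tested in straight coordinates, so that the set becomes a union of
  horizontal rays there. The choice of the logarithm is immaterial by
  \<open>Re_phi_Ln\<close>.\<close>

definition X :: "nat \<Rightarrow> complex set" where
 "X m = {w. \<forall>k. orb m w k \<noteq> 0 \<and> Q \<le> Re (phi (m + k) (Ln (orb m w k)))}"

definition B :: "nat \<Rightarrow> complex set" where "B m = {p. exp (psi m p) \<in> X m}"

lemma X_step: "w \<in> X m \<longleftrightarrow> w \<noteq> 0 \<and> Q \<le> Re (phi m (Ln w)) \<and> h m w \<in> X (Suc m)"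
proof
 assume w: "w \<in> X m"
 have "orb m w (Suc k) \<noteq> 0 \<and> Q \<le> Re (phi (m + Suc k) (Ln (orb m w (Suc k))))" for k using w unfolding X_def by blast
 thus "w \<noteq> 0 \<and> Q \<le> Re (phi m (Ln w)) \<and> h m w \<in> X (Suc m)" using w unfolding X_def orb_shift by (auto dest: spec[of _ 0])
next
 assume w: "w \<noteq> 0 \<and> Q \<le> Re (phi m (Ln w)) \<and> h m w \<in> X (Suc m)"
 have "orb m w k \<noteq> 0 \<and> Q \<le> Re (phi (m + k) (Ln (orb m w k)))" for k
 proof (cases k)
  case (Suc j)
  thus ?thesis using w orb_shift[of m w j] by (simp add: X_def del: orb.simps)
 qed (use w in simp)
 thus "w \<in> X m" by (simp add: X_def)
qed

lemma Re_phi_Ln: "Re (phi m (Ln (exp z))) = Re (phi m z)"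
proof -
 have "exp (Ln (exp z)) = exp z" by simp
 then obtain n where "Ln (exp z) = z + of_int n * tpi" unfolding exp_eq_tpi by blast
 thus ?thesis by (simp add: phi_tpi)
qed

lemma Q_large: "Q \<le> Re (phi m z) \<Longrightarrow> R + 1 \<le> Re z"
 using phi_large[of "R + 1" m z] Q by simp

lemma QR: "R + 1 \<le> Q"
proof -
 have "1 * (R + 1) \<le> (1 + C) * (R + 1)" using C1 Ra by (intro mult_right_mono) auto
 hence "R + 1 \<le> (1 + C) * (R + 1)" by (simp only: mult_1)
 also have "\<dots> \<le> (1 + C) * (R + 1) + 2 * D0" using D0_pos by simp
 also note Q
 finally show ?thesis .
qed

lemma B_Re: "p \<in> B m \<Longrightarrow> Q \<le> Re p"
 using X_step[of "exp (psi m p)" m] by (simp add: B_def Re_phi_Ln)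

lemma B_tpi: "p \<in> B m \<Longrightarrow> p + of_int n * tpi \<in> B m" by (simp add: B_def psi_tpi)

lemma lt_id: "R + 1 \<le> Re (lt R L z) \<Longrightarrow> lt R L z = L z"
 by (auto simp: lt_def kinv_def complex_eq_iff split: if_splits)

lemma X_elim:
 assumes X: "exp z \<in> X m"
 obtains L z' where "lbm m L" "exp z' \<in> X (Suc m)" "R + 1 \<le> Re z'" "L z' = z" "R + 1 \<le> Re z"
proof -
 have Rz: "R + 1 \<le> Re z" and hz: "h m (exp z) \<in> X (Suc m)" using X X_step[of "exp z" m] by (auto simp: Re_phi_Ln intro: Q_large)
 define z' where "z' = Ln (h m (exp z))"
 have e: "exp z' = h m (exp z)" using hz X_step[of "h m (exp z)"] by (simp add: z'_def)
 have Rz': "R + 1 \<le> Re z'" using hz X_step[of "h m (exp z)"] by (intro Q_large[of "Suc m"]) (simp add: z'_def)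
 hence az': "a < Re z'" using Ra by simp
 obtain L where L: "lbm m L" "L z' = z" by (rule tracts.lb_exists[OF tr az' e[symmetric]])
 thus ?thesis using that[of L z'] Rz Rz' hz e by simp
qed

lemma B_elim:
 assumes p: "p \<in> B m"
 obtains L p' where "lbm m L" "p' \<in> B (Suc m)" "R \<le> Re p'" "p = S m L p'"
proof -
 have "exp (psi m p) \<in> X m" using p by (simp add: B_def)
 then obtain L z' where L: "lbm m L" "exp z' \<in> X (Suc m)" "R + 1 \<le> Re z'" "L z' = psi m p" "R + 1 \<le> Re (psi m p)" by (rule X_elim)
 have "lt R L z' = psi m p" using L(4,5) by (simp add: lt_def kinv_def complex_eq_iff)
 hence "S m L (phi (Suc m) z') = p" using phi_lt[OF L(1), of z'] L(3) by simp
 moreover have "phi (Suc m) z' \<in> B (Suc m)" using L(2) by (simp add: B_def)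
 moreover have "R \<le> Re (phi (Suc m) z')" using B_Re[OF calculation(2)] QR by linarith
 ultimately show ?thesis using that[OF L(1)] by blast
qed

lemma psi_S:
 assumes L: "lbm m L" and p: "R \<le> Re p" "Q \<le> Re (S m L p)"
 shows "psi m (S m L p) = L (psi (Suc m) p)" "h m (exp (psi m (S m L p))) = exp (psi (Suc m) p)"
proof -
 have R: "R \<le> Re (psi (Suc m) p)" using phi_left[of "psi (Suc m) p" "Suc m"] p(1) by (cases "Re (psi (Suc m) p) \<le> R") auto
 have S: "S m L p = phi m (lt R L (psi (Suc m) p))" using phi_lt[OF L R] by simp
 hence "R + 1 \<le> Re (lt R L (psi (Suc m) p))" using p(2) by (intro Q_large) simp
 thus 1: "psi m (S m L p) = L (psi (Suc m) p)" unfolding S phi_psi by (rule lt_id)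
 show "h m (exp (psi m (S m L p))) = exp (psi (Suc m) p)" unfolding 1 using R Ra by (intro h_lb[OF L]) simp
qed

lemma B_intro:
 assumes L: "lbm m L" and p: "p \<in> B (Suc m)" "Q \<le> Re (S m L p)"
 shows "S m L p \<in> B m"
proof -
 have "R \<le> Re p" using B_Re[OF p(1)] QR by simp
 note ps = psi_S[OF L this p(2)]
 have "Q \<le> Re (phi m (Ln (exp (psi m (S m L p)))))" unfolding Re_phi_Ln using p(2) by simp
 moreover have "h m (exp (psi m (S m L p))) \<in> X (Suc m)" unfolding ps(2) using p(1) by (simp add: B_def)
 ultimately have "exp (psi m (S m L p)) \<in> X m" by (rule iffD2[OF X_step, OF conjI[OF exp_not_eq_zero conjI]])
 thus ?thesis unfolding B_def by (rule CollectI)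
qed

text \<open>Each point of the family has its image under the dynamics in the family at the next
  index, so the whole orbit stays to the right of \<open>Q\<close>.\<close>

lemma B_coinduct:
 assumes P: "\<And>m p. p \<in> P m \<Longrightarrow> Q \<le> Re p \<and> (\<exists>L p'. lbm m L \<and> p' \<in> P (Suc m) \<and> p = S m L p')"
  and p: "p \<in> P m"
 shows "p \<in> B m"
proof -
 have *: "\<exists>q\<in>P (m + k). orb m (exp (psi m p)) k = exp (psi (m + k) q)" for k
 proof (induction k)
  case (Suc k)
  then obtain q where q: "q \<in> P (m + k)" "orb m (exp (psi m p)) k = exp (psi (m + k) q)" by blast
  obtain L q' where L: "lbm (m + k) L" "q' \<in> P (Suc (m + k))" "q = S (m + k) L q'" using P[OF q(1)] by blast
  have "R \<le> Re q'" "Q \<le> Re (S (m + k) L q')" using P[OF L(2)] P[OF q(1)] QR L(3) by auto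
  hence "orb m (exp (psi m p)) (Suc k) = exp (psi (Suc (m + k)) q')" using psi_S(2)[OF L(1)] q(2) L(3) by simp
  thus ?case using L(2) by auto
 qed (use p in auto)
 have "orb m (exp (psi m p)) k \<noteq> 0 \<and> Q \<le> Re (phi (m + k) (Ln (orb m (exp (psi m p)) k)))" for k
 proof -
  obtain q where q: "q \<in> P (m + k)" "orb m (exp (psi m p)) k = exp (psi (m + k) q)" using *[of k] by blast
  show ?thesis unfolding q(2) Re_phi_Ln using P[OF q(1)] by simp
 qed
 thus ?thesis by (simp add: B_def X_def)
qed

lemma S_solve:
 assumes L: "lbm m L" and q: "R \<le> Re q" and x: "Re (S m L q) \<le> x"
 obtains p where "Im p = Im q" "Re q \<le> Re p" "S m L p = Complex x (v m L (Im q))"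
proof -
 obtain t where t: "R \<le> t" "x \<le> Re (S m L (Complex t (Im q)))" using S_top[OF L] by blast
 have qt: "Re q \<le> t"
 proof (rule ccontr)
  assume "\<not> Re q \<le> t"
  hence "Re (S m L (Complex t (Im q))) < Re (S m L q)" using t(1) by (intro S_mono[OF L]) auto
  thus False using t(2) x by simp
 qed
 have "continuous_on {Re q..t} (\<lambda>u. Re (S m L (Complex u (Im q))))"
 proof (rule lipschitz_on_continuous_on[OF lipschitz_onI])
  fix u w assume u: "u \<in> {Re q..t}" "w \<in> {Re q..t}"
  have "norm (S m L (Complex u (Im q)) - S m L (Complex w (Im q))) \<le> 1/2 * norm (Complex u (Im q) - Complex w (Im q))"
   using u q by (intro S_lip[OF L]) auto
  also have "norm (Complex u (Im q) - Complex w (Im q)) = \<bar>u - w\<bar>" by (simp add: cmod_def)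
  finally show "dist (Re (S m L (Complex u (Im q)))) (Re (S m L (Complex w (Im q)))) \<le> 1 * dist u w"
   using abs_Re_le_cmod[of "S m L (Complex u (Im q)) - S m L (Complex w (Im q))"] by (simp add: dist_real_def)
 qed simp
 moreover have "Re (S m L (Complex (Re q) (Im q))) \<le> x" using x by simp
 ultimately obtain u where u: "Re q \<le> u" "Re (S m L (Complex u (Im q))) = x"
  using IVT'[of "\<lambda>u. Re (S m L (Complex u (Im q)))" "Re q" x t] t(2) qt by auto
 show ?thesis by (rule that[of "Complex u (Im q)"]) (use u S_Im[OF L, of "Complex u (Im q)"] q in \<open>auto simp: complex_eq_iff\<close>)
qed

text \<open>A point to the right of \<open>S m L p'\<close> at the same height is, by
  \<open>S_solve\<close>, the value of the same branch at a point to the right of \<open>p'\<close>.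
  So the points to the right of \<open>B\<close> form a coinductive family.\<close>

lemma B_up: assumes "p \<in> B m" "Re p \<le> x" shows "Complex x (Im p) \<in> B m"
proof (rule B_coinduct[of "\<lambda>m. {q. \<exists>p\<in>B m. Im q = Im p \<and> Re p \<le> Re q}"])
 fix m q assume "q \<in> {q. \<exists>p\<in>B m. Im q = Im p \<and> Re p \<le> Re q}"
 then obtain p where p: "p \<in> B m" "Im q = Im p" "Re p \<le> Re q" by blast
 obtain L p' where L: "lbm m L" "p' \<in> B (Suc m)" "R \<le> Re p'" "p = S m L p'" by (rule B_elim[OF p(1)])
 obtain q' where q': "Im q' = Im p'" "Re p' \<le> Re q'" "S m L q' = Complex (Re q) (v m L (Im p'))"
  by (rule S_solve[OF L(1,3), of "Re q"]) (use p L in auto)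
 have "q = S m L q'" using q'(3) S_Im[OF L(1,3)] p(2) L(4) by (simp add: complex_eq_iff)
 thus "Q \<le> Re q \<and> (\<exists>L q'. lbm m L \<and> q' \<in> {q. \<exists>p\<in>B (Suc m). Im q = Im p \<and> Re p \<le> Re q} \<and> q = S m L q')"
  using L q' B_Re[OF p(1)] p(3) by (intro conjI exI[of _ L] exI[of _ q'] CollectI bexI[of _ p']) auto
qed (use assms in auto)

text \<open>The pulled back point may fall to the left of \<open>Q\<close>. It is then moved to the
  right up to the vertical line through \<open>S m L p'\<close>, which does not increase the
  distance from that point.\<close>

lemma B_pull:
 assumes L: "lbm m L" and p: "R \<le> Re p'" "Q \<le> Re (S m L p')" and q: "q' \<in> B (Suc m)"
 obtains q where "q \<in> B m" "Im q = v m L (Im q')" "norm (q - S m L p') \<le> 1/2 * norm (q' - p')" "Re (S m L p') \<le> Re q"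
proof -
 have Rq: "R \<le> Re q'" using B_Re[OF q] QR by simp
 define x where "x = max (Re (S m L p')) (Re (S m L q'))"
 obtain r where r: "Im r = Im q'" "Re q' \<le> Re r" "S m L r = Complex x (v m L (Im q'))" by (rule S_solve[OF L Rq, of x]) (simp add: x_def)
 have "r = Complex (Re r) (Im q')" using r(1) by (simp add: complex_eq_iff)
 hence "r \<in> B (Suc m)" using B_up[OF q r(2)] by simp
 hence "S m L r \<in> B m" using r(3) p by (intro B_intro[OF L]) (auto simp: x_def)
 moreover have "norm (S m L r - S m L p') \<le> norm (S m L q' - S m L p')"
  using S_Im[OF L Rq] unfolding r(3) cmod_def by (auto simp: x_def max_def abs_le_square_iff)
 moreover have "norm (S m L q' - S m L p') \<le> 1/2 * norm (q' - p')" by (rule S_lip[OF L Rq p(1)])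
 ultimately show ?thesis using that[of "S m L r"] r(3) by (simp add: x_def)
qed

text \<open>At the \<open>n\<close>-th point of the orbit, the translates by \<open>tpi\<close> in
  both directions belong to the set. Each branch on the way back halves the distance and keeps the
  order of heights.\<close>

lemma B_approx:
 assumes "p \<in> B m" "\<sigma> = 1 \<or> \<sigma> = -1"
 shows "\<exists>q\<in>B m. norm (q - p) \<le> 2 * pi / 2 ^ n \<and> 0 < \<sigma> * (Im q - Im p)"
 using assms(1)
proof (induction n arbitrary: m p)
 case 0
 have "p + of_int (if \<sigma> = 1 then 1 else -1) * tpi \<in> B m" by (rule B_tpi[OF 0])
 thus ?case using assms(2) by (intro bexI[of _ "p + of_int (if \<sigma> = 1 then 1 else -1) * tpi"]) (auto simp: norm_mult tpi_def)
next
 case (Suc n)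
 obtain L p' where L: "lbm m L" "p' \<in> B (Suc m)" "R \<le> Re p'" "p = S m L p'" by (rule B_elim[OF Suc.prems])
 obtain q' where q': "q' \<in> B (Suc m)" "norm (q' - p') \<le> 2 * pi / 2 ^ n" "0 < \<sigma> * (Im q' - Im p')" using Suc.IH[OF L(2)] by blast
 obtain q where q: "q \<in> B m" "Im q = v m L (Im q')" "norm (q - S m L p') \<le> 1/2 * norm (q' - p')"
  by (rule B_pull[OF L(1,3) _ q'(1)]) (use B_Re[OF Suc.prems] L(4) in auto)
 have "Im p = v m L (Im p')" using S_Im[OF L(1,3)] L(4) by simp
 hence "0 < \<sigma> * (Im q - Im p)" using assms(2) q'(3) q(2) strict_monoD[OF model.v_mono[OF md L(1)]] by auto
 moreover have "norm (q - p) \<le> 2 * pi / 2 ^ Suc n" using q(3) q'(2) L(4) by simp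
 ultimately show ?case using q(1) by blast
qed

text \<open>The translates of one point by multiples of \<open>tpi\<close> have spacing
  \<open>2 * pi\<close>. Pulling back contracts errors, and \<open>v_dense\<close> supplies a tract
  near the desired height at every step.\<close>

lemma B_dense_step: assumes "\<And>m. B m \<noteq> {}" shows "\<exists>p\<in>B m. \<bar>Im p - c\<bar> \<le> 2 * pi / 2 ^ n"
proof (induction n arbitrary: m c)
 case 0
 obtain p where p: "p \<in> B m" using assms by blast
 define k where "k = \<lfloor>(c - Im p) / (2 * pi)\<rfloor>"
 have "of_int k \<le> (c - Im p) / (2 * pi)" "(c - Im p) / (2 * pi) < of_int k + 1" by (simp_all add: k_def)
 hence "of_int k * (2 * pi) \<le> c - Im p" "c - Im p < (of_int k + 1) * (2 * pi)" using pi_gt_zero by (simp_all add: field_simps)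
 thus ?case using B_tpi[OF p, of k] by (intro bexI[of _ "p + of_int k * tpi"]) (auto simp: algebra_simps)
next
 case (Suc n)
 \<comment> \<open>A quarter of the previous error \<open>2 * pi / 2 ^ n\<close>. The new error has
   two such shares: one for the height of the tract, and one for the contracted previous
   error.\<close>
 define e where "e = pi / 2 ^ n / 2"
 have e: "e > 0" by (simp add: e_def)
 obtain L y where L: "lbm m L" "c - e < v m L y" "v m L y < c + e" using model.v_dense[OF md, of "c - e" "c + e" m] e by auto
 obtain p where p: "p \<in> B (Suc m)" "\<bar>Im p - y\<bar> \<le> 2 * pi / 2 ^ n" using Suc by blast
 have Rp: "R \<le> Re p" using B_Re[OF p(1)] QR by simp
 obtain r where r: "Im r = Im p" "Re p \<le> Re r" "S m L r = Complex (max Q (Re (S m L p))) (v m L (Im p))"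
  by (rule S_solve[OF L(1) Rp, of "max Q (Re (S m L p))"]) simp
 have "r = Complex (Re r) (Im p)" using r(1) by (simp add: complex_eq_iff)
 hence "r \<in> B (Suc m)" using B_up[OF p(1) r(2)] by simp
 hence "S m L r \<in> B m" using r(3) by (intro B_intro[OF L(1)]) auto
 moreover have "\<bar>v m L (Im p) - v m L y\<bar> \<le> e" using model.v_lip[OF md L(1), of "Im p" y] p(2) by (simp add: e_def)
 hence "\<bar>v m L (Im p) - c\<bar> \<le> 2 * e" using L(2,3) by linarith
 hence "\<bar>Im (S m L r) - c\<bar> \<le> 2 * pi / 2 ^ Suc n" using r(3) by (simp add: e_def)
 ultimately show ?case by blast
qed

section \<open>Existence of hairs and the set of their heights\<close>

definition Lm :: "nat \<Rightarrow> complex \<Rightarrow> complex" where "Lm m = (SOME L. lbm m L)"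

lemma Lm: "lbm m (Lm m)"
proof -
 have "\<exists>L. lbm m L" using model.v_dense[OF md, of 0 1 m] by auto
 thus ?thesis unfolding Lm_def by (rule someI_ex)
qed

lemma periodic_bounded:
 fixes f :: "nat \<Rightarrow> real" assumes "\<And>m. f (m + N) = f m" obtains U where "0 \<le> U" "\<And>m. \<bar>f m\<bar> \<le> U"
proof (rule that[of "\<Sum>i<N. \<bar>f i\<bar>"])
 fix m
 have "f (i + k * N) = f i" for i k
 proof (induction k)
  case (Suc k)
  have "i + Suc k * N = (i + k * N) + N" by simp
  thus ?case using assms Suc by metis
 qed simp
 from this[of "m mod N" "m div N"] have "f m = f (m mod N)" by simp
 thus "\<bar>f m\<bar> \<le> (\<Sum>i<N. \<bar>f i\<bar>)" using N0 member_le_sum[of "m mod N" "{..<N}" "\<lambda>i. \<bar>f i\<bar>"] by simp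
qed (simp add: sum_nonneg)

text \<open>With one branch \<open>Lm m\<close> fixed for each index, the height contractions have a
  bounded solution of \<open>vm m (y (Suc m)) = y m\<close>, the limit of iterates of 0. Right parts
  of the rays at these heights form a coinductive family. Periodicity makes the bounds
  \<open>U\<close> and \<open>V\<close> independent of the index.\<close>

lemma B_ne: "B m \<noteq> {}"
proof -
 define vm where "vm m = v m (Lm m)" for m
 have Lp: "Lm (m + N) = Lm m" for m by (simp add: Lm_def per)
 obtain V where V: "0 \<le> V" "\<And>m. \<bar>vm m 0\<bar> \<le> V" by (rule periodic_bounded[of "\<lambda>m. vm m 0"]) (auto simp: vm_def Lp per)
 obtain U where U: "0 \<le> U" "\<And>m. \<bar>Re (S m (Lm m) (Complex R 0))\<bar> \<le> U"
  by (rule periodic_bounded[of "\<lambda>m. Re (S m (Lm m) (Complex R 0))"]) (auto simp: S_def Lp per)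
 have vl: "\<bar>vm m y - vm m y'\<bar> \<le> 1/4 * \<bar>y - y'\<bar>" for m y y' unfolding vm_def by (rule model.v_lip[OF md Lm])
 define Y where "Y = rec_nat (\<lambda>m. 0) (\<lambda>n f m. vm m (f (Suc m)))"
 have Y: "Y 0 m = 0" "Y (Suc n) m = vm m (Y n (Suc m))" for n m by (simp_all add: Y_def)
 have st: "\<bar>Y (Suc n) m - Y n m\<bar> \<le> V / 2 ^ n" for n m
 proof (induction n arbitrary: m)
  case (Suc n)
  have "\<bar>Y (Suc (Suc n)) m - Y (Suc n) m\<bar> \<le> 1/4 * \<bar>Y (Suc n) (Suc m) - Y n (Suc m)\<bar>"
   using vl unfolding Y(2)[of "Suc n"] Y(2)[of n m] by blast
  also have "\<dots> \<le> 1/4 * (V / 2 ^ n)" using Suc by (intro mult_left_mono) auto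
  also have "\<dots> \<le> V / 2 ^ Suc n" using V(1) by (simp add: field_simps)
  finally show ?case .
 qed (use V in \<open>simp add: Y\<close>)
 have "norm (complex_of_real (Y (Suc n) m) - of_real (Y n m)) \<le> V / 2 ^ n" for n m using st[of n m] by (simp flip: of_real_diff)
 then obtain g where g: "\<And>n m. norm (of_real (Y n m) - g m) \<le> 2 * V / 2 ^ n" "\<And>m. (\<lambda>n. complex_of_real (Y n m)) \<longlonglongrightarrow> g m"
  by (rule geometric_limit[of "\<lambda>n m. of_real (Y n m)" V]) blast
 define y where "y m = Re (g m)" for m
 have ylim: "(\<lambda>n. Y n m) \<longlonglongrightarrow> y m" for m using tendsto_Re[OF g(2)[of m]] by (simp add: y_def)
 have yb: "\<bar>y m\<bar> \<le> 2 * V" for m using g(1)[of 0 m] abs_Re_le_cmod[of "g m"] by (simp add: Y y_def)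
 have yv: "vm m (y (Suc m)) = y m" for m
 proof (rule LIMSEQ_unique)
  have "continuous_on UNIV (vm m)" 
  proof (rule lipschitz_on_continuous_on[OF lipschitz_onI])
   show "dist (vm m x) (vm m y) \<le> 1/4 * dist x y" for x y unfolding dist_real_def by (rule vl)
  qed simp
  thus "(\<lambda>n. Y (Suc n) m) \<longlonglongrightarrow> vm m (y (Suc m))" unfolding Y(2) by (rule continuous_on_tendsto_compose[OF _ ylim]) auto
  show "(\<lambda>n. Y (Suc n) m) \<longlonglongrightarrow> y m" by (rule LIMSEQ_Suc[OF ylim])
 qed
 \<comment> \<open>\<open>U + V\<close> bounds the real part of the image of
   \<open>Complex R (y (Suc m))\<close>. As \<open>S m\<close> contracts by 1/2, a point whose image
   has real part \<open>x \<ge> 2 * (U + V)\<close> has real part at least \<open>x\<close>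
   itself.\<close>
 define X0 where "X0 = max Q (2 * (U + V))"
 have "Complex X0 (y m) \<in> B m"
 proof (rule B_coinduct[of "\<lambda>m. {Complex x (y m) | x. X0 \<le> x}"])
  fix m p assume "p \<in> {Complex x (y m) | x. X0 \<le> x}"
  then obtain x where x: "p = Complex x (y m)" "X0 \<le> x" by blast
  let ?q = "Complex R (y (Suc m))"
  have "norm (S m (Lm m) ?q - S m (Lm m) (Complex R 0)) \<le> 1/2 * norm (?q - Complex R 0)" by (intro S_lip[OF Lm]) auto
  also have "norm (?q - Complex R 0) = \<bar>y (Suc m)\<bar>" by (simp add: cmod_def)
  finally have "\<bar>Re (S m (Lm m) ?q) - Re (S m (Lm m) (Complex R 0))\<bar> \<le> V"
   using abs_Re_le_cmod[of "S m (Lm m) ?q - S m (Lm m) (Complex R 0)"] yb[of "Suc m"] by simp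
  hence q: "Re (S m (Lm m) ?q) \<le> U + V" using U(2)[of m] by linarith
  obtain r where r: "Im r = Im ?q" "Re ?q \<le> Re r" "S m (Lm m) r = Complex x (v m (Lm m) (Im ?q))"
   by (rule S_solve[OF Lm, of ?q m x]) (use q x U(1) V(1) in \<open>auto simp: X0_def\<close>)
  have "norm (S m (Lm m) r - S m (Lm m) ?q) \<le> 1/2 * norm (r - ?q)" using r by (intro S_lip[OF Lm]) auto
  moreover have "norm (r - ?q) = Re r - R" using r by (simp add: cmod_def)
  ultimately have "x - (U + V) \<le> 1/2 * (Re r - R)" using abs_Re_le_cmod[of "S m (Lm m) r - S m (Lm m) ?q"] q r(3) by simp
  hence "X0 \<le> Re r" using x Ra by (simp add: X0_def)
  moreover have "r = Complex (Re r) (y (Suc m))" using r by (simp add: complex_eq_iff)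
  moreover have "p = S m (Lm m) r" using r(3) yv[of m] x by (simp add: vm_def)
  moreover have "Q \<le> Re p" using x by (simp add: X0_def)
  ultimately show "Q \<le> Re p \<and> (\<exists>L p'. lbm m L \<and> p' \<in> {Complex x (y (Suc m)) | x. X0 \<le> x} \<and> p = S m L p')"
   using Lm by blast
 qed auto
 thus ?thesis by blast
qed

lemma B_dense: assumes "b < c" shows "\<exists>p\<in>B m. b < Im p \<and> Im p < c"
proof -
 obtain n where n: "2 * pi / 2 ^ n < (c - b) / 2" using half_powers_less[of "(c - b) / 2" "2 * pi"] assms by auto
 obtain p where p: "p \<in> B m" "\<bar>Im p - (b + c) / 2\<bar> \<le> 2 * pi / 2 ^ n" using B_dense_step[OF B_ne] by blast
 hence "\<bar>Im p - (b + c) / 2\<bar> < (c - b) / 2" using n by simp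
 thus ?thesis using p(1) by (intro bexI[of _ p]) (auto simp: abs_less_iff field_simps)
qed

text \<open>The sets \<open>range (v m L)\<close> are open, and disjoint for different tracts. An
  interval covered by them lies in a single one, so it comes entirely from one branch.\<close>

lemma B_interval:
 assumes bc: "b \<le> c" "{b..c} \<subseteq> Im ` B m"
 obtains L b' c' where "lbm m L" "v m L b' = b" "v m L c' = c" "{b'..c'} \<subseteq> Im ` B (Suc m)"
proof -
 have el: "\<exists>L y. lbm m L \<and> t = v m L y \<and> y \<in> Im ` B (Suc m)" if t: "t \<in> {b..c}" for t
 proof -
  obtain p where p: "p \<in> B m" "t = Im p" using t bc(2) by blast
  obtain L p' where L: "lbm m L" "p' \<in> B (Suc m)" "R \<le> Re p'" "p = S m L p'" by (rule B_elim[OF p(1)])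
  show ?thesis using L p(2) S_Im[OF L(1,3)] by (intro exI[of _ L] exI[of _ "Im p'"]) auto
 qed
 have cont: "continuous_on UNIV (v m L)" if "lbm m L" for L
 proof (rule lipschitz_on_continuous_on[OF lipschitz_onI])
  show "dist (v m L x) (v m L y) \<le> 1/4 * dist x y" for x y unfolding dist_real_def by (rule model.v_lip[OF md that])
 qed simp
 have op: "open (range (v m L))" if "lbm m L" for L
  by (rule invariance_of_domain[OF cont[OF that] open_UNIV]) (rule strict_mono_imp_inj_on[OF model.v_mono[OF md that]])
 obtain L b' where L: "lbm m L" "b = v m L b'" using el[of b] bc(1) by auto
 define O' where "O' = \<Union>{range (v m L') | L'. lbm m L' \<and> range (v m L') \<inter> range (v m L) = {}}"
 have oO: "open O'" unfolding O'_def using op by blast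
 have eq: "range (v m L') = range (v m L)" if L': "lbm m L'" "range (v m L') \<inter> range (v m L) \<noteq> {}" for L'
 proof -
  obtain t where "t \<in> range (v m L')" "t \<in> range (v m L)" using L'(2) by blast
  then obtain y y' where "v m L y = v m L' y'" by (metis rangeE)
  then obtain k :: int where k: "\<And>W. a < Re W \<Longrightarrow> L' (W + of_int k * tpi) = L W" using model.v_eq[OF md L(1) L'(1)] by blast
  have "v m L' (u + 2 * pi * of_int k) = v m L u" for u
  proof -
   have "lt R L' (Complex R u + of_int k * tpi) = lt R L (Complex R u)" using k Ra by (simp add: lt_def)
   thus ?thesis using S_Im[OF L(1), of "Complex R u"] S_Im[OF L'(1), of "Complex R u + of_int k * tpi"]
    by (simp add: S_def mult.commute mult.left_commute)
  qed
  note s = this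
  have "v m L' u \<in> range (v m L)" for u using s[of "u - 2 * pi * of_int k"] by simp
  moreover have "v m L u \<in> range (v m L')" for u using s[of u, symmetric] by simp
  ultimately show ?thesis by (intro equalityI image_subsetI)
 qed
 have "c \<in> range (v m L)"
 proof (rule ccontr)
  assume c: "c \<notin> range (v m L)"
  have cov: "{b..c} \<subseteq> range (v m L) \<union> O'"
  proof
   fix t assume "t \<in> {b..c}"
   then obtain L' y where L': "lbm m L'" "t = v m L' y" using el by blast
   show "t \<in> range (v m L) \<union> O'"
   proof (cases "range (v m L') \<inter> range (v m L) = {}")
    case True
    thus ?thesis using L' by (auto simp: O'_def)
   next
    case False
    thus ?thesis using eq[OF L'(1)] L'(2) by blast
   qed
  qed
  have "connected {b..c}" by simp
  from connectedD[OF this op[OF L(1)] oO _ cov] have "range (v m L) \<inter> {b..c} = {} \<or> O' \<inter> {b..c} = {}" by (auto simp: O'_def)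
  moreover have "b \<in> range (v m L) \<inter> {b..c}" using L(2) bc(1) by simp
  moreover have "c \<in> O' \<inter> {b..c}" using c cov bc(1) by auto
  ultimately show False by blast
 qed
 then obtain c' where c': "c = v m L c'" by blast
 have mono: "v m L x \<le> v m L y \<longleftrightarrow> x \<le> y" for x y by (rule strict_mono_less_eq[OF model.v_mono[OF md L(1)]])
 have "{b'..c'} \<subseteq> Im ` B (Suc m)"
 proof
  fix t assume "t \<in> {b'..c'}"
  hence "v m L t \<in> {b..c}" using mono L(2) c' by simp
  then obtain L' y where L': "lbm m L'" "v m L t = v m L' y" "y \<in> Im ` B (Suc m)" using el by blast
  obtain k :: int where k: "y = t + 2 * pi * of_int k" using model.v_eq[OF md L(1) L'(1,2)] by blast
  obtain p where p: "p \<in> B (Suc m)" "y = Im p" using L'(3) by blast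
  thus "t \<in> Im ` B (Suc m)" using B_tpi[OF p(1), of "-k"] k by (intro image_eqI[of _ _ "p + of_int (-k) * tpi"]) (auto simp: algebra_simps)
 qed
 thus ?thesis using that[of L b' c'] L c' by simp
qed

text \<open>An interval of heights gets longer by a definite factor at each step of the orbit, while
  \<open>v_range\<close> bounds the heights of one tract by \<open>2 * pi\<close>. The missing
  heights are what the cut in \<open>log_brush_bouquet\<close> is made of.\<close>

lemma B_no_interval: assumes "b < c" shows "\<not> {b..c} \<subseteq> Im ` B m"
proof
 assume bc: "{b..c} \<subseteq> Im ` B m"
 have *: "c - b \<le> 2 * pi / 2 ^ n" if "b \<le> c" "{b..c} \<subseteq> Im ` B m" for b c m n using that
 proof (induction n arbitrary: b c m)
  case 0
  obtain L b' c' where L: "lbm m L" "v m L b' = b" "v m L c' = c" by (rule B_interval[OF 0]) blast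
  thus ?case using model.v_range[OF md L(1), of c' b'] by simp
 next
  case (Suc n)
  obtain L b' c' where L: "lbm m L" "v m L b' = b" "v m L c' = c" "{b'..c'} \<subseteq> Im ` B (Suc m)" by (rule B_interval[OF Suc.prems])
  have "b' \<le> c'" using strict_mono_less_eq[OF model.v_mono[OF md L(1)], of b' c'] L(2,3) Suc.prems(1) by simp
  define x where "x = 2 * pi / 2 ^ n"
  have "c' - b' \<le> x" "\<bar>c' - b'\<bar> = c' - b'" using Suc.IH[OF \<open>b' \<le> c'\<close> L(4)] \<open>b' \<le> c'\<close> by (auto simp: x_def)
  moreover have "c - b \<le> 1/4 * \<bar>c' - b'\<bar>" using model.v_lip[OF md L(1), of c' b'] unfolding L(2,3) by linarith
  moreover have "0 \<le> x" by (simp add: x_def)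
  ultimately have "c - b \<le> 1/4 * \<bar>c' - b'\<bar>" "1/4 * \<bar>c' - b'\<bar> \<le> 1/4 * x" "1/4 * x \<le> 1/2 * x" by simp_all
  hence "c - b \<le> 1/2 * x" by (meson order_trans)
  hence "c - b \<le> 1/2 * (2 * pi / 2 ^ n)" by (simp only: x_def)
  thus ?case by simp
 qed
 have "c - b \<le> 0" by (rule LIMSEQ_le_const[OF half_powers]) (use *[OF less_imp_le[OF assms] bc] in blast)
 thus False using assms by simp
qed

section \<open>Closedness and position in the Julia set\<close>

lemma h_hol: "h m holomorphic_on UNIV" by (rule tracts.gh[OF tr])

lemma orb_cont: "continuous_on UNIV (\<lambda>w. orb m w k)"
proof (induction k)
 case (Suc k)
 have "continuous_on UNIV (\<lambda>w. h (m + k) (orb m w k))" by (rule continuous_on_compose2[OF holomorphic_on_imp_continuous_on[OF h_hol] Suc]) simp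
 thus ?case by simp
qed simp

lemma X_norm: assumes "w \<in> X m" shows "exp (R + 1) \<le> norm (orb m w k)"
proof -
 have o: "orb m w k \<noteq> 0" "Q \<le> Re (phi (m + k) (Ln (orb m w k)))" using assms by (auto simp: X_def)
 have "exp (R + 1) \<le> exp (Re (Ln (orb m w k)))" using Q_large[OF o(2)] by (rule iffD2[OF exp_le_cancel_iff])
 thus ?thesis using o(1) by simp
qed

lemma X_closed: "closed (X m)"
 unfolding closed_sequential_limits
proof (intro allI impI)
 fix x l assume "(\<forall>n. x n \<in> X m) \<and> x \<longlonglongrightarrow> l"
 hence x: "\<And>n. x n \<in> X m" "x \<longlonglongrightarrow> l" by auto
 have "orb m l k \<noteq> 0 \<and> Q \<le> Re (phi (m + k) (Ln (orb m l k)))" for k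
 proof -
  define o' where "o' n = orb m (x n) k" for n
  have lim: "o' \<longlonglongrightarrow> orb m l k" unfolding o'_def by (intro continuous_on_tendsto_compose[OF orb_cont x(2)]) auto
  have "exp (R + 1) \<le> norm (orb m l k)" by (rule LIMSEQ_le_const[OF tendsto_norm[OF lim]]) (use X_norm[OF x(1)] in \<open>auto simp: o'_def\<close>)
  hence nz: "orb m l k \<noteq> 0" using exp_gt_zero[of "R + 1"] by (metis norm_zero not_le)
  have o': "o' n \<noteq> 0" "Q \<le> Re (phi (m + k) (Ln (o' n)))" for n using x(1)[of n] by (auto simp: X_def o'_def)
  obtain z where zl: "z \<longlonglongrightarrow> Ln (orb m l k)" and ez: "\<And>n. exp (z n) = o' n" by (rule Ln_lift[OF lim nz o'(1)]) blast
  have zn: "Q \<le> Re (phi (m + k) (z n))" for n using Re_phi_Ln[of "m + k" "z n"] o'(2)[of n] unfolding ez by simp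
  have "(\<lambda>n. phi (m + k) (z n)) \<longlonglongrightarrow> phi (m + k) (Ln (orb m l k))"
   by (intro continuous_on_tendsto_compose[OF homeomorphism_cont1[OF phi(3)] zl]) auto
  hence "Q \<le> Re (phi (m + k) (Ln (orb m l k)))" using zn by (intro LIMSEQ_le_const[OF tendsto_Re]) auto
  thus ?thesis using nz by simp
 qed
 thus "l \<in> X m" by (simp add: X_def)
qed

lemma B_closed: "closed (B m)"
proof -
 have "continuous_on UNIV (\<lambda>p. exp (psi m p))" by (intro continuous_intros homeomorphism_cont2[OF phi(3)])
 hence "closed ((\<lambda>p. exp (psi m p)) -` X m)" using continuous_on_closed_vimage[OF closed_UNIV] X_closed by fastforce
 thus ?thesis by (simp add: B_def vimage_def)
qed

text \<open>The branches contract by 1/2 on \<open>R - 9 \<le> Re y\<close>, so a disc of radius 10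
  around a logarithm of the \<open>n\<close>-th orbit point is covered from a disc of radius
  \<open>10 / 2 ^ n\<close>. As 10 exceeds \<open>pi\<close>, the image under \<open>exp\<close> of
  the large disc contains a full circle around 0.\<close>

lemma cover:
 assumes "exp z \<in> X m"
 shows "\<exists>z'. exp z' = orb m (exp z) n \<and> (\<forall>u\<in>ball z' 10. \<exists>y\<in>ball z (10 / 2 ^ n). orb m (exp y) n = exp u)"
 using assms
proof (induction n arbitrary: m z)
 case (Suc n)
 obtain L z1 where L: "lbm m L" "exp z1 \<in> X (Suc m)" "R + 1 \<le> Re z1" "L z1 = z" by (rule X_elim[OF Suc.prems]) blast
 have hL: "h m (exp (L y)) = exp y" if "R - 9 \<le> Re y" for y using h_lb[OF L(1), of y] that R400 by simp
 obtain z' where z': "exp z' = orb (Suc m) (exp z1) n" "\<forall>u\<in>ball z' 10. \<exists>y\<in>ball z1 (10 / 2 ^ n). orb (Suc m) (exp y) n = exp u"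
  using Suc.IH[OF L(2)] by blast
 have "h m (exp z) = exp z1" using hL[of z1] L by simp
 hence "exp z' = orb m (exp z) (Suc n)" unfolding orb_shift using z'(1) by simp
 moreover have "\<exists>y\<in>ball z (10 / 2 ^ Suc n). orb m (exp y) (Suc n) = exp u" if u: "u \<in> ball z' 10" for u
 proof -
  obtain y where y: "y \<in> ball z1 (10 / 2 ^ n)" "orb (Suc m) (exp y) n = exp u" using z'(2) u by blast
  have "norm (z1 - y) < 10 / 2 ^ n" using y(1) by (simp add: dist_norm)
  also have "\<dots> \<le> 10 / 1" by (intro divide_left_mono) auto
  finally have Ry: "R - 9 \<le> Re y" using abs_Re_le_cmod[of "z1 - y"] L(3) by simp
  have "norm (L z1 - L y) \<le> 12 * pi / (R - 9 - a) * norm (z1 - y)" using Ry L(3) R400 by (intro tracts.lb_lip[OF tr L(1)]) auto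
  also have "\<dots> \<le> 1/2 * norm (z1 - y)" using R400 pi_less_4 by (intro mult_right_mono) (auto simp: field_simps)
  also have "\<dots> < 10 / 2 ^ Suc n" using y(1) by (simp add: dist_norm)
  finally have "L y \<in> ball z (10 / 2 ^ Suc n)" using L(4) by (simp add: dist_norm)
  thus ?thesis using hL[OF Ry] y(2) unfolding orb_shift by (intro bexI[of _ "L y"]) auto
 qed
 ultimately show ?case by blast
qed auto

text \<open>Otherwise a whole vertical line would be covered by images of branches and, being
  connected, lie in the image of a single one. It contains points that differ by \<open>tpi\<close>,
  against \<open>lb_inj\<close>.\<close>

lemma no_circle: "\<exists>d. norm d = exp t \<and> norm (h m d) \<le> exp a"
proof (rule ccontr)
 assume "\<not> ?thesis"
 hence out: "exp a < norm (h m (exp (Complex t y)))" for y by (metis complex.sel(1) not_le norm_exp_eq_Re)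
 have cov: "\<exists>L Z. lbm m L \<and> a < Re Z \<and> L Z = Complex t y" for y by (rule tracts.tract_cover[OF tr out[of y]]) blast
 obtain L Z where L: "lbm m L" "a < Re Z" "L Z = Complex t 0" using cov by blast
 have op: "open (L' ` hp a)" if L': "lbm m L'" for L'
 proof (rule invariance_of_domain[OF _ open_hp])
  show "continuous_on (hp a) L'" using tracts.lbD(1)[OF tr L'] by (rule holomorphic_on_imp_continuous_on)
  show "inj_on L' (hp a)" using tracts.lb_inj(1)[OF tr L', of _ _ 0] by (intro inj_onI) simp
 qed
 define O' where "O' = \<Union>{L' ` hp a | L'. lbm m L' \<and> L' ` hp a \<inter> L ` hp a = {}}"
 have oO: "open O'" unfolding O'_def using op by blast
 let ?l = "range (Complex t)"
 have "?l \<subseteq> L ` hp a \<union> O'"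
 proof
  fix s assume "s \<in> ?l"
  then obtain y where "s = Complex t y" by blast
  then obtain L' Z' where L': "lbm m L'" "a < Re Z'" "s = L' Z'" using cov[of y] by metis
  show "s \<in> L ` hp a \<union> O'"
  proof (cases "L' ` hp a \<inter> L ` hp a = {}")
   case True
   hence "L' ` hp a \<subseteq> O'" using L'(1) unfolding O'_def by blast
   moreover have "s \<in> L' ` hp a" using L' by simp
   ultimately show ?thesis by blast
  next
   case False
   then obtain p where "p \<in> L' ` hp a" "p \<in> L ` hp a" by blast
   then obtain Z1 Z2 where Z: "a < Re Z1" "a < Re Z2" "L Z1 = L' Z2" by auto
   hence "exp (L Z1) = exp (L' Z2)" by simp
   then obtain k n :: int where k: "Z2 = Z1 + of_int k * tpi" "\<And>W. a < Re W \<Longrightarrow> L' (W + of_int k * tpi) = L W + of_int n * tpi"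
    by (rule tracts.lb_meet[OF tr L(1) L'(1) Z(1,2)]) blast
   have "n = 0" using k(2)[OF Z(1)] k(1) Z(3) by simp
   hence "s = L (Z' + of_int (-k) * tpi)" using k(2)[of "Z' + of_int (-k) * tpi"] L' by simp
   thus ?thesis using L'(2) by auto
  qed
 qed
 moreover have "connected ?l"
 proof (rule connected_continuous_image)
  show "continuous_on UNIV (\<lambda>y. Complex t y)" by (intro continuous_intros)
 qed simp
 ultimately have "L ` hp a \<inter> ?l = {} \<or> O' \<inter> ?l = {}" using connectedD[OF _ op[OF L(1)] oO, of ?l] by (auto simp: O'_def)
 moreover have "Complex t 0 \<in> L ` hp a \<inter> ?l" using L by (metis IntI hp_iff imageI rangeI)
 ultimately have "?l \<subseteq> L ` hp a" using \<open>?l \<subseteq> _\<close> by blast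
 hence "Complex t (2 * pi) \<in> L ` hp a" by blast
 then obtain Z2 where Z2: "a < Re Z2" "L Z2 = Complex t (2 * pi)" by (metis hp_iff imageE)
 have "L Z2 = L Z + of_int 1 * tpi" using L(3) Z2(2) by (simp add: complex_eq_iff)
 hence "(1::int) = 0" by (rule tracts.lb_inj(2)[OF tr L(1) Z2(1) L(2)])
 thus False by simp
qed

definition f :: "complex \<Rightarrow> complex" where "f w = orb 0 w N"

lemma orb_add: "orb m w (j + k) = orb (m + j) (orb m w j) k"
 by (induction k) (auto simp: add.assoc)

lemma orb_period: "orb (m + N) w k = orb m w k"
proof (induction k)
 case (Suc k)
 have "m + N + k = (m + k) + N" by simp
 thus ?case using Suc per(1) by (metis orb.simps(2))
qed simp

lemma f_pow: "(f ^^ j) w = orb 0 w (j * N)"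
proof (induction j)
 case (Suc j)
 have "orb (j * N) u k = orb 0 u k" for u k 
 proof (induction j)
  case (Suc j)
  thus ?case using orb_period[of "j * N" u k] by (simp add: add.commute)
 qed simp
 thus ?case using Suc orb_add[of 0 w "j * N" N] by (simp add: f_def add.commute)
qed simp

lemma f_X: "f ` X 0 \<subseteq> X 0"
proof -
 have 1: "orb 0 w k \<in> X k" if "w \<in> X 0" for w k
 proof (induction k)
  case (Suc k)
  thus ?case using X_step[of "orb 0 w k" k] by simp
 qed (use that in simp)
 have 2: "X N = X 0"
 proof -
  have "phi (N + k) = phi k" "orb N w k = orb 0 w k" for k w using phi_period[of k] orb_period[of 0 w k] by (simp_all add: add.commute)
  thus ?thesis by (simp add: X_def)
 qed
 show ?thesis
 proof (intro image_subsetI)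
  fix w assume "w \<in> X 0"
  from 1[OF this, of N] show "f w \<in> X 0" unfolding f_def 2 .
 qed
qed

text \<open>If a limit function is finite, images of a small disc around \<open>w\<close> lie close
  to a single value, but they contain both \<open>q\<close> and \<open>- q\<close> with
  \<open>norm q \<ge> 1\<close>. If the limit is infinite, the circle covered one factor earlier
  contains a point that the last factor maps into the disc of radius \<open>exp a\<close>.\<close>

lemma X_julia: "X 0 \<subseteq> julia_set f"
proof
 fix w assume w: "w \<in> X 0"
 have w0: "w \<noteq> 0" using w X_step by blast
 have images: "\<exists>n0. \<forall>n\<ge>n0. \<forall>s. norm s = norm (orb 0 w n) \<longrightarrow> (\<exists>u\<in>ball w x. orb 0 u n = s)" if eps: "x > 0" for x
 proof -
  have "isCont exp (Ln w)" by simp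
  then obtain r0 where r0: "r0 > 0" "\<And>y. dist y (Ln w) < r0 \<Longrightarrow> dist (exp y) (exp (Ln w)) < x"
   using eps unfolding continuous_at_eps_delta by blast
  obtain n0 where n0: "\<And>n. n0 \<le> n \<Longrightarrow> 10 / 2 ^ n < r0" by (rule half_powers_less[OF r0(1)]) blast
  have "\<exists>u\<in>ball w x. orb 0 u n = s" if n: "n0 \<le> n" and z: "norm s = norm (orb 0 w n)" for n s
  proof -
   have "exp (Ln w) \<in> X 0" using w w0 by simp
   from cover[OF this, of n] obtain z' where z': "exp z' = orb 0 w n"
    "\<forall>u\<in>ball z' 10. \<exists>y\<in>ball (Ln w) (10 / 2 ^ n). orb 0 (exp y) n = exp u" using w0 by auto
   define u where "u = z' + Ln (s / orb 0 w n)"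
   have o0: "orb 0 w n \<noteq> 0" using w by (auto simp: X_def)
   have "norm (s / orb 0 w n) = 1" using z o0 by (simp add: norm_divide)
   hence c: "s / orb 0 w n \<noteq> 0" "Re (Ln (s / orb 0 w n)) = 0"
    by (metis norm_zero zero_neq_one, metis Re_Ln ln_one norm_zero zero_neq_one)
   hence "norm (Ln (s / orb 0 w n)) \<le> pi" using cmod_le[of "Ln (s / orb 0 w n)"] mpi_less_Im_Ln[OF c(1)] Im_Ln_le_pi[OF c(1)] by auto
   hence "u \<in> ball z' 10" using pi_less_4 by (simp add: u_def dist_norm)
   then obtain y where y: "y \<in> ball (Ln w) (10 / 2 ^ n)" "orb 0 (exp y) n = exp u" using z'(2) by blast
   have "exp u = s" using c(1) o0 by (simp add: u_def exp_add z'(1) del: divide_eq_0_iff)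
   moreover have "exp y \<in> ball w x" using r0(2)[of y] y(1) n0[OF n] w0 by (simp add: dist_commute)
   ultimately show ?thesis using y(2) by blast
  qed
  thus ?thesis by blast
 qed
 show "w \<in> julia_set f"
 proof (rule ccontr)
  assume "w \<notin> julia_set f"
  then obtain U where U: "open U" "w \<in> U" "normal_family (range (\<lambda>n. f ^^ n)) U" by (auto simp: julia_set_def fatou_set_def)
  obtain e where e: "e > 0" "cball w e \<subseteq> U" using U open_contains_cball by blast
  obtain r :: "nat \<Rightarrow> nat" where r: "strict_mono r"
   "(\<exists>g. g holomorphic_on U \<and> (\<forall>K. compact K \<and> K \<subseteq> U \<longrightarrow> uniform_limit K ((\<lambda>n. f ^^ n) \<circ> r) g sequentially)) \<or>
    (\<forall>K. compact K \<and> K \<subseteq> U \<longrightarrow> (\<forall>M. \<forall>\<^sub>F n in sequentially. \<forall>z\<in>K. norm ((f ^^ r n) z) > M))"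
   using U(3) unfolding normal_family_def by blast
  have big: "\<exists>n. m \<le> n \<and> n0 \<le> r n * N - 1 \<and> 1 \<le> r n" for m n0
  proof (intro exI[of _ "m + n0 + 1"])
   have "m + n0 + 1 \<le> r (m + n0 + 1)" using strict_mono_imp_increasing[OF r(1)] .
   moreover have "r (m + n0 + 1) * 1 \<le> r (m + n0 + 1) * N" using N0 by (intro mult_left_mono) auto
   ultimately show "m \<le> m + n0 + 1 \<and> n0 \<le> r (m + n0 + 1) * N - 1 \<and> 1 \<le> r (m + n0 + 1)" by linarith
  qed
  from r(2) show False
  proof
   assume "\<exists>g. g holomorphic_on U \<and> (\<forall>K. compact K \<and> K \<subseteq> U \<longrightarrow> uniform_limit K ((\<lambda>n. f ^^ n) \<circ> r) g sequentially)"
   then obtain g where g: "g holomorphic_on U" "uniform_limit (cball w e) ((\<lambda>n. f ^^ n) \<circ> r) g sequentially" using e(2) by auto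
   have "isCont g w" using holomorphic_on_imp_continuous_on[OF g(1)] U by (simp add: continuous_on_eq_continuous_at)
   then obtain d where d: "d > 0" "\<And>u. dist u w < d \<Longrightarrow> dist (g u) (g w) < 1/4" unfolding continuous_at_eps_delta by (metis zero_less_divide_1_iff zero_less_numeral)
   define \<delta> where "\<delta> = min d e"
   have \<delta>: "\<delta> > 0" "ball w \<delta> \<subseteq> cball w e" "ball w \<delta> \<subseteq> ball w d" using d e by (auto simp: \<delta>_def)
   obtain m where m: "\<And>n u. m \<le> n \<Longrightarrow> u \<in> cball w e \<Longrightarrow> dist ((f ^^ r n) u) (g u) < 1/4"
    using uniform_limitD[OF g(2), of "1/4"] unfolding eventually_sequentially o_def by (metis zero_less_divide_1_iff zero_less_numeral)
   obtain n0 where n0: "\<And>n s. n0 \<le> n \<Longrightarrow> norm s = norm (orb 0 w n) \<Longrightarrow> \<exists>u\<in>ball w \<delta>. orb 0 u n = s" using images[OF \<delta>(1)] by blast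
   obtain n where n: "m \<le> n" "n0 \<le> r n * N - 1" using big by blast
   define q where "q = (f ^^ r n) w"
   have "n0 \<le> r n * N" "norm (- q) = norm (orb 0 w (r n * N))" using n(2) by (auto simp: q_def f_pow)
   then obtain u where u: "u \<in> ball w \<delta>" "(f ^^ r n) u = - q" using n0[of "r n * N" "- q"] unfolding f_pow by blast
   have "dist (- q) (g u) < 1/4" using m[OF n(1), of u] u \<delta>(2) by auto
   moreover have "dist (g u) (g w) < 1/4" using subsetD[OF \<delta>(3) u(1)] by (intro d(2)) (simp add: dist_commute)
   moreover have "dist q (g w) < 1/4" using m[OF n(1), of w] e(1) by (simp add: q_def)
   ultimately have "dist (- q) q < 1" using dist_triangle[of "-q" q "g u"] dist_triangle[of "g u" q "g w"] by (simp add: dist_commute)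
   hence "norm (2 * q) < 1" by (simp add: dist_norm norm_minus_commute)
   moreover have "1 \<le> exp (R + 1)" using Ra by simp
   hence "1 \<le> norm q" using X_norm[OF w, of "r n * N"] unfolding q_def f_pow by linarith
   ultimately show False by (simp add: norm_mult)
  next
   assume "\<forall>K. compact K \<and> K \<subseteq> U \<longrightarrow> (\<forall>M. \<forall>\<^sub>F n in sequentially. \<forall>z\<in>K. norm ((f ^^ r n) z) > M)"
   hence "\<forall>\<^sub>F n in sequentially. \<forall>z\<in>cball w e. norm ((f ^^ r n) z) > exp a" using e(2) by simp
   then obtain m where m: "\<And>n u. m \<le> n \<Longrightarrow> u \<in> cball w e \<Longrightarrow> exp a < norm ((f ^^ r n) u)"
    unfolding eventually_sequentially by blast
   obtain n0 where n0: "\<And>n s. n0 \<le> n \<Longrightarrow> norm s = norm (orb 0 w n) \<Longrightarrow> \<exists>u\<in>ball w e. orb 0 u n = s" using images[OF e(1)] by blast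
   obtain n where n: "m \<le> n" "n0 \<le> r n * N - 1" "1 \<le> r n" using big by blast
   define k where "k = r n * N - 1"
   have k: "r n * N = Suc k" using n(3) N0 by (simp add: k_def)
   have "orb 0 w k \<noteq> 0" using w by (auto simp: X_def)
   then obtain s where z: "norm s = norm (orb 0 w k)" "norm (h k s) \<le> exp a" using no_circle[of "ln (norm (orb 0 w k))" k] by auto
   obtain u where u: "u \<in> ball w e" "orb 0 u k = s" using n0[OF n(2)[folded k_def] z(1)] by blast
   have "(f ^^ r n) u = h k s" unfolding f_pow k using u(2) by simp
   thus False using m[OF n(1), of u] u(1) z(2) by auto
  qed
 qed
qed

end

section \<open>From radial brushes to straight brushes\<close>

text \<open>Approximation of points gives hairs whose end points are in the limit not further to the
  right than \<open>t y\<close>. They are not further to the left either: otherwise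
  \<open>up\<close> and closedness would produce a point of \<open>B\<close> to the left of the end
  point at \<open>y\<close>.\<close>

lemma straight_brushI:
 assumes sub: "B \<subseteq> {0..} \<times> - \<rat>" and cl: "closed B" and up: "\<And>x y x'. (x, y) \<in> B \<Longrightarrow> x \<le> x' \<Longrightarrow> (x', y) \<in> B"
  and dense: "\<And>b c. b < c \<Longrightarrow> \<exists>y\<in>snd ` B. b < y \<and> y < c"
  and approx: "\<And>x y e \<sigma>. (x, y) \<in> B \<Longrightarrow> 0 < e \<Longrightarrow> \<sigma> = 1 \<or> \<sigma> = -1 \<Longrightarrow>
   \<exists>x' y'. (x', y') \<in> B \<and> \<bar>x' - x\<bar> < e \<and> \<bar>y' - y\<bar> < e \<and> 0 < \<sigma> * (y' - y)"
 shows "straight_brush B"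
proof -
 define t where "t y = Inf {x. (x, y) \<in> B}" for y
 have t: "(t y, y) \<in> B" and tle: "(x, y) \<in> B \<Longrightarrow> t y \<le> x" if y: "y \<in> snd ` B" for x y
 proof -
  have bdd: "bdd_below {x. (x, y) \<in> B}" using sub by (intro bdd_belowI[of _ 0]) auto
  have "closed ((\<lambda>x. (x, y)) -` B)" by (intro continuous_closed_vimage cl) (auto intro!: continuous_intros)
  hence "closed {x. (x, y) \<in> B}" by (simp add: vimage_def)
  moreover have "{x. (x, y) \<in> B} \<noteq> {}" using y by auto
  ultimately show "(t y, y) \<in> B" using closed_contains_Inf[OF _ bdd] by (auto simp: t_def)
  show "(x, y) \<in> B \<Longrightarrow> t y \<le> x" unfolding t_def by (rule cInf_lower[OF _ bdd]) simp
 qed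
 have seq: "\<exists>\<beta>. range \<beta> \<subseteq> snd ` B \<and> (\<forall>n. 0 < \<sigma> * (\<beta> n - y)) \<and> \<beta> \<longlonglongrightarrow> y \<and> (\<lambda>n. t (\<beta> n)) \<longlonglongrightarrow> t y"
  if y: "y \<in> snd ` B" and \<sigma>: "\<sigma> = 1 \<or> \<sigma> = -1" for y \<sigma>
 proof -
  have "\<forall>n. \<exists>q. q \<in> B \<and> \<bar>fst q - t y\<bar> < inverse (real (Suc n)) \<and> \<bar>snd q - y\<bar> < inverse (real (Suc n)) \<and> 0 < \<sigma> * (snd q - y)"
   using approx[OF t[OF y] _ \<sigma>] by (metis fst_conv inverse_positive_iff_positive of_nat_0_less_iff snd_conv zero_less_Suc)
  then obtain q where q: "\<forall>n. q n \<in> B \<and> \<bar>fst (q n) - t y\<bar> < inverse (real (Suc n)) \<and> \<bar>snd (q n) - y\<bar> < inverse (real (Suc n)) \<and> 0 < \<sigma> * (snd (q n) - y)"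
   by (rule exE[OF choice])
  define \<beta> where "\<beta> n = snd (q n)" for n
  have \<beta>S: "\<beta> n \<in> snd ` B" for n using q by (auto simp: \<beta>_def)
  have qB: "(fst (q n), \<beta> n) \<in> B" for n using q by (auto simp: \<beta>_def)
  have lim: "g \<longlonglongrightarrow> l" if "\<And>n. \<bar>g n - l\<bar> < inverse (real (Suc n))" for g :: "nat \<Rightarrow> real" and l
  proof -
   have "(\<lambda>n. \<bar>g n - l\<bar>) \<longlonglongrightarrow> 0"
    by (rule tendsto_sandwich[OF _ _ tendsto_const LIMSEQ_inverse_real_of_nat]) (use that in \<open>auto intro!: always_eventually less_imp_le\<close>)
   thus ?thesis by (simp add: tendsto_rabs_zero_iff LIM_zero_iff)
  qed
  have \<beta>l: "\<beta> \<longlonglongrightarrow> y" by (rule lim) (use q in \<open>simp add: \<beta>_def\<close>)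
  have ql: "(\<lambda>n. fst (q n)) \<longlonglongrightarrow> t y" by (rule lim) (use q in blast)
  have "(\<lambda>n. t (\<beta> n)) \<longlonglongrightarrow> t y"
  proof (rule order_tendstoI)
   fix b assume "t y < b"
   from order_tendstoD(2)[OF ql this] show "\<forall>\<^sub>F n in sequentially. t (\<beta> n) < b"
    by eventually_elim (use tle[OF \<beta>S qB] in \<open>blast intro: le_less_trans\<close>)
  next
   fix b assume b: "b < t y"
   show "\<forall>\<^sub>F n in sequentially. b < t (\<beta> n)"
   proof (rule ccontr)
    assume "\<not> ?thesis"
    then obtain r :: "nat \<Rightarrow> nat" where r: "strict_mono r" "\<And>n. t (\<beta> (r n)) \<le> b"
     using not_eventually_sequentiallyD[of "\<lambda>n. b < t (\<beta> n)"] by (auto simp: not_less)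
    have "(b, \<beta> (r n)) \<in> B" for n using up[OF t[OF \<beta>S] r(2)] .
    moreover have "(\<lambda>n. (b, \<beta> (r n))) \<longlonglongrightarrow> (b, y)"
     using LIMSEQ_subseq_LIMSEQ[OF \<beta>l r(1)] by (intro tendsto_intros) (simp add: o_def)
    ultimately have "(b, y) \<in> B" by (rule closed_sequentially[OF cl])
    thus False using tle[OF y] b by fastforce
   qed
  qed
  thus ?thesis using \<beta>S \<beta>l q by (intro exI[of _ \<beta>]) (auto simp: \<beta>_def)
 qed
 have "closure (snd ` B) = UNIV"
 proof (rule ccontr)
  assume "\<not> ?thesis"
  then obtain c where "c \<in> - closure (snd ` B)" by blast
  then obtain e where e: "e > 0" "ball c e \<subseteq> - closure (snd ` B)" using open_contains_ball open_Compl closed_closure by blast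
  obtain y where y: "y \<in> snd ` B" "c - e < y" "y < c + e" using dense[of "c - e" "c + e"] e(1) by auto
  hence "y \<in> ball c e" by (auto simp: dist_real_def)
  thus False using e(2) subsetD[OF closure_subset y(1)] by blast
 qed
 hence d: "- \<rat> \<subseteq> closure (snd ` B)" by simp
 have e1: "\<exists>\<beta> \<gamma>. range \<beta> \<subseteq> snd ` B \<and> range \<gamma> \<subseteq> snd ` B \<and> (\<forall>n. \<beta> n < y \<and> y < \<gamma> n) \<and> \<beta> \<longlonglongrightarrow> y \<and> \<gamma> \<longlonglongrightarrow> y \<and>
   (\<lambda>n. t (\<beta> n)) \<longlonglongrightarrow> t y \<and> (\<lambda>n. t (\<gamma> n)) \<longlonglongrightarrow> t y" if y: "y \<in> snd ` B" for y
 proof -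
  obtain \<beta> where \<beta>: "range \<beta> \<subseteq> snd ` B" "\<forall>n. 0 < -1 * (\<beta> n - y)" "\<beta> \<longlonglongrightarrow> y" "(\<lambda>n. t (\<beta> n)) \<longlonglongrightarrow> t y" using seq[OF y, of "-1"] by auto
  obtain \<gamma> where \<gamma>: "range \<gamma> \<subseteq> snd ` B" "\<forall>n. 0 < 1 * (\<gamma> n - y)" "\<gamma> \<longlonglongrightarrow> y" "(\<lambda>n. t (\<gamma> n)) \<longlonglongrightarrow> t y" using seq[OF y, of 1] by auto
  show ?thesis using \<beta> \<gamma> by (intro exI[of _ \<beta>] exI[of _ \<gamma>]) simp
 qed
 have e2: "t y \<ge> 0 \<and> {x. (x, y) \<in> B} = {t y..}" if y: "y \<in> snd ` B" for y
 proof (intro conjI set_eqI)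
  show "t y \<ge> 0" using t[OF y] sub by auto
  show "x \<in> {x. (x, y) \<in> B} \<longleftrightarrow> x \<in> {t y..}" for x using tle[OF y, of x] up[OF t[OF y], of x] by auto
 qed
 show ?thesis unfolding straight_brush_def
 proof (rule conjI[OF sub], rule conjI[OF cl], rule conjI[OF d], rule exI[of _ t], rule conjI)
  show "\<forall>y\<in>snd ` B. t y \<ge> 0 \<and> {x. (x, y) \<in> B} = {t y..}" by (rule ballI, rule e2)
 qed (rule ballI, rule e1)
qed

text \<open>Parabolic coordinates: level sets of \<open>uu\<close> are parabolas with focus 0, and
  \<open>vv\<close> is the tangent of half the argument, constant on rays from 0. \<open>ww\<close>
  is the inverse.\<close>

definition uu :: "complex \<Rightarrow> real" where "uu w = norm w + Re w"
definition vv :: "complex \<Rightarrow> real" where "vv w = Im w / uu w"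
definition ww :: "real \<Rightarrow> real \<Rightarrow> complex" where "ww u v = Complex (u * (1 - v\<^sup>2) / 2) (u * v)"

lemma uu_nonneg: "0 \<le> uu w" using abs_Re_le_cmod[of w] by (simp add: uu_def)

lemma norm_ww: "0 \<le> u \<Longrightarrow> norm (ww u v) = u * (1 + v\<^sup>2) / 2"
 unfolding cmod_def by (rule real_sqrt_unique) (auto simp: ww_def power2_eq_square field_simps)

lemma uu_ww [simp]: assumes "0 < u" shows "uu (ww u v) = u" "vv (ww u v) = v"
proof -
 show 1: "uu (ww u v) = u" unfolding uu_def using assms by (simp add: norm_ww) (simp add: ww_def field_simps)
 show "vv (ww u v) = v" unfolding vv_def 1 using assms by (simp add: ww_def)
qed

lemma ww_uu: assumes "0 < uu w" shows "ww (uu w) (vv w) = w"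
proof -
 have r: "(norm w)\<^sup>2 = (Re w)\<^sup>2 + (Im w)\<^sup>2" by (rule cmod_power2)
 have "(uu w)\<^sup>2 - (Im w)\<^sup>2 = 2 * Re w * uu w" unfolding uu_def power2_sum r by (simp add: algebra_simps power2_eq_square)
 moreover have "uu w * (1 - (vv w)\<^sup>2) / 2 = ((uu w)\<^sup>2 - (Im w)\<^sup>2) / (2 * uu w)"
  using assms by (simp add: vv_def power_divide diff_divide_distrib right_diff_distrib power2_eq_square)
 ultimately have "uu w * (1 - (vv w)\<^sup>2) / 2 = Re w" using assms by simp
 moreover have "uu w * vv w = Im w" using assms by (simp add: vv_def)
 ultimately show ?thesis by (simp add: ww_def complex_eq_iff)
qed

lemma norm_uu: "0 < uu w \<Longrightarrow> norm w = uu w * (1 + (vv w)\<^sup>2) / 2"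
 using norm_ww[of "uu w" "vv w"] ww_uu[of w] by simp

lemma uu_cont: "continuous_on A uu" unfolding uu_def by (intro continuous_intros)

lemma vv_cont: "continuous_on {w. 0 < uu w} vv"
 unfolding vv_def by (intro continuous_intros uu_cont) auto

lemma ww_cont: assumes "continuous_on A f" "continuous_on A g" shows "continuous_on A (\<lambda>w. ww (f w) (g w))"
 unfolding ww_def by (intro continuous_intros assms) auto

text \<open>The plane is cut along the parabola \<open>norm w + Re w = 1\<close>: rays from the origin become horizontal outside of it,
 and the inside is sheared onto a half plane.\<close>

definition parab :: "complex \<Rightarrow> complex" where
 "parab w = (if uu w \<le> 1 then Complex (Re w + (1 + (Im w)\<^sup>2) / 2) (Im w) else Complex (uu w) (vv w))"

lemma uu_le_1: "uu w \<le> 1 \<longleftrightarrow> Re w + (1 + (Im w)\<^sup>2) / 2 \<le> 1"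
proof -
 have aux: "0 \<le> 1 - x" if "x + (1 + q) / 2 \<le> 1" "0 \<le> q" for x q :: real
 proof -
  have "2 * x + q \<le> 1" using that(1) by (simp add: field_simps)
  thus ?thesis using that(2) by linarith
 qed
 have "uu w \<le> 1 \<longleftrightarrow> norm w \<le> 1 - Re w" by (auto simp: uu_def)
 also have "\<dots> \<longleftrightarrow> 0 \<le> 1 - Re w \<and> (norm w)\<^sup>2 \<le> (1 - Re w)\<^sup>2"
  using order_trans[OF norm_ge_zero] by (blast intro: power_mono[OF _ norm_ge_zero] power2_le_imp_le)
 also have "(norm w)\<^sup>2 \<le> (1 - Re w)\<^sup>2 \<longleftrightarrow> Re w + (1 + (Im w)\<^sup>2) / 2 \<le> 1"
  unfolding cmod_power2 by (simp add: power2_diff field_simps)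
 also have "(0 \<le> 1 - Re w \<and> Re w + (1 + (Im w)\<^sup>2) / 2 \<le> 1) \<longleftrightarrow> Re w + (1 + (Im w)\<^sup>2) / 2 \<le> 1"
  using aux[OF _ zero_le_power2] by blast
 finally show ?thesis .
qed

lemma parab_homeo: "homeomorphism UNIV UNIV parab (inv parab)"
proof (rule plane_homeo)
 show "continuous_on UNIV parab" unfolding parab_def
 proof (rule continuous_on_cases_le)
  show "continuous_on {w \<in> UNIV. uu w \<le> 1} (\<lambda>w. Complex (Re w + (1 + (Im w)\<^sup>2) / 2) (Im w))" by (intro continuous_intros) auto
  have "continuous_on {w \<in> UNIV. 1 \<le> uu w} vv" by (rule continuous_on_subset[OF vv_cont]) auto
  thus "continuous_on {w \<in> UNIV. 1 \<le> uu w} (\<lambda>w. Complex (uu w) (vv w))" by (intro continuous_intros uu_cont)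
  show "Complex (Re w + (1 + (Im w)\<^sup>2) / 2) (Im w) = Complex (uu w) (vv w)" if "uu w = 1" for w
  proof -
   have "Re w = (1 - (vv w)\<^sup>2) / 2" "Im w = vv w" using ww_uu[of w] that by (auto simp: ww_def complex_eq_iff)
   thus ?thesis using that by (simp add: complex_eq_iff diff_divide_distrib add_divide_distrib)
  qed
 qed (rule uu_cont)
 have R: "Re (parab w) \<le> 1 \<longleftrightarrow> uu w \<le> 1" for w using uu_le_1[of w] by (simp add: parab_def)
 show "inj parab"
 proof (rule injI)
  fix w z assume e: "parab w = parab z"
  show "w = z"
  proof (cases "uu w \<le> 1")
   case True
   hence "uu z \<le> 1" using R e by metis
   hence pw: "parab w = Complex (Re w + (1 + (Im w)\<^sup>2) / 2) (Im w)" and pz: "parab z = Complex (Re z + (1 + (Im z)\<^sup>2) / 2) (Im z)"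
    using True by (simp_all add: parab_def)
   have i: "Im w = Im z" using arg_cong[OF e, of Im] unfolding pw pz complex.sel .
   from arg_cong[OF e, of Re] show ?thesis unfolding pw pz complex.sel i by (simp add: complex_eq_iff i)
  next
   case False
   hence "\<not> uu z \<le> 1" using R e by metis
   hence "uu w = uu z" "vv w = vv z" using e False by (simp_all add: parab_def)
   hence "ww (uu w) (vv w) = ww (uu z) (vv z)" by (simp only:)
   thus ?thesis using ww_uu[of w] ww_uu[of z] False \<open>\<not> uu z \<le> 1\<close> by simp
  qed
 qed
 have "\<exists>w. parab w = z" for z
 proof (cases "Re z \<le> 1")
  case True
  hence "uu (Complex (Re z - (1 + (Im z)\<^sup>2) / 2) (Im z)) \<le> 1" by (simp add: uu_le_1)
  hence "parab (Complex (Re z - (1 + (Im z)\<^sup>2) / 2) (Im z)) = z" by (simp add: parab_def)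
  thus ?thesis by blast
 next
  case False
  hence "parab (ww (Re z) (Im z)) = z" by (simp add: parab_def)
  thus ?thesis by blast
 qed
 thus "surj parab" unfolding surj_def by metis
qed

text \<open>Moves points outwards along their rays, beginning at radius \<open>\<rho>\<close>, in
  order to bring a given set out of the region \<open>uu w \<le> 1\<close>, where
  \<open>parab\<close> does not make rays horizontal.\<close>

definition stretch :: "(real \<Rightarrow> real) \<Rightarrow> complex \<Rightarrow> complex" where
 "stretch \<rho> w = (if uu w = 0 then w else ww (uu w + max 0 (norm w - \<rho> (vv w))) (vv w))"

text \<open>Near the negative real axis, where \<open>vv\<close> is unbounded, \<open>\<rho>\<close>
  exceeds the modulus and the map is the identity; this gives continuity across the axis.\<close>

lemma stretch_homeo:
 assumes c: "continuous_on UNIV \<rho>" and \<rho>1: "\<And>v. 1 \<le> \<rho> v" and top: "\<And>M. \<exists>V>0. \<forall>v. V \<le> \<bar>v\<bar> \<longrightarrow> M \<le> \<rho> v"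
 shows "homeomorphism UNIV UNIV (stretch \<rho>) (inv (stretch \<rho>))"
proof (rule plane_homeo)
 have id: "stretch \<rho> w = w" if "0 < uu w \<Longrightarrow> norm w \<le> \<rho> (vv w)" for w
  using that ww_uu[of w] uu_nonneg[of w] by (cases "uu w = 0") (auto simp: stretch_def)
 have opens: "open {w. 0 < uu w}" by (rule open_Collect_less[OF continuous_on_const uu_cont])
 have "isCont (stretch \<rho>) w0" for w0
 proof (cases "uu w0 = 0")
  case False
  have "continuous_on {w. 0 < uu w} (\<lambda>w. ww (uu w + max 0 (norm w - \<rho> (vv w))) (vv w))"
  proof (rule ww_cont[OF _ vv_cont])
   have "continuous_on {w. 0 < uu w} (\<lambda>w. \<rho> (vv w))" by (rule continuous_on_compose2[OF c vv_cont subset_UNIV])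
   thus "continuous_on {w. 0 < uu w} (\<lambda>w. uu w + max 0 (norm w - \<rho> (vv w)))"
    by (intro continuous_on_add uu_cont continuous_on_max continuous_on_const continuous_on_diff continuous_on_norm_id)
  qed
  moreover have "continuous_on {w. 0 < uu w} (stretch \<rho>) \<longleftrightarrow> continuous_on {w. 0 < uu w} (\<lambda>w. ww (uu w + max 0 (norm w - \<rho> (vv w))) (vv w))"
   by (rule continuous_on_cong) (auto simp: stretch_def)
  moreover have "0 < uu w0" using False uu_nonneg[of w0] by linarith
  ultimately show ?thesis using continuous_on_eq_continuous_at[OF opens, of "stretch \<rho>"] by blast
 next
  case True
  obtain V where V: "V > 0" "\<And>v. V \<le> \<bar>v\<bar> \<Longrightarrow> norm w0 + 1 \<le> \<rho> v" using top by blast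
  \<comment> \<open>Off the axis \<open>(vv w)\<^sup>2 = (norm w - Re w) / uu w\<close>, so the
    second condition says \<open>V < \<bar>vv w\<bar>\<close> without division by
    \<open>uu w\<close>. At 0 the unit disc suffices because \<open>\<rho>\<close> is at least
    1.\<close>
  define O' where "O' = (if w0 = 0 then ball 0 1 else {w. norm w < norm w0 + 1 \<and> V\<^sup>2 * uu w < norm w - Re w})"
  have "open {w :: complex. norm w < norm w0 + 1}" "open {w. V\<^sup>2 * uu w < norm w - Re w}"
   by (rule open_Collect_less; intro continuous_intros uu_cont)+
  hence oO: "open O'" unfolding O'_def by (simp add: open_Collect_conj)
  have wO: "w0 \<in> O'"
  proof (cases "w0 = 0")
   case False
   have "Re w0 = - norm w0" using True by (simp add: uu_def)
   thus ?thesis using False True by (simp add: O'_def)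
  qed (simp add: O'_def)
  have "stretch \<rho> w = w" if w: "w \<in> O'" for w
  proof (rule id)
   assume u: "0 < uu w"
   show "norm w \<le> \<rho> (vv w)"
   proof (cases "w0 = 0")
    case True
    thus ?thesis using w \<rho>1[of "vv w"] by (simp add: O'_def)
   next
    case False
    have "(norm w - Re w) * uu w = (Im w)\<^sup>2" unfolding uu_def using cmod_power2[of w] by (simp add: algebra_simps power2_eq_square)
    hence "norm w - Re w = (Im w)\<^sup>2 / uu w" using u by (simp only: eq_divide_eq) simp
    also have "\<dots> = (vv w)\<^sup>2 * uu w" using u by (simp add: vv_def power_divide power2_eq_square)
    finally have "norm w - Re w = (vv w)\<^sup>2 * uu w" .
    hence "V\<^sup>2 < (vv w)\<^sup>2" using w False u by (simp add: O'_def)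
    hence "V\<^sup>2 \<le> \<bar>vv w\<bar>\<^sup>2" by simp
    hence "V \<le> \<bar>vv w\<bar>" by (rule power2_le_imp_le) simp
    from V(2)[OF this] show ?thesis using w False by (simp add: O'_def)
   qed
  qed
  note sid = this
  have "continuous_on O' (stretch \<rho>) \<longleftrightarrow> continuous_on O' (\<lambda>w. w)" by (rule continuous_on_cong) (use sid in auto)
  hence "continuous_on O' (stretch \<rho>)" by simp
  thus ?thesis using oO wO continuous_on_eq_continuous_at by blast
 qed
 thus "continuous_on UNIV (stretch \<rho>)" by (intro continuous_at_imp_continuous_on) blast
 define s where "s v u = u + max 0 (u * (1 + v\<^sup>2) / 2 - \<rho> v)" for v u
 have S: "stretch \<rho> w = ww (s (vv w) (uu w)) (vv w)" "0 < s (vv w) (uu w)" if "0 < uu w" for w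
  using that by (simp_all add: stretch_def s_def norm_uu[OF that, symmetric] add_pos_nonneg)
 have smono: "s v u < s v u'" if "u < u'" for v u u'
 proof -
  have "u * (1 + v\<^sup>2) / 2 \<le> u' * (1 + v\<^sup>2) / 2" using that by (intro divide_right_mono mult_right_mono) auto
  hence "max 0 (u * (1 + v\<^sup>2) / 2 - \<rho> v) \<le> max 0 (u' * (1 + v\<^sup>2) / 2 - \<rho> v)" by (intro max.mono diff_right_mono order_refl)
  thus ?thesis using that unfolding s_def by linarith
 qed
 have uS: "uu (stretch \<rho> w) = 0 \<longleftrightarrow> uu w = 0" for w using S[of w] uu_nonneg[of w] by (cases "uu w = 0") (auto simp: stretch_def)
 show "inj (stretch \<rho>)"
 proof (rule injI)
  fix w z assume e: "stretch \<rho> w = stretch \<rho> z"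
  show "w = z"
  proof (cases "uu w = 0")
   case True
   hence "uu z = 0" using uS e by metis
   thus ?thesis using e True by (simp add: stretch_def)
  next
   case False
   hence "uu z \<noteq> 0" using uS e by metis
   hence p: "0 < uu w" "0 < uu z" using False uu_nonneg[of w] uu_nonneg[of z] by simp_all
   have v: "vv w = vv z" using arg_cong[OF e, of vv] unfolding S(1)[OF p(1)] S(1)[OF p(2)] uu_ww(2)[OF S(2)[OF p(1)]] uu_ww(2)[OF S(2)[OF p(2)]] .
   have "s (vv w) (uu w) = s (vv z) (uu z)"
    using arg_cong[OF e, of uu] unfolding S(1)[OF p(1)] S(1)[OF p(2)] uu_ww(1)[OF S(2)[OF p(1)]] uu_ww(1)[OF S(2)[OF p(2)]] .
   hence u: "uu w = uu z" using smono[of "uu w" "uu z" "vv z"] smono[of "uu z" "uu w" "vv z"] unfolding v by linarith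
   have "w = ww (uu w) (vv w)" by (rule ww_uu[OF p(1), symmetric])
   also have "\<dots> = z" unfolding u v by (rule ww_uu[OF p(2)])
   finally show ?thesis .
  qed
 qed
 have "\<exists>w. stretch \<rho> w = z" for z
 proof (cases "uu z = 0")
  case False
  hence z: "0 < uu z" using uu_nonneg[of z] by linarith
  \<comment> \<open>\<open>u\<close> solves the piecewise linear equation
    \<open>u + max 0 (u * c - \<rho> (vv z)) = uu z\<close>.\<close>
  define c u where "c = (1 + (vv z)\<^sup>2) / 2" and "u = (if uu z * c \<le> \<rho> (vv z) then uu z else (uu z + \<rho> (vv z)) / (1 + c))"
  have c0: "0 < c" by (simp add: c_def add_pos_nonneg)
  have u0: "0 < u" using z c0 \<rho>1[of "vv z"] by (auto simp: u_def)
  have "s (vv z) u = u + max 0 (u * c - \<rho> (vv z))" by (simp add: s_def c_def)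
  also have "\<dots> = uu z"
  proof (cases "uu z * c \<le> \<rho> (vv z)")
   case f: False
   have uc: "u * (1 + c) = uu z + \<rho> (vv z)" using f c0 by (simp add: u_def)
   have "\<rho> (vv z) * (1 + c) \<le> u * (1 + c) * c" unfolding uc using f by (simp add: algebra_simps)
   hence "\<rho> (vv z) * (1 + c) \<le> (u * c) * (1 + c)" by (simp add: algebra_simps)
   hence "\<rho> (vv z) \<le> u * c" using c0 by simp
   thus ?thesis using uc by (simp add: algebra_simps)
  qed (simp add: u_def)
  finally have "stretch \<rho> (ww u (vv z)) = z" using S(1)[of "ww u (vv z)"] u0 ww_uu[OF z] by simp
  thus ?thesis by blast
 qed (auto simp: stretch_def)
 thus "surj (stretch \<rho>)" unfolding surj_def by metis
qed

text \<open>\<open>stretch\<close> followed by \<open>parab\<close> turns the rays in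
  \<open>Y\<close> into horizontal ones with abscissas above 1, at the irrational heights
  \<open>vv w\<close>.\<close>

lemma radial_bouquet:
 assumes cl: "closed Y" and big: "\<And>w. w \<in> Y \<Longrightarrow> 2 \<le> norm w"
  and ray: "\<And>w t. w \<in> Y \<Longrightarrow> 1 \<le> t \<Longrightarrow> of_real t * w \<in> Y" and pos: "\<And>w. w \<in> Y \<Longrightarrow> 0 < uu w" and irr: "\<And>w. w \<in> Y \<Longrightarrow> vv w \<notin> \<rat>"
  and dense: "\<And>b c. b < c \<Longrightarrow> \<exists>w\<in>Y. b < vv w \<and> vv w < c"
  and approx: "\<And>w e \<sigma>. w \<in> Y \<Longrightarrow> 0 < e \<Longrightarrow> \<sigma> = 1 \<or> \<sigma> = -1 \<Longrightarrow> \<exists>w'\<in>Y. dist w' w < e \<and> 0 < \<sigma> * (vv w' - vv w)"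
 shows "cantor_bouquet Y"
proof -
 \<comment> \<open>A 1-Lipschitz minorant of the moduli of \<open>Y\<close> as a function of
   \<open>vv\<close>, lowered by 1 so that \<open>stretch\<close> raises \<open>uu\<close> by at
   least 1 on \<open>Y\<close>.\<close>
 define \<rho> where "\<rho> v = (INF w\<in>Y. norm w + \<bar>v - vv w\<bar>) - 1" for v
 obtain w0 where w0: "w0 \<in> Y" using dense[of 0 1] by auto
 have bdd: "bdd_below ((\<lambda>w. norm w + \<bar>v - vv w\<bar>) ` Y)" for v by (rule bdd_belowI[of _ 0]) auto
 have \<rho>_le: "\<rho> v \<le> norm w + \<bar>v - vv w\<bar> - 1" if "w \<in> Y" for v w
  unfolding \<rho>_def using cINF_lower[OF bdd that, of v] by simp
 have \<rho>_ge: "b \<le> \<rho> v" if "\<And>w. w \<in> Y \<Longrightarrow> b + 1 \<le> norm w + \<bar>v - vv w\<bar>" for b v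
 proof -
  have "Y \<noteq> {}" using w0 by blast
  from cINF_greatest[OF this, of "b + 1" "\<lambda>w. norm w + \<bar>v - vv w\<bar>", OF that] show ?thesis unfolding \<rho>_def by simp
 qed
 have \<rho>1: "1 \<le> \<rho> v" for v by (rule \<rho>_ge) (use big in force)
 have lip: "\<rho> v' - \<bar>v - v'\<bar> \<le> \<rho> v" for v v'
 proof (rule \<rho>_ge)
  fix w assume "w \<in> Y"
  from \<rho>_le[OF this, of v'] show "\<rho> v' - \<bar>v - v'\<bar> + 1 \<le> norm w + \<bar>v - vv w\<bar>" by linarith
 qed
 have \<rho>c: "continuous_on UNIV \<rho>"
 proof (rule lipschitz_on_continuous_on[OF lipschitz_onI])
  show "dist (\<rho> v) (\<rho> v') \<le> 1 * dist v v'" for v v' using lip[of v v'] lip[of v' v] by (simp add: dist_real_def abs_le_iff abs_minus_commute)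
 qed simp
 \<comment> \<open>\<open>Y\<close> is closed and misses the negative real axis, so
   \<open>vv\<close> is bounded on bounded parts of \<open>Y\<close>; for large arguments only
   distant points compete in the infimum.\<close>
 have top: "\<exists>V>0. \<forall>v. V \<le> \<bar>v\<bar> \<longrightarrow> M \<le> \<rho> v" for M
 proof -
  define K where "K = Y \<inter> cball 0 (M + 1)"
  have "compact K" unfolding K_def using cl by (simp add: closed_Int_compact)
  moreover have "continuous_on K vv" by (rule continuous_on_subset[OF vv_cont]) (use pos in \<open>auto simp: K_def\<close>)
  ultimately have "bounded (vv ` K)" by (intro compact_imp_bounded compact_continuous_image)
  then obtain V where V: "V > 0" "\<And>w. w \<in> K \<Longrightarrow> \<bar>vv w\<bar> \<le> V" unfolding bounded_pos by auto
  have "M \<le> \<rho> v" if v: "V + \<bar>M\<bar> + 1 \<le> \<bar>v\<bar>" for v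
  proof (rule \<rho>_ge)
   fix w assume w: "w \<in> Y"
   show "M + 1 \<le> norm w + \<bar>v - vv w\<bar>"
   proof (cases "norm w \<le> M + 1")
    case True
    hence "\<bar>vv w\<bar> \<le> V" using w by (intro V(2)) (simp add: K_def)
    thus ?thesis using v norm_ge_zero[of w] by linarith
   qed simp
  qed
  thus ?thesis using V(1) by (intro exI[of _ "V + \<bar>M\<bar> + 1"]) auto
 qed
 define H where "H = parab \<circ> stretch \<rho>"
 define Hi where "Hi = inv (stretch \<rho>) \<circ> inv parab"
 have homeo: "homeomorphism UNIV UNIV H Hi" unfolding H_def Hi_def
  by (rule homeomorphism_compose[OF stretch_homeo[OF \<rho>c \<rho>1 top] parab_homeo])
 define x where "x w = uu w + norm w - \<rho> (vv w)" for w
 have H: "H w = Complex (x w) (vv w)" and x1: "1 < x w" if w: "w \<in> Y" for w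
 proof -
  have nr: "1 \<le> norm w - \<rho> (vv w)" using \<rho>_le[OF w, of "vv w"] by simp
  thus x1: "1 < x w" using pos[OF w] by (simp add: x_def)
  hence "stretch \<rho> w = ww (x w) (vv w)" using pos[OF w] nr by (simp add: stretch_def x_def max_def add.assoc add_diff_eq)
  thus "H w = Complex (x w) (vv w)" using x1 by (simp add: H_def parab_def)
 qed
 define B where "B = (\<lambda>w. (x w, vv w)) ` Y"
 have HY: "H ` Y = (\<lambda>(x, y). Complex x y) ` B" unfolding B_def image_image by (rule image_cong[OF refl]) (simp add: H)
 have "straight_brush B"
 proof (rule straight_brushI)
  show "B \<subseteq> {0..} \<times> - \<rat>" using x1 irr by (force simp: B_def)
  have "closed (H ` Y)" 
  proof -
   have "H ` Y = Hi -` Y"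
   proof (intro set_eqI iffI)
    fix z assume "z \<in> H ` Y"
    thus "z \<in> Hi -` Y" using homeomorphism_apply1[OF homeo] by auto
   next
    fix z assume "z \<in> Hi -` Y"
    thus "z \<in> H ` Y" using homeomorphism_apply2[OF homeo, of z] by (intro image_eqI[of z H "Hi z"]) auto
   qed
   moreover have "isCont Hi z" for z using homeomorphism_cont2[OF homeo] by (simp add: continuous_on_eq_continuous_at)
   ultimately show ?thesis using continuous_closed_vimage[OF cl, of Hi] by simp
  qed
  hence "closed ((\<lambda>p. Complex (fst p) (snd p)) -` (H ` Y))" by (rule closed_vimage) (intro continuous_intros)
  also have "(\<lambda>p. Complex (fst p) (snd p)) -` (H ` Y) = B"
  proof (intro set_eqI)
   fix p
   show "p \<in> (\<lambda>p. Complex (fst p) (snd p)) -` (H ` Y) \<longleftrightarrow> p \<in> B" unfolding HY by (cases p) force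
  qed
  finally show "closed B" .
 next
  fix s y s' assume "(s, y) \<in> B" "s \<le> s'"
  then obtain w where w: "w \<in> Y" "s = x w" "y = vv w" by (auto simp: B_def)
  define t where "t = (s' + \<rho> y) / (uu w + norm w)"
  have n: "0 < uu w + norm w" using pos[OF w(1)] by (simp add: add_pos_nonneg)
  have t1: "1 \<le> t" using \<open>s \<le> s'\<close> w n by (simp add: t_def x_def)
  have "uu (of_real t * w) = t * uu w" using t1 by (simp add: uu_def norm_mult algebra_simps)
  moreover from this have v: "vv (of_real t * w) = vv w" using t1 by (simp add: vv_def)
  ultimately have "x (of_real t * w) = t * (uu w + norm w) - \<rho> y" using t1 w by (simp add: x_def norm_mult algebra_simps)
  hence "x (of_real t * w) = s'" using n by (simp add: t_def)
  thus "(s', y) \<in> B" using imageI[OF ray[OF w(1) t1], of "\<lambda>w. (x w, vv w)", folded B_def] v w(3) by simp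
 next
  fix b c :: real assume "b < c"
  thus "\<exists>y\<in>snd ` B. b < y \<and> y < c" using dense[of b c] by (auto simp: B_def)
 next
  fix s y e \<sigma> assume "(s, y) \<in> B" and e: "0 < (e::real)" and \<sigma>: "\<sigma> = 1 \<or> \<sigma> = (-1::real)"
  then obtain w where w: "w \<in> Y" "s = x w" "y = vv w" by (auto simp: B_def)
  have "isCont H w" using homeomorphism_cont1[OF homeo] by (simp add: continuous_on_eq_continuous_at)
  then obtain d where d: "d > 0" "\<And>w'. dist w' w < d \<Longrightarrow> dist (H w') (H w) < e" using e unfolding continuous_at_eps_delta by blast
  obtain w' where w': "w' \<in> Y" "dist w' w < d" "0 < \<sigma> * (vv w' - vv w)" using approx[OF w(1) d(1) \<sigma>] by blast
  have "norm (Complex (x w' - x w) (vv w' - vv w)) < e" using d(2)[OF w'(2)] H[OF w(1)] H[OF w'(1)] by (simp add: dist_norm complex_diff)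
  hence "\<bar>x w' - x w\<bar> < e" "\<bar>vv w' - vv w\<bar> < e"
   using abs_Re_le_cmod[of "Complex (x w' - x w) (vv w' - vv w)"] abs_Im_le_cmod[of "Complex (x w' - x w) (vv w' - vv w)"] by auto
  thus "\<exists>x' y'. (x', y') \<in> B \<and> \<bar>x' - s\<bar> < e \<and> \<bar>y' - y\<bar> < e \<and> 0 < \<sigma> * (y' - y)"
   unfolding w(2,3) using w'(3) imageI[OF w'(1), of "\<lambda>w. (x w, vv w)", folded B_def] by (intro exI[of _ "x w'"] exI[of _ "vv w'"] conjI)
 qed
 moreover have "Y = Hi ` (\<lambda>(x, y). Complex x y) ` B" unfolding HY[symmetric] using homeomorphism_apply1[OF homeo] by (simp add: image_image)
 ultimately show ?thesis unfolding cantor_bouquet_def by (intro exI[of _ B] exI[of _ Hi] exI[of _ H] conjI homeomorphism_symD[OF homeo])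
qed

lemma bouquet_homeo:
 assumes X: "cantor_bouquet X" and H: "homeomorphism UNIV UNIV H H'" shows "cantor_bouquet (H ` X)"
proof -
 obtain B h k where B: "straight_brush B" "homeomorphism UNIV UNIV h k" "X = h ` (\<lambda>(x, y). Complex x y) ` B"
  using X unfolding cantor_bouquet_def by (elim exE conjE)
 thus ?thesis unfolding cantor_bouquet_def
  by (intro exI[of _ B] exI[of _ "H \<circ> h"] exI[of _ "k \<circ> H'"] conjI homeomorphism_compose[OF B(2) H]) (auto simp: image_comp)
qed

text \<open>The rotation by \<open>s\<close> must place the negative real axis off the image of
  \<open>B\<close> under \<open>exp\<close>, and must make all heights irrational after
  straightening. A height is \<open>tan (x / 2)\<close> for the argument \<open>x\<close>, so the
  angles to avoid are \<open>pi\<close> and \<open>2 * arctan q\<close> for rational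
  \<open>q\<close>. These are countably many conditions on \<open>s\<close>, dense by
  \<open>noint\<close>, and Baire's theorem applies.\<close>

lemma log_brush_bouquet:
 assumes cl: "closed B" and Re1: "\<And>p. p \<in> B \<Longrightarrow> 1 \<le> Re p" and up: "\<And>p x. p \<in> B \<Longrightarrow> Re p \<le> x \<Longrightarrow> Complex x (Im p) \<in> B"
  and per: "\<And>p n. p \<in> B \<Longrightarrow> p + of_int n * tpi \<in> B" and dense: "\<And>b c. b < c \<Longrightarrow> \<exists>p\<in>B. b < Im p \<and> Im p < c"
  and approx: "\<And>p e \<sigma>. p \<in> B \<Longrightarrow> 0 < e \<Longrightarrow> \<sigma> = 1 \<or> \<sigma> = -1 \<Longrightarrow> \<exists>q\<in>B. norm (q - p) < e \<and> 0 < \<sigma> * (Im q - Im p)"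
  and noint: "\<And>b c. b < c \<Longrightarrow> \<not> {b..c} \<subseteq> Im ` B"
 shows "cantor_bouquet (exp ` B)"
proof -
 define D where "D = insert pi ((\<lambda>q. 2 * arctan q) ` \<rat>)"
 \<comment> \<open>Testing at one abscissa \<open>n\<close> makes each condition open. Since hairs
   extend to the right, testing at all natural numbers excludes the height altogether.\<close>
 define \<G> where "\<G> = (\<lambda>(n::nat, d). {s. Complex (real n) (s + d) \<notin> B}) ` (UNIV \<times> D)"
 have "\<exists>s. s \<in> \<Inter>\<G>"
 proof -
  have "UNIV \<subseteq> closure (\<Inter>\<G>)"
  proof (rule Baire)
   show "countable \<G>" unfolding \<G>_def D_def by (intro countable_image countable_SIGMA countable_insert countable_rat) auto
   fix T assume "T \<in> \<G>"
   then obtain n :: nat and d where T: "T = {s. Complex (real n) (s + d) \<notin> B}" by (auto simp: \<G>_def)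
   have "closed ((\<lambda>s. Complex (real n) (s + d)) -` B)" by (rule closed_vimage[OF cl]) (intro continuous_intros)
   hence "open T" unfolding T by (simp add: vimage_def closed_def Collect_neg_eq)
   moreover have "s \<in> closure T" for s unfolding closure_approachable
   proof (intro allI impI)
    fix e :: real assume e: "e > 0"
    obtain y where y: "s + d \<le> y" "y \<le> s + d + e / 2" "y \<notin> Im ` B"
     using noint[of "s + d" "s + d + e / 2"] e by (meson atLeastAtMost_iff subsetI less_add_same_cancel1 half_gt_zero)
    have "Complex (real n) (y - d + d) \<notin> B" using y(3) by (auto simp: image_iff)
    thus "\<exists>t\<in>T. dist t s < e" using y e by (intro bexI[of _ "y - d"]) (auto simp: T dist_real_def)
   qed
   ultimately show "openin (top_of_set UNIV) T \<and> UNIV \<subseteq> closure T" by auto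
  qed simp
  thus ?thesis by (metis UNIV_I closure_empty empty_iff equals0I subsetD)
 qed
 then obtain s where th: "Complex (real n) (s + d) \<notin> B" if "d \<in> D" for n d unfolding \<G>_def by auto
 have th: "s + d \<notin> Im ` B" if d: "d \<in> D" for d
 proof
  assume "s + d \<in> Im ` B"
  then obtain p where p: "p \<in> B" "s + d = Im p" by blast
  obtain n :: nat where "Re p \<le> real n" using real_arch_simple by blast
  hence "Complex (real n) (Im p) \<in> B" by (rule up[OF p(1)])
  thus False using th[OF d, of n] p(2) by simp
 qed
 define B' where "B' = {p. p + \<i> * of_real s \<in> B}"
 define Y where "Y = exp ` B'"
 have perY: "p \<in> B'" if e: "exp p \<in> Y" for p
 proof -
  obtain q where q: "q \<in> B'" "exp p = exp q" using e by (auto simp: Y_def)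
  obtain n where "p = q + of_int n * tpi" using q(2) unfolding exp_eq_tpi by blast
  thus ?thesis using per[of "q + \<i> * of_real s" n] q(1) by (simp add: B'_def algebra_simps)
 qed
 have rep: "\<exists>p\<in>B'. w = exp p \<and> -pi < Im p \<and> Im p < pi" if w: "w \<in> Y" for w
 proof -
  have w0: "w \<noteq> 0" using w by (auto simp: Y_def)
  have p: "Ln w \<in> B'" using w w0 by (intro perY) simp
  have "Im (Ln w) \<noteq> pi"
  proof
   assume "Im (Ln w) = pi"
   hence "s + pi \<in> Im ` B" using p by (intro image_eqI[of _ _ "Ln w + \<i> * of_real s"]) (auto simp: B'_def)
   thus False using th[of pi] by (simp add: D_def)
  qed
  thus ?thesis using p w0 mpi_less_Im_Ln[OF w0] Im_Ln_le_pi[OF w0] by (intro bexI[of _ "Ln w"]) auto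
 qed
 have uv: "0 < uu (exp p)" "vv (exp p) = tan (Im p / 2)" if "-pi < Im p" "Im p < pi" for p
 proof -
  have "0 < cos (Im p / 2)" using that by (intro cos_gt_zero_pi) auto
  hence "0 < (cos (Im p / 2))\<^sup>2 * 2" by simp
  hence c: "0 < 1 + cos (Im p)" using cos_double_cos[of "Im p / 2"] by simp
  have u: "uu (exp p) = exp (Re p) * (1 + cos (Im p))" by (simp add: uu_def Re_exp algebra_simps)
  thus "0 < uu (exp p)" using c by simp
  show "vv (exp p) = tan (Im p / 2)" unfolding vv_def u using c tan_half[of "Im p / 2"] by (simp add: Im_exp add.commute)
 qed
 have tanm: "tan (x / 2) < tan (y / 2)" if "-pi < x" "x < y" "y < pi" for x y using that by (intro tan_monotone) auto
 have "cantor_bouquet Y"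
 proof (rule radial_bouquet)
  show "closed Y" unfolding closed_sequential_limits
  proof (intro allI impI)
   fix x l assume "(\<forall>n. x n \<in> Y) \<and> x \<longlonglongrightarrow> l"
   hence x: "\<And>n. x n \<in> Y" "x \<longlonglongrightarrow> l" by auto
   have "exp 1 \<le> norm (x n)" for n using x(1)[of n] Re1 by (force simp: Y_def B'_def norm_exp_eq_Re)
   hence "exp 1 \<le> norm l" by (intro LIMSEQ_le_const[OF tendsto_norm[OF x(2)]]) auto
   hence l0: "l \<noteq> 0" using exp_gt_zero[of "1::real"] by (metis norm_zero not_le)
   have "x n \<noteq> 0" for n using x(1)[of n] by (auto simp: Y_def)
   then obtain z where z: "z \<longlonglongrightarrow> Ln l" "\<And>n. exp (z n) = x n" by (rule Ln_lift[OF x(2) l0]) blast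
   have "z n + \<i> * of_real s \<in> B" for n using perY[of "z n"] z(2) x(1) by (simp add: B'_def)
   hence "Ln l + \<i> * of_real s \<in> B" using tendsto_add[OF z(1) tendsto_const] by (rule closed_sequentially[OF cl])
   thus "l \<in> Y" using l0 unfolding Y_def by (intro image_eqI[of _ _ "Ln l"]) (auto simp: B'_def)
  qed
 next
  fix w assume "w \<in> Y"
  then obtain p where p: "w = exp p" "1 \<le> Re p" using Re1 by (force simp: Y_def B'_def)
  have "2 \<le> exp (1::real)" using exp_ge_add_one_self[of 1] by simp
  also have "exp 1 \<le> exp (Re p)" using p(2) by simp
  finally show "2 \<le> norm w" using p(1) by (simp add: norm_exp_eq_Re)
 next
  fix w t assume "w \<in> Y" "1 \<le> (t::real)"
  then obtain p where p: "p \<in> B'" "w = exp p" by (auto simp: Y_def)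
  have "Complex (Re p + ln t) (Im (p + \<i> * of_real s)) \<in> B" using p(1) \<open>1 \<le> t\<close> by (intro up) (auto simp: B'_def)
  moreover have "Complex (Re p + ln t) (Im (p + \<i> * of_real s)) = p + of_real (ln t) + \<i> * of_real s" by (simp add: complex_eq_iff)
  ultimately have "p + of_real (ln t) \<in> B'" by (simp add: B'_def)
  moreover have "exp (p + of_real (ln t)) = of_real t * w" using p(2) \<open>1 \<le> t\<close> by (simp add: exp_add exp_of_real)
  ultimately show "of_real t * w \<in> Y" by (metis Y_def image_eqI)
 next
  fix w assume w: "w \<in> Y"
  obtain p where p: "p \<in> B'" "w = exp p" "-pi < Im p" "Im p < pi" using rep[OF w] by blast
  show "0 < uu w" using uv p by simp
  show "vv w \<notin> \<rat>"
  proof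
   assume q: "vv w \<in> \<rat>"
   have "arctan (vv w) = Im p / 2" using uv(2)[OF p(3,4)] p arctan_tan[of "Im p / 2"] by simp
   hence "Im p = 2 * arctan (vv w)" by simp
   hence "s + Im p \<notin> Im ` B" using th[of "2 * arctan (vv w)"] q by (simp add: D_def)
   moreover have "s + Im p \<in> Im ` B" using p(1) by (intro image_eqI[of _ _ "p + \<i> * of_real s"]) (auto simp: B'_def)
   ultimately show False by blast
  qed
 next
  fix b c :: real assume "b < c"
  hence "s + 2 * arctan b < s + 2 * arctan c" by (simp add: arctan_less_iff)
  then obtain q where q: "q \<in> B" "s + 2 * arctan b < Im q" "Im q < s + 2 * arctan c" using dense by blast
  define p where "p = q - \<i> * of_real s"
  have p: "p \<in> B'" "2 * arctan b < Im p" "Im p < 2 * arctan c" using q by (auto simp: p_def B'_def)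
  have r: "-pi < 2 * arctan b" "2 * arctan c < pi" using arctan_bounded[of b] arctan_bounded[of c] by auto
  hence "vv (exp p) = tan (Im p / 2)" using p by (intro uv(2)) auto
  hence "b < vv (exp p) \<and> vv (exp p) < c" using tanm[OF r(1) p(2)] tanm[OF _ p(3) r(2)] p r by (simp add: tan_arctan)
  thus "\<exists>w\<in>Y. b < vv w \<and> vv w < c" using p(1) by (auto simp: Y_def)
 next
  fix w e \<sigma> assume w: "w \<in> Y" and e: "0 < (e::real)" and \<sigma>: "\<sigma> = 1 \<or> \<sigma> = (-1::real)"
  obtain p where p: "p \<in> B'" "w = exp p" "-pi < Im p" "Im p < pi" using rep[OF w] by blast
  have "isCont exp p" by simp
  then obtain d where d: "d > 0" "\<And>y. dist y p < d \<Longrightarrow> dist (exp y) (exp p) < e" using e unfolding continuous_at_eps_delta by blast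
  define d' where "d' = min d (pi - \<bar>Im p\<bar>)"
  have "d' > 0" using d p by (auto simp: d'_def)
  then obtain q where q: "q \<in> B" "norm (q - (p + \<i> * of_real s)) < d'" "0 < \<sigma> * (Im q - Im (p + \<i> * of_real s))"
   using approx[of "p + \<i> * of_real s" d' \<sigma>] p(1) \<sigma> by (auto simp: B'_def)
  define p' where "p' = q - \<i> * of_real s"
  have p': "p' \<in> B'" "norm (p' - p) < d'" "0 < \<sigma> * (Im p' - Im p)" using q by (auto simp: p'_def B'_def algebra_simps)
  have "\<bar>Im p' - Im p\<bar> < pi - \<bar>Im p\<bar>" using p'(2) abs_Im_le_cmod[of "p' - p"] by (simp add: d'_def)
  hence i: "-pi < Im p'" "Im p' < pi" by linarith+
  have "0 < \<sigma> * (vv (exp p') - vv w)"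
   unfolding p(2) uv(2)[OF i] uv(2)[OF p(3,4)] using \<sigma> p'(3) tanm[OF p(3) _ i(2)] tanm[OF i(1) _ p(4)] by auto
  moreover have "dist (exp p') w < e" using d(2)[of p'] p'(2) p(2) by (simp add: dist_norm d'_def)
  ultimately show "\<exists>w'\<in>Y. dist w' w < e \<and> 0 < \<sigma> * (vv w' - vv w)" using p'(1) by (auto simp: Y_def)
 qed
 moreover have "homeomorphism UNIV UNIV (\<lambda>w. w * cis s) (\<lambda>w. w * cis (-s))"
  by (rule homeomorphismI) (auto simp: mult.assoc cis_mult intro!: continuous_intros)
 ultimately have "cantor_bouquet ((\<lambda>w. w * cis s) ` Y)" by (rule bouquet_homeo)
 moreover have "(\<lambda>w. w * cis s) ` Y = exp ` B"
 proof -
  have "exp p * cis s = exp (p + \<i> * of_real s)" for p by (simp add: exp_add cis_conv_exp)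
  hence "(\<lambda>w. w * cis s) ` Y = exp ` (\<lambda>p. p + \<i> * of_real s) ` B'" by (simp add: Y_def image_image)
  moreover have "(\<lambda>p. p + \<i> * of_real s) ` B' = B" by (auto simp: B'_def intro!: image_eqI[of _ _ "_ - \<i> * of_real s"])
  ultimately show ?thesis by simp
 qed
 ultimately show ?thesis by simp
qed

section \<open>Back from straight coordinates to the dynamical plane\<close>

context large_system begin

text \<open>Maps that commute with \<open>tpi\<close> descend to the plane: \<open>E F\<close> sends
  \<open>exp z\<close> to \<open>exp (F z)\<close> and fixes 0. In this way \<open>psi m\<close>
  becomes a homeomorphism of the plane that carries the image of \<open>B m\<close> under
  \<open>exp\<close> to \<open>X m\<close>.\<close>

lemma X_bouquet: "cantor_bouquet (X m)"
proof -
 have "cantor_bouquet (exp ` B m)"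
 proof (rule log_brush_bouquet[OF B_closed _ B_up B_tpi B_dense])
  show "1 \<le> Re p" if "p \<in> B m" for p using B_Re[OF that] QR Ra by simp
  show "\<not> {b..c} \<subseteq> Im ` B m" if "b < c" for b c using B_no_interval[OF that] .
  fix p \<sigma> and e :: real assume p: "p \<in> B m" and e: "0 < e" and \<sigma>: "\<sigma> = 1 \<or> \<sigma> = (-1::real)"
  obtain n where n: "2 * pi / 2 ^ n < e" using half_powers_less[OF e, of "2 * pi"] by auto
  from B_approx[OF p \<sigma>, of n] n show "\<exists>q\<in>B m. norm (q - p) < e \<and> 0 < \<sigma> * (Im q - Im p)" by (meson le_less_trans)
 qed
 moreover define E where "E F w = (if w = 0 then 0 else exp (F (Ln w) :: complex))" for F w
 have E: "E F (exp z) = exp (F z)" if "\<And>z n. F (z + of_int n * tpi) = F z + of_int n * tpi" for F z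
 proof -
  have "exp (Ln (exp z)) = exp z" by simp
  then obtain n where "Ln (exp z) = z + of_int n * tpi" unfolding exp_eq_tpi by blast
  thus ?thesis using that by (simp add: E_def)
 qed
 have EE: "E F (E G w) = w" if "\<And>z n. F (z + of_int n * tpi) = F z + of_int n * tpi" "\<And>z. F (G z) = z" for F G w
  using E[of F "G (Ln w)", OF that(1)] that(2) by (cases "w = 0") (auto simp: E_def)
 \<comment> \<open>In the unit disc \<open>E F\<close> is the identity by \<open>left\<close>.
   Elsewhere a branch of the logarithm centred at \<open>w\<close> avoids the jump of
   \<open>Ln\<close>.\<close>
 have cont: "continuous_on UNIV (E F)" if F: "continuous_on UNIV F" and per: "\<And>z n. F (z + of_int n * tpi) = F z + of_int n * tpi"
  and left: "\<And>z. Re z \<le> R \<Longrightarrow> F z = z" for F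
 proof -
  have "isCont (E F) w" for w
  proof (cases "norm w < 1")
   case True
   have id: "E F u = u" if u: "u \<in> ball 0 1" for u
   proof (cases "u = 0")
    case False
    hence "Re (Ln u) \<le> 0" using u by (simp add: ln_le_zero_iff)
    hence "Re (Ln u) \<le> R" using Ra by linarith
    thus ?thesis using False left[of "Ln u"] by (simp add: E_def)
   qed (simp add: E_def)
   have "continuous_on (ball 0 1) (E F) \<longleftrightarrow> continuous_on (ball (0::complex) 1) (\<lambda>w. w)" by (rule continuous_on_cong) (simp_all add: id)
   hence "continuous_on (ball 0 1) (E F)" by simp
   thus ?thesis using True continuous_on_eq_continuous_at[OF open_ball, of 0 1 "E F"] by simp
  next
   case False
   hence w: "w \<noteq> 0" by auto
   have e: "E F u = exp (F (Ln w + Ln (u / w)))" if u: "u \<noteq> 0" for u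
   proof -
    have "exp (Ln w + Ln (u / w)) = u" using u w by (simp add: exp_add)
    thus ?thesis using E[of F "Ln w + Ln (u / w)", OF per] by simp
   qed
   have "isCont (\<lambda>u. Ln w + Ln (u / w)) w" using w by (intro continuous_intros) auto
   moreover have "isCont F (Ln w + Ln (w / w))" using F by (simp add: continuous_on_eq_continuous_at)
   ultimately have "isCont (\<lambda>u. F (Ln w + Ln (u / w))) w" by (rule isCont_o2)
   hence "isCont (\<lambda>u. exp (F (Ln w + Ln (u / w)))) w" by (intro continuous_intros)
   moreover have "\<forall>\<^sub>F u in nhds w. E F u = exp (F (Ln w + Ln (u / w)))"
    by (rule eventually_mono[OF eventually_nhds_in_open[of "- {0}" w]]) (use w e in auto)
   ultimately show ?thesis by (simp add: isCont_cong)
  qed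
  thus ?thesis by (intro continuous_at_imp_continuous_on) blast
 qed
 have psi_left: "psi m z = z" if "Re z \<le> R" for z using phi_left[OF that, of m] phi_psi(2)[of m z] by simp
 have "homeomorphism UNIV UNIV (E (psi m)) (E (phi m))"
  by (rule homeomorphismI[OF cont[OF homeomorphism_cont2[OF phi(3)] psi_tpi psi_left] cont[OF homeomorphism_cont1[OF phi(3)] phi_tpi phi_left]
    subset_UNIV subset_UNIV EE[OF phi_tpi phi_psi(1)] EE[OF psi_tpi phi_psi(2)]])
 ultimately have "cantor_bouquet (E (psi m) ` exp ` B m)" by (rule bouquet_homeo)
 moreover have "E (psi m) ` exp ` B m = X m"
 proof -
  have "E (psi m) ` exp ` B m = (\<lambda>p. exp (psi m p)) ` B m" by (simp add: image_image E psi_tpi)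
  also have "\<dots> = X m"
  proof (intro equalityI subsetI)
   fix w assume w: "w \<in> X m"
   hence "w \<noteq> 0" using X_step by blast
   thus "w \<in> (\<lambda>p. exp (psi m p)) ` B m" using w by (intro image_eqI[of _ _ "phi m (Ln w)"]) (auto simp: B_def)
  qed (auto simp: B_def)
  finally show ?thesis .
 qed
 ultimately show ?thesis by simp
qed

text \<open>Only every \<open>N\<close>-th orbit point is known to be large. If a point in between
  lay in \<open>cball 0 (exp t)\<close>, the remaining factors of its block would map it into a
  fixed disc, and the next point of the orbit of \<open>f\<close> would be small.\<close>

lemma X_absorb: "\<exists>M. \<forall>w. (\<forall>j. M \<le> norm ((f ^^ j) w)) \<longrightarrow> w \<in> X 0"
proof -
 \<comment> \<open>By \<open>phi_coarse\<close>, \<open>t \<le> Re z\<close> implies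
   \<open>Q \<le> Re (phi m z)\<close>.\<close>
 define t where "t = max R (C * (Q + 2 * D0))"
 have bd: "\<exists>K. \<forall>i<n. \<forall>u\<in>cball 0 (exp t). norm (orb i u (N - i)) \<le> K" for n
 proof (induction n)
  case (Suc n)
  then obtain K where K: "\<forall>i<n. \<forall>u\<in>cball 0 (exp t). norm (orb i u (N - i)) \<le> K" by blast
  have "bounded ((\<lambda>u. orb n u (N - n)) ` cball 0 (exp t))"
   by (intro compact_imp_bounded compact_continuous_image continuous_on_subset[OF orb_cont]) auto
  then obtain K' where "\<forall>u\<in>cball 0 (exp t). norm (orb n u (N - n)) \<le> K'" unfolding bounded_iff by auto
  thus ?case using K by (intro exI[of _ "max K K'"]) (auto simp: less_Suc_eq le_max_iff_disj)
 qed simp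
 obtain K where "\<forall>i<N. \<forall>u\<in>cball 0 (exp t). norm (orb i u (N - i)) \<le> K" using bd by blast
 hence K: "norm (orb i u (N - i)) \<le> K" if "i < N" "norm u \<le> exp t" for i u using that by simp
 have "w \<in> X 0" if w: "\<And>j. max K (exp t) + 1 \<le> norm ((f ^^ j) w)" for w
 proof -
  have "orb 0 w k \<noteq> 0 \<and> Q \<le> Re (phi k (Ln (orb 0 w k)))" for k
  proof -
   define i j where "i = k mod N" and "j = k div N"
   have k: "k = j * N + i" "i < N" using N0 by (simp_all add: i_def j_def)
   have sh: "orb (j * N + i) u l = orb i u l" for u l
   proof (induction j)
    case (Suc j)
    thus ?case using orb_period[of "j * N + i" u l] by (simp add: algebra_simps)
   qed simp
   have "orb 0 w (Suc j * N) = orb (j * N + i) (orb 0 w k) (N - i)" using orb_add[of 0 w k "N - i"] k by (simp add: algebra_simps)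
   hence "(f ^^ Suc j) w = orb i (orb 0 w k) (N - i)" unfolding f_pow sh .
   hence "exp t < norm (orb 0 w k)" using K[OF k(2), of "orb 0 w k"] w[of "Suc j"] by (cases "norm (orb 0 w k) \<le> exp t") auto
   hence n0: "0 < norm (orb 0 w k)" and "ln (exp t) < ln (norm (orb 0 w k))"
    using exp_gt_zero[of t] by (auto simp only: ln_less_cancel_iff intro: less_trans)
   hence nz: "orb 0 w k \<noteq> 0" and "t < ln (norm (orb 0 w k))" by auto
   hence tl: "R \<le> Re (Ln (orb 0 w k))" "C * (Q + 2 * D0) \<le> Re (Ln (orb 0 w k))" by (auto simp: t_def)
   have "C * (Q + 2 * D0) \<le> C * (Re (phi k (Ln (orb 0 w k))) + 2 * D0)" using tl(2) phi_coarse[OF tl(1), of k] by linarith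
   thus ?thesis using nz C1 by simp
  qed
  thus ?thesis by (simp add: X_def)
 qed
 thus ?thesis by (intro exI[of _ "max K (exp t) + 1"]) blast
qed

end

section \<open>Finite compositions\<close>

text \<open>Logarithms are taken twice in
  \<open>exp (Re Z) \<le> c * exp (exp (\<sigma> * Re (L Z)))\<close>. The lower bound on
  \<open>Re Z\<close> makes \<open>ln c\<close> at most half of \<open>Re Z\<close>.\<close>

lemma finite_order_growth:
 assumes "finite_order g"
 obtains \<alpha> \<beta> r where "0 < \<alpha>" "\<And>a L Z. lbranch g a L \<Longrightarrow> a < Re Z \<Longrightarrow> r \<le> Re Z \<Longrightarrow> \<alpha> * ln (Re Z) - \<beta> \<le> Re (L Z)"
proof -
 obtain c \<sigma> where c: "c > 0" "\<sigma> > 0" "\<And>z. norm (g z) \<le> c * exp (norm z powr \<sigma>)" using assms unfolding finite_order_def by blast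
 show ?thesis
 proof (rule that[of "1 / \<sigma>" "max 1 (2 * ln c)" "ln 2 / \<sigma>"])
  fix a L Z assume L: "lbranch g a L" "a < Re Z" "max 1 (2 * ln c) \<le> Re Z"
  have "exp (Re Z) = norm (g (exp (L Z)))" using L(1,2) by (simp add: lbranch_def norm_exp_eq_Re)
  also have "\<dots> \<le> c * exp (norm (exp (L Z)) powr \<sigma>)" by (rule c(3))
  also have "norm (exp (L Z)) powr \<sigma> = exp (\<sigma> * Re (L Z))" by (simp add: norm_exp_eq_Re powr_def)
  finally have "ln (exp (Re Z)) \<le> ln (c * exp (exp (\<sigma> * Re (L Z))))" using c(1) by (subst ln_le_cancel_iff) auto
  hence "Re Z \<le> ln c + exp (\<sigma> * Re (L Z))" using c(1) by (simp add: ln_mult_pos)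
  hence "Re Z / 2 \<le> exp (\<sigma> * Re (L Z))" using L(3) by simp
  hence "ln (Re Z / 2) \<le> ln (exp (\<sigma> * Re (L Z)))" using L(3) by (subst ln_le_cancel_iff) auto
  hence "ln (Re Z) - ln 2 \<le> \<sigma> * Re (L Z)" using L(3) by (simp add: ln_div)
  thus "1 / \<sigma> * ln (Re Z) - ln 2 / \<sigma> \<le> Re (L Z)" using c(2) by (simp add: field_simps)
 qed (use c in simp)
qed

lemma (in tracts) model_ex: "\<exists>\<Phi> v C. model g a R \<alpha> \<beta> \<Phi> v C"
proof -
 obtain \<rho> \<gamma> where rm: "\<rho> holomorphic_on V" "\<gamma> holomorphic_on ball 0 1" "\<And>z. z \<in> V \<Longrightarrow> \<rho> z \<in> ball 0 1"
  "\<And>z. z \<in> V \<Longrightarrow> \<gamma> (\<rho> z) = z" "\<And>z. z \<in> ball 0 1 \<Longrightarrow> \<gamma> z \<in> V" "\<And>z. z \<in> ball 0 1 \<Longrightarrow> \<rho> (\<gamma> z) = z"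
  "\<rho> 0 = 0" "deriv \<rho> 0 \<in> \<real>" "0 < Re (deriv \<rho> 0)" by (rule riemann_map) blast
 have "riemann g a R \<alpha> \<beta> \<rho> \<gamma>" by (intro riemann.intro riemann_axioms.intro tracts_axioms rm)
 from riemann.model_exists[OF this] show ?thesis by blast
qed

theorem theorem1p6:
  fixes f :: "complex \<Rightarrow> complex" and gs :: "(complex \<Rightarrow> complex) list"
  assumes "gs \<noteq> []"
    and "\<And>g. g \<in> set gs \<Longrightarrow> g \<in> class_B \<and> finite_order g"
    and "f = foldr (\<circ>) gs id"
  shows "\<forall>R::real. R > 0 \<longrightarrow>
    (\<exists>X. cantor_bouquet X \<and> X \<subseteq> julia_set f \<and> f ` X \<subseteq> X \<and>
       (\<forall>z\<in>X. \<forall>j. norm ((f ^^ j) z) \<ge> R) \<and>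
       (\<exists>R'\<ge>R. \<forall>z. (\<forall>j. norm ((f ^^ j) z) \<ge> R') \<longrightarrow> z \<in> X))"
proof (intro allI impI)
 fix R0 :: real assume R0: "R0 > 0"
 let ?G = "set gs"
 have "bounded (\<Union>g\<in>?G. insert (g 0) (sing_inverse g))" using assms(2) by (intro bounded_UN) (auto simp: class_B_def)
 then obtain M where M: "M > 0" "\<And>x. x \<in> (\<Union>g\<in>?G. insert (g 0) (sing_inverse g)) \<Longrightarrow> norm x \<le> M" unfolding bounded_pos by blast
 \<comment> \<open>\<open>M\<close> will serve as the parameter \<open>a\<close>: the disc of radius
   \<open>exp a\<close> then contains all singular values, and the values at 0 lie strictly
   inside.\<close>
 have eM: "M < exp M" using exp_ge_add_one_self[of M] by linarith
 have "\<exists>q. 0 < fst q \<and> (\<forall>a L Z. lbranch g a L \<longrightarrow> a < Re Z \<longrightarrow> snd (snd q) \<le> Re Z \<longrightarrow> fst q * ln (Re Z) - fst (snd q) \<le> Re (L Z))"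
  if g: "g \<in> ?G" for g
 proof -
  have fo: "finite_order g" using assms(2)[OF g] by blast
  obtain \<alpha> \<beta> r where "0 < \<alpha>" "\<And>a L Z. lbranch g a L \<Longrightarrow> a < Re Z \<Longrightarrow> r \<le> Re Z \<Longrightarrow> \<alpha> * ln (Re Z) - \<beta> \<le> Re (L Z)"
   by (rule finite_order_growth[OF fo]) blast
  thus ?thesis by (intro exI[of _ "(\<alpha>, \<beta>, r)"]) simp
 qed
 then obtain q where q: "\<forall>g\<in>?G. 0 < fst (q g) \<and> (\<forall>a L Z. lbranch g a L \<longrightarrow> a < Re Z \<longrightarrow> snd (snd (q g)) \<le> Re Z \<longrightarrow> fst (q g) * ln (Re Z) - fst (snd (q g)) \<le> Re (L Z))"
  using bchoice[of ?G] by (metis (no_types, lifting))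
 define \<alpha> \<beta> r where "\<alpha> g = fst (q g)" and "\<beta> g = fst (snd (q g))" and "r g = snd (snd (q g))" for g
 \<comment> \<open>The terms provide the gap of 400, the validity of all growth bounds, and
   \<open>R0 \<le> exp (R + 1)\<close>, which \<open>X_norm\<close> turns into the lower bound for
   orbits.\<close>
 define R where "R = M + 400 + \<bar>ln R0\<bar> + (\<Sum>g\<in>?G. \<bar>r g\<bar>)"
 have sum0: "0 \<le> (\<Sum>g\<in>?G. \<bar>r g\<bar>)" by (intro sum_nonneg) simp
 have R: "M + 400 \<le> R" "ln R0 \<le> R" unfolding R_def using sum0 M(1) abs_ge_self[of "ln R0"] by linarith+
 have tr: "tracts g M R (\<alpha> g) (\<beta> g)" if g: "g \<in> ?G" for g
 proof
  show "transcendental_entire g" using assms(2)[OF g] by (simp add: class_B_def)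
  show "sing_inverse g \<subseteq> cball 0 (exp M)" "norm (g 0) < exp M" using M(2) g eM by force+
  show "0 \<le> M" "M + 400 \<le> R" using M(1) R by auto
  show "0 < \<alpha> g" using q g by (simp add: \<alpha>_def)
  fix L Z assume L: "lbranch g M L" "R \<le> Re Z"
  have "\<bar>r g\<bar> \<le> (\<Sum>g\<in>?G. \<bar>r g\<bar>)" using g by (intro member_le_sum) auto
  hence "r g \<le> Re Z" "M < Re Z" using L(2) M(1) sum0 unfolding R_def by linarith+
  thus "\<alpha> g * ln (Re Z) - \<beta> g \<le> Re (L Z)" using q g L(1) by (simp add: \<alpha>_def \<beta>_def r_def)
 qed
 have "\<forall>g\<in>?G. \<exists>t. model g M R (\<alpha> g) (\<beta> g) (fst t) (fst (snd t)) (snd (snd t))"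
  using tracts.model_ex[OF tr] by (metis fst_conv snd_conv)
 then obtain t where t: "\<forall>g\<in>?G. model g M R (\<alpha> g) (\<beta> g) (fst (t g)) (fst (snd (t g))) (snd (snd (t g)))"
  by (rule bchoice[THEN exE])
 define C where "C = (\<Sum>g\<in>?G. \<bar>snd (snd (t g))\<bar>)"
 have mdl: "model g M R (\<alpha> g) (\<beta> g) (fst (t g)) (fst (snd (t g))) C" if g: "g \<in> ?G" for g
 proof (rule model_mono)
  show "model g M R (\<alpha> g) (\<beta> g) (fst (t g)) (fst (snd (t g))) (snd (snd (t g)))" using t g by blast
  have "\<bar>snd (snd (t g))\<bar> \<le> C" unfolding C_def using g by (intro member_le_sum) auto
  thus "snd (snd (t g)) \<le> C" by simp
 qed
 define N where "N = length gs"
 have N0: "0 < N" using assms(1) by (simp add: N_def)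
 \<comment> \<open>The composition applies the last map of \<open>gs\<close> first.\<close>
 define h where "h m = rev gs ! (m mod N)" for m
 have hG: "h m \<in> ?G" for m using nth_mem[of "m mod N" "rev gs"] N0 by (simp add: h_def N_def)
 define \<Phi> v where "\<Phi> m = fst (t (h m))" and "v m = fst (snd (t (h m)))" for m
 have per: "h (m + N) = h m" for m by (simp add: h_def)
 interpret system h M R "\<lambda>m. \<alpha> (h m)" "\<lambda>m. \<beta> (h m)" \<Phi> v C N
  by (rule system.intro) (use mdl[OF hG] N0 per in \<open>simp_all add: \<Phi>_def v_def\<close>)
 interpret large_system h M R "\<lambda>m. \<alpha> (h m)" "\<lambda>m. \<beta> (h m)" \<Phi> v C N "(1 + C) * (R + 1) + 2 * D0" by unfold_locales simp
 have orb_fold: "orb 0 w k = foldr (\<circ>) (rev (take k (rev gs))) id w" if "k \<le> N" for w k using that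
 proof (induction k)
  case (Suc k)
  have "h k = rev gs ! k" using Suc.prems by (simp add: h_def)
  moreover have "take (Suc k) (rev gs) = take k (rev gs) @ [rev gs ! k]" using Suc.prems by (intro take_Suc_conv_app_nth) (simp add: N_def)
  hence "foldr (\<circ>) (rev (take (Suc k) (rev gs))) id w = (rev gs ! k) (foldr (\<circ>) (rev (take k (rev gs))) id w)"
   by (simp only: rev_append rev.simps append.simps foldr.simps o_apply)
  moreover have "orb 0 w k = foldr (\<circ>) (rev (take k (rev gs))) id w" using Suc by (intro Suc.IH) simp
  ultimately show ?case by (simp only: orb.simps add_0)
 qed simp
 have fe: "local.f = f"
 proof
  fix w
  have "local.f w = orb 0 w N" by (rule f_def)
  also have "\<dots> = f w" unfolding orb_fold[OF order_refl] assms(3) by (simp add: N_def)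
  finally show "local.f w = f w" .
 qed
 obtain K where K: "\<forall>w. (\<forall>j. K \<le> norm ((f ^^ j) w)) \<longrightarrow> w \<in> X 0" using X_absorb unfolding fe by blast
 show "\<exists>X. cantor_bouquet X \<and> X \<subseteq> julia_set f \<and> f ` X \<subseteq> X \<and> (\<forall>z\<in>X. \<forall>j. norm ((f ^^ j) z) \<ge> R0) \<and>
    (\<exists>R'\<ge>R0. \<forall>z. (\<forall>j. norm ((f ^^ j) z) \<ge> R') \<longrightarrow> z \<in> X)"
 proof (intro exI[of _ "X 0"] conjI X_bouquet X_julia[unfolded fe] f_X[unfolded fe] ballI allI)
  fix z j assume z: "z \<in> X 0"
  have "R0 = exp (ln R0)" using R0 by simp
  also have "\<dots> \<le> exp (R + 1)" using R(2) by simp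
  also have "\<dots> \<le> norm ((f ^^ j) z)" using X_norm[OF z] f_pow[unfolded fe] by simp
  finally show "R0 \<le> norm ((f ^^ j) z)" .
 next
  show "\<exists>R'\<ge>R0. \<forall>z. (\<forall>j. R' \<le> norm ((f ^^ j) z)) \<longrightarrow> z \<in> X 0"
   using K by (intro exI[of _ "max R0 K"]) auto
 qed
qed

end
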